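(* The propagation number is invariant under stable equivalence, i.e., for any unital operator system $E$ one has $$\mathrm{prop}(E)=\mathrm{prop}(E\otimes_{\min}\mathcal K),$$ where $\mathcal K$ is the $C^*$-algebra of compact operators.
   Context: Operator systems. A matrix-ordered $*$-vector space is a complex vector space $E$ with a conjugate-linear involution and cones $M_n(E)_+\subseteq M_n(E)_h=\{x: x=x^*\}$ with $M_n(E)_+\cap(-M_n(E)_+)=\{0\}$ and $AM_n(E)_+A^*\subseteq M_m(E)_+$ for $A\in M_{mn}(\mathbb C)$. A unital operator system is such an $E$ with $e\in E_h$ such that $\mathrm{diag}(e,\dots,e)$ is an Archimedean order unit for each $M_n(E)$; it carries the norms $\|x\|_n=\inf\{t:\left(\begin{smallmatrix} tI_n & x \\ x^* & tI_n\end{smallmatrix}\right)\ge0\}$. By Choi--Effros, it can be realized as a self-adjoint unital subspace of some $B(H)$. A matrix-ordered operator space is an operator space $E$ (complete, satisfying Ruan's axioms) with a matrix order such that all cones $M_n(E)_+$ are closed and the involution is isometric on each $M_n(E)$. Let $\mathcal S_n(E)$ be the set of positive linear functionals of norm $1$ on $M_n(E)$. The partial unitization $E^\sharp=E\oplus\mathbb C$ has involution $(x,A)^*=(x^*,A^* )$, and a self-adjoint $(x,A)\in M_n(E)\oplus M_n(\mathbb C)$ is positive iff $A\ge0$ and $\phi(A_\epsilon^{-1/2}xA_\epsilon^{-1/2})\ge-1$ for all $\epsilon>0$, $\phi\in\mathcal S_n(E)$, where $A_\epsilon=A+\epsilon 1_n$. A non-unital operator system is a matrix-ordered operator space for which,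 for all $n$ and $x\in M_n(E)$, $\|x\|=\nu_E(x):=\sup\{|\phi\left(\begin{smallmatrix} 0 & x \\ x^* & 0\end{smallmatrix}\right)|:\phi\in\mathcal S_{2n}(E)\}$. Maps. A linear map $\kappa$ is completely isometric (resp. completely positive) if all its amplifications $\kappa_n$ to $n\times n$ matrices are isometric (resp. positive); it is a complete order isomorphism if it is invertible and both it and its inverse are completely positive. $\kappa^\sharp$ denotes the unital extension of $\kappa$ to partial unitizations. Envelopes. A $C^\sharp$-extension of an operator system $E$ (unital or not) is a completely isometric, completely positive map $\kappa:E\to A$ to a $C^*$-algebra with $A=C^*(\kappa(E))$ such that $\kappa^\sharp:E^\sharp\to A^\sharp$ is a complete order isomorphism onto its range. The ($C^\sharp$-, or $C^*$-) envelope $\imath_E:E\to C^*_{\mathrm{env}}(E)$ is a $C^\sharp$-extension such that for every $C^\sharp$-extension $\lambda:E\to B$ there is a unique surjective $*$-homomorphism $\rho:B\to C^*_{\mathrm{env}}(E)$ with $\rho\circ\lambda=\imath_E$; it exists and is unique up to equivalence, and for unital $E$ it coincides with the usual $C^*$-envelope. Tensor products and stable equivalence. If $E\subseteq B(H)$ and $F\subseteq B(K)$ then $E\otimes_{\min}F$ is the norm closure of $E\otimes F$ in $B(H\otimes K)$. $\mathcal K$ is the algebra of compact operators (on a separable infinite-dimensional Hilbert space). Two operator systems $E,F$ are stably equivalent if $E\otimes_{\min}\mathcal K$ and $F\otimes_{\min}\mathcal K$ are completely order isomorphic operator systems. Propagation number. For $E$ inside a $C^*$-algebra, $E^{\circ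 n}$ is the norm closure of the linear span of products of at most $n$ elements of $E$. $\mathrm{prop}(E)$ is the smallest integer $n\geq 1$ such that $\imath_E(E)^{\circ n}\subseteq C^*_{\mathrm{env}}(E)$ is a $C^*$-algebra, and $\mathrm{prop}(E)=\infty$ if there is no such $n$. *)

theory Defs
  imports "HOL-Analysis.Analysis" "HOL-Library.Extended_Nat" "HOL-Library.FuncSet"
begin

section \<open>Matrix-ordered $*$-vector spaces\<close>

text \<open>
  Complex $*$-vector spaces are given by explicit carriers, since the universal property of the
  envelope below quantifies over $C^*$-algebras whose carriers are subsets of a fixed large type.
\<close>

record 'a star_space =
  carrier :: "'a set"
  vzero :: 'a
  vadd :: "'a \<Rightarrow> 'a \<Rightarrow> 'a"
  vscale :: "complex \<Rightarrow> 'a \<Rightarrow> 'a"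
  vstar :: "'a \<Rightarrow> 'a"

locale star_vector_space =
  fixes V :: "('a, 'm) star_space_scheme"
  assumes zero_closed: "vzero V \<in> carrier V"
    and add_closed: "x \<in> carrier V \<Longrightarrow> y \<in> carrier V \<Longrightarrow> vadd V x y \<in> carrier V"
    and scale_closed: "x \<in> carrier V \<Longrightarrow> vscale V c x \<in> carrier V"
    and star_closed: "x \<in> carrier V \<Longrightarrow> vstar V x \<in> carrier V"
    and add_assoc: "x \<in> carrier V \<Longrightarrow> y \<in> carrier V \<Longrightarrow> z \<in> carrier V \<Longrightarrow>
      vadd V (vadd V x y) z = vadd V x (vadd V y z)"
    and add_commute: "x \<in> carrier V \<Longrightarrow> y \<in> carrier V \<Longrightarrow> vadd V x y = vadd V y x"
    and add_zero: "x \<in> carrier V \<Longrightarrow> vadd V (vzero V) x = x"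
    and add_minus: "x \<in> carrier V \<Longrightarrow> vadd V x (vscale V (-1) x) = vzero V"
    and scale_one: "x \<in> carrier V \<Longrightarrow> vscale V 1 x = x"
    and scale_scale: "x \<in> carrier V \<Longrightarrow> vscale V c (vscale V d x) = vscale V (c * d) x"
    and scale_add_left: "x \<in> carrier V \<Longrightarrow> vscale V (c + d) x = vadd V (vscale V c x) (vscale V d x)"
    and scale_add_right: "x \<in> carrier V \<Longrightarrow> y \<in> carrier V \<Longrightarrow>
      vscale V c (vadd V x y) = vadd V (vscale V c x) (vscale V c y)"
    and star_star: "x \<in> carrier V \<Longrightarrow> vstar V (vstar V x) = x"
    and star_add: "x \<in> carrier V \<Longrightarrow> y \<in> carrier V \<Longrightarrow>
      vstar V (vadd V x y) = vadd V (vstar V x) (vstar V y)"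
    and star_scale: "x \<in> carrier V \<Longrightarrow> vstar V (vscale V c x) = vscale V (cnj c) (vstar V x)"

definition vminus :: "('a, 'm) star_space_scheme \<Rightarrow> 'a \<Rightarrow> 'a \<Rightarrow> 'a" where
  "vminus V x y = vadd V x (vscale V (-1) y)"

primrec vsum :: "('a, 'm) star_space_scheme \<Rightarrow> (nat \<Rightarrow> 'a) \<Rightarrow> nat \<Rightarrow> 'a" where
  "vsum V f 0 = vzero V"
| "vsum V f (Suc n) = vadd V (vsum V f n) (f n)"

definition lin_subspace :: "('a, 'm) star_space_scheme \<Rightarrow> 'a set \<Rightarrow> bool" where
  "lin_subspace V S \<longleftrightarrow> S \<subseteq> carrier V \<and> vzero V \<in> S \<and>
     (\<forall>x\<in>S. \<forall>y\<in>S. vadd V x y \<in> S) \<and> (\<forall>c. \<forall>x\<in>S. vscale V c x \<in> S)"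

definition lin_span :: "('a, 'm) star_space_scheme \<Rightarrow> 'a set \<Rightarrow> 'a set" where
  "lin_span V X = \<Inter>{S. lin_subspace V S \<and> X \<subseteq> S}"

definition lin_map ::
  "('a, 'm) star_space_scheme \<Rightarrow> ('b, 'k) star_space_scheme \<Rightarrow> ('a \<Rightarrow> 'b) \<Rightarrow> bool" where
  "lin_map V W f \<longleftrightarrow> f \<in> carrier V \<rightarrow> carrier W \<and>
     (\<forall>x\<in>carrier V. \<forall>y\<in>carrier V. f (vadd V x y) = vadd W (f x) (f y)) \<and>
     (\<forall>c. \<forall>x\<in>carrier V. f (vscale V c x) = vscale W c (f x))"

text \<open>
  An $n\times n$ matrix has its entries at the indices $i,j<n$ and is zero elsewhere, so that
  equality of matrices is equality of functions.
\<close>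

type_synonym 'a mat = "nat \<Rightarrow> nat \<Rightarrow> 'a"

definition Mat :: "('a, 'm) star_space_scheme \<Rightarrow> nat \<Rightarrow> 'a mat set" where
  "Mat V n = {x. \<forall>i j. if i < n \<and> j < n then x i j \<in> carrier V else x i j = vzero V}"

definition mat_zero :: "('a, 'm) star_space_scheme \<Rightarrow> 'a mat" where
  "mat_zero V = (\<lambda>i j. vzero V)"

definition mat_add :: "('a, 'm) star_space_scheme \<Rightarrow> 'a mat \<Rightarrow> 'a mat \<Rightarrow> 'a mat" where
  "mat_add V x y = (\<lambda>i j. vadd V (x i j) (y i j))"

definition mat_scale :: "('a, 'm) star_space_scheme \<Rightarrow> complex \<Rightarrow> 'a mat \<Rightarrow> 'a mat" where
  "mat_scale V c x = (\<lambda>i j. vscale V c (x i j))"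

definition mat_star :: "('a, 'm) star_space_scheme \<Rightarrow> nat \<Rightarrow> 'a mat \<Rightarrow> 'a mat" where
  "mat_star V n x = (\<lambda>i j. if i < n \<and> j < n then vstar V (x j i) else vzero V)"

definition mat_diag :: "('a, 'm) star_space_scheme \<Rightarrow> nat \<Rightarrow> 'a \<Rightarrow> 'a mat" where
  "mat_diag V n e = (\<lambda>i j. if i < n \<and> i = j then e else vzero V)"

text \<open>$\alpha x\alpha^*\in M_m(V)$ for $\alpha\in M_{m,n}(\mathbb C)$ and $x\in M_n(V)$.\<close>

definition mat_conj ::
  "('a, 'm) star_space_scheme \<Rightarrow> nat \<Rightarrow> nat \<Rightarrow> complex mat \<Rightarrow> 'a mat \<Rightarrow> 'a mat" where
  "mat_conj V m n \<alpha> x = (\<lambda>i j. if i < m \<and> j < m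
     then vsum V (\<lambda>k. vsum V (\<lambda>l. vscale V (\<alpha> i k * cnj (\<alpha> j l)) (x k l)) n) n else vzero V)"

text \<open>The $2n\times 2n$ matrix with $n\times n$ blocks $a,b,c,d$.\<close>

definition mat_block :: "nat \<Rightarrow> 'a mat \<Rightarrow> 'a mat \<Rightarrow> 'a mat \<Rightarrow> 'a mat \<Rightarrow> 'a mat" where
  "mat_block n a b c d = (\<lambda>i j.
     if i < n then (if j < n then a i j else b i (j - n))
     else (if j < n then c (i - n) j else d (i - n) (j - n)))"

definition amplify :: "('a \<Rightarrow> 'b) \<Rightarrow> 'a mat \<Rightarrow> 'b mat" where
  "amplify f x = (\<lambda>i j. f (x i j))"

definition Mat_sa :: "('a, 'm) star_space_scheme \<Rightarrow> nat \<Rightarrow> 'a mat set" where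
  "Mat_sa V n = {x \<in> Mat V n. mat_star V n x = x}"

record 'a ordered_space = "'a star_space" +
  cone :: "nat \<Rightarrow> 'a mat set"

locale matrix_ordered_space = star_vector_space E
  for E :: "('a, 'm) ordered_space_scheme" +
  assumes cone_selfadjoint: "0 < n \<Longrightarrow> cone E n \<subseteq> Mat_sa E n"
    and cone_zero: "0 < n \<Longrightarrow> mat_zero E \<in> cone E n"
    and cone_add: "0 < n \<Longrightarrow> x \<in> cone E n \<Longrightarrow> y \<in> cone E n \<Longrightarrow> mat_add E x y \<in> cone E n"
    and cone_scale: "0 < n \<Longrightarrow> 0 \<le> t \<Longrightarrow> x \<in> cone E n \<Longrightarrow>
      mat_scale E (complex_of_real t) x \<in> cone E n"
    and cone_proper: "0 < n \<Longrightarrow> x \<in> cone E n \<Longrightarrow> mat_scale E (-1) x \<in> cone E n \<Longrightarrow> x = mat_zero E"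
    and cone_conj: "0 < m \<Longrightarrow> 0 < n \<Longrightarrow> x \<in> cone E n \<Longrightarrow> mat_conj E m n \<alpha> x \<in> cone E m"

locale unital_operator_system = matrix_ordered_space E
  for E :: "('a, 'm) ordered_space_scheme" +
  fixes e :: 'a
  assumes unit_closed: "e \<in> carrier E"
    and unit_selfadjoint: "vstar E e = e"
    and order_unit: "0 < n \<Longrightarrow> x \<in> Mat_sa E n \<Longrightarrow> \<exists>t>0.
      mat_add E (mat_diag E n (vscale E (complex_of_real t) e)) x \<in> cone E n"
    and archimedean: "0 < n \<Longrightarrow> x \<in> Mat_sa E n \<Longrightarrow>
      (\<And>t. t > 0 \<Longrightarrow> mat_add E (mat_diag E n (vscale E (complex_of_real t) e)) x \<in> cone E n) \<Longrightarrow>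
      x \<in> cone E n"

record 'a operator_space = "'a ordered_space" +
  mnorm :: "nat \<Rightarrow> 'a mat \<Rightarrow> real"

text \<open>
  The restriction to \<open>t \<ge> 0\<close> in the order norm only matters for the zero space, where the
  condition holds for every real \<open>t\<close>.
\<close>

definition order_mnorm :: "('a, 'm) ordered_space_scheme \<Rightarrow> 'a \<Rightarrow> nat \<Rightarrow> 'a mat \<Rightarrow> real" where
  "order_mnorm E e n x = Inf {t. 0 \<le> t \<and>
     (let d = mat_diag E n (vscale E (complex_of_real t) e)
      in mat_block n d x (mat_star E n x) d \<in> cone E (2 * n))}"

definition operator_space_of_system :: "'a ordered_space \<Rightarrow> 'a \<Rightarrow> 'a operator_space" where
  "operator_space_of_system E e =
     ordered_space.extend E \<lparr>mnorm = order_mnorm E e\<rparr>"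

subsection \<open>Maps\<close>

definition completely_positive ::
  "('a, 'm) ordered_space_scheme \<Rightarrow> ('b, 'k) ordered_space_scheme \<Rightarrow> ('a \<Rightarrow> 'b) \<Rightarrow> bool" where
  "completely_positive V W f \<longleftrightarrow> lin_map V W f \<and> (\<forall>n>0. \<forall>x\<in>cone V n. amplify f x \<in> cone W n)"

definition completely_isometric ::
  "('a, 'm) operator_space_scheme \<Rightarrow> ('b, 'k) operator_space_scheme \<Rightarrow> ('a \<Rightarrow> 'b) \<Rightarrow> bool" where
  "completely_isometric V W f \<longleftrightarrow> lin_map V W f \<and>
     (\<forall>n>0. \<forall>x\<in>Mat V n. mnorm W n (amplify f x) = mnorm V n x)"

definition complete_order_iso ::
  "('a, 'm) ordered_space_scheme \<Rightarrow> ('b, 'k) ordered_space_scheme \<Rightarrow> ('a \<Rightarrow> 'b) \<Rightarrow> bool" where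
  "complete_order_iso V W f \<longleftrightarrow> bij_betw f (carrier V) (carrier W) \<and>
     completely_positive V W f \<and> completely_positive W V (inv_into (carrier V) f)"

definition restrict_to :: "('a, 'm) ordered_space_scheme \<Rightarrow> 'a set \<Rightarrow> ('a, 'm) ordered_space_scheme"
  where
  "restrict_to W S = W\<lparr>carrier := S, cone := (\<lambda>n. {x \<in> cone W n. \<forall>i<n. \<forall>j<n. x i j \<in> S})\<rparr>"

definition complete_order_iso_onto_range ::
  "('a, 'm) ordered_space_scheme \<Rightarrow> ('b, 'k) ordered_space_scheme \<Rightarrow> ('a \<Rightarrow> 'b) \<Rightarrow> bool" where
  "complete_order_iso_onto_range V W f \<longleftrightarrow>
     f \<in> carrier V \<rightarrow> carrier W \<and> complete_order_iso V (restrict_to W (f ` carrier V)) f"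

subsection \<open>The partial unitization\<close>

definition norm_one_positive_functional ::
  "('a, 'm) operator_space_scheme \<Rightarrow> nat \<Rightarrow> ('a mat \<Rightarrow> complex) \<Rightarrow> bool" where
  "norm_one_positive_functional E n \<phi> \<longleftrightarrow>
     (\<forall>x\<in>Mat E n. \<forall>y\<in>Mat E n. \<phi> (mat_add E x y) = \<phi> x + \<phi> y) \<and>
     (\<forall>c. \<forall>x\<in>Mat E n. \<phi> (mat_scale E c x) = c * \<phi> x) \<and>
     (\<forall>x\<in>cone E n. \<phi> x \<in> \<real>\<^sub>\<ge>\<^sub>0) \<and>
     (\<forall>x\<in>Mat E n. cmod (\<phi> x) \<le> mnorm E n x) \<and>
     (\<forall>c. (\<forall>x\<in>Mat E n. cmod (\<phi> x) \<le> c * mnorm E n x) \<longrightarrow> 1 \<le> c)"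

definition pos_semidef :: "nat \<Rightarrow> complex mat \<Rightarrow> bool" where
  "pos_semidef n A \<longleftrightarrow> (\<forall>i<n. \<forall>j<n. A i j = cnj (A j i)) \<and>
     (\<forall>v. (\<Sum>i<n. \<Sum>j<n. cnj (v i) * A i j * v j) \<in> \<real>\<^sub>\<ge>\<^sub>0)"

definition plus_eps :: "real \<Rightarrow> complex mat \<Rightarrow> complex mat" where
  "plus_eps \<epsilon> A = (\<lambda>i j. A i j + (if i = j then complex_of_real \<epsilon> else 0))"

text \<open>\<open>R\<close> is the inverse positive square root of the positive invertible matrix \<open>B\<close>.\<close>

definition is_inv_sqrt :: "nat \<Rightarrow> complex mat \<Rightarrow> complex mat \<Rightarrow> bool" where
  "is_inv_sqrt n B R \<longleftrightarrow> pos_semidef n R \<and>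
     (\<forall>i<n. \<forall>j<n. (\<Sum>k<n. \<Sum>l<n. R i k * R k l * B l j) = (if i = j then 1 else 0))"

text \<open>
  Below, \<open>R\<close> is Hermitian, so \<open>mat_conj E n n R x\<close> is $RxR=A_\epsilon^{-1/2}xA_\epsilon^{-1/2}$.
  The real part only matters for spaces in which the positive cones do not span: otherwise
  positive functionals are real on self-adjoint elements.
\<close>

definition unitization :: "('a, 'm) operator_space_scheme \<Rightarrow> ('a \<times> complex) ordered_space" where
  "unitization E =
    (let U = \<lparr>carrier = carrier E \<times> UNIV, vzero = (vzero E, 0),
        vadd = (\<lambda>u v. (vadd E (fst u) (fst v), snd u + snd v)),
        vscale = (\<lambda>c u. (vscale E c (fst u), c * snd u)),
        vstar = (\<lambda>u. (vstar E (fst u), cnj (snd u)))\<rparr>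
     in star_space.extend U \<lparr>cone = (\<lambda>n. {X \<in> Mat_sa U n.
        pos_semidef n (amplify snd X) \<and>
        (\<forall>\<epsilon>>0. \<forall>R \<phi>. is_inv_sqrt n (plus_eps \<epsilon> (amplify snd X)) R \<longrightarrow>
           norm_one_positive_functional E n \<phi> \<longrightarrow>
           Re (\<phi> (mat_conj E n n R (amplify fst X))) \<ge> -1)})\<rparr>)"

definition unital_extension :: "('a \<Rightarrow> 'b) \<Rightarrow> 'a \<times> complex \<Rightarrow> 'b \<times> complex" where
  "unital_extension \<kappa> = map_prod \<kappa> id"

section \<open>$C^*$-algebras\<close>

record 'a cstar = "'a star_space" +
  cmult :: "'a \<Rightarrow> 'a \<Rightarrow> 'a"
  cnorm :: "'a \<Rightarrow> real"

locale cstar_algebra = star_vector_space A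
  for A :: "('a, 'm) cstar_scheme" +
  assumes mult_closed: "x \<in> carrier A \<Longrightarrow> y \<in> carrier A \<Longrightarrow> cmult A x y \<in> carrier A"
    and mult_assoc: "x \<in> carrier A \<Longrightarrow> y \<in> carrier A \<Longrightarrow> z \<in> carrier A \<Longrightarrow>
      cmult A (cmult A x y) z = cmult A x (cmult A y z)"
    and mult_add_left: "x \<in> carrier A \<Longrightarrow> y \<in> carrier A \<Longrightarrow> z \<in> carrier A \<Longrightarrow>
      cmult A (vadd A x y) z = vadd A (cmult A x z) (cmult A y z)"
    and mult_add_right: "x \<in> carrier A \<Longrightarrow> y \<in> carrier A \<Longrightarrow> z \<in> carrier A \<Longrightarrow>
      cmult A x (vadd A y z) = vadd A (cmult A x y) (cmult A x z)"
    and mult_scale_left: "x \<in> carrier A \<Longrightarrow> y \<in> carrier A \<Longrightarrow>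
      cmult A (vscale A c x) y = vscale A c (cmult A x y)"
    and mult_scale_right: "x \<in> carrier A \<Longrightarrow> y \<in> carrier A \<Longrightarrow>
      cmult A x (vscale A c y) = vscale A c (cmult A x y)"
    and star_mult: "x \<in> carrier A \<Longrightarrow> y \<in> carrier A \<Longrightarrow>
      vstar A (cmult A x y) = cmult A (vstar A y) (vstar A x)"
    and norm_eq_zero: "x \<in> carrier A \<Longrightarrow> cnorm A x = 0 \<longleftrightarrow> x = vzero A"
    and norm_triangle: "x \<in> carrier A \<Longrightarrow> y \<in> carrier A \<Longrightarrow>
      cnorm A (vadd A x y) \<le> cnorm A x + cnorm A y"
    and norm_scale: "x \<in> carrier A \<Longrightarrow> cnorm A (vscale A c x) = cmod c * cnorm A x"
    and norm_mult: "x \<in> carrier A \<Longrightarrow> y \<in> carrier A \<Longrightarrow>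
      cnorm A (cmult A x y) \<le> cnorm A x * cnorm A y"
    and norm_cstar: "x \<in> carrier A \<Longrightarrow> cnorm A (cmult A (vstar A x) x) = (cnorm A x)\<^sup>2"
    and complete: "(\<And>n. f n \<in> carrier A) \<Longrightarrow>
      (\<And>\<epsilon>. \<epsilon> > 0 \<Longrightarrow> \<exists>N. \<forall>m\<ge>N. \<forall>n\<ge>N. cnorm A (vminus A (f m) (f n)) < \<epsilon>) \<Longrightarrow>
      \<exists>x\<in>carrier A. (\<lambda>n. cnorm A (vminus A (f n) x)) \<longlonglongrightarrow> 0"

definition cstar_closure :: "('a, 'm) cstar_scheme \<Rightarrow> 'a set \<Rightarrow> 'a set" where
  "cstar_closure A S = {x \<in> carrier A. \<forall>\<epsilon>>0. \<exists>y\<in>S. cnorm A (vminus A x y) < \<epsilon>}"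

definition cstar_subalgebra :: "('a, 'm) cstar_scheme \<Rightarrow> 'a set \<Rightarrow> bool" where
  "cstar_subalgebra A S \<longleftrightarrow> lin_subspace A S \<and>
     (\<forall>x\<in>S. \<forall>y\<in>S. cmult A x y \<in> S) \<and> (\<forall>x\<in>S. vstar A x \<in> S) \<and> cstar_closure A S \<subseteq> S"

definition cstar_generated :: "('a, 'm) cstar_scheme \<Rightarrow> 'a set \<Rightarrow> 'a set" where
  "cstar_generated A X = \<Inter>{S. cstar_subalgebra A S \<and> X \<subseteq> S}"

definition star_hom :: "('a, 'm) cstar_scheme \<Rightarrow> ('b, 'k) cstar_scheme \<Rightarrow> ('a \<Rightarrow> 'b) \<Rightarrow> bool" where
  "star_hom A B f \<longleftrightarrow> lin_map A B f \<and>
     (\<forall>x\<in>carrier A. \<forall>y\<in>carrier A. f (cmult A x y) = cmult B (f x) (f y)) \<and>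
     (\<forall>x\<in>carrier A. f (vstar A x) = vstar B (f x))"

definition mat_mult :: "('a, 'm) cstar_scheme \<Rightarrow> nat \<Rightarrow> 'a mat \<Rightarrow> 'a mat \<Rightarrow> 'a mat" where
  "mat_mult A n x y = (\<lambda>i j. if i < n \<and> j < n
     then vsum A (\<lambda>k. cmult A (x i k) (y k j)) n else vzero A)"

definition mat_algebra :: "('a, 'm) cstar_scheme \<Rightarrow> nat \<Rightarrow> ('a mat \<Rightarrow> real) \<Rightarrow> 'a mat cstar" where
  "mat_algebra A n N = \<lparr>carrier = Mat A n, vzero = mat_zero A, vadd = mat_add A,
     vscale = mat_scale A, vstar = mat_star A n, cmult = mat_mult A n, cnorm = N\<rparr>"

text \<open>
  The matrix norms of a $C^*$-algebra are the unique norms making the matrix $*$-algebras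
  $C^*$-algebras. (The description operator is applied to the value at \<open>x\<close> because the norm
  is unique only as a function on \<open>Mat A n\<close>.)
\<close>

definition cstar_mnorm :: "('a, 'm) cstar_scheme \<Rightarrow> nat \<Rightarrow> 'a mat \<Rightarrow> real" where
  "cstar_mnorm A n x = (THE r. \<exists>N. cstar_algebra (mat_algebra A n N) \<and> N x = r)"

definition operator_space_of_cstar :: "('a, 'm) cstar_scheme \<Rightarrow> 'a operator_space" where
  "operator_space_of_cstar A = \<lparr>carrier = carrier A, vzero = vzero A, vadd = vadd A,
     vscale = vscale A, vstar = vstar A,
     cone = (\<lambda>n. {mat_mult A n (mat_star A n y) y | y. y \<in> Mat A n}),
     mnorm = cstar_mnorm A\<rparr>"

section \<open>Envelopes and the propagation number\<close>

definition Csharp_extension :: "'a operator_space \<Rightarrow> 'b cstar \<Rightarrow> ('a \<Rightarrow> 'b) \<Rightarrow> bool" where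
  "Csharp_extension E A \<kappa> \<longleftrightarrow> cstar_algebra A \<and>
     completely_isometric E (operator_space_of_cstar A) \<kappa> \<and>
     completely_positive E (operator_space_of_cstar A) \<kappa> \<and>
     cstar_generated A (\<kappa> ` carrier E) = carrier A \<and>
     complete_order_iso_onto_range (unitization E) (unitization (operator_space_of_cstar A))
       (unital_extension \<kappa>)"

text \<open>
  In a $C^\sharp$-extension of \<open>E\<close> every element of the algebra is the limit of a sequence of
  finite sums of finite products of elements of the (self-adjoint) image of \<open>E\<close>. Choosing such
  sequences injects the algebra into the following type, so that every $C^\sharp$-extension of \<open>E\<close>,
  of whatever type, has an isomorphic copy whose carrier is a subset of this type, and it suffices
  to demand the universal property of the envelope for these.
\<close>

type_synonym 'a extension_carrier = "nat \<Rightarrow> 'a list list"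

definition Csharp_envelope :: "'a operator_space \<Rightarrow> 'b cstar \<Rightarrow> ('a \<Rightarrow> 'b) \<Rightarrow> bool" where
  "Csharp_envelope E A \<iota> \<longleftrightarrow> Csharp_extension E A \<iota> \<and>
     (\<forall>(B :: 'a extension_carrier cstar) \<kappa>. Csharp_extension E B \<kappa> \<longrightarrow>
        (\<exists>!\<rho>. \<rho> \<in> extensional (carrier B) \<and> star_hom B A \<rho> \<and> \<rho> ` carrier B = carrier A \<and>
           (\<forall>x\<in>carrier E. \<rho> (\<kappa> x) = \<iota> x)))"

fun nonempty_product :: "('a, 'm) cstar_scheme \<Rightarrow> 'a \<Rightarrow> 'a list \<Rightarrow> 'a" where
  "nonempty_product A x [] = x"
| "nonempty_product A x (y # ys) = cmult A x (nonempty_product A y ys)"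

text \<open>$X^{\circ n}$: products of at most $n$ (and at least one) elements, for $n \ge 1$.\<close>

definition product_closure :: "('a, 'm) cstar_scheme \<Rightarrow> 'a set \<Rightarrow> nat \<Rightarrow> 'a set" where
  "product_closure A X n = cstar_closure A (lin_span A
     {nonempty_product A x xs | x xs. set (x # xs) \<subseteq> X \<and> length (x # xs) \<le> n})"

text \<open>
  The propagation number of \<open>E\<close>, computed in its envelope \<open>\<iota> : E \<rightarrow> A\<close>;
  note that \<open>Inf {} = \<infinity>\<close> in \<open>enat\<close>.
\<close>

definition propagation_number :: "'a operator_space \<Rightarrow> 'b cstar \<Rightarrow> ('a \<Rightarrow> 'b) \<Rightarrow> enat" where
  "propagation_number E A \<iota> =
     Inf {enat n | n. 1 \<le> n \<and> cstar_subalgebra A (product_closure A (\<iota> ` carrier E) n)}"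

section \<open>Operators on complex Hilbert spaces\<close>

class complex_hilbert = banach +
  fixes cscale :: "complex \<Rightarrow> 'a \<Rightarrow> 'a"
    and cinner :: "'a \<Rightarrow> 'a \<Rightarrow> complex"
  assumes cscale_add_right: "cscale c (x + y) = cscale c x + cscale c y"
    and cscale_add_left: "cscale (c + d) x = cscale c x + cscale d x"
    and cscale_cscale: "cscale c (cscale d x) = cscale (c * d) x"
    and scaleR_cscale: "r *\<^sub>R x = cscale (complex_of_real r) x"
    and cinner_add_right: "cinner x (y + z) = cinner x y + cinner x z"
    and cinner_scale_right: "cinner x (cscale c y) = c * cinner x y"
    and cinner_commute: "cinner x y = cnj (cinner y x)"
    and cinner_norm: "cinner x x = complex_of_real ((norm x)\<^sup>2)"

text \<open>
  \<open>'h \<Rightarrow>\<^sub>L 'h\<close> consists of the bounded real-linear operators, with the operator norm and its topology.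
\<close>

definition bounded_ops :: "('h::complex_hilbert \<Rightarrow>\<^sub>L 'h) set" where
  "bounded_ops = {T. \<forall>c v. blinfun_apply T (cscale c v) = cscale c (blinfun_apply T v)}"

definition compact_ops :: "('h::complex_hilbert \<Rightarrow>\<^sub>L 'h) set" where
  "compact_ops = {T \<in> bounded_ops. compact (closure (blinfun_apply T ` cball 0 1))}"

definition op_scale :: "complex \<Rightarrow> ('h::complex_hilbert \<Rightarrow>\<^sub>L 'h) \<Rightarrow> ('h \<Rightarrow>\<^sub>L 'h)" where
  "op_scale c T = Blinfun (\<lambda>v. cscale c (blinfun_apply T v))"

definition op_adjoint :: "('h::complex_hilbert \<Rightarrow>\<^sub>L 'h) \<Rightarrow> ('h \<Rightarrow>\<^sub>L 'h)" where
  "op_adjoint T = (THE S. \<forall>u v. cinner (blinfun_apply S u) v = cinner u (blinfun_apply T v))"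

text \<open>
  A self-adjoint subspace of $B(H)$ with the norms and cones of $M_n(B(H))=B(H^n)$.
  By polarization, a complex-linear operator with nonnegative quadratic form is self-adjoint.
\<close>

definition concrete_operator_space ::
  "('h::complex_hilbert \<Rightarrow>\<^sub>L 'h) set \<Rightarrow> ('h \<Rightarrow>\<^sub>L 'h) operator_space" where
  "concrete_operator_space S =
    (let U = \<lparr>carrier = S, vzero = 0, vadd = (+), vscale = op_scale, vstar = op_adjoint\<rparr>
     in star_space.extend U \<lparr>
       cone = (\<lambda>n. {x \<in> Mat_sa U n. \<forall>v.
         (\<Sum>i<n. \<Sum>j<n. cinner (v i) (blinfun_apply (x i j) (v j))) \<in> \<real>\<^sub>\<ge>\<^sub>0}),
       mnorm = (\<lambda>n x. Inf {c. 0 \<le> c \<and> (\<forall>v.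
         L2_set (\<lambda>i. norm (\<Sum>j<n. blinfun_apply (x i j) (v j))) {..<n}
           \<le> c * L2_set (\<lambda>j. norm (v j)) {..<n})})\<rparr>)"

text \<open>A realization of a unital operator system as a self-adjoint unital subspace of $B(H)$.\<close>

definition realization ::
  "'a ordered_space \<Rightarrow> 'a \<Rightarrow> ('a \<Rightarrow> 'h::complex_hilbert \<Rightarrow>\<^sub>L 'h) \<Rightarrow> bool" where
  "realization E e \<pi> \<longleftrightarrow> \<pi> ` carrier E \<subseteq> bounded_ops \<and> \<pi> e = id_blinfun \<and>
     (\<forall>x\<in>carrier E. \<pi> (vstar E x) = op_adjoint (\<pi> x)) \<and>
     complete_order_iso E (concrete_operator_space (\<pi> ` carrier E)) \<pi>"

subsection \<open>Tensor products\<close>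

text \<open>\<open>t\<close> exhibits \<open>'k\<close> as the Hilbert space tensor product of \<open>'h\<close> and \<open>'l\<close>.\<close>

definition hilbert_tensor ::
  "('h::complex_hilbert \<Rightarrow> 'l::complex_hilbert \<Rightarrow> 'k::complex_hilbert) \<Rightarrow> bool" where
  "hilbert_tensor t \<longleftrightarrow>
     (\<forall>u u' v. t (u + u') v = t u v + t u' v) \<and> (\<forall>u v v'. t u (v + v') = t u v + t u v') \<and>
     (\<forall>c u v. t (cscale c u) v = cscale c (t u v)) \<and> (\<forall>c u v. t u (cscale c v) = cscale c (t u v)) \<and>
     (\<forall>u u' v v'. cinner (t u v) (t u' v') = cinner u u' * cinner v v') \<and>
     closure (span {t u v | u v. True}) = UNIV"

definition op_tensor ::
  "('h::complex_hilbert \<Rightarrow> 'l::complex_hilbert \<Rightarrow> 'k::complex_hilbert) \<Rightarrow>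
   ('h \<Rightarrow>\<^sub>L 'h) \<Rightarrow> ('l \<Rightarrow>\<^sub>L 'l) \<Rightarrow> ('k \<Rightarrow>\<^sub>L 'k)" where
  "op_tensor t x y = (THE z. z \<in> bounded_ops \<and> (\<forall>u v.
     blinfun_apply z (t u v) = t (blinfun_apply x u) (blinfun_apply y v)))"

definition min_tensor ::
  "('h::complex_hilbert \<Rightarrow> 'l::complex_hilbert \<Rightarrow> 'k::complex_hilbert) \<Rightarrow>
   ('h \<Rightarrow>\<^sub>L 'h) set \<Rightarrow> ('l \<Rightarrow>\<^sub>L 'l) set \<Rightarrow> ('k \<Rightarrow>\<^sub>L 'k) set" where
  "min_tensor t S T = closure (lin_span (concrete_operator_space bounded_ops)
     {op_tensor t x y | x y. x \<in> S \<and> y \<in> T})"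

definition separable_infinite_dimensional :: "'l::complex_hilbert set \<Rightarrow> bool" where
  "separable_infinite_dimensional H \<longleftrightarrow>
     (\<exists>D. countable D \<and> D \<subseteq> H \<and> H \<subseteq> closure D) \<and> \<not> (\<exists>B. finite B \<and> H \<subseteq> span B)"

end

theory Submission
  imports Defs
begin

text \<open>
  Let $B$ and $B'$ be the $C^*$-algebras of operators generated by $E$ and $E\otimes_{\min}\mathcal K$ in
  concrete representations. The universal property of the envelope, applied to quotients of $B$, says that the
  kernel $J$ of $B\to C^*_{\mathrm{env}}(E)$ is the largest ideal $I$ such that $B/I$ is a
  $C^\sharp$-extension of $E$; let $J'$ be the corresponding ideal of $B'$. Since the norm of the envelope is
  the quotient norm, $\mathrm{prop}(E)\le n$ means that the linear span of the products of at most $n$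
  elements of $E$ has a dense sum with $J$.

  For vectors $a$ of the second tensor factor put $V_a u=u\otimes a$. These operators link the
  two situations: $b\mapsto V_abV_c^*$ maps $B$ to $B'$ and $T\mapsto V_a^*TV_c$ maps $B'$ to $B$, both
  mapping products of $n$ elements to limits of sums of such products. For a unit vector $a$ the ideal
  $\{b: V_abV_a^*\in J'\}$ yields a $C^\sharp$-extension of $E$, hence lies in $J$, and
  $\{T: V_a^*TV_c\in J \text{ for all } a,c\}$ yields one of $E\otimes_{\min}\mathcal K$, hence lies in $J'$.
  With these two inclusions, density passes from either side to the other.
\<close>

section \<open>Hilbert spaces\<close>

text \<open>The stabilization has no unit in general, so its order and its norms cannot be read off
  from one. Both spaces are therefore treated as a \<open>presentation\<close>, operators with a
  bounded approximate unit: the unit itself for E, the cut-offs 1 tensor P with P of finite rank for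
  the stabilization. The approximate unit makes the order of the partial unitization visible on the
  Hilbert space: all states have real part at least -1 at x exactly when 1 + x is positive. Hence
  being a C-sharp-extension turns into \<open>admissible\<close>, a condition on norms and
  functionals of B that mentions no quotient and can be moved along the operators V_a. The two
  directions differ in difficulty: the corner embedding is a homomorphism, but compressing operators
  on the tensor product to matrices over B is merely positive, so there positivity of functionals is
  transferred through square roots. Spectral theory is replaced by a single iteration, k = (b +
  k^2)/2. It gives square roots and the contractivity of star-homomorphisms, hence the uniqueness of
  C*-norms; without uniqueness the matrix norms, which are given by a definite description, could
  not be computed.\<close>

lemma cinner_add_left: "cinner (x + y) z = cinner x z + cinner (y::'h::complex_hilbert) z"
  by (metis cinner_add_right cinner_commute complex_cnj_add)

lemma cinner_scale_left: "cinner (cscale c x) y = cnj c * cinner (x::'h::complex_hilbert) y"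
  by (metis cinner_commute cinner_scale_right complex_cnj_mult)

lemma cinner_scaleR_right: "cinner x (r *\<^sub>R y) = r *\<^sub>R cinner (x::'h::complex_hilbert) y"
  by (simp add: scaleR_cscale cinner_scale_right scaleR_conv_of_real)

lemma cinner_scaleR_left: "cinner (r *\<^sub>R x) y = r *\<^sub>R cinner (x::'h::complex_hilbert) y"
  by (simp add: scaleR_cscale cinner_scale_left scaleR_conv_of_real)

lemma norm_sq_cinner: "(norm (x::'h::complex_hilbert))\<^sup>2 = Re (cinner x x)"
  by (simp add: cinner_norm)

lemma norm_cscale: "norm (cscale c (x::'h::complex_hilbert)) = cmod c * norm x"
proof -
  have "complex_of_real ((norm (cscale c x))\<^sup>2) = (c * cnj c) * cinner x x"
    unfolding cinner_norm[symmetric] by (simp add: cinner_scale_left cinner_scale_right mult_ac)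
  also have "c * cnj c = complex_of_real ((cmod c)\<^sup>2)"
    by (metis complex_norm_square)
  also have "\<dots> * cinner x x = complex_of_real ((cmod c * norm x)\<^sup>2)"
    by (simp add: cinner_norm power_mult_distrib)
  finally have "(norm (cscale c x))\<^sup>2 = (cmod c * norm x)\<^sup>2"
    using of_real_eq_iff by blast
  then show ?thesis
    by (simp add: power2_eq_iff_nonneg)
qed

lemma cinner_zero_right [simp]: "cinner x (0::'h::complex_hilbert) = 0"
  using cinner_scaleR_right[of x 0 0] by simp

lemma cinner_zero_left [simp]: "cinner (0::'h::complex_hilbert) x = 0"
  using cinner_scaleR_left[of 0 0 x] by simp

lemma cscale_one [simp]: "cscale 1 (x::'h::complex_hilbert) = x"
  using scaleR_cscale[of 1 x] by simp

lemma cscale_minus_one: "cscale (-1) (x::'h::complex_hilbert) = - x"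
  using scaleR_cscale[of "-1" x] by simp

lemma cscale_zero_left [simp]: "cscale 0 (x::'h::complex_hilbert) = 0"
  using scaleR_cscale[of 0 x] by simp

lemma cscale_scaleR: "cscale c (r *\<^sub>R x) = r *\<^sub>R cscale c (x::'h::complex_hilbert)"
  by (simp add: scaleR_cscale cscale_cscale mult.commute)

lemma cscale_zero_right [simp]: "cscale c (0::'h::complex_hilbert) = 0"
  using cscale_scaleR[of c 0 0] by simp

lemma bounded_linear_cscale: "bounded_linear (cscale c :: 'h::complex_hilbert \<Rightarrow> 'h)"
  by (rule bounded_linear_intro[where K = "cmod c"])
    (simp_all add: cscale_add_right cscale_scaleR norm_cscale)

lemma Re_cinner_le_norm: "Re (cinner x y) \<le> norm (x::'h::complex_hilbert) * norm y"
proof -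
  have pos: "0 \<le> t\<^sup>2 * (norm x)\<^sup>2 - 2 * t * Re (cinner x y) + (norm y)\<^sup>2" for t
  proof -
    have "(norm (y + (-t) *\<^sub>R x))\<^sup>2 = (norm y)\<^sup>2 - t * Re (cinner x y) - t * Re (cinner y x) + t\<^sup>2 * (norm x)\<^sup>2"
      unfolding norm_sq_cinner cinner_add_left cinner_add_right cinner_scaleR_left
          cinner_scaleR_right by (simp add: power2_eq_square algebra_simps)
    moreover have "Re (cinner y x) = Re (cinner x y)"
      by (subst cinner_commute) simp
    ultimately have "(norm (y + (-t) *\<^sub>R x))\<^sup>2 = t\<^sup>2 * (norm x)\<^sup>2 - 2 * t * Re (cinner x y) + (norm y)\<^sup>2"
      by simp
    then show ?thesis by (metis zero_le_power2)
  qed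
  show ?thesis
  proof (cases "x = 0")
    case False
    \<comment> \<open>For this \<open>t\<close> the two squares t^2 |x|^2 and |y|^2 that bound 2 t
      Re <x, y> are equal, so dividing by \<open>2 * t\<close> leaves the product of the
      norms.\<close>
    define t where "t = norm y / norm x"
    have t: "t * norm x = norm y" using False by (simp add: t_def)
    show ?thesis
    proof (cases "y = 0")
      case False
      with \<open>x \<noteq> 0\<close> have "t > 0" by (simp add: t_def)
      have "2 * t * Re (cinner x y) \<le> (t * norm x)\<^sup>2 + (norm y)\<^sup>2"
        using pos[of t] by (simp add: power_mult_distrib)
      also have "\<dots> = 2 * t * (norm x * norm y)"
        using t by (metis (no_types, lifting) mult.assoc mult.commute mult_2 power2_eq_square)
      finally show ?thesis using \<open>t > 0\<close> by simp
    qed simp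
  qed simp
qed

lemma cmod_cinner_le: "cmod (cinner x y) \<le> norm (x::'h::complex_hilbert) * norm y"
proof (cases "cinner x y = 0")
  case False
  \<comment> \<open>The phase that rotates \<open>cinner x y\<close> onto the nonnegative real axis;
    it reduces the modulus to the real part.\<close>
  define c where "c = cnj (cinner x y) / complex_of_real (cmod (cinner x y))"
  have "cmod c = 1" using False by (simp add: c_def norm_divide)
  have "cinner x (cscale c y) = complex_of_real (cmod (cinner x y))"
    using False
    by (simp add: cinner_scale_right c_def divide_eq_eq)
      (metis complex_norm_square mult.commute of_real_mult power2_eq_square)
  then show ?thesis
    using Re_cinner_le_norm[of x "cscale c y"] \<open>cmod c = 1\<close> by (simp add: norm_cscale)
qed simp

lemma bounded_bilinear_cinner: "bounded_bilinear (cinner :: 'h::complex_hilbert \<Rightarrow> 'h \<Rightarrow> complex)"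
  by (rule bounded_bilinear.intro)
    (auto simp: cinner_add_left cinner_add_right cinner_scaleR_left cinner_scaleR_right
      intro!: exI[of _ 1] cmod_cinner_le)

interpretation cinner: bounded_bilinear "cinner :: 'h::complex_hilbert \<Rightarrow> 'h \<Rightarrow> complex"
  by (rule bounded_bilinear_cinner)

lemmas cscale_diff_right = linear_diff[OF bounded_linear.linear[OF bounded_linear_cscale]]
  and cscale_sum_right = linear_sum[OF bounded_linear.linear[OF bounded_linear_cscale]]

lemma cinner_ext: "(\<And>u. cinner u x = cinner u y) \<Longrightarrow> x = (y::'h::complex_hilbert)"
proof -
  assume "\<And>u. cinner u x = cinner u y"
  then have "cinner (x - y) (x - y) = 0" by (simp add: cinner.diff_right)
  then show "x = y" by (simp add: cinner_norm)
qed

lemma parallelogram: "(norm (x - y))\<^sup>2 + (norm (x + y))\<^sup>2 = 2 * (norm x)\<^sup>2 + 2 * (norm (y::'h::complex_hilbert))\<^sup>2"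
  by (simp add: norm_sq_cinner cinner.add_left cinner.add_right cinner.diff_left cinner.diff_right)

text \<open>The representing vector minimizes \<open>(norm x)\<^sup>2 - 2 * Re (f x)\<close>.\<close>

lemma riesz_representation:
  fixes f :: "'h::complex_hilbert \<Rightarrow> complex"
  assumes f: "bounded_linear f" and fc: "\<And>c x. f (cscale c x) = c * f x"
  obtains w where "\<And>v. f v = cinner w v"
proof -
  interpret f: bounded_linear f by (rule f)
  define J where "J x = (norm x)\<^sup>2 - 2 * Re (f x)" for x
  obtain C where C: "\<And>x. cmod (f x) \<le> norm x * C" using f.bounded by blast
  have lower: "J x \<ge> - C\<^sup>2" for x
  proof -
    have "2 * Re (f x) \<le> 2 * (norm x * C)"
      using C[of x] complex_Re_le_cmod[of "f x"] by linarith
    also have "\<dots> \<le> (norm x)\<^sup>2 + C\<^sup>2"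
      using sum_squares_bound[of "norm x" C] by (simp add: mult.assoc)
    finally show ?thesis by (simp add: J_def)
  qed
  define m where "m = Inf (range J)"
  have bdd: "bdd_below (range J)" using lower by (auto intro!: bdd_belowI)
  have m_le: "m \<le> J x" for x unfolding m_def by (rule cInf_lower[OF _ bdd]) simp
  have "\<exists>x. J x < m + 1 / real (Suc n)" for n
    using cInf_lessD[of "range J" "m + 1 / real (Suc n)"] by (auto simp: m_def)
  then obtain X where X: "\<And>n. J (X n) < m + 1 / real (Suc n)" by metis
  \<comment> \<open>Parallelogram law at the midpoint, where \<open>J\<close> is at least
    \<open>m\<close>: two near-minimizers are close to each other, so a minimizing sequence is
    Cauchy.\<close>
  have gap: "(norm (x - y))\<^sup>2 \<le> 2 * (J x - m) + 2 * (J y - m)" for x y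
  proof -
    have "J ((1/2) *\<^sub>R (x + y)) = (norm (x + y))\<^sup>2 / 4 - Re (f x) - Re (f y)"
      by (simp add: J_def f.scaleR f.add power2_eq_square add_divide_distrib)
    then show ?thesis
      using m_le[of "(1/2) *\<^sub>R (x + y)"] parallelogram[of x y] by (simp add: J_def)
  qed
  have "Cauchy X"
  proof (rule metric_CauchyI)
    fix e :: real assume "e > 0"
    obtain N where N: "1 / real (Suc N) < e\<^sup>2 / 4"
      using \<open>e > 0\<close> nat_approx_posE[of "e\<^sup>2 / 4"] by (metis divide_pos_pos zero_less_numeral zero_less_power)
    show "\<exists>M. \<forall>m\<ge>M. \<forall>n\<ge>M. dist (X m) (X n) < e"
    proof (intro exI[of _ N] allI impI)
      fix i j assume "i \<ge> N" "j \<ge> N"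
      have le: "J (X i) - m < e\<^sup>2 / 4" if "i \<ge> N" for i
      proof -
        have "1 / real (Suc i) \<le> 1 / real (Suc N)" using that by (simp add: frac_le)
        then show ?thesis using X[of i] N by linarith
      qed
      have "(norm (X i - X j))\<^sup>2 < e\<^sup>2"
        using order_le_less_trans[OF gap add_strict_mono[OF mult_strict_left_mono[OF le[OF \<open>i \<ge> N\<close>]]
          mult_strict_left_mono[OF le[OF \<open>j \<ge> N\<close>]]]] by simp
      then show "dist (X i) (X j) < e"
        using \<open>e > 0\<close> by (simp add: dist_norm power2_less_imp_less)
    qed
  qed
  then obtain w where w: "X \<longlonglongrightarrow> w" using convergent_eq_Cauchy by blast
  have "(\<lambda>n. J (X n)) \<longlonglongrightarrow> J w"
    unfolding J_def by (intro tendsto_intros w f.tendsto)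
  moreover have "(\<lambda>n. m + 1 / real (Suc n)) \<longlonglongrightarrow> m + 0"
    by (intro tendsto_intros LIMSEQ_Suc[OF lim_1_over_n])
  ultimately have Jw: "J w \<le> m"
    using less_imp_le[OF X] LIMSEQ_le[of "\<lambda>n. J (X n)" "J w" "\<lambda>n. m + 1 / real (Suc n)" "m + 0"] by auto
  \<comment> \<open>First variation at the minimizer: a quadratic in \<open>s\<close> without
    constant term stays nonnegative only if its linear coefficient \<open>2 * d\<close>
    vanishes.\<close>
  have re: "Re (cinner w v) = Re (f v)" for v
  proof -
    define d where "d = Re (cinner w v) - Re (f v)"
    have ineq: "0 \<le> s\<^sup>2 * (norm v)\<^sup>2 + 2 * s * d" for s
    proof -
      have "J (w + s *\<^sub>R v) = J w + s\<^sup>2 * (norm v)\<^sup>2 + s * Re (cinner w v) + s * Re (cinner v w) - 2 * s * Re (f v)"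
        unfolding J_def norm_sq_cinner cinner.add_left cinner.add_right cinner_scaleR_left
          cinner_scaleR_right f.add f.scaleR by (simp add: power2_eq_square algebra_simps)
      moreover have "Re (cinner v w) = Re (cinner w v)" by (subst cinner_commute) simp
      ultimately show ?thesis
        using m_le[of "w + s *\<^sub>R v"] Jw by (simp add: d_def algebra_simps)
    qed
    have "d = 0"
    proof (rule ccontr)
      assume "d \<noteq> 0"
      \<comment> \<open>The added 1 keeps the test value \<open>- d / k\<close> meaningful when
        \<open>v = 0\<close>.\<close>
      define k where "k = (norm v)\<^sup>2 + 1"
      have "k > 0" by (simp add: k_def add_nonneg_pos)
      have "0 \<le> (d/k)\<^sup>2 * (norm v)\<^sup>2 - 2 * (d/k) * d" using ineq[of "- d / k"] by simp
      also have "(d/k)\<^sup>2 * (norm v)\<^sup>2 \<le> (d/k)\<^sup>2 * k" by (intro mult_left_mono) (simp_all add: k_def)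
      also have "(d/k)\<^sup>2 * k - 2 * (d/k) * d = - (d\<^sup>2 / k)"
        using \<open>k > 0\<close> by (simp add: power2_eq_square field_simps)
      finally have "d\<^sup>2 / k \<le> 0" by simp
      moreover have "d\<^sup>2 / k > 0" using \<open>k > 0\<close> \<open>d \<noteq> 0\<close> by simp
      ultimately show False by simp
    qed
    then show ?thesis by (simp add: d_def)
  qed
  \<comment> \<open>Complex linearity recovers the imaginary part: it is minus the real part at
    \<open>cscale \<i> v\<close>.\<close>
  have "f v = cinner w v" for v
  proof (rule complex_eqI)
    show "Re (f v) = Re (cinner w v)" by (simp add: re)
    have "Re (f (cscale \<i> v)) = Re (cinner w (cscale \<i> v))" by (simp add: re)
    then show "Im (f v) = Im (cinner w v)" by (simp add: fc cinner_scale_right)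
  qed
  then show thesis by (rule that)
qed

section \<open>Operators and adjoints\<close>

type_synonym 'h op = "'h \<Rightarrow>\<^sub>L 'h"

text \<open>Versions for operators between two different spaces: \<open>bounded_ops\<close> and
  \<open>op_adjoint\<close> cover a single space only, whereas the maps sending u to u tensor a lead
  from H to the tensor product.\<close>

definition clin :: "('h::complex_hilbert \<Rightarrow>\<^sub>L 'g::complex_hilbert) \<Rightarrow> bool" where
  "clin T \<longleftrightarrow> (\<forall>c v. T (cscale c v) = cscale c (T v))"

definition adj :: "('h::complex_hilbert \<Rightarrow>\<^sub>L 'g::complex_hilbert) \<Rightarrow> ('g \<Rightarrow>\<^sub>L 'h)" where
  "adj T = (THE S. \<forall>u v. cinner (blinfun_apply S u) v = cinner u (blinfun_apply T v))"

lemma clinD: "clin T \<Longrightarrow> T (cscale c v) = cscale c (T v)"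
  by (simp add: clin_def)

lemma bounded_ops_iff: "T \<in> bounded_ops \<longleftrightarrow> clin T"
  by (simp add: bounded_ops_def clin_def)

lemma op_adjoint_eq: "op_adjoint = adj"
  by (rule ext) (simp add: op_adjoint_def adj_def)

lemma adj_eqI:
  assumes "\<And>u v. cinner (blinfun_apply S u) v = cinner u (blinfun_apply T v)"
  shows "adj T = S"
  unfolding adj_def
proof (rule the_equality)
  fix R assume R: "\<forall>u v. cinner (blinfun_apply R u) v = cinner u (blinfun_apply T v)"
  show "R = S"
  proof (rule blinfun_eqI, rule cinner_ext)
    fix u v
    show "cinner v (R u) = cinner v (S u)"
      using R assms by (metis cinner_commute)
  qed
qed (use assms in blast)

text \<open>Riesz representation of the functional v to <u, T v> defines the adjoint pointwise; its
  bound comes from |s u|^2 = <u, T (s u)>, where one factor |s u| cancels.\<close>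

lemma adj_exists:
  fixes T :: "'h::complex_hilbert \<Rightarrow>\<^sub>L 'g::complex_hilbert"
  assumes T: "clin T"
  shows "\<exists>S. \<forall>u v. cinner (blinfun_apply S u) v = cinner u (blinfun_apply T v)"
proof -
  have "\<exists>w. \<forall>v. cinner u (T v) = cinner w v" for u
  proof -
    have "bounded_linear (\<lambda>v. cinner u (T v))"
      by (intro bounded_linear_compose[OF cinner.bounded_linear_right] blinfun.bounded_linear_right)
    then show ?thesis
      using riesz_representation[of "\<lambda>v. cinner u (T v)"] clinD[OF T] by (metis cinner_scale_right)
  qed
  then obtain s where s: "\<And>u v. cinner (s u) v = cinner u (T v)" by metis
  have s': "cinner v (s u) = cinner (T v) u" for u v
    using s by (metis cinner_commute)
  have "bounded_linear s"
  proof (rule bounded_linear_intro[where K = "norm T"])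
    show "s (x + y) = s x + s y" for x y
      by (rule cinner_ext) (simp add: s' cinner.add_right)
    show "s (r *\<^sub>R x) = r *\<^sub>R s x" for r x
      by (rule cinner_ext) (simp add: s' cinner.scaleR_right)
    show "norm (s x) \<le> norm x * norm T" for x
    proof -
      have "(norm (s x))\<^sup>2 = Re (cinner x (T (s x)))" by (simp add: norm_sq_cinner s)
      also have "\<dots> \<le> norm x * norm (T (s x))" by (rule Re_cinner_le_norm)
      also have "\<dots> \<le> norm x * (norm T * norm (s x))"
        by (intro mult_left_mono norm_blinfun) simp
      finally have "norm (s x) * norm (s x) \<le> (norm x * norm T) * norm (s x)"
        by (simp add: power2_eq_square mult.assoc)
      then show ?thesis
        by (metis linorder_not_le mult_right_le_imp_le norm_ge_zero norm_le_zero_iff order_trans zero_le_mult_iff norm_zero)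
    qed
  qed
  then show ?thesis
    by (intro exI[of _ "Blinfun s"]) (simp add: bounded_linear_Blinfun_apply s)
qed

lemma cinner_adj_left: "clin T \<Longrightarrow> cinner (adj T u) v = cinner u (T v)"
  using adj_exists[of T] adj_eqI by metis

lemma cinner_adj_right: "clin T \<Longrightarrow> cinner u (adj T v) = cinner (T u) v"
  by (metis cinner_adj_left cinner_commute)

lemma clin_adj: "clin T \<Longrightarrow> clin (adj T)"
  unfolding clin_def[of "adj T"]
  by (intro allI cinner_ext) (simp add: cinner_adj_right cinner_scale_right)

lemma adj_adj: "clin T \<Longrightarrow> adj (adj T) = T"
  by (rule adj_eqI) (simp add: cinner_adj_right)

lemma clin_add: "clin S \<Longrightarrow> clin T \<Longrightarrow> clin (S + T)"
  by (simp add: clin_def blinfun.add_left cscale_add_right)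

lemma clin_diff: "clin S \<Longrightarrow> clin T \<Longrightarrow> clin (S - T)"
  by (simp add: clin_def blinfun.diff_left cscale_diff_right)

lemma clin_zero [simp]: "clin 0"
  by (simp add: clin_def)

lemma clin_scaleR: "clin T \<Longrightarrow> clin (r *\<^sub>R T)"
  by (simp add: clin_def blinfun.scaleR_left cscale_scaleR)

lemma clin_id [simp]: "clin id_blinfun"
  by (simp add: clin_def)

lemma clin_comp: "clin S \<Longrightarrow> clin T \<Longrightarrow> clin (S o\<^sub>L T)"
  by (simp add: clin_def)

lemma adj_add: "clin S \<Longrightarrow> clin T \<Longrightarrow> adj (S + T) = adj S + adj T"
  by (rule adj_eqI) (simp add: blinfun.add_left cinner.add_left cinner.add_right cinner_adj_left)

lemma adj_diff: "clin S \<Longrightarrow> clin T \<Longrightarrow> adj (S - T) = adj S - adj T"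
  by (rule adj_eqI) (simp add: blinfun.diff_left cinner.diff_left cinner.diff_right cinner_adj_left)

lemma adj_scaleR: "clin T \<Longrightarrow> adj (r *\<^sub>R T) = r *\<^sub>R adj T"
  by (rule adj_eqI) (simp add: blinfun.scaleR_left cinner.scaleR_left cinner.scaleR_right cinner_adj_left)

lemma adj_comp: "clin S \<Longrightarrow> clin T \<Longrightarrow> adj (S o\<^sub>L T) = adj T o\<^sub>L adj S"
  by (rule adj_eqI) (simp add: cinner_adj_left)

lemma adj_id [simp]: "adj id_blinfun = id_blinfun"
  by (rule adj_eqI) simp

lemma adj_zero [simp]: "adj 0 = 0"
  by (rule adj_eqI) simp

lemma op_scale_apply [simp]: "blinfun_apply (op_scale c T) v = cscale c (blinfun_apply T v)"
  unfolding op_scale_def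
  by (subst bounded_linear_Blinfun_apply)
    (intro bounded_linear_compose[OF bounded_linear_cscale] blinfun.bounded_linear_right, simp)

lemma clin_op_scale: "clin T \<Longrightarrow> clin (op_scale c T)"
  by (simp add: clin_def cscale_cscale mult.commute)

lemma adj_op_scale: "clin T \<Longrightarrow> adj (op_scale c T) = op_scale (cnj c) (adj T)"
  by (rule adj_eqI) (simp add: cinner_scale_left cinner_scale_right cinner_adj_left)

lemma op_scale_of_real: "op_scale (complex_of_real r) T = r *\<^sub>R T"
  by (rule blinfun_eqI) (simp add: blinfun.scaleR_left scaleR_cscale)

lemma op_scale_one [simp]: "op_scale 1 T = T"
  by (rule blinfun_eqI) simp

lemma op_scale_minus_one: "op_scale (-1) T = - T"
  by (rule blinfun_eqI) (simp add: cscale_minus_one blinfun.minus_left)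

lemma op_scale_scale: "op_scale c (op_scale d T) = op_scale (c * d) T"
  by (rule blinfun_eqI) (simp add: cscale_cscale)

lemma op_scale_add_right: "op_scale c (S + T) = op_scale c S + op_scale c T"
  by (rule blinfun_eqI) (simp add: blinfun.add_left cscale_add_right)

lemma op_scale_diff_right: "op_scale c (S - T) = op_scale c S - op_scale c T"
  by (rule blinfun_eqI) (simp add: blinfun.diff_left cscale_diff_right)

lemma op_scale_add_left: "op_scale (c + d) T = op_scale c T + op_scale d T"
  by (rule blinfun_eqI) (simp add: blinfun.add_left cscale_add_left)

lemma op_scale_zero_right [simp]: "op_scale c 0 = 0"
  by (rule blinfun_eqI) simp

lemma op_scale_zero_left [simp]: "op_scale 0 T = 0"
  by (rule blinfun_eqI) simp

lemma comp_op_scale_left: "op_scale c S o\<^sub>L T = op_scale c (S o\<^sub>L T)"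
  by (rule blinfun_eqI) simp

lemma comp_op_scale_right: "clin S \<Longrightarrow> S o\<^sub>L op_scale c T = op_scale c (S o\<^sub>L T)"
  by (rule blinfun_eqI) (simp add: clinD)

lemma norm_op_scale: "norm (op_scale c T) = cmod c * norm T"
proof -
  have le: "norm (op_scale c T) \<le> cmod c * norm T" for c and T :: "'a op"
  proof (rule norm_blinfun_bound)
    show "norm (blinfun_apply (op_scale c T) v) \<le> cmod c * norm T * norm v" for v
      by (simp add: norm_cscale mult.assoc mult_left_mono norm_blinfun)
  qed simp
  show ?thesis
  proof (cases "c = 0")
    case False
    have "norm T = norm (op_scale (1 / c) (op_scale c T))"
      using False by (simp add: op_scale_scale)
    also have "\<dots> \<le> cmod (1 / c) * norm (op_scale c T)" by (rule le)
    finally have "cmod c * norm T \<le> norm (op_scale c T)"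
      using False by (simp add: norm_divide field_simps)
    then show ?thesis using le[of c T] by simp
  qed simp
qed

lemma bounded_linear_op_scale: "bounded_linear (op_scale c)"
  by (rule bounded_linear_intro[where K = "cmod c"])
    (simp_all add: op_scale_add_right op_scale_scale norm_op_scale mult.commute flip: op_scale_of_real)

lemma clin_sum: "(\<And>i. i \<in> I \<Longrightarrow> clin (f i)) \<Longrightarrow> clin (\<Sum>i\<in>I. f i)"
  by (induction I rule: infinite_finite_induct) (auto intro: clin_add)

lemma adj_sum: "(\<And>i. i \<in> I \<Longrightarrow> clin (f i)) \<Longrightarrow> adj (\<Sum>i\<in>I. f i) = (\<Sum>i\<in>I. adj (f i))"
  by (induction I rule: infinite_finite_induct) (auto simp: adj_add clin_sum)

lemma norm_adj_le: "clin T \<Longrightarrow> norm (adj T) \<le> norm T"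
proof (rule norm_blinfun_bound)
  fix v assume T: "clin T"
  have "(norm (adj T v))\<^sup>2 = Re (cinner v (T (adj T v)))" by (simp add: norm_sq_cinner cinner_adj_left T)
  also have "\<dots> \<le> norm v * norm (T (adj T v))" by (rule Re_cinner_le_norm)
  also have "\<dots> \<le> norm v * (norm T * norm (adj T v))"
    by (intro mult_left_mono norm_blinfun) simp
  finally have "norm (adj T v) * norm (adj T v) \<le> (norm T * norm v) * norm (adj T v)"
    by (simp add: power2_eq_square mult_ac)
  then show "norm (adj T v) \<le> norm T * norm v"
    by (cases "norm (adj T v) = 0") auto
qed simp

lemma norm_adj: "clin T \<Longrightarrow> norm (adj T) = norm T"
  using norm_adj_le[of T] norm_adj_le[of "adj T"] by (simp add: clin_adj adj_adj)

text \<open>The lower bound is |T v|^2 = <v, adj T (T v)>, estimated by Cauchy-Schwarz.\<close>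

lemma norm_adj_comp: "clin T \<Longrightarrow> norm (adj T o\<^sub>L T) = (norm T)\<^sup>2"
proof (rule antisym)
  assume T: "clin T"
  show "norm (adj T o\<^sub>L T) \<le> (norm T)\<^sup>2"
    using norm_blinfun_compose[of "adj T" T] by (simp add: norm_adj T power2_eq_square)
  have "norm T \<le> sqrt (norm (adj T o\<^sub>L T))"
  proof (rule norm_blinfun_bound)
    fix v
    have "(norm (T v))\<^sup>2 = Re (cinner v ((adj T o\<^sub>L T) v))"
      by (simp add: norm_sq_cinner cinner_adj_right T)
    also have "\<dots> \<le> norm v * norm ((adj T o\<^sub>L T) v)" by (rule Re_cinner_le_norm)
    also have "\<dots> \<le> norm v * (norm (adj T o\<^sub>L T) * norm v)"
      by (intro mult_left_mono norm_blinfun) simp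
    finally have "(norm (T v))\<^sup>2 \<le> (sqrt (norm (adj T o\<^sub>L T)) * norm v)\<^sup>2"
      by (simp add: power_mult_distrib power2_eq_square mult_ac)
    then show "norm (T v) \<le> sqrt (norm (adj T o\<^sub>L T)) * norm v"
      by (rule power2_le_imp_le) simp
  qed simp
  then show "(norm T)\<^sup>2 \<le> norm (adj T o\<^sub>L T)"
    by (metis norm_ge_zero power_mono real_sqrt_pow2)
qed

lemma closed_bounded_ops: "closed (bounded_ops :: 'h::complex_hilbert op set)"
proof -
  have eq: "bounded_ops = (\<Inter>c. \<Inter>v. {T :: 'h \<Rightarrow>\<^sub>L 'h. T (cscale c v) = cscale c (T v)})"
    by (auto simp: bounded_ops_def)
  have cl: "closed {T :: 'h \<Rightarrow>\<^sub>L 'h. T (cscale c v) = cscale c (T v)}" for c v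
    by (intro closed_Collect_eq continuous_intros linear_continuous_on bounded_linear_cscale
        continuous_on_compose2[OF linear_continuous_on[OF bounded_linear_cscale], of UNIV _ UNIV]) auto
  show ?thesis unfolding eq by (intro closed_INT ballI cl)
qed

lemma tendsto_adj:
  assumes "(f \<longlongrightarrow> T) F" "\<And>i. clin (f i)" "clin T"
  shows "((\<lambda>i. adj (f i)) \<longlongrightarrow> adj T) F"
proof -
  have "((\<lambda>i. norm (f i - T)) \<longlongrightarrow> 0) F" using assms(1) tendsto_norm_zero LIM_zero by blast
  moreover have "norm (f i - T) = norm (adj (f i) - adj T)" for i
    using assms by (simp flip: adj_diff add: norm_adj clin_diff)
  ultimately show ?thesis by (simp add: tendsto_norm_zero_iff LIM_zero_iff)
qed

lemmas comp_simps =
  bounded_bilinear.add_left[OF bounded_bilinear_blinfun_compose]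
  bounded_bilinear.add_right[OF bounded_bilinear_blinfun_compose]
  bounded_bilinear.diff_left[OF bounded_bilinear_blinfun_compose]
  bounded_bilinear.diff_right[OF bounded_bilinear_blinfun_compose]
  bounded_bilinear.scaleR_left[OF bounded_bilinear_blinfun_compose]
  bounded_bilinear.scaleR_right[OF bounded_bilinear_blinfun_compose]
  bounded_bilinear.minus_left[OF bounded_bilinear_blinfun_compose]
  bounded_bilinear.minus_right[OF bounded_bilinear_blinfun_compose]

lemma comp_assoc: "(R o\<^sub>L S) o\<^sub>L T = R o\<^sub>L (S o\<^sub>L T)"
  by (rule blinfun_eqI) simp

lemma comp_id [simp]: "T o\<^sub>L id_blinfun = T" "id_blinfun o\<^sub>L T = T"
  by (auto intro: blinfun_eqI)

lemma comp_zero [simp]: "T o\<^sub>L 0 = 0" "0 o\<^sub>L T = 0"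
  by (auto intro: blinfun_eqI)

lemmas tendsto_comp = bounded_bilinear.tendsto[OF bounded_bilinear_blinfun_compose]

section \<open>Concrete operator algebras\<close>

definition op_subspace :: "'h::complex_hilbert op set \<Rightarrow> bool" where
  "op_subspace B \<longleftrightarrow> B \<subseteq> bounded_ops \<and> 0 \<in> B \<and> (\<forall>S\<in>B. \<forall>T\<in>B. S + T \<in> B) \<and>
     (\<forall>c. \<forall>T\<in>B. op_scale c T \<in> B) \<and> (\<forall>T\<in>B. adj T \<in> B)"

text \<open>No unit is demanded, since the algebra generated by the stabilization has none in
  general.\<close>

definition op_alg :: "'h::complex_hilbert op set \<Rightarrow> bool" where
  "op_alg B \<longleftrightarrow> op_subspace B \<and> (\<forall>S\<in>B. \<forall>T\<in>B. S o\<^sub>L T \<in> B) \<and> closed B"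

definition op_ideal :: "'h::complex_hilbert op set \<Rightarrow> 'h op set \<Rightarrow> bool" where
  "op_ideal B I \<longleftrightarrow> op_subspace I \<and> I \<subseteq> B \<and> (\<forall>S\<in>B. \<forall>T\<in>I. S o\<^sub>L T \<in> I \<and> T o\<^sub>L S \<in> I) \<and> closed I"

lemma op_subspaceD:
  assumes "op_subspace B"
  shows "S \<in> B \<Longrightarrow> clin S" "0 \<in> B" "S \<in> B \<Longrightarrow> T \<in> B \<Longrightarrow> S + T \<in> B"
    "S \<in> B \<Longrightarrow> op_scale c S \<in> B" "S \<in> B \<Longrightarrow> adj S \<in> B"
  using assms by (auto simp: op_subspace_def bounded_ops_iff)

lemma op_subspace_scaleR: "op_subspace B \<Longrightarrow> S \<in> B \<Longrightarrow> r *\<^sub>R S \<in> B"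
  by (metis op_scale_of_real op_subspaceD(4))

lemma op_subspace_uminus: "op_subspace B \<Longrightarrow> S \<in> B \<Longrightarrow> - S \<in> B"
  by (metis op_scale_minus_one op_subspaceD(4))

lemma op_subspace_diff: "op_subspace B \<Longrightarrow> S \<in> B \<Longrightarrow> T \<in> B \<Longrightarrow> S - T \<in> B"
  by (metis add_uminus_conv_diff op_subspaceD(3) op_subspace_uminus)

lemma sum_mem: "0 \<in> S \<Longrightarrow> (\<And>x y. x \<in> S \<Longrightarrow> y \<in> S \<Longrightarrow> x + y \<in> S) \<Longrightarrow> (\<And>i. i \<in> A \<Longrightarrow> f i \<in> S) \<Longrightarrow> sum f A \<in> S"
  by (induction A rule: infinite_finite_induct) auto

lemma op_subspace_sum: "op_subspace B \<Longrightarrow> (\<And>i. i \<in> I \<Longrightarrow> f i \<in> B) \<Longrightarrow> (\<Sum>i\<in>I. f i) \<in> B"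
  by (induction I rule: infinite_finite_induct) (auto intro: op_subspaceD)

lemma op_algD:
  assumes "op_alg B"
  shows "op_subspace B" "S \<in> B \<Longrightarrow> T \<in> B \<Longrightarrow> S o\<^sub>L T \<in> B" "closed B"
  using assms by (auto simp: op_alg_def)

lemma op_idealD:
  assumes "op_ideal B I"
  shows "op_subspace I" "T \<in> I \<Longrightarrow> T \<in> B" "S \<in> B \<Longrightarrow> T \<in> I \<Longrightarrow> S o\<^sub>L T \<in> I"
    "S \<in> B \<Longrightarrow> T \<in> I \<Longrightarrow> T o\<^sub>L S \<in> I" "closed I"
  using assms by (auto simp: op_ideal_def)

lemma op_ideal_zero: "op_alg B \<Longrightarrow> op_ideal B {0}"
  by (auto simp: op_ideal_def op_subspace_def bounded_ops_iff op_alg_def)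

section \<open>Positive operators and lifts from a quotient\<close>

definition op_pos :: "'h::complex_hilbert op \<Rightarrow> bool" where
  "op_pos T \<longleftrightarrow> (\<forall>v. cinner v (blinfun_apply T v) \<in> \<real>\<^sub>\<ge>\<^sub>0)"

lemma op_posI:
  assumes "clin T" "adj T = T" "\<And>v. 0 \<le> Re (cinner v (T v))"
  shows "op_pos T"
  unfolding op_pos_def
proof
  fix v
  have "cinner v (T v) = cnj (cinner v (T v))"
    using assms(1,2) by (metis cinner_adj_left cinner_commute)
  then have "Im (cinner v (T v)) = 0" by (metis complex_cnj complex.sel(2) equal_neg_zero complex_surj)
  then show "cinner v (T v) \<in> \<real>\<^sub>\<ge>\<^sub>0" using assms(3)[of v] by (simp add: complex_nonneg_Reals_iff)
qed

lemma op_posD: "op_pos T \<Longrightarrow> 0 \<le> Re (cinner v (T v))"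
  by (auto simp: op_pos_def complex_nonneg_Reals_iff)

lemma op_pos_adj_comp: "clin T \<Longrightarrow> op_pos (adj T o\<^sub>L T)"
  by (auto simp: op_pos_def cinner_adj_right cinner_norm)

text \<open>Discriminant of the nonnegative quadratic form of \<open>T\<close> at the vectors t w +
  v; for \<open>a = 0\<close> the form is affine in t, which forces \<open>b = 0\<close>.\<close>

lemma op_pos_cauchy_schwarz:
  assumes T: "clin T" "adj T = T" "op_pos T"
  shows "(Re (cinner w (T v)))\<^sup>2 \<le> Re (cinner w (T w)) * Re (cinner v (T v))"
proof -
  define a b c where "a = Re (cinner w (T w))" and "b = Re (cinner w (T v))" and "c = Re (cinner v (T v))"
  have vw: "Re (cinner v (T w)) = b"
    unfolding b_def using T by (metis cinner_adj_left cinner_commute complex_cnj complex.sel(1) complex_surj)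
  have quad: "0 \<le> a * t\<^sup>2 + 2 * b * t + c" for t :: real
  proof -
    have "0 \<le> Re (cinner (t *\<^sub>R w + v) (T (t *\<^sub>R w + v)))"
      by (rule op_posD[OF T(3)])
    also have "\<dots> = a * t\<^sup>2 + 2 * b * t + c"
      using vw by (simp add: blinfun.add_right blinfun.scaleR_right cinner.add_left cinner.add_right
          cinner.scaleR_left cinner.scaleR_right power2_eq_square algebra_simps a_def b_def c_def)
    finally show ?thesis .
  qed
  have "a \<ge> 0" "c \<ge> 0" using op_posD[OF T(3)] by (auto simp: a_def c_def)
  show "b\<^sup>2 \<le> a * c"
  proof (cases "a = 0")
    case True
    have "b = 0"
    proof (rule ccontr)
      assume "b \<noteq> 0"
      have "0 \<le> 2 * b * (- (c + 1) / (2 * b)) + c" using quad[of "- (c + 1) / (2 * b)"] True by simp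
      also have "\<dots> = -1" using \<open>b \<noteq> 0\<close> by (simp add: field_simps)
      finally show False by simp
    qed
    then show ?thesis using True by simp
  next
    case False
    then have "a > 0" using \<open>a \<ge> 0\<close> by simp
    have "0 \<le> a * (a * (- b / a)\<^sup>2 + 2 * b * (- b / a) + c)"
      using quad[of "- b / a"] \<open>a > 0\<close> by simp
    also have "\<dots> = a * c - b\<^sup>2" using \<open>a > 0\<close> by (simp add: field_simps power2_eq_square)
    finally show ?thesis by simp
  qed
qed

text \<open>Cauchy-Schwarz for the form of \<open>T\<close> yields T^2 \<le> T, that is |T v|^2
  \<le> q; then |v - T v|^2 = |v|^2 - 2 q + |T v|^2 is at most |v|^2. It makes id - T a legitimate
  input of the square root iteration.\<close>

lemma norm_id_diff_le:
  assumes T: "clin T" "adj T = T" "op_pos T" "norm T \<le> 1"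
  shows "norm (id_blinfun - T) \<le> 1"
proof (rule norm_blinfun_bound)
  fix v
  define q where "q = Re (cinner v (T v))"
  have "q \<ge> 0" using op_posD[OF T(3)] by (simp add: q_def)
  have "((norm (T v))\<^sup>2)\<^sup>2 = (Re (cinner (T v) (T v)))\<^sup>2" by (simp add: norm_sq_cinner)
  also have "\<dots> \<le> Re (cinner (T v) (T (T v))) * q"
    unfolding q_def by (rule op_pos_cauchy_schwarz[OF T(1-3)])
  also have "\<dots> \<le> (norm (T v))\<^sup>2 * q"
  proof (rule mult_right_mono[OF _ \<open>q \<ge> 0\<close>])
    have "Re (cinner (T v) (T (T v))) \<le> norm (T v) * norm (T (T v))" by (rule Re_cinner_le_norm)
    also have "norm (T (T v)) \<le> 1 * norm (T v)"
      using norm_blinfun[of T "T v"] T(4) by (meson mult_right_mono norm_ge_zero order_trans)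
    finally show "Re (cinner (T v) (T (T v))) \<le> (norm (T v))\<^sup>2"
      by (simp add: power2_eq_square mult_left_mono)
  qed
  finally have "(norm (T v))\<^sup>2 * (norm (T v))\<^sup>2 \<le> (norm (T v))\<^sup>2 * q" by (simp only: power2_eq_square)
  then have le: "(norm (T v))\<^sup>2 \<le> q"
    using \<open>q \<ge> 0\<close> mult_le_cancel_left_pos[of "(norm (T v))\<^sup>2" "(norm (T v))\<^sup>2" q]
    by (cases "T v = 0") auto
  have "Re (cinner (T v) v) = q" unfolding q_def by (subst cinner_commute) simp
  then have "(norm (v - T v))\<^sup>2 = (norm v)\<^sup>2 - 2 * q + (norm (T v))\<^sup>2"
    by (simp add: norm_sq_cinner cinner.diff_left cinner.diff_right q_def)
  also have "\<dots> \<le> (norm v)\<^sup>2" using le \<open>q \<ge> 0\<close> by simp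
  finally show "norm ((id_blinfun - T) v) \<le> 1 * norm v"
    by (simp add: blinfun.diff_left power2_le_iff_abs_le)
qed simp

text \<open>The scalar model, at b = 1, of the iteration taking K to (b + K^2)/2. For a contraction
  b it dominates norms and increments of the iterates, so its monotone convergence carries over. The
  limit solves (l - 1)^2 = 0.\<close>

lemma half_square_limit:
  fixes r :: "nat \<Rightarrow> real"
  assumes "r 0 = 0" "\<And>n. r (Suc n) = (1 + (r n)\<^sup>2) / 2"
  shows "r \<longlonglongrightarrow> 1" "r n \<le> r (Suc n)" "0 \<le> r n" "r n \<le> 1"
proof -
  have bd: "0 \<le> r n \<and> r n \<le> 1" for n
    by (induction n) (auto simp: assms power_le_one)
  then show "0 \<le> r n" "r n \<le> 1" by auto
  have mono: "r n \<le> r (Suc n)" for n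
    using sum_squares_bound[of "r n" 1] by (simp add: assms)
  show "r n \<le> r (Suc n)" by (rule mono)
  have "convergent r"
    using mono bd by (intro Bseq_mono_convergent BseqI'[of _ 1]) (auto simp: incseq_SucI incseqD)
  then obtain l where l: "r \<longlonglongrightarrow> l" by (auto simp: convergent_def)
  have "(\<lambda>n. r (Suc n)) \<longlonglongrightarrow> (1 + l\<^sup>2) / 2"
    unfolding assms(2) by (intro tendsto_intros l) simp
  then have "l = (1 + l\<^sup>2) / 2" using LIMSEQ_Suc[OF l] LIMSEQ_unique by blast
  then have "(l - 1)\<^sup>2 = 0" by (simp add: power2_eq_square algebra_simps)
  then show "r \<longlonglongrightarrow> 1" using l by simp
qed

text \<open>The $C^*$-identity for quotient norms. With \<open>z = adj y o\<^sub>L y - h\<close>, which may be assumed to be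
  self-adjoint, and \<open>s = id - z\<^sup>2 / M\<^sup>2\<close>, the powers \<open>g = s ^ m\<close> are contractions equal to the identity
  modulo \<open>I\<close>, and \<open>norm (z o\<^sub>L g) \<longlonglongrightarrow> 0\<close>; so the lift \<open>y o\<^sub>L g\<close> has the desired norm.\<close>

lemma quotient_norm_lift:
  assumes B: "op_alg B" and I: "op_ideal B I" and y: "y \<in> B"
    and h: "h \<in> B" "(adj y o\<^sub>L y) - h \<in> I" and \<epsilon>: "\<epsilon> > 0"
  shows "\<exists>y'\<in>B. y - y' \<in> I \<and> (norm y')\<^sup>2 \<le> norm h + \<epsilon>"
proof -
  note Bs = op_algD(1)[OF B] and Is = op_idealD(1)[OF I]
  \<comment> \<open>Averaging with the adjoint does not raise the norm and keeps the class modulo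
    \<open>I\<close>, because \<open>adj y o\<^sub>L y\<close> is self-adjoint.\<close>
  define h' where "h' = (1/2) *\<^sub>R (h + adj h)"
  have cy: "clin y" and ch: "clin h" using y h Bs op_subspaceD(1) by blast+
  have h'B: "h' \<in> B" unfolding h'_def by (intro op_subspace_scaleR op_subspaceD Bs h)
  have ah': "adj h' = h'"
    unfolding h'_def by (simp add: adj_scaleR adj_add clin_add ch clin_adj adj_adj add.commute)
  have nh': "norm h' \<le> norm h"
    using norm_triangle_ineq[of h "adj h"] by (simp add: h'_def norm_adj ch)
  define z where "z = (adj y o\<^sub>L y) - h'"
  have zI: "z \<in> I"
  proof -
    have "adj ((adj y o\<^sub>L y) - h) = (adj y o\<^sub>L y) - adj h"
      by (simp add: adj_diff adj_comp clin_comp clin_adj cy ch adj_adj)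
    then have "(adj y o\<^sub>L y) - adj h \<in> I" using h op_subspaceD(5)[OF Is] by metis
    then have "(1/2) *\<^sub>R (((adj y o\<^sub>L y) - h) + ((adj y o\<^sub>L y) - adj h)) \<in> I"
      by (intro op_subspace_scaleR op_subspaceD Is h)
    moreover have "(1/2) *\<^sub>R (((adj y o\<^sub>L y) - h) + ((adj y o\<^sub>L y) - adj h)) = z"
      by (simp add: z_def h'_def algebra_simps flip: scaleR_add_left)
    ultimately show ?thesis by simp
  qed
  have cz: "clin z" using zI Is op_subspaceD(1) by blast
  have az: "adj z = z"
    by (simp add: z_def adj_diff adj_comp clin_comp clin_adj cy adj_adj ah' op_subspaceD(1)[OF Bs h'B])
  \<comment> \<open>Positive even for \<open>z = 0\<close>, and large enough that z^2 / M^2 is at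
    most 1.\<close>
  define M where "M = norm z + 1"
  have "M > 0" by (simp add: M_def add_nonneg_pos)
  define t where "t = (1 / M\<^sup>2) *\<^sub>R (z o\<^sub>L z)"
  define s where "s = id_blinfun - t"
  have tI: "t \<in> I"
    unfolding t_def by (intro op_subspace_scaleR op_idealD(3)[OF I] Is zI op_idealD(2)[OF I])
  have ct: "clin t" "adj t = t"
    by (simp_all add: t_def clin_scaleR clin_comp cz adj_scaleR adj_comp az)
  have cs: "clin s" "adj s = s" by (simp_all add: s_def clin_diff adj_diff ct)
  \<comment> \<open>What \<open>s\<close> takes away from the squared norm of \<open>w\<close>
    controls |z w|: the cross terms remove |z w|^2 / M^2 twice, and |t w|^2 gives back at most one
    of the two.\<close>
  have key: "(norm (z w))\<^sup>2 \<le> M\<^sup>2 * ((norm w)\<^sup>2 - (norm (s w))\<^sup>2)" for w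
  proof -
    have tw: "t w = (1 / M\<^sup>2) *\<^sub>R z (z w)" by (simp add: t_def blinfun.scaleR_left)
    have zz: "cinner w (z (z w)) = cinner (z w) (z w)"
      using az cz by (metis cinner_adj_left)
    have r1: "Re (cinner w (t w)) = (norm (z w))\<^sup>2 / M\<^sup>2"
      by (simp add: tw cinner.scaleR_right zz norm_sq_cinner)
    have r2: "Re (cinner (t w) w) = (norm (z w))\<^sup>2 / M\<^sup>2"
      by (subst cinner_commute) (simp add: r1)
    have "norm (z (z w)) \<le> M * norm (z w)"
      using norm_blinfun[of z "z w"] norm_ge_zero[of "z w"] unfolding M_def distrib_right by linarith
    then have "(norm (z (z w)))\<^sup>2 \<le> M\<^sup>2 * (norm (z w))\<^sup>2"
      by (metis norm_ge_zero power_mono power_mult_distrib)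
    then have "(norm (t w))\<^sup>2 \<le> (norm (z w))\<^sup>2 / M\<^sup>2"
      using \<open>M > 0\<close> by (simp add: tw power_mult_distrib power_divide field_simps power2_eq_square)
    moreover have "(norm (s w))\<^sup>2 = (norm w)\<^sup>2 - 2 * ((norm (z w))\<^sup>2 / M\<^sup>2) + (norm (t w))\<^sup>2"
      using r1 r2 by (simp add: norm_sq_cinner s_def blinfun.diff_left cinner.diff_left cinner.diff_right)
    ultimately have "(norm (z w))\<^sup>2 / M\<^sup>2 \<le> (norm w)\<^sup>2 - (norm (s w))\<^sup>2" by linarith
    then show ?thesis using \<open>M > 0\<close> by (simp add: field_simps)
  qed
  have s1: "norm (s w) \<le> norm w" for w
  proof -
    have "0 \<le> M\<^sup>2 * ((norm w)\<^sup>2 - (norm (s w))\<^sup>2)" using key[of w] by (rule order_trans[rotated]) simp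
    then have "(norm (s w))\<^sup>2 \<le> (norm w)\<^sup>2" using \<open>M > 0\<close> by (simp add: zero_le_mult_iff)
    then show ?thesis by (rule power2_le_imp_le) simp
  qed
  define g where "g = (\<lambda>m. ((o\<^sub>L) s ^^ m) id_blinfun)"
  have g: "g 0 = id_blinfun" "g (Suc m) = s o\<^sub>L g m" for m by (simp_all add: g_def)
  have zs: "z o\<^sub>L s = s o\<^sub>L z"
    by (simp add: s_def t_def comp_simps comp_assoc)
  have gs: "g m o\<^sub>L s = s o\<^sub>L g m" for m
    by (induction m) (auto simp: g comp_assoc)
  have cg: "clin (g m) \<and> adj (g m) = g m" for m
    by (induction m) (auto simp: g clin_comp cs adj_comp gs)
  have gI: "id_blinfun - g m \<in> I" for m
  proof (induction m)
    case 0 then show ?case by (simp add: g op_subspaceD[OF Is])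
  next
    case (Suc m)
    have "id_blinfun - g (Suc m) = (id_blinfun - g m) + t - (t o\<^sub>L (id_blinfun - g m))"
      by (simp add: g s_def comp_simps algebra_simps)
    also have "\<dots> \<in> I"
      by (intro op_subspace_diff op_subspaceD Is tI Suc op_idealD(3)[OF I] op_idealD(2)[OF I])
    finally show ?case .
  qed
  have gn: "norm (g m w) \<le> norm w" for m w
  proof (induction m)
    case (Suc m) then show ?case using s1[of "g m w"] by (simp add: g)
  qed (simp add: g)
  \<comment> \<open>Telescoping of \<open>key\<close> along the powers of \<open>s\<close>. As
    \<open>z\<close> commutes with \<open>s\<close>, the numbers |z (g m w)| decrease, so the last
    squared term times their number is bounded by the total loss of norm.\<close>
  have zg: "real (Suc m) * (norm (z (g m w)))\<^sup>2 \<le> M\<^sup>2 * ((norm w)\<^sup>2 - (norm (g (Suc m) w))\<^sup>2)" for m w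
  proof (induction m)
    case 0 then show ?case using key[of w] by (simp add: g)
  next
    case (Suc m)
    have zgs: "z (g (Suc m) w) = s (z (g m w))"
      using zs by (metis blinfun_apply_blinfun_compose g(2))
    have "(norm (z (g (Suc m) w)))\<^sup>2 \<le> (norm (z (g m w)))\<^sup>2"
      unfolding zgs by (intro power_mono s1) simp
    then have "real (Suc m) * (norm (z (g (Suc m) w)))\<^sup>2 \<le> real (Suc m) * (norm (z (g m w)))\<^sup>2"
      by (intro mult_left_mono) auto
    moreover have "(norm (z (g (Suc m) w)))\<^sup>2 \<le> M\<^sup>2 * ((norm (g (Suc m) w))\<^sup>2 - (norm (g (Suc (Suc m)) w))\<^sup>2)"
      using key[of "g (Suc m) w"] by (simp add: g)
    ultimately show ?case using Suc by (simp add: algebra_simps)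
  qed
  \<comment> \<open>With \<open>k = m * m\<close> powers, the bound M^2 / (k + 1) from
    \<open>zg\<close> falls below the square of \<open>\<epsilon>\<close>.\<close>
  obtain m where m: "M / \<epsilon> < real m" using reals_Archimedean2 by blast
  have "M\<^sup>2 / \<epsilon>\<^sup>2 < real (Suc (m * m))"
  proof -
    have "(M / \<epsilon>)\<^sup>2 < (real m)\<^sup>2"
      using m \<open>M > 0\<close> \<epsilon> by (intro power_strict_mono) auto
    then show ?thesis by (simp add: power_divide power2_eq_square)
  qed
  define k where "k = m * m"
  have zgk: "norm (z o\<^sub>L g k) \<le> \<epsilon>"
  proof (rule norm_blinfun_bound)
    fix w
    have "real (Suc k) * (norm (z (g k w)))\<^sup>2 \<le> M\<^sup>2 * (norm w)\<^sup>2"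
      by (rule order_trans[OF zg]) (intro mult_left_mono, simp_all)
    also have "\<dots> \<le> (\<epsilon>\<^sup>2 * real (Suc k)) * (norm w)\<^sup>2"
      using \<open>M\<^sup>2 / \<epsilon>\<^sup>2 < real (Suc (m * m))\<close> \<epsilon> unfolding k_def[symmetric]
      by (intro mult_right_mono) (auto simp: field_simps)
    finally have "real (Suc k) * (norm (z (g k w)))\<^sup>2 \<le> real (Suc k) * (\<epsilon> * norm w)\<^sup>2"
      by (simp add: power_mult_distrib mult_ac)
    then have "(norm (z (g k w)))\<^sup>2 \<le> (\<epsilon> * norm w)\<^sup>2"
      by (subst (asm) mult_le_cancel_left_pos) simp_all
    then show "norm ((z o\<^sub>L g k) w) \<le> \<epsilon> * norm w"
      using \<epsilon> power2_le_imp_le[of "norm (z (g k w))" "\<epsilon> * norm w"] by simp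
  qed (use \<epsilon> in simp)
  have gk1: "norm (g k) \<le> 1" using gn by (intro norm_blinfun_bound) auto
  define y' where "y' = y o\<^sub>L g k"
  have dI: "y - y' \<in> I"
  proof -
    have "y - y' = y o\<^sub>L (id_blinfun - g k)" by (simp add: y'_def comp_simps)
    then show ?thesis using op_idealD(3)[OF I y gI] by simp
  qed
  have y'B: "y' \<in> B"
    using op_subspace_diff[OF Bs y op_idealD(2)[OF I dI]] by simp
  have "(norm y')\<^sup>2 = norm (adj y' o\<^sub>L y')"
    by (simp add: norm_adj_comp y'_def clin_comp cy cg)
  \<comment> \<open>\<open>g k\<close> is a self-adjoint contraction, so it does not enlarge
    \<open>h'\<close>, and it makes the remainder \<open>z\<close> small.\<close>
  also have "adj y' o\<^sub>L y' = g k o\<^sub>L ((h' + z) o\<^sub>L g k)"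
    by (simp add: y'_def adj_comp cy cg comp_assoc z_def)
  also have "\<dots> = (g k o\<^sub>L (h' o\<^sub>L g k)) + (g k o\<^sub>L (z o\<^sub>L g k))"
    by (simp add: comp_simps)
  also have "norm \<dots> \<le> norm (g k o\<^sub>L (h' o\<^sub>L g k)) + norm (g k o\<^sub>L (z o\<^sub>L g k))"
    by (rule norm_triangle_ineq)
  also have "norm (g k o\<^sub>L (h' o\<^sub>L g k)) \<le> 1 * (norm h' * 1)"
    by (intro order_trans[OF norm_blinfun_compose] mult_mono gk1 mult_nonneg_nonneg norm_ge_zero
      order_trans[OF norm_blinfun_compose] order_refl) auto
  also have "norm (g k o\<^sub>L (z o\<^sub>L g k)) \<le> 1 * \<epsilon>"
    by (intro order_trans[OF norm_blinfun_compose] mult_mono gk1 zgk) auto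
  finally have "(norm y')\<^sup>2 \<le> norm h + \<epsilon>" using nh' by simp
  then show ?thesis using dI y'B by blast
qed

section \<open>Square-summable sequences and operator matrices\<close>

text \<open>One Hilbert space on which matrices of every size act: a type cannot depend on n, so H^n
  is realized on the first n coordinates.\<close>

typedef (overloaded) 'h ell2 = "{f :: nat \<Rightarrow> 'h::complex_hilbert. summable (\<lambda>i. (norm (f i))\<^sup>2)}"
  morphisms ell2_nth mk_ell2
  by (intro exI[of _ "\<lambda>_. 0"]) simp

lemma ell2_summable: "summable (\<lambda>i. (norm (ell2_nth v i))\<^sup>2)"
  using ell2_nth[of v] by simp

lemma ell2_eqI: "(\<And>i. ell2_nth v i = ell2_nth w i) \<Longrightarrow> v = w"
  using ell2_nth_inject[of v w] by auto

lemma L2_bounded_summable: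
  fixes f :: "nat \<Rightarrow> 'h::real_normed_vector"
  assumes "\<And>n. L2_set (\<lambda>i. norm (f i)) {..<n} \<le> C"
  shows "summable (\<lambda>i. (norm (f i))\<^sup>2)"
proof (rule summableI_nonneg_bounded)
  fix n
  have "C \<ge> 0" using assms[of 0] by simp
  have "(L2_set (\<lambda>i. norm (f i)) {..<n})\<^sup>2 \<le> C\<^sup>2"
    by (intro power_mono assms L2_set_nonneg)
  then show "(\<Sum>i<n. (norm (f i))\<^sup>2) \<le> C\<^sup>2"
    by (simp add: L2_set_def sum_nonneg)
qed simp

lemma mk_ell2_nth: "summable (\<lambda>i. (norm (f i))\<^sup>2) \<Longrightarrow> ell2_nth (mk_ell2 f) = f"
  by (rule mk_ell2_inverse) simp

lemma L2_set_le_sqrt_suminf: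
  fixes f :: "nat \<Rightarrow> 'h::real_normed_vector"
  assumes "summable (\<lambda>i. (norm (f i))\<^sup>2)"
  shows "L2_set (\<lambda>i. norm (f i)) {..<n} \<le> sqrt (\<Sum>i. (norm (f i))\<^sup>2)"
  unfolding L2_set_def by (intro real_sqrt_le_mono sum_le_suminf assms) auto

lemma sqrt_suminf_le:
  fixes f :: "nat \<Rightarrow> 'h::real_normed_vector"
  assumes "\<And>n. L2_set (\<lambda>i. norm (f i)) {..<n} \<le> C"
  shows "sqrt (\<Sum>i. (norm (f i))\<^sup>2) \<le> C"
proof -
  have "C \<ge> 0" using assms[of 0] by simp
  have "(\<Sum>i. (norm (f i))\<^sup>2) \<le> C\<^sup>2"
  proof (rule suminf_le_const[OF L2_bounded_summable[OF assms]])
    fix n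
    have "(L2_set (\<lambda>i. norm (f i)) {..<n})\<^sup>2 \<le> C\<^sup>2"
      by (intro power_mono assms L2_set_nonneg)
    then show "(\<Sum>i<n. (norm (f i))\<^sup>2) \<le> C\<^sup>2"
      by (simp add: L2_set_def sum_nonneg)
  qed
  then show ?thesis using \<open>C \<ge> 0\<close> by (simp add: real_le_lsqrt)
qed

lemma L2_set_norm_add_le:
  fixes f g :: "nat \<Rightarrow> 'h::real_normed_vector"
  shows "L2_set (\<lambda>i. norm (f i + g i)) A \<le> L2_set (\<lambda>i. norm (f i)) A + L2_set (\<lambda>i. norm (g i)) A"
  by (rule order_trans[OF L2_set_mono L2_set_triangle_ineq]) (auto simp: norm_triangle_ineq)

lemma summable_add_sq:
  fixes f g :: "nat \<Rightarrow> 'h::real_normed_vector"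
  assumes "summable (\<lambda>i. (norm (f i))\<^sup>2)" "summable (\<lambda>i. (norm (g i))\<^sup>2)"
  shows "summable (\<lambda>i. (norm (f i + g i))\<^sup>2)"
  by (rule L2_bounded_summable[OF order_trans[OF L2_set_norm_add_le add_mono[OF
    L2_set_le_sqrt_suminf[OF assms(1)] L2_set_le_sqrt_suminf[OF assms(2)]]]])

lemma summable_scaleR_sq:
  fixes f :: "nat \<Rightarrow> 'h::real_normed_vector"
  assumes "summable (\<lambda>i. (norm (f i))\<^sup>2)"
  shows "summable (\<lambda>i. (norm (r *\<^sub>R f i))\<^sup>2)"
  using summable_mult[OF assms, of "r\<^sup>2"] by (simp add: power_mult_distrib)

section \<open>Hilbert space structure on square-summable sequences\<close>

instantiation ell2 :: (complex_hilbert) real_normed_vector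
begin

definition zero_ell2 :: "'a ell2" where "zero_ell2 = mk_ell2 (\<lambda>_. 0)"
definition plus_ell2 :: "'a ell2 \<Rightarrow> 'a ell2 \<Rightarrow> 'a ell2" where
  "plus_ell2 v w = mk_ell2 (\<lambda>i. ell2_nth v i + ell2_nth w i)"
definition scaleR_ell2 :: "real \<Rightarrow> 'a ell2 \<Rightarrow> 'a ell2" where
  "scaleR_ell2 r v = mk_ell2 (\<lambda>i. r *\<^sub>R ell2_nth v i)"
definition uminus_ell2 :: "'a ell2 \<Rightarrow> 'a ell2" where "uminus_ell2 v = scaleR (-1) v"
definition minus_ell2 :: "'a ell2 \<Rightarrow> 'a ell2 \<Rightarrow> 'a ell2" where "minus_ell2 v w = v + (- w)"
definition norm_ell2 :: "'a ell2 \<Rightarrow> real" where "norm_ell2 v = sqrt (\<Sum>i. (norm (ell2_nth v i))\<^sup>2)"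
definition dist_ell2 :: "'a ell2 \<Rightarrow> 'a ell2 \<Rightarrow> real" where "dist_ell2 v w = norm (v - w)"
definition sgn_ell2 :: "'a ell2 \<Rightarrow> 'a ell2" where "sgn_ell2 v = scaleR (inverse (norm v)) v"
definition uniformity_ell2 :: "('a ell2 \<times> 'a ell2) filter" where
  "uniformity_ell2 = (INF e\<in>{0 <..}. principal {(x, y). dist x y < e})"
definition open_ell2 :: "'a ell2 set \<Rightarrow> bool" where
  "open_ell2 U = (\<forall>x\<in>U. eventually (\<lambda>(x', y). x' = x \<longrightarrow> y \<in> U) uniformity)"

lemma nth0: "ell2_nth (0 :: 'a ell2) i = 0"
  by (simp add: zero_ell2_def mk_ell2_nth)

lemma nth_add: "ell2_nth (v + w) i = ell2_nth v i + ell2_nth (w :: 'a ell2) i"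
  by (simp add: plus_ell2_def mk_ell2_nth summable_add_sq ell2_summable)

lemma nth_scaleR: "ell2_nth (r *\<^sub>R v) i = r *\<^sub>R ell2_nth (v :: 'a ell2) i"
  by (simp only: scaleR_ell2_def mk_ell2_nth summable_scaleR_sq ell2_summable)

lemma nth_minus: "ell2_nth (- v) i = - ell2_nth (v :: 'a ell2) i"
  by (simp add: uminus_ell2_def nth_scaleR)

lemma nth_diff: "ell2_nth (v - w) i = ell2_nth v i - ell2_nth (w :: 'a ell2) i"
  by (simp add: minus_ell2_def nth_add nth_minus)

instance
proof
  fix x y z :: "'a ell2" and a b :: real
  show "x + y + z = x + (y + z)" by (rule ell2_eqI) (simp add: nth_add)
  show "x + y = y + x" by (rule ell2_eqI) (simp add: nth_add)
  show "0 + x = x" by (rule ell2_eqI) (simp add: nth_add nth0)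
  show "- x + x = 0" by (rule ell2_eqI) (simp add: nth_add nth0 nth_minus)
  show "x - y = x + - y" by (simp add: minus_ell2_def)
  show "a *\<^sub>R (x + y) = a *\<^sub>R x + a *\<^sub>R y" by (rule ell2_eqI) (simp add: nth_add nth_scaleR scaleR_add_right)
  show "(a + b) *\<^sub>R x = a *\<^sub>R x + b *\<^sub>R x" by (rule ell2_eqI) (simp add: nth_add nth_scaleR scaleR_add_left)
  show "a *\<^sub>R b *\<^sub>R x = (a * b) *\<^sub>R x" by (rule ell2_eqI) (simp add: nth_scaleR)
  show "1 *\<^sub>R x = x" by (rule ell2_eqI) (simp add: nth_scaleR)
  show "dist x y = norm (x - y)" by (rule dist_ell2_def)
  show "sgn x = scaleR (inverse (norm x)) x" by (rule sgn_ell2_def)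
  show "(uniformity :: ('a ell2 \<times> 'a ell2) filter) = (INF e\<in>{0 <..}. principal {(x, y). dist x y < e})"
    by (rule uniformity_ell2_def)
  show "open U = (\<forall>x\<in>U. eventually (\<lambda>(x', y). x' = x \<longrightarrow> y \<in> U) uniformity)" for U :: "'a ell2 set"
    by (rule open_ell2_def)
  show "(norm x = 0) = (x = 0)"
  proof
    assume "norm x = 0"
    then have "(\<Sum>i. (norm (ell2_nth x i))\<^sup>2) = 0" by (simp add: norm_ell2_def suminf_nonneg ell2_summable)
    then have "\<forall>i. (norm (ell2_nth x i))\<^sup>2 = 0" by (subst (asm) suminf_eq_zero_iff[OF ell2_summable]) auto
    then show "x = 0" by (intro ell2_eqI) (simp add: nth0)
  qed (simp add: norm_ell2_def nth0)
  show "norm (x + y) \<le> norm x + norm y"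
    unfolding norm_ell2_def nth_add
    by (rule sqrt_suminf_le[OF order_trans[OF L2_set_norm_add_le add_mono[OF
      L2_set_le_sqrt_suminf[OF ell2_summable] L2_set_le_sqrt_suminf[OF ell2_summable]]]])
  show "norm (a *\<^sub>R x) = \<bar>a\<bar> * norm x"
    by (simp add: norm_ell2_def nth_scaleR power_mult_distrib suminf_mult ell2_summable real_sqrt_mult)
qed

end

lemma norm_ell2_sq: "(norm v)\<^sup>2 = (\<Sum>i. (norm (ell2_nth v i))\<^sup>2)"
  by (simp add: norm_ell2_def suminf_nonneg ell2_summable)

lemma L2_set_le_norm_ell2: "L2_set (\<lambda>i. norm (ell2_nth v i)) {..<n} \<le> norm v"
  unfolding norm_ell2_def by (rule L2_set_le_sqrt_suminf[OF ell2_summable])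

lemma norm_ell2_le:
  "(\<And>n. L2_set (\<lambda>i. norm (ell2_nth v i)) {..<n} \<le> C) \<Longrightarrow> norm v \<le> C"
  unfolding norm_ell2_def by (rule sqrt_suminf_le)

lemma norm_ell2_nth_le: "norm (ell2_nth v i) \<le> norm v"
proof -
  have "norm (ell2_nth v i) \<le> L2_set (\<lambda>i. norm (ell2_nth v i)) {..<Suc i}"
    by (rule member_le_L2_set) auto
  also have "\<dots> \<le> norm v" by (rule L2_set_le_norm_ell2)
  finally show ?thesis .
qed

lemma summable_cscale_sq:
  fixes f :: "nat \<Rightarrow> 'h::complex_hilbert"
  assumes "summable (\<lambda>i. (norm (f i))\<^sup>2)"
  shows "summable (\<lambda>i. (norm (cscale r (f i)))\<^sup>2)"
  using summable_mult[OF assms, of "(cmod r)\<^sup>2"] by (simp add: power_mult_distrib norm_cscale)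

lemma summable_ell2_cinner: "summable (\<lambda>i. cinner (ell2_nth v i) (ell2_nth w i))"
proof (rule summable_comparison_test'[where N = 0])
  show "summable (\<lambda>i. (norm (ell2_nth v i))\<^sup>2 + (norm (ell2_nth w i))\<^sup>2)"
    by (intro summable_add ell2_summable)
  show "norm (cinner (ell2_nth v i) (ell2_nth w i)) \<le> (norm (ell2_nth v i))\<^sup>2 + (norm (ell2_nth w i))\<^sup>2" for i
  proof -
    have "norm (cinner (ell2_nth v i) (ell2_nth w i)) \<le> norm (ell2_nth v i) * norm (ell2_nth w i)"
      by (rule cmod_cinner_le)
    also have "\<dots> \<le> 2 * norm (ell2_nth v i) * norm (ell2_nth w i)" by simp
    also have "\<dots> \<le> (norm (ell2_nth v i))\<^sup>2 + (norm (ell2_nth w i))\<^sup>2" by (rule sum_squares_bound)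
    finally show ?thesis .
  qed
qed

instance ell2 :: (complex_hilbert) banach
proof
  fix X :: "nat \<Rightarrow> 'a ell2" assume X: "Cauchy X"
  have "Cauchy (\<lambda>n. ell2_nth (X n) i)" for i
  proof (rule metric_CauchyI)
    fix e :: real assume "e > 0"
    then obtain M where M: "\<And>m n. m \<ge> M \<Longrightarrow> n \<ge> M \<Longrightarrow> dist (X m) (X n) < e"
      using X unfolding Cauchy_def by blast
    show "\<exists>M. \<forall>m\<ge>M. \<forall>n\<ge>M. dist (ell2_nth (X m) i) (ell2_nth (X n) i) < e"
    proof (intro exI[of _ M] allI impI)
      fix m n assume "m \<ge> M" "n \<ge> M"
      have "dist (ell2_nth (X m) i) (ell2_nth (X n) i) \<le> dist (X m) (X n)"
        using norm_ell2_nth_le[of "X m - X n" i] by (simp add: dist_norm nth_diff)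
      then show "dist (ell2_nth (X m) i) (ell2_nth (X n) i) < e"
        using M[OF \<open>m \<ge> M\<close> \<open>n \<ge> M\<close>] by simp
    qed
  qed
  then have "\<exists>l. (\<lambda>n. ell2_nth (X n) i) \<longlonglongrightarrow> l" for i
    using Cauchy_convergent_iff convergent_def by blast
  then obtain f where f: "\<And>i. (\<lambda>n. ell2_nth (X n) i) \<longlonglongrightarrow> f i" by metis
  \<comment> \<open>Only the first \<open>k\<close> coordinates are passed to the limit; as the
    bound does not depend on \<open>k\<close>, it yields both the square-summability of the limit
    and convergence in norm.\<close>
  have close: "L2_set (\<lambda>i. norm (ell2_nth (X m) i - f i)) {..<k} \<le> e"
    if "\<And>n. n \<ge> M \<Longrightarrow> dist (X m) (X n) < e" for m M e k
  proof (rule LIMSEQ_le_const2)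
    show "(\<lambda>n. L2_set (\<lambda>i. norm (ell2_nth (X m) i - ell2_nth (X n) i)) {..<k})
        \<longlonglongrightarrow> L2_set (\<lambda>i. norm (ell2_nth (X m) i - f i)) {..<k}"
      unfolding L2_set_def by (intro tendsto_intros f)
    show "\<exists>N. \<forall>n\<ge>N. L2_set (\<lambda>i. norm (ell2_nth (X m) i - ell2_nth (X n) i)) {..<k} \<le> e"
    proof (intro exI[of _ M] allI impI)
      fix n assume "n \<ge> M"
      have "L2_set (\<lambda>i. norm (ell2_nth (X m) i - ell2_nth (X n) i)) {..<k} \<le> dist (X m) (X n)"
        using L2_set_le_norm_ell2[of "X m - X n" k] by (simp add: dist_norm nth_diff)
      then show "L2_set (\<lambda>i. norm (ell2_nth (X m) i - ell2_nth (X n) i)) {..<k} \<le> e"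
        using that[OF \<open>n \<ge> M\<close>] by simp
    qed
  qed
  obtain M where M: "\<And>n. n \<ge> M \<Longrightarrow> dist (X M) (X n) < 1"
    using X unfolding Cauchy_def by (metis order_refl zero_less_one)
  have "summable (\<lambda>i. (norm (ell2_nth (X M) i - f i))\<^sup>2)"
    by (rule L2_bounded_summable[OF close[OF M]])
  \<comment> \<open>Writes \<open>f\<close> as \<open>X M\<close> minus the square-summable
    difference.\<close>
  then have "summable (\<lambda>i. (norm (ell2_nth (X M) i + (-1) *\<^sub>R (ell2_nth (X M) i - f i)))\<^sup>2)"
    by (intro summable_add_sq summable_scaleR_sq ell2_summable)
  then have f_nth: "ell2_nth (mk_ell2 f) = f"
    by (intro mk_ell2_nth) simp
  have "X \<longlonglongrightarrow> mk_ell2 f"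
  proof (rule metric_LIMSEQ_I)
    fix e :: real assume "e > 0"
    then obtain M where M: "\<And>m n. m \<ge> M \<Longrightarrow> n \<ge> M \<Longrightarrow> dist (X m) (X n) < e / 2"
      using X unfolding Cauchy_def by (meson half_gt_zero)
    show "\<exists>N. \<forall>n\<ge>N. dist (X n) (mk_ell2 f) < e"
    proof (intro exI[of _ M] allI impI)
      fix m assume "m \<ge> M"
      have "dist (X m) (mk_ell2 f) \<le> e / 2"
        unfolding dist_norm
        by (rule norm_ell2_le) (unfold nth_diff f_nth, rule close[OF M[OF \<open>m \<ge> M\<close>]])
      then show "dist (X m) (mk_ell2 f) < e" using \<open>e > 0\<close> by simp
    qed
  qed
  then show "convergent X" by (rule convergentI)
qed

instantiation ell2 :: (complex_hilbert) complex_hilbert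
begin

definition cscale_ell2 :: "complex \<Rightarrow> 'a ell2 \<Rightarrow> 'a ell2" where
  "cscale_ell2 c v = mk_ell2 (\<lambda>i. cscale c (ell2_nth v i))"
definition cinner_ell2 :: "'a ell2 \<Rightarrow> 'a ell2 \<Rightarrow> complex" where
  "cinner_ell2 v w = (\<Sum>i. cinner (ell2_nth v i) (ell2_nth w i))"

lemma nth_cscale: "ell2_nth (cscale c v) i = cscale c (ell2_nth (v :: 'a ell2) i)"
  by (simp add: cscale_ell2_def mk_ell2_nth summable_cscale_sq ell2_summable)

instance
proof
  fix x y z :: "'a ell2" and c d :: complex and r :: real
  show "cscale c (x + y) = cscale c x + cscale c y"
    by (rule ell2_eqI) (simp add: nth_cscale nth_add cscale_add_right)
  show "cscale (c + d) x = cscale c x + cscale d x"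
    by (rule ell2_eqI) (simp add: nth_cscale nth_add cscale_add_left)
  show "cscale c (cscale d x) = cscale (c * d) x"
    by (rule ell2_eqI) (simp add: nth_cscale cscale_cscale)
  show "r *\<^sub>R x = cscale (complex_of_real r) x"
    by (rule ell2_eqI) (simp add: nth_cscale nth_scaleR scaleR_cscale)
  show "cinner x (y + z) = cinner x y + cinner x z"
    unfolding cinner_ell2_def
    by (simp add: nth_add cinner_add_right suminf_add summable_ell2_cinner)
  show "cinner x (cscale c y) = c * cinner x y"
    unfolding cinner_ell2_def
    by (simp add: nth_cscale cinner_scale_right suminf_mult summable_ell2_cinner)
  show "cinner x y = cnj (cinner y x)"
  proof -
    have "(\<lambda>i. cnj (cinner (ell2_nth y i) (ell2_nth x i))) sums cnj (cinner y x)"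
      unfolding cinner_ell2_def
      by (intro bounded_linear.sums[OF bounded_linear_cnj] summable_sums summable_ell2_cinner)
    then show ?thesis
      unfolding cinner_ell2_def[of x y] by (simp add: sums_iff cinner_commute[symmetric])
  qed
  show "cinner x x = complex_of_real ((norm x)\<^sup>2)"
    unfolding cinner_ell2_def norm_ell2_sq
    by (simp add: cinner_norm suminf_of_real ell2_summable del: of_real_power)
qed

end

definition ell2_fin :: "nat \<Rightarrow> (nat \<Rightarrow> 'h::complex_hilbert) \<Rightarrow> 'h ell2" where
  "ell2_fin n f = mk_ell2 (\<lambda>i. if i < n then f i else 0)"

lemma ell2_fin_nth: "ell2_nth (ell2_fin n f) i = (if i < n then f i else 0)"
proof -
  have "summable (\<lambda>i. (norm (if i < n then f i else 0))\<^sup>2)"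
    by (rule summable_finite[of "{..<n}"]) auto
  then show ?thesis by (simp add: ell2_fin_def mk_ell2_nth)
qed

lemma cinner_ell2_fin: "cinner (ell2_fin n f) v = (\<Sum>i<n. cinner (f i) (ell2_nth v i))"
  unfolding cinner_ell2_def by (subst suminf_finite[of "{..<n}"]) (auto simp: ell2_fin_nth)

lemma norm_ell2_fin: "norm (ell2_fin n f) = L2_set (\<lambda>i. norm (f i)) {..<n}"
proof -
  have "(\<Sum>i. (norm (ell2_nth (ell2_fin n f) i))\<^sup>2) = (\<Sum>i<n. (norm (f i))\<^sup>2)"
    by (subst suminf_finite[of "{..<n}"]) (auto simp: ell2_fin_nth)
  then show ?thesis by (simp add: norm_ell2_def L2_set_def)
qed

definition ell2_single :: "nat \<Rightarrow> 'h::complex_hilbert \<Rightarrow> 'h ell2" where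
  "ell2_single k u = ell2_fin (Suc k) (\<lambda>i. if i = k then u else 0)"

lemma ell2_single_nth: "ell2_nth (ell2_single k u) i = (if i = k then u else 0)"
  by (simp add: ell2_single_def ell2_fin_nth)

lemma cinner_ell2_single: "cinner (ell2_single k u) v = cinner u (ell2_nth v k)"
proof -
  have "cinner (ell2_single k u) v = (\<Sum>i<Suc k. if i = k then cinner u (ell2_nth v k) else 0)"
    unfolding ell2_single_def cinner_ell2_fin by (intro sum.cong) auto
  then show ?thesis by simp
qed

lemma norm_ell2_single: "norm (ell2_single k u) = norm u"
proof -
  have "(norm (ell2_single k u))\<^sup>2 = (norm u)\<^sup>2"
    unfolding norm_sq_cinner by (simp add: cinner_ell2_single ell2_single_nth)
  then show ?thesis by simp
qed

text \<open>\<open>op_mat n X\<close> is the operator of the matrix $X\in M_n(B(H))$ on the first \<open>n\<close> summands of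
  $\ell^2(H)$.\<close>

definition op_mat :: "nat \<Rightarrow> 'h::complex_hilbert op mat \<Rightarrow> ('h ell2 \<Rightarrow>\<^sub>L 'h ell2)" where
  "op_mat n X = Blinfun (\<lambda>v. ell2_fin n (\<lambda>i. \<Sum>j<n. blinfun_apply (X i j) (ell2_nth v j)))"

lemma op_mat_bound:
  "norm (ell2_fin n (\<lambda>i. \<Sum>j<n. blinfun_apply (X i j) (ell2_nth v j))) \<le> norm v * (\<Sum>i<n. \<Sum>j<n. norm (X i j))"
proof -
  have "norm (ell2_fin n (\<lambda>i. \<Sum>j<n. blinfun_apply (X i j) (ell2_nth v j)))
      \<le> (\<Sum>i<n. norm (\<Sum>j<n. blinfun_apply (X i j) (ell2_nth v j)))"
    unfolding norm_ell2_fin by (rule L2_set_le_sum) simp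
  also have "\<dots> \<le> (\<Sum>i<n. \<Sum>j<n. norm (X i j) * norm v)"
    by (intro sum_mono order_trans[OF norm_sum] order_trans[OF norm_blinfun] mult_left_mono norm_ell2_nth_le) simp
  also have "\<dots> = norm v * (\<Sum>i<n. \<Sum>j<n. norm (X i j))"
    by (simp add: sum_distrib_left mult.commute)
  finally show ?thesis .
qed

lemma op_mat_apply:
  "blinfun_apply (op_mat n X) v = ell2_fin n (\<lambda>i. \<Sum>j<n. blinfun_apply (X i j) (ell2_nth v j))"
  unfolding op_mat_def
proof (subst bounded_linear_Blinfun_apply)
  show "bounded_linear (\<lambda>v. ell2_fin n (\<lambda>i. \<Sum>j<n. blinfun_apply (X i j) (ell2_nth v j)))"
    by (rule bounded_linear_intro[OF _ _ op_mat_bound]; rule ell2_eqI)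
      (simp_all add: ell2_fin_nth nth_add nth_scaleR blinfun.add_right blinfun.scaleR_right sum.distrib scaleR_sum_right)
qed simp

lemma op_mat_nth:
  "ell2_nth (blinfun_apply (op_mat n X) v) i = (if i < n then \<Sum>j<n. blinfun_apply (X i j) (ell2_nth v j) else 0)"
  by (simp add: op_mat_apply ell2_fin_nth)

lemma norm_op_mat_le: "norm (op_mat n X) \<le> (\<Sum>i<n. \<Sum>j<n. norm (X i j))"
  by (rule norm_blinfun_bound)
    (simp_all add: op_mat_apply op_mat_bound sum_nonneg mult.commute[of _ "norm _"])

lemma op_mat_single:
  assumes "i < n" "j < n"
  shows "ell2_nth (blinfun_apply (op_mat n X) (ell2_single j u)) i = X i j u"
proof -
  have "(\<Sum>k<n. blinfun_apply (X i k) (ell2_nth (ell2_single j u) k)) = (\<Sum>k<n. if k = j then X i j u else 0)"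
    by (intro sum.cong) (auto simp: ell2_single_nth)
  then show ?thesis using assms by (simp add: op_mat_nth)
qed

lemma norm_entry_le:
  assumes "i < n" "j < n"
  shows "norm (X i j) \<le> norm (op_mat n X)"
proof (rule norm_blinfun_bound)
  fix u
  have "norm (X i j u) \<le> norm (op_mat n X (ell2_single j u))"
    using norm_ell2_nth_le[of "op_mat n X (ell2_single j u)" i] by (simp add: op_mat_single assms)
  also have "\<dots> \<le> norm (op_mat n X) * norm u"
    using norm_blinfun[of "op_mat n X" "ell2_single j u"] by (simp add: norm_ell2_single)
  finally show "norm (X i j u) \<le> norm (op_mat n X) * norm u" .
qed simp

lemma op_mat_cong: "(\<And>i j. i < n \<Longrightarrow> j < n \<Longrightarrow> X i j = Y i j) \<Longrightarrow> op_mat n X = op_mat n Y"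
  by (intro blinfun_eqI ell2_eqI) (simp add: op_mat_nth)

lemma op_mat_inject: "op_mat n X = op_mat n Y \<Longrightarrow> i < n \<Longrightarrow> j < n \<Longrightarrow> X i j = Y i j"
  by (rule blinfun_eqI) (metis op_mat_single)

lemma op_mat_add: "op_mat n (\<lambda>i j. X i j + Y i j) = op_mat n X + op_mat n Y"
  by (intro blinfun_eqI ell2_eqI) (simp add: op_mat_nth blinfun.add_left nth_add sum.distrib)

lemma op_mat_diff: "op_mat n (\<lambda>i j. X i j - Y i j) = op_mat n X - op_mat n Y"
  by (intro blinfun_eqI ell2_eqI) (simp add: op_mat_nth blinfun.diff_left nth_diff sum_subtractf)

lemma op_mat_zero: "op_mat n (\<lambda>i j. 0) = 0"
  by (intro blinfun_eqI ell2_eqI) (simp add: op_mat_nth nth0)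

lemma op_mat_op_scale: "op_mat n (\<lambda>i j. op_scale c (X i j)) = op_scale c (op_mat n X)"
  by (intro blinfun_eqI ell2_eqI) (simp add: op_mat_nth nth_cscale cscale_sum_right)

lemma op_mat_comp:
  "op_mat n X o\<^sub>L op_mat n Y = op_mat n (\<lambda>i j. \<Sum>k<n. X i k o\<^sub>L Y k j)"
proof (intro blinfun_eqI ell2_eqI)
  fix v i
  have "(\<Sum>j<n. \<Sum>k<n. blinfun_apply (X i j) (blinfun_apply (Y j k) (ell2_nth v k)))
    = (\<Sum>j<n. \<Sum>k<n. blinfun_apply (X i k) (blinfun_apply (Y k j) (ell2_nth v j)))"
    by (rule sum.swap)
  then show "ell2_nth (blinfun_apply (op_mat n X o\<^sub>L op_mat n Y) v) i =
     ell2_nth (blinfun_apply (op_mat n (\<lambda>i j. \<Sum>k<n. X i k o\<^sub>L Y k j)) v) i"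
    by (simp add: op_mat_nth blinfun.sum_left blinfun.sum_right)
qed

lemma clin_op_mat: "(\<And>i j. i < n \<Longrightarrow> j < n \<Longrightarrow> clin (X i j)) \<Longrightarrow> clin (op_mat n X)"
  unfolding clin_def[of "op_mat n X"]
  by (intro allI ell2_eqI) (simp add: op_mat_nth nth_cscale cscale_sum_right clinD)

lemma cinner_op_mat:
  "cinner w (op_mat n X v) = (\<Sum>i<n. \<Sum>j<n. cinner (ell2_nth w i) (X i j (ell2_nth v j)))"
proof -
  have "cinner w (op_mat n X v) = (\<Sum>i<n. cinner (ell2_nth w i) (ell2_nth (op_mat n X v) i))"
    unfolding cinner_ell2_def by (rule suminf_finite) (auto simp: op_mat_nth)
  then show ?thesis by (simp add: op_mat_nth cinner.sum_right)
qed

lemma adj_op_mat: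
  assumes "\<And>i j. i < n \<Longrightarrow> j < n \<Longrightarrow> clin (X i j)"
  shows "adj (op_mat n X) = op_mat n (\<lambda>i j. adj (X j i))"
proof (rule adj_eqI)
  fix u v
  have "cinner (op_mat n (\<lambda>i j. adj (X j i)) u) v = cnj (cinner v (op_mat n (\<lambda>i j. adj (X j i)) u))"
    by (rule cinner_commute)
  also have "\<dots> = (\<Sum>i<n. \<Sum>j<n. cinner (ell2_nth u j) (X j i (ell2_nth v i)))"
    unfolding cinner_op_mat cnj_sum cinner_commute[symmetric]
    by (intro sum.cong) (auto simp: cinner_adj_left assms)
  also have "\<dots> = cinner u (op_mat n X v)"
    unfolding cinner_op_mat by (rule sum.swap)
  finally show "cinner (op_mat n (\<lambda>i j. adj (X j i)) u) v = cinner u (op_mat n X v)" .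
qed

lemma op_pos_op_mat:
  "op_pos (op_mat n X) \<longleftrightarrow> (\<forall>v. (\<Sum>i<n. \<Sum>j<n. cinner (v i) (X i j (v j))) \<in> \<real>\<^sub>\<ge>\<^sub>0)"
proof
  assume L: "op_pos (op_mat n X)"
  show "\<forall>v. (\<Sum>i<n. \<Sum>j<n. cinner (v i) (X i j (v j))) \<in> \<real>\<^sub>\<ge>\<^sub>0"
  proof
    fix v
    have "cinner (ell2_fin n v) (op_mat n X (ell2_fin n v)) = (\<Sum>i<n. \<Sum>j<n. cinner (v i) (X i j (v j)))"
      by (simp add: cinner_op_mat ell2_fin_nth)
    then show "(\<Sum>i<n. \<Sum>j<n. cinner (v i) (X i j (v j))) \<in> \<real>\<^sub>\<ge>\<^sub>0"
      using L by (metis op_pos_def)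
  qed
qed (simp add: op_pos_def cinner_op_mat)

text \<open>Connects the infimum that defines the matrix norms of
  \<open>concrete_operator_space\<close> with an operator norm; the infimum is attained.\<close>

lemma norm_op_mat_eq:
  "norm (op_mat n X) = Inf {c. 0 \<le> c \<and> (\<forall>v. L2_set (\<lambda>i. norm (\<Sum>j<n. blinfun_apply (X i j) (v j))) {..<n}
           \<le> c * L2_set (\<lambda>j. norm (v j)) {..<n})}"
  (is "_ = Inf ?S")
proof -
  have low: "norm (op_mat n X) \<le> c" if "c \<in> ?S" for c
  proof (rule norm_blinfun_bound)
    fix v
    have "norm (op_mat n X v) \<le> c * L2_set (\<lambda>j. norm (ell2_nth v j)) {..<n}"
      using that by (simp add: op_mat_apply norm_ell2_fin)
    also have "\<dots> \<le> c * norm v"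
      using that by (intro mult_left_mono L2_set_le_norm_ell2) simp
    finally show "norm (op_mat n X v) \<le> c * norm v" .
  qed (use that in simp)
  have "norm (op_mat n X) \<in> ?S"
  proof (safe; (simp; fail)?)
    fix v :: "nat \<Rightarrow> 'a"
    have "norm (op_mat n X (ell2_fin n v)) \<le> norm (op_mat n X) * norm (ell2_fin n v)"
      by (rule norm_blinfun)
    then show "L2_set (\<lambda>i. norm (\<Sum>j<n. blinfun_apply (X i j) (v j))) {..<n}
      \<le> norm (op_mat n X) * L2_set (\<lambda>j. norm (v j)) {..<n}"
      by (simp add: op_mat_apply norm_ell2_fin ell2_fin_nth)
  qed
  then show ?thesis using low by (metis (no_types, lifting) cInf_eq_minimum)
qed

text \<open>The same normal form as \<open>Mat\<close>: zero entries outside the block make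
  \<open>op_mat n\<close> injective.\<close>

definition op_mats :: "'h::complex_hilbert op set \<Rightarrow> nat \<Rightarrow> 'h op mat set" where
  "op_mats B n = {X. \<forall>i j. if i < n \<and> j < n then X i j \<in> B else X i j = 0}"

lemma op_matsD: "X \<in> op_mats B n \<Longrightarrow> i < n \<Longrightarrow> j < n \<Longrightarrow> X i j \<in> B"
  unfolding op_mats_def mem_Collect_eq by presburger

lemma op_mats_outside: "X \<in> op_mats B n \<Longrightarrow> \<not> (i < n \<and> j < n) \<Longrightarrow> X i j = 0"
  unfolding op_mats_def mem_Collect_eq by presburger

lemma op_matsI:
  "(\<And>i j. i < n \<Longrightarrow> j < n \<Longrightarrow> X i j \<in> B) \<Longrightarrow> (\<And>i j. \<not> (i < n \<and> j < n) \<Longrightarrow> X i j = 0) \<Longrightarrow> X \<in> op_mats B n"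
  by (simp add: op_mats_def)

lemma op_mats_inj: "inj_on (op_mat n) (op_mats B n)"
proof (rule inj_onI)
  fix X Y assume *: "X \<in> op_mats B n" "Y \<in> op_mats B n" "op_mat n X = op_mat n Y"
  have "X i j = Y i j" for i j
    using op_mat_inject[OF *(3), of i j] op_mats_outside[OF *(1), of i j] op_mats_outside[OF *(2), of i j]
    by metis
  then show "X = Y" by (intro ext)
qed

lemma tendsto_op_mat:
  assumes "\<And>i j. i < n \<Longrightarrow> j < n \<Longrightarrow> ((\<lambda>k. X k i j) \<longlongrightarrow> Y i j) F"
  shows "((\<lambda>k. op_mat n (X k)) \<longlongrightarrow> op_mat n Y) F"
proof -
  have "((\<lambda>k. \<Sum>i<n. \<Sum>j<n. norm (X k i j - Y i j)) \<longlongrightarrow> (\<Sum>i<n. \<Sum>j<n. 0)) F"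
    by (intro tendsto_sum tendsto_norm_zero LIM_zero assms) auto
  then have lim: "((\<lambda>k. \<Sum>i<n. \<Sum>j<n. norm (X k i j - Y i j)) \<longlongrightarrow> 0) F" by simp
  have "((\<lambda>k. op_mat n (X k) - op_mat n Y) \<longlongrightarrow> 0) F"
  proof (rule Lim_null_comparison[OF always_eventually lim], rule allI)
    fix k show "norm (op_mat n (X k) - op_mat n Y) \<le> (\<Sum>i<n. \<Sum>j<n. norm (X k i j - Y i j))"
      unfolding op_mat_diff[symmetric] by (rule norm_op_mat_le)
  qed
  then show ?thesis by (simp add: LIM_zero_iff)
qed

lemma op_subspace_op_mats:
  assumes B: "op_subspace B"
  shows "op_subspace (op_mat n ` op_mats B n)"
  unfolding op_subspace_def
proof (intro conjI allI ballI)
  note D = op_subspaceD[OF B]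
  show "op_mat n ` op_mats B n \<subseteq> bounded_ops"
  proof
    fix T assume "T \<in> op_mat n ` op_mats B n"
    then obtain X where "X \<in> op_mats B n" "T = op_mat n X" by blast
    then show "T \<in> bounded_ops"
      unfolding bounded_ops_iff using clin_op_mat[of n X] D(1) op_matsD[of X B n] by blast
  qed
  show "0 \<in> op_mat n ` op_mats B n"
    by (rule image_eqI[of _ _ "\<lambda>i j. 0"]) (auto simp: op_mat_zero op_mats_def D)
  show "S + T \<in> op_mat n ` op_mats B n"
    if S: "S \<in> op_mat n ` op_mats B n" and T: "T \<in> op_mat n ` op_mats B n" for S T
  proof -
    obtain X Y where "X \<in> op_mats B n" "Y \<in> op_mats B n" "S = op_mat n X" "T = op_mat n Y"
      using S T by blast
    then show ?thesis
      by (intro image_eqI[of _ _ "\<lambda>i j. X i j + Y i j"] op_matsI)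
        (auto simp: op_mat_add op_mats_outside intro!: D op_matsD)
  qed
  show "op_scale c T \<in> op_mat n ` op_mats B n" if T: "T \<in> op_mat n ` op_mats B n" for T c
  proof -
    obtain X where "X \<in> op_mats B n" "T = op_mat n X" using T by blast
    then show ?thesis
      by (intro image_eqI[of _ _ "\<lambda>i j. op_scale c (X i j)"] op_matsI)
        (auto simp: op_mat_op_scale op_mats_outside intro!: D op_matsD)
  qed
  show "adj T \<in> op_mat n ` op_mats B n" if T: "T \<in> op_mat n ` op_mats B n" for T
  proof -
    obtain X where "X \<in> op_mats B n" "T = op_mat n X" using T by blast
    then show ?thesis
      by (intro image_eqI[of _ _ "\<lambda>i j. adj (X j i)"] op_matsI)
        (auto simp: op_mats_outside intro!: D op_matsD adj_op_mat)
  qed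
qed

text \<open>Entries are bounded by the operator norm of the matrix, so a convergent sequence has
  Cauchy entries, and the limit is assembled entrywise.\<close>

lemma closed_op_mats:
  assumes B: "closed B" "0 \<in> B"
  shows "closed (op_mat n ` op_mats B n)"
  unfolding closed_sequential_limits
proof (intro allI impI, elim conjE)
  fix T L assume T: "\<forall>k. T k \<in> op_mat n ` op_mats B n" and L: "T \<longlonglongrightarrow> L"
  then obtain X where X: "\<And>k. X k \<in> op_mats B n" "\<And>k. T k = op_mat n (X k)"
    unfolding image_iff by metis
  have "\<exists>l\<in>B. (\<lambda>k. X k i j) \<longlonglongrightarrow> l" if ij: "i < n" "j < n" for i j
  proof -
    have "Cauchy (\<lambda>k. X k i j)"
    proof (rule metric_CauchyI)
      fix e :: real assume "e > 0"
      then obtain M where M: "\<And>k l. k \<ge> M \<Longrightarrow> l \<ge> M \<Longrightarrow> dist (T k) (T l) < e"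
        using LIMSEQ_imp_Cauchy[OF L] unfolding Cauchy_def by blast
      have "dist (X k i j) (X l i j) \<le> dist (T k) (T l)" for k l
        unfolding dist_norm X(2) op_mat_diff[symmetric]
        by (rule norm_entry_le[OF ij, of "\<lambda>i j. X k i j - X l i j"])
      then show "\<exists>M. \<forall>k\<ge>M. \<forall>l\<ge>M. dist (X k i j) (X l i j) < e"
        using M by (meson order_le_less_trans)
    qed
    then obtain l where "(\<lambda>k. X k i j) \<longlonglongrightarrow> l" using Cauchy_convergent_iff convergent_def by blast
    then show ?thesis using closed_sequentially[OF B(1), of "\<lambda>k. X k i j" l] op_matsD[OF X(1) ij] by blast
  qed
  then obtain l where l: "\<And>i j. i < n \<Longrightarrow> j < n \<Longrightarrow> l i j \<in> B \<and> (\<lambda>k. X k i j) \<longlonglongrightarrow> l i j" by metis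
  define Y where "Y i j = (if i < n \<and> j < n then l i j else 0)" for i j
  have "(\<lambda>k. op_mat n (X k)) \<longlonglongrightarrow> op_mat n Y"
    using l by (intro tendsto_op_mat) (simp add: Y_def)
  then have "L = op_mat n Y" using L X(2) LIMSEQ_unique by (metis ext)
  moreover have "Y \<in> op_mats B n" using l B(2) by (auto simp: op_mats_def Y_def)
  ultimately show "L \<in> op_mat n ` op_mats B n" by blast
qed

lemma op_mats_comp:
  assumes "X \<in> op_mats B n" "Y \<in> op_mats C n" "op_subspace D"
    and "\<And>S T. S \<in> B \<Longrightarrow> T \<in> C \<Longrightarrow> S o\<^sub>L T \<in> D"
  shows "op_mat n X o\<^sub>L op_mat n Y \<in> op_mat n ` op_mats D n"
proof (rule image_eqI)
  show "(\<lambda>i j. if i < n \<and> j < n then \<Sum>k<n. X i k o\<^sub>L Y k j else 0) \<in> op_mats D n"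
  proof (rule op_matsI)
    fix i j assume ij: "i < n" "j < n"
    have "(\<Sum>k<n. X i k o\<^sub>L Y k j) \<in> D"
      using ij by (intro op_subspace_sum[OF assms(3)] assms(4) op_matsD[OF assms(1)] op_matsD[OF assms(2)]) auto
    then show "(if i < n \<and> j < n then \<Sum>k<n. X i k o\<^sub>L Y k j else 0) \<in> D" using ij by simp
  qed auto
  show "op_mat n X o\<^sub>L op_mat n Y = op_mat n (\<lambda>i j. if i < n \<and> j < n then \<Sum>k<n. X i k o\<^sub>L Y k j else 0)"
    unfolding op_mat_comp by (rule op_mat_cong) simp
qed

text \<open>Matrices over a concrete algebra again form a concrete algebra; square roots and
  quotient norms thereby become available at all matrix sizes.\<close>

lemma op_alg_op_mats:
  assumes B: "op_alg B"
  shows "op_alg (op_mat n ` op_mats B n)"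
  using op_subspace_op_mats[OF op_algD(1)[OF B]] closed_op_mats[OF op_algD(3)[OF B] op_subspaceD(2)[OF op_algD(1)[OF B]]]
    op_mats_comp[OF _ _ op_algD(1)[OF B] op_algD(2)[OF B]]
  unfolding op_alg_def by blast

lemma op_ideal_op_mats:
  assumes B: "op_alg B" and I: "op_ideal B I"
  shows "op_ideal (op_mat n ` op_mats B n) (op_mat n ` op_mats I n)"
  unfolding op_ideal_def
proof (intro conjI ballI)
  note Is = op_idealD(1)[OF I]
  show "op_subspace (op_mat n ` op_mats I n)" by (rule op_subspace_op_mats[OF Is])
  show "closed (op_mat n ` op_mats I n)"
    by (rule closed_op_mats[OF op_idealD(5)[OF I] op_subspaceD(2)[OF Is]])
  show "op_mat n ` op_mats I n \<subseteq> op_mat n ` op_mats B n"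
    using op_idealD(2)[OF I] by (intro image_mono) (auto intro!: op_matsI intro: op_matsD op_mats_outside)
  fix S T assume "S \<in> op_mat n ` op_mats B n" "T \<in> op_mat n ` op_mats I n"
  then show "S o\<^sub>L T \<in> op_mat n ` op_mats I n" "T o\<^sub>L S \<in> op_mat n ` op_mats I n"
    using op_mats_comp[OF _ _ Is op_idealD(3)[OF I]] op_mats_comp[OF _ _ Is op_idealD(4)[OF I]] by blast+
qed

section \<open>Contractivity of *-homomorphisms\<close>

context star_vector_space
begin

lemma add_zero_right: "x \<in> carrier V \<Longrightarrow> vadd V x (vzero V) = x"
  using add_commute[OF _ zero_closed] add_zero by simp

lemma add_left_commute: "x \<in> carrier V \<Longrightarrow> y \<in> carrier V \<Longrightarrow> z \<in> carrier V \<Longrightarrow>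
    vadd V x (vadd V y z) = vadd V y (vadd V x z)"
  by (metis add_assoc add_commute)

lemma add_left_cancel:
  assumes "x \<in> carrier V" "y \<in> carrier V" "z \<in> carrier V" "vadd V x y = vadd V x z"
  shows "y = z"
proof -
  have *: "vadd V (vscale V (-1) x) (vadd V x w) = w" if "w \<in> carrier V" for w
  proof -
    have "vadd V (vscale V (-1) x) x = vzero V"
      using add_minus[OF assms(1)] add_commute[OF assms(1) scale_closed[OF assms(1)]] by simp
    then show ?thesis
      using add_assoc[OF scale_closed[OF assms(1)] assms(1) that, of "-1"] add_zero[OF that] by simp
  qed
  show ?thesis using *[OF assms(2)] unfolding assms(4) *[OF assms(3)] by simp
qed

lemma scale_zero_left: "x \<in> carrier V \<Longrightarrow> vscale V 0 x = vzero V"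
proof -
  assume x: "x \<in> carrier V"
  have "vadd V (vscale V 1 x) (vscale V 0 x) = vscale V 1 x"
    using scale_add_left[OF x, of 1 0] by simp
  then have "vadd V x (vscale V 0 x) = vadd V x (vzero V)"
    using x by (simp add: scale_one add_zero_right)
  then show ?thesis using x by (intro add_left_cancel[OF x scale_closed[OF x] zero_closed])
qed

lemma scale_zero_right: "vscale V c (vzero V) = vzero V"
  using scale_scale[OF zero_closed, of c 0] scale_zero_left[OF zero_closed] by simp

lemma star_zero: "vstar V (vzero V) = vzero V"
  using star_scale[OF zero_closed, of 0] scale_zero_left[OF zero_closed]
    scale_zero_left[OF star_closed[OF zero_closed]] by simp

lemma minus_closed: "x \<in> carrier V \<Longrightarrow> y \<in> carrier V \<Longrightarrow> vminus V x y \<in> carrier V"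
  by (simp add: vminus_def add_closed scale_closed)

lemma minus_self: "x \<in> carrier V \<Longrightarrow> vminus V x x = vzero V"
  by (simp add: vminus_def add_minus)

lemma minus_zero: "x \<in> carrier V \<Longrightarrow> vminus V x (vzero V) = x"
  by (simp add: vminus_def scale_zero_right add_zero_right)

lemma scale_minus: "x \<in> carrier V \<Longrightarrow> y \<in> carrier V \<Longrightarrow>
    vscale V c (vminus V x y) = vminus V (vscale V c x) (vscale V c y)"
  by (simp add: vminus_def scale_add_right scale_closed scale_scale)

lemma star_minus: "x \<in> carrier V \<Longrightarrow> y \<in> carrier V \<Longrightarrow>
    vstar V (vminus V x y) = vminus V (vstar V x) (vstar V y)"
  by (simp add: vminus_def star_add star_scale scale_closed)

lemma minus_add_minus:
  assumes "x \<in> carrier V" "y \<in> carrier V" "z \<in> carrier V"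
  shows "vadd V (vminus V x y) (vminus V y z) = vminus V x z"
proof -
  have "vadd V (vminus V x y) (vminus V y z) =
      vadd V x (vadd V (vadd V y (vscale V (-1) y)) (vscale V (-1) z))"
    using assms unfolding vminus_def
    by (simp add: add_assoc add_closed scale_closed add_left_commute)
  then show ?thesis using assms by (simp add: add_minus add_zero scale_closed vminus_def)
qed

lemma minus_add: "x \<in> carrier V \<Longrightarrow> y \<in> carrier V \<Longrightarrow> vadd V (vminus V x y) y = x"
  using minus_add_minus[OF _ _ zero_closed] by (simp add: minus_zero)

lemma minus_eq_zero_iff: "x \<in> carrier V \<Longrightarrow> y \<in> carrier V \<Longrightarrow> vminus V x y = vzero V \<longleftrightarrow> x = y"
  by (metis minus_add minus_self add_zero)

lemma scale_minus_one_minus: "x \<in> carrier V \<Longrightarrow> y \<in> carrier V \<Longrightarrow>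
    vscale V (-1) (vminus V x y) = vminus V y x"
  by (simp add: vminus_def scale_add_right scale_closed scale_scale scale_one add_commute)

lemma add_minus_add:
  assumes "x \<in> carrier V" "y \<in> carrier V" "x' \<in> carrier V" "y' \<in> carrier V"
  shows "vminus V (vadd V x y) (vadd V x' y') = vadd V (vminus V x x') (vminus V y y')"
  using assms unfolding vminus_def
  by (simp add: scale_add_right add_assoc add_closed scale_closed add_left_commute)

end

context cstar_algebra
begin

lemma mult_minus_left: "x \<in> carrier A \<Longrightarrow> y \<in> carrier A \<Longrightarrow> z \<in> carrier A \<Longrightarrow>
    cmult A (vminus A x y) z = vminus A (cmult A x z) (cmult A y z)"
  by (simp add: vminus_def mult_add_left mult_scale_left scale_closed)

lemma mult_minus_right: "x \<in> carrier A \<Longrightarrow> y \<in> carrier A \<Longrightarrow> z \<in> carrier A \<Longrightarrow>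
    cmult A x (vminus A y z) = vminus A (cmult A x y) (cmult A x z)"
  by (simp add: vminus_def mult_add_right mult_scale_right scale_closed)

lemma norm_zero: "cnorm A (vzero A) = 0"
  using norm_eq_zero[OF zero_closed] by simp

lemma norm_nonneg: "x \<in> carrier A \<Longrightarrow> 0 \<le> cnorm A x"
  using norm_triangle[of x "vscale A (-1) x"] by (simp add: add_minus scale_closed norm_zero norm_scale)

lemma norm_star_le: "x \<in> carrier A \<Longrightarrow> cnorm A x \<le> cnorm A (vstar A x)"
proof -
  assume x: "x \<in> carrier A"
  have "cnorm A x * cnorm A x \<le> cnorm A (vstar A x) * cnorm A x"
    using norm_mult[OF star_closed[OF x] x] norm_cstar[OF x] by (simp add: power2_eq_square)
  then show ?thesis
    using norm_nonneg[OF x] norm_nonneg[OF star_closed[OF x]] by (cases "cnorm A x = 0") auto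
qed

lemma norm_star: "x \<in> carrier A \<Longrightarrow> cnorm A (vstar A x) = cnorm A x"
  using norm_star_le[of x] norm_star_le[of "vstar A x"] by (simp add: star_closed star_star)

lemma norm_minus_commute: "x \<in> carrier A \<Longrightarrow> y \<in> carrier A \<Longrightarrow>
    cnorm A (vminus A x y) = cnorm A (vminus A y x)"
  using norm_scale[OF minus_closed, of x y "-1"] by (simp add: scale_minus_one_minus)

lemma norm_minus_triangle: "x \<in> carrier A \<Longrightarrow> y \<in> carrier A \<Longrightarrow> z \<in> carrier A \<Longrightarrow>
    cnorm A (vminus A x z) \<le> cnorm A (vminus A x y) + cnorm A (vminus A y z)"
  by (metis minus_add_minus minus_closed norm_triangle)

lemma norm_le_minus: "x \<in> carrier A \<Longrightarrow> y \<in> carrier A \<Longrightarrow>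
    cnorm A x \<le> cnorm A (vminus A x y) + cnorm A y"
  by (metis minus_add minus_closed norm_triangle)

text \<open>The norm is a record field, so no topology comes with the type and limits are spelled
  out, together with membership in the carrier.\<close>

definition tends_to :: "(nat \<Rightarrow> 'a) \<Rightarrow> 'a \<Rightarrow> bool" where
  "tends_to f x \<longleftrightarrow> (\<forall>n. f n \<in> carrier A) \<and> x \<in> carrier A \<and> (\<lambda>n. cnorm A (vminus A (f n) x)) \<longlonglongrightarrow> 0"

lemma tends_to_unique:
  assumes "tends_to f x" "tends_to f y"
  shows "x = y"
proof -
  have c: "x \<in> carrier A" "y \<in> carrier A" "\<And>n. f n \<in> carrier A" using assms by (auto simp: tends_to_def)
  have "(\<lambda>n. cnorm A (vminus A (f n) x) + cnorm A (vminus A (f n) y)) \<longlonglongrightarrow> 0 + 0"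
    using assms unfolding tends_to_def by (intro tendsto_add) auto
  moreover have "cnorm A (vminus A x y) \<le> cnorm A (vminus A (f n) x) + cnorm A (vminus A (f n) y)" for n
    using norm_minus_triangle[OF c(1) c(3)[of n] c(2)] norm_minus_commute[OF c(1) c(3)[of n]] by simp
  ultimately have "cnorm A (vminus A x y) \<le> 0"
    by (intro LIMSEQ_le_const) auto
  then have "cnorm A (vminus A x y) = 0" using norm_nonneg[OF minus_closed[OF c(1,2)]] by simp
  then show ?thesis using c by (simp add: norm_eq_zero minus_closed minus_eq_zero_iff)
qed

lemma tends_toI:
  assumes "\<And>n. f n \<in> carrier A" "x \<in> carrier A" "\<And>n. cnorm A (vminus A (f n) x) \<le> g n" "g \<longlonglongrightarrow> 0"
  shows "tends_to f x"
  unfolding tends_to_def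
proof (intro conjI allI assms(1,2))
  show "(\<lambda>n. cnorm A (vminus A (f n) x)) \<longlonglongrightarrow> 0"
    by (rule tendsto_sandwich[OF _ _ tendsto_const assms(4)])
      (auto intro!: always_eventually norm_nonneg minus_closed assms(1-3))
qed

lemma tends_to_add:
  assumes "tends_to f x" "tends_to g y"
  shows "tends_to (\<lambda>n. vadd A (f n) (g n)) (vadd A x y)"
proof (rule tends_toI)
  have c: "x \<in> carrier A" "y \<in> carrier A" "f n \<in> carrier A" "g n \<in> carrier A" for n
    using assms by (auto simp: tends_to_def)
  show "cnorm A (vminus A (vadd A (f n) (g n)) (vadd A x y))
      \<le> cnorm A (vminus A (f n) x) + cnorm A (vminus A (g n) y)" for n
    using c by (simp add: add_minus_add norm_triangle minus_closed)
  show "(\<lambda>n. cnorm A (vminus A (f n) x) + cnorm A (vminus A (g n) y)) \<longlonglongrightarrow> 0"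
    using assms unfolding tends_to_def by (intro tendsto_add_zero) auto
  show "vadd A (f n) (g n) \<in> carrier A" "vadd A x y \<in> carrier A" for n
    using c by (simp_all add: add_closed)
qed

lemma tends_to_const: "x \<in> carrier A \<Longrightarrow> tends_to (\<lambda>n. x) x"
  by (simp add: tends_to_def minus_self norm_zero)

lemma tends_to_scale:
  assumes "tends_to f x"
  shows "tends_to (\<lambda>n. vscale A c (f n)) (vscale A c x)"
proof (rule tends_toI)
  have cl: "x \<in> carrier A" "f n \<in> carrier A" for n
    using assms by (auto simp: tends_to_def)
  show "cnorm A (vminus A (vscale A c (f n)) (vscale A c x)) \<le> cmod c * cnorm A (vminus A (f n) x)" for n
    using cl by (simp flip: scale_minus add: norm_scale minus_closed)
  show "(\<lambda>n. cmod c * cnorm A (vminus A (f n) x)) \<longlonglongrightarrow> 0"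
    using assms unfolding tends_to_def by (intro tendsto_mult_right_zero) auto
  show "vscale A c (f n) \<in> carrier A" "vscale A c x \<in> carrier A" for n
    using cl by (simp_all add: scale_closed)
qed

lemma tends_to_star:
  assumes "tends_to f x"
  shows "tends_to (\<lambda>n. vstar A (f n)) (vstar A x)"
proof (rule tends_toI)
  have cl: "x \<in> carrier A" "f n \<in> carrier A" for n
    using assms by (auto simp: tends_to_def)
  show "cnorm A (vminus A (vstar A (f n)) (vstar A x)) \<le> cnorm A (vminus A (f n) x)" for n
    using cl by (simp flip: star_minus add: norm_star minus_closed)
  show "vstar A (f n) \<in> carrier A" "vstar A x \<in> carrier A" for n
    using cl by (simp_all add: star_closed)
  show "(\<lambda>n. cnorm A (vminus A (f n) x)) \<longlonglongrightarrow> 0"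
    using assms unfolding tends_to_def by auto
qed

lemma norm_mult_minus_mult:
  assumes "a \<in> carrier A" "b \<in> carrier A" "x \<in> carrier A" "y \<in> carrier A"
  shows "cnorm A (vminus A (cmult A a b) (cmult A x y)) \<le>
    cnorm A a * cnorm A (vminus A b y) + cnorm A (vminus A a x) * cnorm A y"
proof -
  have "vminus A (cmult A a b) (cmult A x y) =
      vadd A (cmult A a (vminus A b y)) (cmult A (vminus A a x) y)"
    using assms by (simp add: mult_minus_left mult_minus_right minus_add_minus mult_closed)
  then have "cnorm A (vminus A (cmult A a b) (cmult A x y)) \<le>
      cnorm A (cmult A a (vminus A b y)) + cnorm A (cmult A (vminus A a x) y)"
    using assms by (simp add: norm_triangle mult_closed minus_closed)
  also have "\<dots> \<le> cnorm A a * cnorm A (vminus A b y) + cnorm A (vminus A a x) * cnorm A y"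
    using assms by (intro add_mono norm_mult minus_closed)
  finally show ?thesis .
qed

lemma tends_to_mult:
  assumes "tends_to f x" "tends_to g y"
  shows "tends_to (\<lambda>n. cmult A (f n) (g n)) (cmult A x y)"
proof (rule tends_toI)
  have cl: "x \<in> carrier A" "y \<in> carrier A" "f n \<in> carrier A" "g n \<in> carrier A" for n
    using assms by (auto simp: tends_to_def)
  show "cnorm A (vminus A (cmult A (f n) (g n)) (cmult A x y))
      \<le> (cnorm A (vminus A (f n) x) + cnorm A x) * cnorm A (vminus A (g n) y) + cnorm A (vminus A (f n) x) * cnorm A y" for n
    using norm_mult_minus_mult[OF cl(3,4) cl(1,2), of n n]
      mult_right_mono[OF norm_le_minus[OF cl(3) cl(1)] norm_nonneg[OF minus_closed[OF cl(4)[of n] cl(2)]], of n]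
    by linarith
  have "(\<lambda>n. (cnorm A (vminus A (f n) x) + cnorm A x) * cnorm A (vminus A (g n) y) + cnorm A (vminus A (f n) x) * cnorm A y)
      \<longlonglongrightarrow> (0 + cnorm A x) * 0 + 0 * cnorm A y"
    using assms unfolding tends_to_def by (intro tendsto_intros) auto
  then show "(\<lambda>n. (cnorm A (vminus A (f n) x) + cnorm A x) * cnorm A (vminus A (g n) y) + cnorm A (vminus A (f n) x) * cnorm A y) \<longlonglongrightarrow> 0"
    by simp
  show "cmult A (f n) (g n) \<in> carrier A" "cmult A x y \<in> carrier A" for n
    using cl by (simp_all add: mult_closed)
qed

lemma tends_to_Suc: "tends_to f x \<Longrightarrow> tends_to (\<lambda>n. f (Suc n)) x"
  unfolding tends_to_def by (auto dest: LIMSEQ_Suc)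

text \<open>Fixed point iteration for k = (b + k^2)/2, that is (1 - k)^2 = 1 - b. Written in this
  form it stays inside an algebra without unit.\<close>

definition half_square :: "'a \<Rightarrow> nat \<Rightarrow> 'a" where
  "half_square b = rec_nat (vzero A) (\<lambda>_ K. vscale A (1/2) (vadd A b (cmult A K K)))"

text \<open>An element \<open>k\<close> with \<open>(1 - k)\<^sup>2 = 1 - b\<close> in the unitization.\<close>

lemma half_square_fixpoint:
  assumes b: "b \<in> carrier A" "vstar A b = b" "cnorm A b \<le> 1"
  shows "\<exists>k\<in>carrier A. vstar A k = k \<and> vscale A 2 k = vadd A b (cmult A k k) \<and>
    (\<forall>h\<in>carrier A. cmult A h b = cmult A b h \<longrightarrow> cmult A h k = cmult A k h) \<and>
    tends_to (half_square b) k"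
proof -
  define K where "K = half_square b"
  have K: "K 0 = vzero A" "K (Suc n) = vscale A (1/2) (vadd A b (cmult A (K n) (K n)))" for n
    by (simp_all add: K_def half_square_def)
  \<comment> \<open>The same iteration for the number 1.\<close>
  define r where "r = rec_nat 0 (\<lambda>_ x::real. (1 + x\<^sup>2) / 2)"
  have r: "r 0 = 0" "r (Suc n) = (1 + (r n)\<^sup>2) / 2" for n
    by (simp_all add: r_def)
  note rl = half_square_limit[OF r]
  have cK: "K n \<in> carrier A" for n
    by (induction n) (auto simp: K zero_closed scale_closed add_closed mult_closed b)
  have sK: "vstar A (K n) = K n" for n
    by (induction n) (auto simp: K star_zero star_scale star_add star_mult add_closed mult_closed b cK)
  \<comment> \<open>Commutation with \<open>b\<close> passes to all iterates and so to the limit. In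
    the application \<open>b\<close> is the square of \<open>h\<close>, and \<open>k\<close> has to
    commute with \<open>h\<close>.\<close>
  have hK: "cmult A h (K n) = cmult A (K n) h"
    if h: "h \<in> carrier A" "cmult A h b = cmult A b h" for h n
  proof (induction n)
    case 0
    have "cmult A h (vscale A 0 h) = cmult A (vscale A 0 h) h"
      using h by (simp add: mult_scale_left mult_scale_right)
    then show ?case using h by (simp add: K scale_zero_left)
  next
    case (Suc n)
    have "cmult A h (cmult A (K n) (K n)) = cmult A (cmult A (K n) (K n)) h"
      using h cK by (metis Suc mult_assoc)
    then show ?case
      using h b cK by (simp add: K mult_scale_left mult_scale_right mult_add_left mult_add_right add_closed mult_closed)
  qed
  have nK: "cnorm A (K n) \<le> r n" for n
  proof (induction n)
    case (Suc n)
    have "cnorm A (K (Suc n)) \<le> (cnorm A b + cnorm A (cmult A (K n) (K n))) / 2"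
      using norm_triangle[of b "cmult A (K n) (K n)"] b cK by (simp add: K norm_scale add_closed mult_closed)
    also have "\<dots> \<le> (1 + (r n)\<^sup>2) / 2"
      using b norm_mult[OF cK cK, of n n] mult_mono[OF Suc Suc] rl(3)[of n] norm_nonneg[OF cK, of n]
      by (simp add: power2_eq_square)
    finally show ?case by (simp add: r)
  qed (simp add: K r norm_zero)
  \<comment> \<open>The difference of consecutive squares is at most the sum of two consecutive
    norms times the previous increment; with the values of \<open>r\<close> inserted, half of this
    is exactly the next increment of \<open>r\<close>.\<close>
  have dK: "cnorm A (vminus A (K (Suc n)) (K n)) \<le> r (Suc n) - r n" for n
  proof (induction n)
    case 0
    have "cmult A (vscale A 0 b) (vzero A) = vzero A"
      using b by (simp add: mult_scale_left zero_closed scale_zero_left mult_closed del: scale_zero_left)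
        (simp add: scale_zero_left mult_closed b zero_closed)
    then have "cmult A (vzero A) (vzero A) = vzero A" using b by (simp add: scale_zero_left)
    then show ?case using b by (simp add: K r add_zero_right minus_zero scale_closed norm_scale)
  next
    case (Suc n)
    have "vminus A (K (Suc (Suc n))) (K (Suc n)) =
        vscale A (1/2) (vminus A (cmult A (K (Suc n)) (K (Suc n))) (cmult A (K n) (K n)))"
    proof -
      have "vminus A (vscale A (1/2) (vadd A b X)) (vscale A (1/2) (vadd A b Y)) = vscale A (1/2) (vminus A X Y)"
        if "X \<in> carrier A" "Y \<in> carrier A" for X Y
        using b that by (simp add: add_closed add_minus_add minus_self add_zero minus_closed flip: scale_minus)
      then show ?thesis
        unfolding K(2)[of "Suc n"] K(2)[of n] using cK mult_closed by (metis K(2))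
    qed
    then have "cnorm A (vminus A (K (Suc (Suc n))) (K (Suc n))) =
        cnorm A (vminus A (cmult A (K (Suc n)) (K (Suc n))) (cmult A (K n) (K n))) / 2"
      using cK by (simp add: norm_scale minus_closed mult_closed)
    also have "\<dots> \<le> (cnorm A (K (Suc n)) * cnorm A (vminus A (K (Suc n)) (K n)) +
        cnorm A (vminus A (K (Suc n)) (K n)) * cnorm A (K n)) / 2"
      using norm_mult_minus_mult[OF cK cK cK cK] by (intro divide_right_mono) auto
    also have "\<dots> \<le> (r (Suc n) * (r (Suc n) - r n) + (r (Suc n) - r n) * r n) / 2"
      using rl(2)[of n] by (intro divide_right_mono add_mono mult_mono nK Suc rl norm_nonneg minus_closed cK) auto
    also have "\<dots> = r (Suc (Suc n)) - r (Suc n)"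
      unfolding r(2)[of "Suc n"] r(2)[of n] by (simp add: power2_eq_square field_simps)
    finally show ?case .
  qed
  have gap: "cnorm A (vminus A (K (m + k)) (K m)) \<le> r (m + k) - r m" for m k
  proof (induction k)
    case 0 then show ?case by (simp add: minus_self cK norm_zero)
  next
    case (Suc k)
    have "cnorm A (vminus A (K (m + Suc k)) (K m)) \<le>
        cnorm A (vminus A (K (Suc (m + k))) (K (m + k))) + cnorm A (vminus A (K (m + k)) (K m))"
      using norm_minus_triangle[OF cK cK cK] by simp
    also have "\<dots> \<le> r (m + Suc k) - r m" using dK[of "m + k"] Suc by simp
    finally show ?case .
  qed
  have gap': "cnorm A (vminus A (K m) (K n)) \<le> \<bar>r m - r n\<bar>" for m n
  proof (cases "m \<le> n")
    case True
    then show ?thesis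
      using gap[of m "n - m"] norm_minus_commute[OF cK cK, of m n] by simp
  next
    case False
    then show ?thesis using gap[of n "m - n"] by simp
  qed
  have "\<exists>k\<in>carrier A. (\<lambda>n. cnorm A (vminus A (K n) k)) \<longlonglongrightarrow> 0"
  proof (rule complete[OF cK])
    fix e :: real assume "e > 0"
    then obtain M where "\<forall>m\<ge>M. \<forall>n\<ge>M. dist (r m) (r n) < e"
      using LIMSEQ_imp_Cauchy[OF rl(1)] unfolding Cauchy_def by blast
    then show "\<exists>N. \<forall>m\<ge>N. \<forall>n\<ge>N. cnorm A (vminus A (K m) (K n)) < e"
      using gap' by (metis dist_real_def order_le_less_trans)
  qed
  then obtain k where k: "tends_to K k" using cK by (auto simp: tends_to_def)
  then have kc: "k \<in> carrier A" by (simp add: tends_to_def)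
  have "tends_to (\<lambda>n. K (Suc n)) (vscale A (1/2) (vadd A b (cmult A k k)))"
    unfolding K by (intro tends_to_scale tends_to_add tends_to_mult tends_to_const k b)
  then have "k = vscale A (1/2) (vadd A b (cmult A k k))"
    using tends_to_unique tends_to_Suc[OF k] by blast
  then have "vscale A 2 k = vadd A b (cmult A k k)"
  proof -
    assume "k = vscale A (1/2) (vadd A b (cmult A k k))"
    then have "vscale A 2 k = vscale A 2 (vscale A (1/2) (vadd A b (cmult A k k)))" by simp
    then show ?thesis using kc b by (simp add: scale_scale scale_one add_closed mult_closed)
  qed
  moreover have "vstar A k = k"
    using tends_to_unique[OF k, of "vstar A k"] tends_to_star[OF k] by (simp add: sK)
  moreover have "cmult A h k = cmult A k h" if "h \<in> carrier A" "cmult A h b = cmult A b h" for h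
    using tends_to_unique[OF tends_to_mult[OF tends_to_const[OF that(1)] k]]
      tends_to_mult[OF k tends_to_const[OF that(1)]] hK[OF that] by simp
  ultimately show ?thesis using kc k unfolding K_def by blast
qed

text \<open>Such a \<open>c\<close> is plus or minus the imaginary unit, so P + c Q has adjoint P -
  c Q. The cross terms of their product cancel by commutation, leaving P^2 + Q^2, and the
  C*-identity applies.\<close>

lemma norm_unitary_combination:
  assumes P: "P \<in> carrier A" "vstar A P = P" and Q: "Q \<in> carrier A" "vstar A Q = Q"
    and PQ: "cmult A P Q = cmult A Q P" and c: "cnj c = - c" "c * c = -1"
  shows "(cnorm A (vadd A P (vscale A c Q)))\<^sup>2 = cnorm A (vadd A (cmult A P P) (cmult A Q Q))"
proof -
  define u where "u = vadd A P (vscale A c Q)"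
  have uc: "u \<in> carrier A" using P Q by (simp add: u_def add_closed scale_closed)
  have su: "vstar A u = vadd A P (vscale A (- c) Q)"
    using P Q c by (simp add: u_def star_add star_scale scale_closed)
  have "cmult A (vstar A u) u =
      vadd A (vadd A (cmult A P P) (vscale A (- c) (cmult A Q P))) (vadd A (vscale A c (cmult A P Q)) (cmult A Q Q))"
    unfolding su unfolding u_def using P(1) Q(1)
    by (simp add: mult_add_left mult_add_right mult_scale_left mult_scale_right scale_closed add_closed
        mult_closed scale_scale scale_add_right scale_one c)
  also have "\<dots> = vadd A (vadd A (vscale A (- c) (cmult A P Q)) (vscale A c (cmult A P Q))) (vadd A (cmult A P P) (cmult A Q Q))"
    using P Q unfolding PQ[symmetric]
    by (simp add: add_assoc add_closed scale_closed mult_closed add_left_commute)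
  also have "vadd A (vscale A (- c) (cmult A P Q)) (vscale A c (cmult A P Q)) = vzero A"
    using P Q scale_add_left[of "cmult A P Q" "- c" c] by (simp add: mult_closed scale_zero_left)
  finally show ?thesis
    using norm_cstar[OF uc] P Q by (simp add: u_def add_zero add_closed mult_closed)
qed

text \<open>With \<open>k\<close> from \<open>half_square_fixpoint\<close>, the element \<open>h + \<i> (1 - k)\<close> of the unitization is unitary.\<close>

lemma norm_le_one_if_fixpoint:
  assumes h: "h \<in> carrier A" "vstar A h = h" and k: "k \<in> carrier A" "vstar A k = k"
    and hk: "cmult A h k = cmult A k h" and eq: "vscale A 2 k = vadd A (cmult A h h) (cmult A k k)"
  shows "cnorm A h \<le> 1"
proof -
  \<comment> \<open>With w = h + \<i> (1 - k) unitary, P + \<i> Q is the product of w and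
    \<open>h\<close>; multiplying by \<open>h\<close> brings w from the unitization into the
    algebra.\<close>
  define P where "P = cmult A h h"
  define Q where "Q = vminus A h (cmult A k h)"
  have c: "P \<in> carrier A" "Q \<in> carrier A" using h k by (simp_all add: P_def Q_def mult_closed minus_closed)
  have s: "vstar A P = P" "vstar A Q = Q"
    using h k by (simp_all add: P_def Q_def star_mult star_minus mult_closed hk)
  have hQ: "cmult A h Q = cmult A Q h"
    using h k by (simp add: Q_def mult_minus_left mult_minus_right mult_closed)
      (metis hk mult_assoc)
  then have PQ: "cmult A P Q = cmult A Q P"
    using h c unfolding P_def by (metis mult_assoc)
  define m n where "m = cmult A k P" and "n = cmult A (cmult A k k) P"
  have mn: "m \<in> carrier A" "n \<in> carrier A" using k c by (simp_all add: m_def n_def mult_closed)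
  have hkh: "cmult A h (cmult A k h) = m"
    unfolding m_def P_def using h k by (metis hk mult_assoc)
  have khh: "cmult A (cmult A k h) h = m"
    unfolding m_def P_def using h k by (metis mult_assoc)
  have khkh: "cmult A (cmult A k h) (cmult A k h) = n"
    unfolding n_def P_def using h k by (metis hk mult_assoc mult_closed)
  have QQ: "cmult A Q Q = vminus A (vminus A P m) (vminus A m n)"
    unfolding Q_def using h k
    by (simp add: mult_minus_left mult_minus_right mult_closed minus_closed khkh hkh khh flip: P_def)
  have "vadd A (cmult A P P) n = cmult A (vscale A 2 k) P"
    unfolding eq n_def P_def[symmetric] using c k by (simp add: mult_add_left mult_closed)
  then have PPn: "vadd A (cmult A P P) n = vscale A 2 m"
    using c k by (simp add: mult_scale_left m_def)
  have "vadd A (cmult A P P) (cmult A Q Q) =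
      vadd A (vadd A P (vadd A (vscale A (-1) m) (vscale A (-1) m))) (vadd A (cmult A P P) n)"
    unfolding QQ vminus_def using c mn
    by (simp add: scale_add_right scale_scale scale_one add_assoc add_closed scale_closed mult_closed add_left_commute)
  also have "\<dots> = P"
    unfolding PPn using c mn
    by (simp add: add_assoc add_closed scale_closed scale_zero_left add_zero_right flip: scale_add_left)
  finally have PPQQ: "vadd A (cmult A P P) (cmult A Q Q) = P" .
  have nP: "cnorm A P = (cnorm A h)\<^sup>2" using norm_cstar[OF h(1)] by (simp add: h P_def)
  \<comment> \<open>P + \<i> Q and P - \<i> Q both have the norm of \<open>h\<close>, and their sum
    is 2 P; hence |h|^2 \<le> |h|.\<close>
  have "cnorm A (vadd A P (vscale A \<i> Q)) = cnorm A h" "cnorm A (vadd A P (vscale A (- \<i>) Q)) = cnorm A h"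
    using norm_unitary_combination[OF c(1) s(1) c(2) s(2) PQ, of \<i>] norm_unitary_combination[OF c(1) s(1) c(2) s(2) PQ, of "- \<i>"]
    by (simp_all add: PPQQ nP norm_nonneg h c add_closed scale_closed)
  moreover have "vadd A (vadd A P (vscale A \<i> Q)) (vadd A P (vscale A (- \<i>) Q)) = vscale A 2 P"
  proof -
    have "vadd A (vadd A P (vscale A \<i> Q)) (vadd A P (vscale A (- \<i>) Q)) =
      vadd A (vadd A P P) (vadd A (vscale A \<i> Q) (vscale A (- \<i>) Q))"
      using c by (simp add: add_assoc add_closed scale_closed add_left_commute)
    also have "\<dots> = vadd A (vscale A 1 P) (vscale A 1 P)"
      using c scale_add_left[of Q \<i> "- \<i>", symmetric] by (simp add: scale_zero_left add_zero_right add_closed scale_one)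
    also have "\<dots> = vscale A 2 P" using c scale_add_left[of P 1 1] by simp
    finally show ?thesis .
  qed
  ultimately have "cnorm A (vscale A 2 P) \<le> cnorm A h + cnorm A h"
    using norm_triangle[of "vadd A P (vscale A \<i> Q)" "vadd A P (vscale A (- \<i>) Q)"] c
    by (simp add: add_closed scale_closed)
  then have "(cnorm A h)\<^sup>2 \<le> cnorm A h" using c by (simp add: norm_scale nP)
  then have "cnorm A h * cnorm A h \<le> 1 * cnorm A h" by (simp add: power2_eq_square)
  then show ?thesis using norm_nonneg[OF h(1)] by (cases "cnorm A h = 0") auto
qed

end

lemma lin_map_zero:
  assumes "star_vector_space V" "star_vector_space W" "lin_map V W f"
  shows "f (vzero V) = vzero W"
proof -
  interpret V: star_vector_space V by fact
  interpret W: star_vector_space W by fact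
  have "f (vscale V 0 (vzero V)) = vscale W 0 (f (vzero V))" "f (vzero V) \<in> carrier W"
    using assms(3) V.zero_closed by (auto simp: lin_map_def)
  then show ?thesis by (simp add: V.scale_zero_right W.scale_zero_left)
qed

text \<open>The certificate in \<open>norm_le_one_if_fixpoint\<close> consists of algebraic
  identities between \<open>h\<close> and \<open>k\<close>, so a star-homomorphism transports it and
  no spectrum is involved. The general case reduces to self-adjoint elements by the C*-identity and
  to norm one by scaling.\<close>

theorem star_hom_contractive:
  assumes B: "cstar_algebra B" and A: "cstar_algebra A" and f: "star_hom B A f" and x: "x \<in> carrier B"
  shows "cnorm A (f x) \<le> cnorm B x"
proof -
  interpret B: cstar_algebra B by (rule B)
  interpret A: cstar_algebra A by (rule A)
  have f_cl: "f y \<in> carrier A" and f_scale: "f (vscale B c y) = vscale A c (f y)"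
    and f_star: "f (vstar B y) = vstar A (f y)" if "y \<in> carrier B" for y c
    using f that by (auto simp: star_hom_def lin_map_def)
  have f_add: "f (vadd B y z) = vadd A (f y) (f z)"
    and f_mult: "f (cmult B y z) = cmult A (f y) (f z)" if "y \<in> carrier B" "z \<in> carrier B" for y z
    using f that by (auto simp: star_hom_def lin_map_def)
  have sa: "cnorm A (f h) \<le> 1" if h: "h \<in> carrier B" "vstar B h = h" "cnorm B h \<le> 1" for h
  proof -
    have "cnorm B (cmult B h h) \<le> 1"
      using B.norm_cstar[OF h(1)] h B.norm_nonneg[OF h(1)] by (simp add: power_le_one)
    then obtain k where k: "k \<in> carrier B" "vstar B k = k" "vscale B 2 k = vadd B (cmult B h h) (cmult B k k)"
        "cmult B h k = cmult B k h"
      using B.half_square_fixpoint[of "cmult B h h"] h(1,2) B.mult_closed B.star_mult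
      by (metis B.mult_assoc)
    show ?thesis
    proof (rule A.norm_le_one_if_fixpoint[of "f h" "f k"])
      show "f h \<in> carrier A" "f k \<in> carrier A" using h k f_cl by auto
      show "vstar A (f h) = f h" "vstar A (f k) = f k" using h k f_star by metis+
      show "cmult A (f h) (f k) = cmult A (f k) (f h)" using h k f_mult by metis
      show "vscale A 2 (f k) = vadd A (cmult A (f h) (f h)) (cmult A (f k) (f k))"
        using h k f_mult f_add f_scale by (metis B.mult_closed)
    qed
  qed
  show ?thesis
  proof (cases "x = vzero B")
    case True
    then show ?thesis
      using f lin_map_zero[OF B.star_vector_space_axioms A.star_vector_space_axioms, of f]
      by (simp add: star_hom_def A.norm_zero B.norm_zero)
  next
    case False
    define t where "t = cnorm B x"
    have "t > 0" using False B.norm_nonneg[OF x] B.norm_eq_zero[OF x] by (simp add: t_def less_le)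
    define y where "y = vscale B (complex_of_real (1 / t)) x"
    have yc: "y \<in> carrier B" using x by (simp add: y_def B.scale_closed)
    have "cnorm B y = 1" using x \<open>t > 0\<close> by (simp add: y_def B.norm_scale t_def norm_divide)
    then have "cnorm A (f (cmult B (vstar B y) y)) \<le> 1"
      using yc B.norm_cstar[OF yc]
      by (intro sa) (simp_all add: B.mult_closed B.star_closed B.star_mult B.star_star)
    then have "(cnorm A (f y))\<^sup>2 \<le> 1"
      using yc A.norm_cstar[OF f_cl[OF yc]] by (simp add: f_mult f_star B.star_closed)
    then have "cnorm A (f y) \<le> 1"
      using power2_le_imp_le[of "cnorm A (f y)" 1] by simp
    then show ?thesis
      using x \<open>t > 0\<close> by (simp add: y_def f_scale A.norm_scale f_cl norm_divide t_def)
  qed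
qed

text \<open>Contractivity in both directions. This is what makes it possible to evaluate
  \<open>cstar_mnorm\<close>, a definite description over all C*-norms.\<close>

lemma cstar_norm_unique:
  assumes "cstar_algebra A" "cstar_algebra B" "star_hom A B f" "star_hom B A g"
    and x: "x \<in> carrier A" "g (f x) = x"
  shows "cnorm B (f x) = cnorm A x"
proof -
  have "f x \<in> carrier B" using assms by (auto simp: star_hom_def lin_map_def)
  then show ?thesis
    using star_hom_contractive[OF assms(1-3) x(1)] star_hom_contractive[OF assms(2,1,4), of "f x"] x by simp
qed

section \<open>Quotients of concrete operator algebras\<close>

definition op_cstar :: "'h::complex_hilbert op set \<Rightarrow> 'h op cstar" where
  "op_cstar B = \<lparr>carrier = B, vzero = 0, vadd = (+), vscale = op_scale, vstar = adj,
     cmult = (o\<^sub>L), cnorm = norm\<rparr>"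

lemma op_cstar_simps [simp]:
  "carrier (op_cstar B) = B" "vzero (op_cstar B) = 0" "vadd (op_cstar B) = (+)"
  "vscale (op_cstar B) = op_scale" "vstar (op_cstar B) = adj" "cmult (op_cstar B) = (o\<^sub>L)"
  "cnorm (op_cstar B) = norm" "vminus (op_cstar B) S T = S - T"
  by (simp_all add: op_cstar_def vminus_def op_scale_minus_one)

text \<open>The $*$-algebra \<open>A\<close>, whose norm is ignored, is $B/I$ with quotient map \<open>f\<close>.\<close>

definition op_quotient ::
  "'h::complex_hilbert op set \<Rightarrow> 'h op set \<Rightarrow> 'b cstar \<Rightarrow> ('h op \<Rightarrow> 'b) \<Rightarrow> bool" where
  "op_quotient B I A f \<longleftrightarrow> op_alg B \<and> op_ideal B I \<and> carrier A = f ` B \<and> vzero A = f 0 \<and>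
     (\<forall>S\<in>B. \<forall>T\<in>B. f S = f T \<longleftrightarrow> S - T \<in> I) \<and>
     (\<forall>S\<in>B. \<forall>T\<in>B. vadd A (f S) (f T) = f (S + T)) \<and> (\<forall>c. \<forall>T\<in>B. vscale A c (f T) = f (op_scale c T)) \<and>
     (\<forall>T\<in>B. vstar A (f T) = f (adj T)) \<and> (\<forall>S\<in>B. \<forall>T\<in>B. cmult A (f S) (f T) = f (S o\<^sub>L T))"

lemma op_quotientD:
  assumes "op_quotient B I A f"
  shows "op_alg B" "op_ideal B I" "carrier A = f ` B" "vzero A = f 0"
    "S \<in> B \<Longrightarrow> T \<in> B \<Longrightarrow> f S = f T \<longleftrightarrow> S - T \<in> I"
    "S \<in> B \<Longrightarrow> T \<in> B \<Longrightarrow> vadd A (f S) (f T) = f (S + T)"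
    "T \<in> B \<Longrightarrow> vscale A c (f T) = f (op_scale c T)"
    "T \<in> B \<Longrightarrow> vstar A (f T) = f (adj T)"
    "S \<in> B \<Longrightarrow> T \<in> B \<Longrightarrow> cmult A (f S) (f T) = f (S o\<^sub>L T)"
  using assms unfolding op_quotient_def by blast+

lemma op_quotient_minus:
  assumes Q: "op_quotient B I A f" and "S \<in> B" "T \<in> B"
  shows "vminus A (f S) (f T) = f (S - T)"
  using assms op_subspaceD[OF op_algD(1)[OF op_quotientD(1)[OF Q]]]
  by (simp add: vminus_def op_quotientD[OF Q] op_scale_minus_one op_subspace_uminus[OF op_algD(1)[OF op_quotientD(1)[OF Q]]])

lemma infdist_less_attained: "A \<noteq> {} \<Longrightarrow> infdist x A < q \<Longrightarrow> \<exists>a\<in>A. dist x a < q"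
  using cInf_lessD[of "dist x ` A" q] by (auto simp: infdist_notempty)

lemma infdist_op_ideal_cong:
  assumes I: "op_subspace I" and "S - T \<in> I"
  shows "infdist S I = infdist T I"
proof -
  have le: "infdist S I \<le> infdist T I" if ST: "S - T \<in> I" for S T
  proof (rule field_le_epsilon)
    fix e :: real assume "e > 0"
    then obtain a where a: "a \<in> I" "dist T a < infdist T I + e"
      using infdist_less_attained[of I T "infdist T I + e"] op_subspaceD(2)[OF I] by fastforce
    have "infdist S I \<le> dist S (S - T + a)"
      by (intro infdist_le op_subspaceD(3)[OF I] ST a)
    then show "infdist S I \<le> infdist T I + e" using a by (simp add: dist_norm)
  qed
  have "T - S \<in> I" using op_subspace_uminus[OF I assms(2)] by simp
  then show ?thesis using le[OF assms(2)] le[of T S] by simp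
qed

text \<open>The norm axioms follow from lifts of almost the same norm, except the C*-identity, which
  rests on \<open>quotient_norm_lift\<close>; for completeness a rapidly converging subsequence is
  lifted to \<open>B\<close>.\<close>

lemma op_quotient_cstar_algebra:
  assumes Q: "op_quotient B I A f" and nrm: "\<And>T. T \<in> B \<Longrightarrow> cnorm A (f T) = infdist T I"
  shows "cstar_algebra A"
proof -
  note qd = op_quotientD[OF Q]
  note Bs = op_algD(1)[OF qd(1)] and Is = op_idealD(1)[OF qd(2)]
  note cl = op_subspaceD(2-5)[OF Bs] op_algD(2)[OF qd(1)] op_subspace_diff[OF Bs]
  have cB: "clin T" if "T \<in> B" for T using op_subspaceD(1)[OF Bs that] .
  note ops = qd(6-9) cl
  have N1: "cnorm A (f T) \<le> norm T" if "T \<in> B" for T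
    using infdist_le[of 0 I T] op_subspaceD(2)[OF Is] nrm[OF that] by simp
  have N2: "\<exists>T\<in>B. f T = x \<and> norm T < q" if x: "x \<in> carrier A" and q: "cnorm A x < q" for x q
  proof -
    obtain S where S: "S \<in> B" "x = f S" using x qd(3) by auto
    have less: "infdist S I < q" using q unfolding S(2) nrm[OF S(1)] .
    have ne: "I \<noteq> {}" using op_subspaceD(2)[OF Is] by (rule ex_in_conv[THEN iffD1, OF exI])
    obtain a where a: "a \<in> I" "dist S a < q"
      using infdist_less_attained[OF ne less] by (elim bexE)
    have "S - a \<in> B" by (rule op_subspace_diff[OF Bs S(1) op_idealD(2)[OF qd(2) a(1)]])
    moreover have "f (S - a) = x"
      using qd(5)[OF \<open>S - a \<in> B\<close> S(1)] S(2) op_subspace_uminus[OF Is a(1)] by simp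
    ultimately show ?thesis using a by (auto simp: dist_norm)
  qed
  have nn: "0 \<le> cnorm A x" if x: "x \<in> carrier A" for x
  proof -
    obtain S where "S \<in> B" "x = f S" using x qd(3) by auto
    then show ?thesis by (simp add: nrm infdist_nonneg)
  qed
  have car: "f T \<in> carrier A" if "T \<in> B" for T using that qd(3) by simp
  have tri: "cnorm A (vadd A x y) \<le> cnorm A x + cnorm A y" if xy: "x \<in> carrier A" "y \<in> carrier A" for x y
  proof (rule field_le_epsilon)
    fix e :: real assume "e > 0"
    obtain S where S: "S \<in> B" "f S = x" "norm S < cnorm A x + e / 2" using N2[OF xy(1), of "cnorm A x + e / 2"] \<open>e > 0\<close> by auto
    obtain T where T: "T \<in> B" "f T = y" "norm T < cnorm A y + e / 2" using N2[OF xy(2), of "cnorm A y + e / 2"] \<open>e > 0\<close> by auto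
    have "cnorm A (vadd A x y) \<le> norm (S + T)" using N1[of "S + T"] S T by (auto simp: ops)
    also have "\<dots> \<le> cnorm A x + cnorm A y + e" using norm_triangle_ineq[of S T] S T by linarith
    finally show "cnorm A (vadd A x y) \<le> cnorm A x + cnorm A y + e" .
  qed
  have mult: "cnorm A (cmult A x y) \<le> cnorm A x * cnorm A y" if xy: "x \<in> carrier A" "y \<in> carrier A" for x y
  proof -
    have "cnorm A (cmult A x y) \<le> (cnorm A x + 1 / real (Suc n)) * (cnorm A y + 1 / real (Suc n))" for n
    proof -
      obtain S where S: "S \<in> B" "f S = x" "norm S < cnorm A x + 1 / real (Suc n)" using N2[OF xy(1), of "cnorm A x + 1 / real (Suc n)"] by auto
      obtain T where T: "T \<in> B" "f T = y" "norm T < cnorm A y + 1 / real (Suc n)" using N2[OF xy(2), of "cnorm A y + 1 / real (Suc n)"] by auto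
      have "cnorm A (cmult A x y) \<le> norm (S o\<^sub>L T)" using N1[of "S o\<^sub>L T"] S T by (auto simp: ops)
      also have "\<dots> \<le> norm S * norm T" by (rule norm_blinfun_compose)
      also have "\<dots> \<le> (cnorm A x + 1 / real (Suc n)) * (cnorm A y + 1 / real (Suc n))"
        using S T nn[OF xy(1)] by (intro mult_mono) auto
      finally show ?thesis .
    qed
    moreover have "(\<lambda>n. (cnorm A x + 1 / real (Suc n)) * (cnorm A y + 1 / real (Suc n))) \<longlonglongrightarrow> (cnorm A x + 0) * (cnorm A y + 0)"
      by (intro tendsto_intros LIMSEQ_Suc[OF lim_1_over_n])
    ultimately show ?thesis
      using LIMSEQ_le_const[of "\<lambda>n. (cnorm A x + 1 / real (Suc n)) * (cnorm A y + 1 / real (Suc n))"] by auto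
  qed
  have scale_le: "cnorm A (vscale A c x) \<le> cmod c * cnorm A x" if x: "x \<in> carrier A" for c x
  proof (rule field_le_epsilon)
    fix e :: real assume "e > 0"
    define d where "d = e / (cmod c + 1)"
    have "cmod c + 1 > 0" by (simp add: add_nonneg_pos)
    then have "d > 0" using \<open>e > 0\<close> by (simp add: d_def)
    obtain S where S: "S \<in> B" "f S = x" "norm S < cnorm A x + d" using N2[OF x, of "cnorm A x + d"] \<open>d > 0\<close> by auto
    have "cnorm A (vscale A c x) \<le> norm (op_scale c S)" using N1[of "op_scale c S"] S by (auto simp: ops)
    also have "\<dots> \<le> cmod c * (cnorm A x + d)"
      unfolding norm_op_scale using S by (intro mult_left_mono) auto
    also have "\<dots> \<le> cmod c * cnorm A x + e"
    proof -
      have "cmod c * d \<le> (cmod c + 1) * d" using \<open>d > 0\<close> by (intro mult_right_mono) auto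
      also have "\<dots> = e" using \<open>cmod c + 1 > 0\<close> by (simp add: d_def)
      finally show ?thesis by (simp add: distrib_left)
    qed
    finally show "cnorm A (vscale A c x) \<le> cmod c * cnorm A x + e" .
  qed
  have scale: "cnorm A (vscale A c x) = cmod c * cnorm A x" if x: "x \<in> carrier A" for c x
  proof (cases "c = 0")
    case True
    then show ?thesis using scale_le[OF x, of 0] nn[of "vscale A 0 x"] x qd(3) by (auto simp: ops)
  next
    case False
    obtain S where S: "S \<in> B" "x = f S" using x qd(3) by auto
    have "vscale A (1 / c) (vscale A c x) = x" "vscale A c x \<in> carrier A"
      using S False qd(3) by (auto simp: ops op_scale_scale)
    then have "cnorm A x \<le> cmod (1 / c) * cnorm A (vscale A c x)" using scale_le[of "vscale A c x" "1 / c"] by simp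
    then have "cmod c * cnorm A x \<le> cnorm A (vscale A c x)"
      using False by (simp add: norm_divide field_simps)
    then show ?thesis using scale_le[OF x, of c] by simp
  qed
  have star_le: "cnorm A (vstar A x) \<le> cnorm A x" if x: "x \<in> carrier A" for x
  proof (rule field_le_epsilon)
    fix e :: real assume "e > 0"
    obtain S where S: "S \<in> B" "f S = x" "norm S < cnorm A x + e" using N2[OF x, of "cnorm A x + e"] \<open>e > 0\<close> by auto
    have "cnorm A (vstar A x) \<le> norm (adj S)" using N1[of "adj S"] S by (auto simp: ops)
    then show "cnorm A (vstar A x) \<le> cnorm A x + e" using S by (simp add: norm_adj cB)
  qed
  have cstar: "cnorm A (cmult A (vstar A x) x) = (cnorm A x)\<^sup>2" if x: "x \<in> carrier A" for x
  proof (rule antisym)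
    obtain y where y: "y \<in> B" "x = f y" using x qd(3) by auto
    have sx: "vstar A x \<in> carrier A" using y car by (simp add: ops)
    show "cnorm A (cmult A (vstar A x) x) \<le> (cnorm A x)\<^sup>2"
      using mult[OF sx x] mult_right_mono[OF star_le[OF x] nn[OF x]] by (simp add: power2_eq_square)
    show "(cnorm A x)\<^sup>2 \<le> cnorm A (cmult A (vstar A x) x)"
    proof (rule field_le_epsilon)
      fix e :: real assume "e > 0"
      have xx: "cmult A (vstar A x) x = f (adj y o\<^sub>L y)" using y by (simp add: ops)
      then have "cmult A (vstar A x) x \<in> carrier A" using y by (simp add: ops car)
      then obtain h where h: "h \<in> B" "f h = cmult A (vstar A x) x" "norm h < cnorm A (cmult A (vstar A x) x) + e / 2"
        using N2[of "cmult A (vstar A x) x" "cnorm A (cmult A (vstar A x) x) + e / 2"] \<open>e > 0\<close> by auto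
      have "(adj y o\<^sub>L y) - h \<in> I" using qd(5)[of "adj y o\<^sub>L y" h] h y xx by (simp add: cl)
      then obtain y' where y': "y' \<in> B" "y - y' \<in> I" "(norm y')\<^sup>2 \<le> norm h + e / 2"
        using quotient_norm_lift[OF qd(1,2) y(1) h(1), of "e / 2"] \<open>e > 0\<close> by auto
      have "f y' = x" using qd(5)[OF y(1) y'(1)] y' y by simp
      then have "(cnorm A x)\<^sup>2 \<le> (norm y')\<^sup>2" using N1[OF y'(1)] nn[OF x] by (simp add: power_mono)
      then show "(cnorm A x)\<^sup>2 \<le> cnorm A (cmult A (vstar A x) x) + e" using y' h by linarith
    qed
  qed
  have minus: "vminus A x y \<in> carrier A" if "x \<in> carrier A" "y \<in> carrier A" for x y
    using that op_quotient_minus[OF Q] qd(3) cl by auto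
  have complete: "\<exists>l\<in>carrier A. (\<lambda>n. cnorm A (vminus A (x n) l)) \<longlonglongrightarrow> 0"
    if xc: "\<And>n. x n \<in> carrier A" and cau: "\<And>e. e > 0 \<Longrightarrow> \<exists>N. \<forall>m\<ge>N. \<forall>n\<ge>N. cnorm A (vminus A (x m) (x n)) < e" for x
  proof -
    have "\<exists>N. \<forall>m\<ge>N. \<forall>n\<ge>N. cnorm A (vminus A (x m) (x n)) < (1/2)^k" for k :: nat
      by (rule cau) simp
    then obtain N where N: "\<And>k m n. m \<ge> N k \<Longrightarrow> n \<ge> N k \<Longrightarrow> cnorm A (vminus A (x m) (x n)) < (1/2)^k" by metis
    \<comment> \<open>Partial sums instead of \<open>N\<close> itself: the indices increase and
      still dominate each \<open>N k\<close>.\<close>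
    define r where "r k = (\<Sum>i\<le>k. N i)" for k
    have rN: "N k \<le> r k" for k unfolding r_def by (rule member_le_sum) auto
    have rS: "r k \<le> r (Suc k)" for k by (simp add: r_def)
    \<comment> \<open>Each lift is chosen after the previous one, at distance less than 2^-k from
      it, which makes the lifted sequence converge in \<open>B\<close>.\<close>
    have "\<exists>T. \<forall>k. (T k \<in> B \<and> f (T k) = x (r k)) \<and> norm (T (Suc k) - T k) < (1/2)^k"
    proof (rule dependent_nat_choice)
      show "\<exists>T. T \<in> B \<and> f T = x (r 0)" using xc[of "r 0"] qd(3) by auto
      fix T k assume T: "T \<in> B \<and> f T = x (r k)"
      have "cnorm A (vminus A (x (r (Suc k))) (x (r k))) < (1/2)^k"
        using rN[of k] rS[of k] by (intro N) auto
      then obtain D where D: "D \<in> B" "f D = vminus A (x (r (Suc k))) (x (r k))" "norm D < (1/2)^k"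
        using N2[OF minus[OF xc xc]] by blast
      obtain S where S: "S \<in> B" "f S = x (r (Suc k))" using xc[of "r (Suc k)"] qd(3) by auto
      have "f D = f (S - T)" using op_quotient_minus[OF Q S(1), of T] S T D by simp
      then have "D - (S - T) \<in> I" using qd(5)[OF D(1), of "S - T"] S T cl by simp
      then have "f (T + D) = f S" using qd(5)[of "T + D" S] S T D cl by (simp add: algebra_simps)
      then show "\<exists>T'. (T' \<in> B \<and> f T' = x (r (Suc k))) \<and> norm (T' - T) < (1/2)^k"
        using T D S cl by (intro exI[of _ "T + D"]) auto
    qed
    then obtain T where T: "\<And>k. T k \<in> B" "\<And>k. f (T k) = x (r k)" "\<And>k. norm (T (Suc k) - T k) < (1/2)^k" by metis
    have "summable (\<lambda>k. T (Suc k) - T k)"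
      by (rule summable_comparison_test'[of "\<lambda>k. (1/2)^k" 0]) (use T(3) in \<open>auto intro: less_imp_le\<close>)
    then have "(\<lambda>n. (\<Sum>k<n. T (Suc k) - T k) + T 0) \<longlonglongrightarrow> (\<Sum>k. T (Suc k) - T k) + T 0"
      by (intro tendsto_add tendsto_const summable_LIMSEQ)
    then have "\<exists>L. T \<longlonglongrightarrow> L" by (auto simp: sum_lessThan_telescope)
    then obtain L where L: "T \<longlonglongrightarrow> L" by blast
    have LB: "L \<in> B" by (rule closed_sequentially[OF op_algD(3)[OF qd(1)] T(1) L])
    have "(\<lambda>n. cnorm A (vminus A (x n) (f L))) \<longlonglongrightarrow> 0"
    proof (rule LIMSEQ_I)
      fix e :: real assume "e > 0"
      obtain k0 where k0: "(1/2)^k0 < e / 2" using real_arch_pow_inv[of "e / 2" "1/2"] \<open>e > 0\<close> by auto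
      obtain k1 where k1: "\<And>k. k \<ge> k1 \<Longrightarrow> norm (T k - L) < e / 2"
        using LIMSEQ_D[OF L, of "e / 2"] \<open>e > 0\<close> by auto
      define k where "k = max k0 k1"
      have k: "(1/2::real)^k < e / 2"
        by (rule order_le_less_trans[OF power_decreasing k0]) (simp_all add: k_def)
      show "\<exists>no. \<forall>n\<ge>no. norm (cnorm A (vminus A (x n) (f L)) - 0) < e"
      proof (intro exI[of _ "r k"] allI impI)
        fix n assume n: "n \<ge> r k"
        obtain S where S: "S \<in> B" "f S = x n" using xc[of n] qd(3) by auto
        have "vminus A (x n) (f L) = vadd A (vminus A (x n) (x (r k))) (vminus A (x (r k)) (f L))"
          using S T LB by (simp add: op_quotient_minus[OF Q] ops flip: S(2) T(2))
        then have "cnorm A (vminus A (x n) (f L)) \<le> cnorm A (vminus A (x n) (x (r k))) + cnorm A (vminus A (x (r k)) (f L))"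
          using tri minus xc car LB by metis
        also have "cnorm A (vminus A (x n) (x (r k))) < (1/2)^k"
          using n rN[of k] by (intro N) auto
        also have "cnorm A (vminus A (x (r k)) (f L)) \<le> norm (T k - L)"
          using N1[of "T k - L"] T LB cl by (simp add: op_quotient_minus[OF Q] flip: T(2))
        also have "norm (T k - L) < e / 2" by (rule k1) (simp add: k_def)
        finally have "cnorm A (vminus A (x n) (f L)) < e" using k by simp
        then show "norm (cnorm A (vminus A (x n) (f L)) - 0) < e"
          using nn[OF minus[OF xc car[OF LB]]] by simp
      qed
    qed
    then show ?thesis using car[OF LB] by blast
  qed
  have ne0: "cnorm A x = 0 \<longleftrightarrow> x = vzero A" if x: "x \<in> carrier A" for x
  proof -
    obtain S where S: "S \<in> B" "x = f S" using x qd(3) by auto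
    have "infdist S I = 0 \<longleftrightarrow> S \<in> I"
      using in_closed_iff_infdist_zero[OF op_idealD(5)[OF qd(2)], of S] op_subspaceD(2)[OF Is] by auto
    then show ?thesis using S nrm[OF S(1)] qd(5)[OF S(1) cl(1)] qd(4) by simp
  qed
  show ?thesis
  proof (unfold_locales, goal_cases)
    case (23 x) then show ?case by (rule ne0)
  next
    case (24 x y) then show ?case by (rule tri)
  next
    case (25 x c) then show ?case by (rule scale)
  next
    case (26 x y) then show ?case by (rule mult)
  next
    case (27 x) then show ?case by (rule cstar)
  next
    case (28 g) then show ?case by (rule complete)
  qed (auto simp: qd(3,4) ops algebra_simps op_scale_scale op_scale_add_left op_scale_add_right
      comp_assoc comp_simps comp_op_scale_left comp_op_scale_right cB adj_add adj_adj adj_op_scale adj_comp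
      op_scale_minus_one op_subspace_uminus[OF Bs])
qed

text \<open>\<open>op_quotient\<close> disregards the norm of \<open>A\<close>; here the same
  star-algebra receives the distance to \<open>I\<close>, the reference norm for the uniqueness
  argument.\<close>

lemma op_quotient_update_norm:
  assumes Q: "op_quotient B I A f"
  shows "\<exists>N. cstar_algebra (A\<lparr>cnorm := N\<rparr>) \<and> (\<forall>T\<in>B. N (f T) = infdist T I)"
proof -
  define N where "N x = infdist (SOME T. T \<in> B \<and> f T = x) I" for x
  have N: "N (f T) = infdist T I" if T: "T \<in> B" for T
  proof -
    have "(SOME S. S \<in> B \<and> f S = f T) \<in> B \<and> f (SOME S. S \<in> B \<and> f S = f T) = f T"
      by (rule someI_ex) (use T in blast)
    then show ?thesis unfolding N_def
      using op_quotientD(5)[OF Q _ T] infdist_op_ideal_cong[OF op_idealD(1)[OF op_quotientD(2)[OF Q]]] by blast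
  qed
  have "op_quotient B I (A\<lparr>cnorm := N\<rparr>) f" using Q by (simp add: op_quotient_def)
  then have "cstar_algebra (A\<lparr>cnorm := N\<rparr>)"
    by (rule op_quotient_cstar_algebra) (simp add: N)
  then show ?thesis using N by blast
qed

lemma star_hom_id_norm_update:
  assumes "cstar_algebra A"
  shows "star_hom A (A\<lparr>cnorm := N\<rparr>) id" "star_hom (A\<lparr>cnorm := N\<rparr>) A id"
  by (auto simp: star_hom_def lin_map_def)

text \<open>The identity is a star-isomorphism between \<open>A\<close> and its copy with the
  distance norm, and C*-norms are unique.\<close>

lemma op_quotient_norm:
  assumes Q: "op_quotient B I A f" and A: "cstar_algebra A" and T: "T \<in> B"
  shows "cnorm A (f T) = infdist T I"
proof -
  obtain N where N: "cstar_algebra (A\<lparr>cnorm := N\<rparr>)" "\<forall>T\<in>B. N (f T) = infdist T I"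
    using op_quotient_update_norm[OF Q] by blast
  have "f T \<in> carrier A" using T op_quotientD(3)[OF Q] by simp
  then have "N (f T) = cnorm A (f T)"
    using cstar_norm_unique[OF A N(1) star_hom_id_norm_update[OF A], of "f T"] by simp
  then show ?thesis using N(2) T by simp
qed

lemma op_quotient_vsum:
  assumes Q: "op_quotient B I A f" and "\<And>k. k < n \<Longrightarrow> g k \<in> B"
  shows "vsum A (\<lambda>k. f (g k)) n = f (\<Sum>k<n. g k)"
  using assms(2)
proof (induction n)
  case 0 then show ?case by (simp add: op_quotientD[OF Q])
next
  case (Suc n)
  then have "(\<Sum>k<n. g k) \<in> B"
    by (intro op_subspace_sum[OF op_algD(1)[OF op_quotientD(1)[OF Q]]]) auto
  then show ?case using Suc by (simp add: op_quotientD[OF Q])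
qed

section \<open>Matrix algebras over a quotient\<close>

lemma op_matsD': "op_subspace B \<Longrightarrow> X \<in> op_mats B n \<Longrightarrow> X i j \<in> B"
  using op_matsD op_mats_outside op_subspaceD(2) by metis

lemma op_mats_mono: "B \<subseteq> C \<Longrightarrow> op_mats B n \<subseteq> op_mats C n"
  by (fastforce simp: op_mats_def split: if_splits)

definition op_mat_mult :: "nat \<Rightarrow> 'h::complex_hilbert op mat \<Rightarrow> 'h op mat \<Rightarrow> 'h op mat" where
  "op_mat_mult n X Y = (\<lambda>i j. if i < n \<and> j < n then \<Sum>k<n. X i k o\<^sub>L Y k j else 0)"

definition op_mat_adj :: "'h::complex_hilbert op mat \<Rightarrow> 'h op mat" where
  "op_mat_adj X = (\<lambda>i j. adj (X j i))"

lemma op_mat_of_mult: "op_mat n (op_mat_mult n X Y) = op_mat n X o\<^sub>L op_mat n Y"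
  unfolding op_mat_comp op_mat_mult_def by (rule op_mat_cong) simp

lemma op_mat_of_adj:
  "(\<And>i j. i < n \<Longrightarrow> j < n \<Longrightarrow> clin (X i j)) \<Longrightarrow> op_mat n (op_mat_adj X) = adj (op_mat n X)"
  by (simp add: op_mat_adj_def adj_op_mat)

lemma op_mat_mult_closed:
  "op_alg B \<Longrightarrow> X \<in> op_mats B n \<Longrightarrow> Y \<in> op_mats B n \<Longrightarrow> op_mat_mult n X Y \<in> op_mats B n"
proof (rule op_matsI)
  fix i j assume B: "op_alg B" and X: "X \<in> op_mats B n" and Y: "Y \<in> op_mats B n" and ij: "i < n" "j < n"
  note D = op_matsD'[OF op_algD(1)[OF B]]
  have "(\<Sum>k<n. X i k o\<^sub>L Y k j) \<in> B"
    by (intro op_subspace_sum[OF op_algD(1)[OF B]] op_algD(2)[OF B] D[OF X] D[OF Y])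
  then show "op_mat_mult n X Y i j \<in> B" using ij by (simp add: op_mat_mult_def)
qed (auto simp: op_mat_mult_def)

lemma op_mat_adj_closed: "op_subspace B \<Longrightarrow> X \<in> op_mats B n \<Longrightarrow> op_mat_adj X \<in> op_mats B n"
  by (rule op_matsI) (auto simp: op_mat_adj_def op_mats_outside intro: op_subspaceD(5) op_matsD)

lemma op_mats_add: "op_subspace B \<Longrightarrow> X \<in> op_mats B n \<Longrightarrow> Y \<in> op_mats B n \<Longrightarrow> (\<lambda>i j. X i j + Y i j) \<in> op_mats B n"
  by (rule op_matsI) (auto simp: op_mats_outside intro: op_subspaceD(3) op_matsD)

lemma op_mats_diff: "op_subspace B \<Longrightarrow> X \<in> op_mats B n \<Longrightarrow> Y \<in> op_mats B n \<Longrightarrow> (\<lambda>i j. X i j - Y i j) \<in> op_mats B n"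
  by (rule op_matsI) (auto simp: op_mats_outside intro: op_subspace_diff op_matsD)

lemma op_mats_op_scale: "op_subspace B \<Longrightarrow> X \<in> op_mats B n \<Longrightarrow> (\<lambda>i j. op_scale c (X i j)) \<in> op_mats B n"
  by (rule op_matsI) (auto simp: op_mats_outside intro: op_subspaceD(4) op_matsD)

lemma op_quotient_Mat:
  assumes Q: "op_quotient B I A f"
  shows "Mat A n = amplify f ` op_mats B n"
proof (intro equalityI subsetI)
  fix x assume x: "x \<in> Mat A n"
  have "\<forall>i j. \<exists>T. (i < n \<and> j < n \<longrightarrow> T \<in> B \<and> f T = x i j)"
    using x op_quotientD(3)[OF Q] unfolding Mat_def mem_Collect_eq by (metis imageE)
  then obtain T where T: "\<And>i j. i < n \<Longrightarrow> j < n \<Longrightarrow> T i j \<in> B \<and> f (T i j) = x i j" by metis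
  show "x \<in> amplify f ` op_mats B n"
  proof (rule image_eqI)
    show "(\<lambda>i j. if i < n \<and> j < n then T i j else 0) \<in> op_mats B n"
      using T by (intro op_matsI) auto
    show "x = amplify f (\<lambda>i j. if i < n \<and> j < n then T i j else 0)"
      using x T unfolding amplify_def by (intro ext) (auto simp: Mat_def op_quotientD(4)[OF Q])
  qed
next
  fix x assume "x \<in> amplify f ` op_mats B n"
  then obtain X where X: "X \<in> op_mats B n" "x = amplify f X" by blast
  show "x \<in> Mat A n"
    unfolding Mat_def X(2) amplify_def mem_Collect_eq op_quotientD(3,4)[OF Q]
    using op_matsD[OF X(1)] op_mats_outside[OF X(1)] by auto
qed

lemma op_quotient_mat_ops:
  assumes Q: "op_quotient B I A f" and X: "X \<in> op_mats B n"
  shows "Y \<in> op_mats B n \<Longrightarrow> mat_add A (amplify f X) (amplify f Y) = amplify f (\<lambda>i j. X i j + Y i j)"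
    "mat_scale A c (amplify f X) = amplify f (\<lambda>i j. op_scale c (X i j))"
    "mat_star A n (amplify f X) = amplify f (op_mat_adj X)"
    "Y \<in> op_mats B n \<Longrightarrow> mat_mult A n (amplify f X) (amplify f Y) = amplify f (op_mat_mult n X Y)"
    "mat_zero A = amplify f (\<lambda>i j. 0)"
proof -
  note qd = op_quotientD[OF Q] and Bs = op_algD(1)[OF op_quotientD(1)[OF Q]]
  note mD = op_matsD'[OF Bs]
  show "mat_zero A = amplify f (\<lambda>i j. 0)" by (simp add: mat_zero_def amplify_def qd)
  show "Y \<in> op_mats B n \<Longrightarrow> mat_add A (amplify f X) (amplify f Y) = amplify f (\<lambda>i j. X i j + Y i j)"
    by (intro ext) (simp add: mat_add_def amplify_def qd mD[OF X] mD)
  show "mat_scale A c (amplify f X) = amplify f (\<lambda>i j. op_scale c (X i j))"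
    by (intro ext) (simp add: mat_scale_def amplify_def qd mD[OF X])
  show "mat_star A n (amplify f X) = amplify f (op_mat_adj X)"
    by (intro ext) (auto simp add: mat_star_def amplify_def qd mD[OF X] op_mat_adj_def op_mats_outside[OF X])
  assume Y: "Y \<in> op_mats B n"
  have "vsum A (\<lambda>k. cmult A (f (X i k)) (f (Y k j))) n = f (\<Sum>k<n. X i k o\<^sub>L Y k j)" for i j
    by (simp add: qd mD[OF X] mD[OF Y] op_algD(2)[OF qd(1)] op_quotient_vsum[OF Q])
  then show "mat_mult A n (amplify f X) (amplify f Y) = amplify f (op_mat_mult n X Y)"
    by (intro ext) (simp add: mat_mult_def amplify_def op_mat_mult_def qd(4))
qed

text \<open>M_n(B)/M_n(I) is M_n(B/I). The inverse of \<open>op_mat n\<close> reads the matrix off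
  an operator; \<open>N\<close> is arbitrary because \<open>op_quotient\<close> ignores
  norms.\<close>

lemma op_quotient_mat_algebra:
  assumes Q: "op_quotient B I A f"
  shows "op_quotient (op_mat n ` op_mats B n) (op_mat n ` op_mats I n) (mat_algebra A n N)
    (\<lambda>T. amplify f (inv_into (op_mats B n) (op_mat n) T))"
proof -
  note qd = op_quotientD[OF Q] and Bs = op_algD(1)[OF op_quotientD(1)[OF Q]]
  note Is = op_idealD(1)[OF qd(2)]
  have inv: "inv_into (op_mats B n) (op_mat n) (op_mat n X) = X" if "X \<in> op_mats B n" for X
    using that op_mats_inj by (rule inv_into_f_f[rotated])
  have z: "(\<lambda>i j. 0) \<in> op_mats B n" by (simp add: op_mats_def op_subspaceD[OF Bs])
  have inv0: "inv_into (op_mats B n) (op_mat n) 0 = (\<lambda>i j. 0)"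
    using inv[OF z] by (simp add: op_mat_zero)
  have ker: "amplify f X = amplify f Y \<longleftrightarrow> op_mat n X - op_mat n Y \<in> op_mat n ` op_mats I n"
    if X: "X \<in> op_mats B n" and Y: "Y \<in> op_mats B n" for X Y
  proof
    assume "amplify f X = amplify f Y"
    then have "f (X i j) = f (Y i j)" for i j by (metis amplify_def)
    then have "X i j - Y i j \<in> I" for i j using qd(5) op_matsD'[OF Bs] X Y by blast
    then have "(\<lambda>i j. X i j - Y i j) \<in> op_mats I n"
      using X Y by (intro op_matsI) (auto simp: op_mats_outside)
    then show "op_mat n X - op_mat n Y \<in> op_mat n ` op_mats I n"
      unfolding op_mat_diff[symmetric] by (rule imageI)
  next
    assume "op_mat n X - op_mat n Y \<in> op_mat n ` op_mats I n"
    then obtain Z where Z: "Z \<in> op_mats I n" "op_mat n (\<lambda>i j. X i j - Y i j) = op_mat n Z"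
      by (auto simp: op_mat_diff)
    have "X i j - Y i j \<in> I" for i j
    proof (cases "i < n \<and> j < n")
      case True
      then have "X i j - Y i j = Z i j" using op_mat_inject[OF Z(2), of i j] by simp
      then show ?thesis using op_matsD'[OF Is Z(1)] by simp
    next
      case False
      then show ?thesis using X Y op_subspaceD(2)[OF Is] by (simp add: op_mats_outside)
    qed
    then have "f (X i j) = f (Y i j)" for i j using qd(5) op_matsD'[OF Bs] X Y by blast
    then show "amplify f X = amplify f Y" by (simp add: amplify_def)
  qed
  show ?thesis
    unfolding op_quotient_def
  proof (intro conjI)
    show "op_alg (op_mat n ` op_mats B n)" by (rule op_alg_op_mats[OF qd(1)])
    show "op_ideal (op_mat n ` op_mats B n) (op_mat n ` op_mats I n)"
      by (rule op_ideal_op_mats[OF qd(1,2)])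
    show "carrier (mat_algebra A n N) = (\<lambda>T. amplify f (inv_into (op_mats B n) (op_mat n) T)) ` op_mat n ` op_mats B n"
      by (simp add: mat_algebra_def op_quotient_Mat[OF Q] image_image inv cong: image_cong)
    show "vzero (mat_algebra A n N) = amplify f (inv_into (op_mats B n) (op_mat n) 0)"
      by (simp add: mat_algebra_def inv0 op_quotient_mat_ops(5)[OF Q z])
  qed (auto simp: inv ker mat_algebra_def op_quotient_mat_ops[OF Q] op_mats_add[OF Bs] op_mats_op_scale[OF Bs]
      op_mat_adj_closed[OF Bs] op_mat_mult_closed[OF qd(1)] op_subspaceD(1)[OF Bs] op_matsD'[OF Bs]
      simp flip: op_mat_add op_mat_op_scale op_mat_of_adj op_mat_of_mult)
qed

text \<open>Existence comes from the distance norm on the matrix algebra and uniqueness from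
  \<open>op_quotient_norm\<close>; the description operator is thereby evaluated.\<close>

theorem op_quotient_mnorm:
  assumes Q: "op_quotient B I A f" and X: "X \<in> op_mats B n"
  shows "cstar_mnorm A n (amplify f X) = infdist (op_mat n X) (op_mat n ` op_mats I n)"
proof -
  define F where "F = (\<lambda>T. amplify f (inv_into (op_mats B n) (op_mat n) T))"
  have Q': "op_quotient (op_mat n ` op_mats B n) (op_mat n ` op_mats I n) (mat_algebra A n N) F" for N
    unfolding F_def by (rule op_quotient_mat_algebra[OF Q])
  have FX: "F (op_mat n X) = amplify f X"
    unfolding F_def using X by (subst inv_into_f_f[OF op_mats_inj]) auto
  obtain N where N: "cstar_algebra (mat_algebra A n N)"
    using op_quotient_update_norm[OF Q'[of undefined]] by (auto simp: mat_algebra_def)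
  have "N' (amplify f X) = infdist (op_mat n X) (op_mat n ` op_mats I n)"
    if "cstar_algebra (mat_algebra A n N')" for N'
    using op_quotient_norm[OF Q' that, of "op_mat n X"] X by (simp add: FX) (simp add: mat_algebra_def)
  then show ?thesis
    unfolding cstar_mnorm_def using N by (intro the_equality) blast+
qed

lemma op_cstar_quotient: "op_alg B \<Longrightarrow> op_quotient B {0} (op_cstar B) id"
  by (simp add: op_quotient_def op_ideal_zero)

lemma cstar_algebra_op_cstar: "op_alg B \<Longrightarrow> cstar_algebra (op_cstar B)"
  by (rule op_quotient_cstar_algebra[OF op_cstar_quotient]) (simp_all add: dist_norm)

text \<open>First isomorphism theorem; the kernel is closed because star-homomorphisms are
  contractive.\<close>

lemma op_quotient_star_hom:
  assumes B: "op_alg B" and A: "cstar_algebra A" and f: "star_hom (op_cstar B) A f" and onto: "f ` B = carrier A"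
  shows "op_quotient B {T \<in> B. f T = vzero A} A f"
proof -
  interpret A: cstar_algebra A by (rule A)
  interpret C: cstar_algebra "op_cstar B" by (rule cstar_algebra_op_cstar[OF B])
  note Bs = op_algD(1)[OF B]
  define I where "I = {T \<in> B. f T = vzero A}"
  have fl: "lin_map (op_cstar B) A f" using f by (simp add: star_hom_def)
  have f0: "f 0 = vzero A"
    using lin_map_zero[OF C.star_vector_space_axioms A.star_vector_space_axioms fl] by simp
  have fc: "f T \<in> carrier A" if "T \<in> B" for T using onto that by blast
  have fadd: "f (S + T) = vadd A (f S) (f T)" and fmult: "f (S o\<^sub>L T) = cmult A (f S) (f T)" if "S \<in> B" "T \<in> B" for S T
    using f that by (auto simp: star_hom_def lin_map_def)
  have fscale: "f (op_scale c T) = vscale A c (f T)" and fstar: "f (adj T) = vstar A (f T)" if "T \<in> B" for c T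
    using f that by (auto simp: star_hom_def lin_map_def)
  have fminus: "f (S - T) = vminus A (f S) (f T)" if "S \<in> B" "T \<in> B" for S T
  proof -
    have eq: "S - T = S + op_scale (-1) T" by (simp add: op_scale_minus_one)
    show ?thesis unfolding eq using that by (simp add: fadd fscale op_subspaceD(4)[OF Bs] vminus_def)
  qed
  have mult0: "cmult A x (vzero A) = vzero A" "cmult A (vzero A) x = vzero A" if "x \<in> carrier A" for x
    using A.mult_scale_right[OF that A.zero_closed, of 0] A.mult_scale_left[OF A.zero_closed that, of 0] that
    by (simp_all add: A.scale_zero_right A.scale_zero_left A.mult_closed A.zero_closed)
  have "closed I"
    unfolding closed_sequential_limits
  proof (intro allI impI, elim conjE)
    fix T L assume T: "\<forall>n. T n \<in> I" and L: "T \<longlonglongrightarrow> L"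
    have LB: "L \<in> B" using T L closed_sequentially[OF op_algD(3)[OF B], of T L] by (simp add: I_def)
    have "cnorm A (f L) \<le> norm (T n - L)" for n
    proof -
      have TB: "T n \<in> B" "f (T n) = vzero A" using T by (auto simp: I_def)
      have "cnorm A (f (T n - L)) \<le> norm (T n - L)"
        using star_hom_contractive[OF cstar_algebra_op_cstar[OF B] A f, of "T n - L"] TB LB
        by (simp add: op_subspace_diff[OF Bs])
      also have "f (T n - L) = vscale A (-1) (f L)"
        using TB LB by (simp add: fminus vminus_def A.add_zero A.scale_closed fc)
      finally show ?thesis using LB by (simp add: A.norm_scale fc)
    qed
    moreover have "(\<lambda>n. norm (T n - L)) \<longlonglongrightarrow> 0" using L tendsto_norm_zero LIM_zero by blast
    ultimately have "cnorm A (f L) \<le> 0" by (intro LIMSEQ_le_const) auto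
    then have "f L = vzero A"
      using A.norm_nonneg[OF fc[OF LB]] A.norm_eq_zero[OF fc[OF LB]] by simp
    then show "L \<in> I" using LB by (simp add: I_def)
  qed
  moreover have "op_subspace I"
    unfolding op_subspace_def I_def
    using op_subspaceD[OF Bs] by (auto simp: bounded_ops_iff f0 fadd fscale fstar A.add_zero A.zero_closed A.scale_zero_right A.star_zero)
  ultimately have "op_ideal B I"
    unfolding op_ideal_def using op_algD(2)[OF B] by (auto simp: I_def fmult mult0 fc)
  then show ?thesis
    unfolding op_quotient_def I_def[symmetric] using B onto f0
    by (auto simp: fadd fscale fstar fmult I_def fminus A.minus_eq_zero_iff fc op_subspace_diff[OF Bs])
qed

lemma op_alg_bounded_ops: "op_alg (bounded_ops :: 'h::complex_hilbert op set)"
  by (auto simp: op_alg_def op_subspace_def bounded_ops_iff clin_add clin_op_scale clin_adj clin_comp closed_bounded_ops)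

text \<open>The iteration, which is the binomial series of \<open>1 - sqrt (1 - x)\<close> at \<open>x = id - T\<close>, keeps the
  difference to a multiple of the identity in \<open>B\<close>.\<close>

lemma op_sqrt_contraction:
  assumes B: "op_alg B" and T: "T \<in> B" "adj T = T" "op_pos T" "norm T \<le> 1"
  shows "\<exists>S\<in>B. adj S = S \<and> S o\<^sub>L S = T"
proof -
  note Bs = op_algD(1)[OF B]
  have cT: "clin T" using T Bs op_subspaceD(1) by blast
  let ?C = "op_cstar (bounded_ops :: 'a op set)"
  interpret C: cstar_algebra ?C by (rule cstar_algebra_op_cstar[OF op_alg_bounded_ops])
  define X where "X = id_blinfun - T"
  have "norm X \<le> 1" unfolding X_def by (rule norm_id_diff_le[OF cT T(2-4)])
  moreover have cX: "clin X" "adj X = X" using cT T(2) by (simp_all add: X_def clin_diff adj_diff)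
  ultimately obtain L where L: "L \<in> carrier ?C" "vstar ?C L = L" "vscale ?C 2 L = vadd ?C X (cmult ?C L L)" "C.tends_to (C.half_square X) L"
    using C.half_square_fixpoint[of X] by (auto simp: bounded_ops_iff)
  have cL: "clin L" and aL: "adj L = L" using L by (simp_all add: bounded_ops_iff)
  define K where "K = C.half_square X"
  have K: "K 0 = 0" "K (Suc n) = (1/2) *\<^sub>R (X + (K n o\<^sub>L K n))" for n
    using op_scale_of_real[of "1/2"] by (simp_all add: K_def C.half_square_def)
  have lim: "K \<longlonglongrightarrow> L"
    using L(4) by (simp add: C.tends_to_def LIM_zero_cancel tendsto_norm_zero_iff flip: K_def)
  define r where "r = rec_nat 0 (\<lambda>_ x::real. (1 + x\<^sup>2) / 2)"
  have r: "r 0 = 0" "r (Suc n) = (1 + (r n)\<^sup>2) / 2" for n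
    by (simp_all add: r_def)
  have inB: "r n *\<^sub>R id_blinfun - K n \<in> B" for n
  proof (induction n)
    case 0 then show ?case by (simp add: K r op_subspaceD[OF Bs])
  next
    case (Suc n)
    define D where "D = r n *\<^sub>R id_blinfun - K n"
    have KD: "K n = r n *\<^sub>R id_blinfun - D" by (simp add: D_def)
    have "r (Suc n) *\<^sub>R id_blinfun - K (Suc n) = (1/2) *\<^sub>R (T + (2 * r n) *\<^sub>R D - (D o\<^sub>L D))"
      unfolding K r KD X_def by (simp add: comp_simps algebra_simps power2_eq_square) (simp add: add_divide_distrib flip: add.assoc scaleR_add_left)
    also have "\<dots> \<in> B"
      using Suc T(1) unfolding D_def[symmetric]
      by (intro op_subspace_scaleR op_subspace_diff op_subspaceD(3) op_algD(2)[OF B] Bs) auto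
    finally show ?case .
  qed
  \<comment> \<open>The scalars tend to exactly 1, so id - L lies in \<open>B\<close> although
    neither term need do so.\<close>
  have "(\<lambda>n. r n *\<^sub>R id_blinfun - K n) \<longlonglongrightarrow> 1 *\<^sub>R id_blinfun - L"
    by (intro tendsto_intros lim half_square_limit(1)[OF r])
  then have "id_blinfun - L \<in> B"
    using closed_sequentially[OF op_algD(3)[OF B], of "\<lambda>n. r n *\<^sub>R id_blinfun - K n"] inB by simp
  moreover have "adj (id_blinfun - L) = id_blinfun - L" by (simp add: adj_diff cL aL)
  moreover have "(id_blinfun - L) o\<^sub>L (id_blinfun - L) = T"
  proof -
    have "2 *\<^sub>R L = X + (L o\<^sub>L L)" using L(3) op_scale_of_real[of 2 L] by simp
    then have "L + L = id_blinfun - T + (L o\<^sub>L L)" by (simp add: X_def scaleR_2)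
    then show ?thesis by (simp add: comp_simps algebra_simps)
  qed
  ultimately show ?thesis by blast
qed

lemma op_sqrt:
  assumes B: "op_alg B" and T: "T \<in> B" "adj T = T" "op_pos T"
  shows "\<exists>S\<in>B. adj S = S \<and> S o\<^sub>L S = T"
proof -
  note Bs = op_algD(1)[OF B]
  have cT: "clin T" using T Bs op_subspaceD(1) by blast
  \<comment> \<open>Adding 1 keeps the divisor positive for \<open>T = 0\<close>.\<close>
  define c where "c = norm T + 1"
  have "c > 0" by (simp add: c_def add_nonneg_pos)
  have "norm ((1/c) *\<^sub>R T) \<le> 1" using \<open>c > 0\<close> by (simp add: c_def)
  moreover have "op_pos ((1/c) *\<^sub>R T)"
    using \<open>c > 0\<close> op_posD[OF T(3)] cT T(2)
    by (intro op_posI) (auto simp: clin_scaleR adj_scaleR blinfun.scaleR_left cinner.scaleR_right)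
  ultimately obtain S where S: "S \<in> B" "adj S = S" "S o\<^sub>L S = (1/c) *\<^sub>R T"
    using op_sqrt_contraction[OF B, of "(1/c) *\<^sub>R T"] T cT by (auto simp: op_subspace_scaleR[OF Bs] adj_scaleR)
  have cS: "clin S" using S Bs op_subspaceD(1) by blast
  show ?thesis
    using S \<open>c > 0\<close> op_subspace_scaleR[OF Bs S(1), of "sqrt c"] cS
    by (intro bexI[of _ "sqrt c *\<^sub>R S"]) (auto simp: adj_scaleR comp_simps)
qed

section \<open>Concretely presented operator spaces\<close>

context star_vector_space
begin

lemma vsum_closed: "(\<And>k. k < n \<Longrightarrow> f k \<in> carrier V) \<Longrightarrow> vsum V f n \<in> carrier V"
  by (induction n) (auto simp: zero_closed add_closed)

lemma Mat_closed: "x \<in> Mat V n \<Longrightarrow> x i j \<in> carrier V"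
  unfolding Mat_def mem_Collect_eq by (metis zero_closed)

lemma mat_add_closed: "x \<in> Mat V n \<Longrightarrow> y \<in> Mat V n \<Longrightarrow> mat_add V x y \<in> Mat V n"
  unfolding Mat_def mat_add_def mem_Collect_eq by (metis add_closed add_zero zero_closed)

lemma mat_scale_closed: "x \<in> Mat V n \<Longrightarrow> mat_scale V c x \<in> Mat V n"
  unfolding Mat_def mat_scale_def mem_Collect_eq by (metis scale_closed scale_zero_right)

lemma mat_star_closed: "x \<in> Mat V n \<Longrightarrow> mat_star V n x \<in> Mat V n"
  by (auto simp: Mat_def mat_star_def star_closed)

lemma mat_conj_closed: "x \<in> Mat V n \<Longrightarrow> mat_conj V m n R x \<in> Mat V m"
  by (auto simp: Mat_def[of V m] mat_conj_def intro!: vsum_closed scale_closed Mat_closed[of x n])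

end

lemma lin_map_vsum:
  assumes "star_vector_space V" "star_vector_space W" "lin_map V W f" "\<And>k. k < n \<Longrightarrow> g k \<in> carrier V"
  shows "f (vsum V g n) = vsum W (\<lambda>k. f (g k)) n"
  using assms(4)
proof (induction n)
  case 0 then show ?case by (simp add: lin_map_zero[OF assms(1-3)])
next
  case (Suc n)
  have "vsum V g n \<in> carrier V" using Suc.prems by (intro star_vector_space.vsum_closed[OF assms(1)]) auto
  then show ?case using Suc assms(3) by (auto simp: lin_map_def)
qed

lemma vsum_cong: "(\<And>k. k < n \<Longrightarrow> f k = g k) \<Longrightarrow> vsum V f n = vsum V g n"
  by (induction n) auto

lemma lin_map_mat_conj:
  assumes V: "star_vector_space V" and W: "star_vector_space W" and f: "lin_map V W f" and x: "x \<in> Mat V n"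
  shows "amplify f (mat_conj V m n R x) = mat_conj W m n R (amplify f x)"
proof (intro ext)
  fix i j
  interpret V: star_vector_space V by (rule V)
  have sc: "vscale V c (x k l) \<in> carrier V" for c k l
    by (intro V.scale_closed V.Mat_closed[OF x])
  have fs: "f (vscale V c (x k l)) = vscale W c (f (x k l))" for c k l
    using f V.Mat_closed[OF x] by (simp add: lin_map_def)
  show "amplify f (mat_conj V m n R x) i j = mat_conj W m n R (amplify f x) i j"
    by (simp add: amplify_def mat_conj_def lin_map_vsum[OF V W f] V.vsum_closed sc fs lin_map_zero[OF V W f])
qed

lemma lin_map_mat_add:
  assumes "star_vector_space V" "lin_map V W f" "x \<in> Mat V n" "y \<in> Mat V n"
  shows "amplify f (mat_add V x y) = mat_add W (amplify f x) (amplify f y)"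
  using assms star_vector_space.Mat_closed[OF assms(1)] by (simp add: amplify_def mat_add_def lin_map_def)

lemma lin_map_mat_scale:
  assumes "star_vector_space V" "lin_map V W f" "x \<in> Mat V n"
  shows "amplify f (mat_scale V c x) = mat_scale W c (amplify f x)"
  using assms star_vector_space.Mat_closed[OF assms(1)] by (simp add: amplify_def mat_scale_def lin_map_def)

lemma lin_map_Mat:
  assumes "star_vector_space V" "star_vector_space W" "lin_map V W f" "x \<in> Mat V n"
  shows "amplify f x \<in> Mat W n"
  using assms(4) lin_map_zero[OF assms(1-3)] assms(3)
  by (auto simp: Mat_def amplify_def lin_map_def split: if_splits)

text \<open>Norm at most 1 instead of exactly 1: the form in which states survive restriction to a
  subspace, where the norm may drop.\<close>

definition positive_contraction :: "('a, 'm) operator_space_scheme \<Rightarrow> nat \<Rightarrow> ('a mat \<Rightarrow> complex) \<Rightarrow> bool" where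
  "positive_contraction F n \<phi> \<longleftrightarrow>
     (\<forall>x\<in>Mat F n. \<forall>y\<in>Mat F n. \<phi> (mat_add F x y) = \<phi> x + \<phi> y) \<and>
     (\<forall>c. \<forall>x\<in>Mat F n. \<phi> (mat_scale F c x) = c * \<phi> x) \<and>
     (\<forall>x\<in>cone F n. \<phi> x \<in> \<real>\<^sub>\<ge>\<^sub>0) \<and> (\<forall>x\<in>Mat F n. cmod (\<phi> x) \<le> mnorm F n x)"

lemma norm_one_positive_contraction: "norm_one_positive_functional F n \<phi> \<Longrightarrow> positive_contraction F n \<phi>"
  by (simp add: norm_one_positive_functional_def positive_contraction_def)

text \<open>Dividing by the norm, which is positive and at most 1, only lowers a value below -1; so
  contractions detect the same failures of positivity as functionals of norm one.\<close>

lemma normalize_positive_contraction: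
  assumes \<phi>: "positive_contraction F n \<phi>" and nn: "\<And>x. x \<in> Mat F n \<Longrightarrow> 0 \<le> mnorm F n x"
    and x: "x \<in> Mat F n" "Re (\<phi> x) < -1"
  shows "\<exists>\<psi>. norm_one_positive_functional F n \<psi> \<and> Re (\<psi> x) < -1"
proof -
  define S where "S = {c. 0 \<le> c \<and> (\<forall>y\<in>Mat F n. cmod (\<phi> y) \<le> c * mnorm F n y)}"
  have S1: "1 \<in> S" using \<phi> by (simp add: S_def positive_contraction_def)
  have ne: "S \<noteq> {}" using S1 by blast
  have bdd: "bdd_below S" by (rule bdd_belowI[of _ 0]) (simp add: S_def)
  \<comment> \<open>The norm of \<open>\<phi>\<close>; it is positive because
    \<open>\<phi> x\<close> is nonzero.\<close>
  define c where "c = Inf S"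
  have cS: "cmod (\<phi> y) \<le> c * mnorm F n y" if y: "y \<in> Mat F n" for y
  proof (cases "mnorm F n y = 0")
    case True
    moreover have "cmod (\<phi> y) \<le> mnorm F n y" using \<phi> y by (simp add: positive_contraction_def)
    ultimately show ?thesis by simp
  next
    case False
    then have pos: "mnorm F n y > 0" using nn[OF y] by simp
    have "cmod (\<phi> y) / mnorm F n y \<le> c"
      unfolding c_def using y pos by (intro cInf_greatest[OF ne]) (auto simp: S_def divide_le_eq)
    then show ?thesis using pos by (simp add: divide_le_eq)
  qed
  have c1: "c \<le> 1" unfolding c_def by (rule cInf_lower[OF S1 bdd])
  have c0: "0 \<le> c" unfolding c_def by (intro cInf_greatest[OF ne]) (auto simp: S_def)
  have x0: "cmod (\<phi> x) > 0" using x(2) by auto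
  have "c \<noteq> 0" using cS[OF x(1)] x0 by auto
  then have "c > 0" using c0 by simp
  define \<psi> where "\<psi> y = complex_of_real (1 / c) * \<phi> y" for y
  have "norm_one_positive_functional F n \<psi>"
    unfolding norm_one_positive_functional_def
  proof (intro conjI ballI allI impI)
    fix y z d assume y: "y \<in> Mat F n"
    show "\<psi> (mat_scale F d y) = d * \<psi> y" using \<phi> y by (simp add: \<psi>_def positive_contraction_def)
    show "cmod (\<psi> y) \<le> mnorm F n y"
      using cS[OF y] \<open>c > 0\<close> by (simp add: \<psi>_def norm_mult norm_divide divide_le_eq mult.commute)
    assume z: "z \<in> Mat F n"
    show "\<psi> (mat_add F y z) = \<psi> y + \<psi> z"
      using \<phi> y z by (simp add: \<psi>_def positive_contraction_def distrib_left)
  next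
    fix y assume "y \<in> cone F n"
    then have "\<phi> y \<in> \<real>\<^sub>\<ge>\<^sub>0" using \<phi> by (simp add: positive_contraction_def)
    then show "\<psi> y \<in> \<real>\<^sub>\<ge>\<^sub>0" unfolding \<psi>_def using \<open>c > 0\<close> by (intro nonneg_Reals_mult_I) auto
  next
    fix d assume d: "\<forall>y\<in>Mat F n. cmod (\<psi> y) \<le> d * mnorm F n y"
    have le: "cmod (\<phi> y) \<le> (d * c) * mnorm F n y" if "y \<in> Mat F n" for y
      using bspec[OF d that] \<open>c > 0\<close> by (simp add: \<psi>_def norm_mult norm_divide divide_le_eq mult_ac)
    have "0 \<le> d * c"
    proof (rule ccontr)
      assume "\<not> 0 \<le> d * c"
      then have "(d * c) * mnorm F n x \<le> 0" using nn[OF x(1)] by (simp add: mult_nonpos_nonneg)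
      then show False using le[OF x(1)] x0 by simp
    qed
    then have "d * c \<in> S" using le by (simp add: S_def)
    then have "c \<le> d * c" unfolding c_def by (rule cInf_lower[OF _ bdd])
    then show "1 \<le> d" using \<open>c > 0\<close> by simp
  qed
  moreover have "Re (\<psi> x) < -1"
  proof -
    have "Re (\<psi> x) = Re (\<phi> x) / c" by (simp add: \<psi>_def)
    also have "\<dots> < - 1" using x(2) c1 \<open>c > 0\<close> by (simp add: divide_less_eq)
    finally show ?thesis .
  qed
  ultimately show ?thesis by blast
qed

lemma unitization_sel:
  "carrier (unitization F) = carrier F \<times> UNIV" "vzero (unitization F) = (vzero F, 0)"
  "vadd (unitization F) = (\<lambda>u v. (vadd F (fst u) (fst v), snd u + snd v))"
  "vscale (unitization F) = (\<lambda>c u. (vscale F c (fst u), c * snd u))"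
  by (simp_all add: unitization_def Let_def star_space.defs)

text \<open>Separates the two components of the cone. That the scalar part is Hermitian is absorbed
  into \<open>pos_semidef\<close>.\<close>

lemma unitization_cone:
  "X \<in> cone (unitization F) n \<longleftrightarrow> amplify fst X \<in> Mat_sa F n \<and> (\<forall>i j. \<not> (i < n \<and> j < n) \<longrightarrow> snd (X i j) = 0) \<and>
     pos_semidef n (amplify snd X) \<and>
     (\<forall>\<epsilon>>0. \<forall>R \<phi>. is_inv_sqrt n (plus_eps \<epsilon> (amplify snd X)) R \<longrightarrow> norm_one_positive_functional F n \<phi> \<longrightarrow>
        Re (\<phi> (mat_conj F n n R (amplify fst X))) \<ge> -1)"
proof -
  define U where "U = \<lparr>carrier = carrier F \<times> UNIV, vzero = (vzero F, 0),
        vadd = (\<lambda>u v. (vadd F (fst u) (fst v), snd u + snd v)),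
        vscale = (\<lambda>c u. (vscale F c (fst u), c * snd u)),
        vstar = (\<lambda>u. (vstar F (fst u), cnj (snd u)))\<rparr>"
  have M: "X \<in> Mat U n \<longleftrightarrow> amplify fst X \<in> Mat F n \<and> (\<forall>i j. \<not> (i < n \<and> j < n) \<longrightarrow> snd (X i j) = 0)"
  proof -
    have "(if i < n \<and> j < n then X i j \<in> carrier U else X i j = vzero U) \<longleftrightarrow>
        (if i < n \<and> j < n then fst (X i j) \<in> carrier F else fst (X i j) = vzero F) \<and>
        (\<not> (i < n \<and> j < n) \<longrightarrow> snd (X i j) = 0)" for i j
      by (simp add: U_def mem_Times_iff prod_eq_iff)
    then show ?thesis unfolding Mat_def amplify_def mem_Collect_eq by blast
  qed
  have S: "mat_star U n X = X \<longleftrightarrow> mat_star F n (amplify fst X) = amplify fst X \<and>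
      (\<forall>i j. (i < n \<and> j < n \<longrightarrow> snd (X i j) = cnj (snd (X j i))) \<and> (\<not> (i < n \<and> j < n) \<longrightarrow> snd (X i j) = 0))"
  proof -
    have "mat_star U n X i j = X i j \<longleftrightarrow> mat_star F n (amplify fst X) i j = amplify fst X i j \<and>
      (i < n \<and> j < n \<longrightarrow> snd (X i j) = cnj (snd (X j i))) \<and> (\<not> (i < n \<and> j < n) \<longrightarrow> snd (X i j) = 0)" for i j
      by (cases "i < n \<and> j < n") (auto simp: mat_star_def U_def amplify_def prod_eq_iff)
    then show ?thesis unfolding fun_eq_iff by blast
  qed
  have "X \<in> Mat_sa U n \<longleftrightarrow> amplify fst X \<in> Mat_sa F n \<and> (\<forall>i j. \<not> (i < n \<and> j < n) \<longrightarrow> snd (X i j) = 0) \<and>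
      (\<forall>i<n. \<forall>j<n. snd (X i j) = cnj (snd (X j i)))"
    unfolding Mat_sa_def mem_Collect_eq M S by blast
  moreover have "pos_semidef n (amplify snd X) \<Longrightarrow> \<forall>i<n. \<forall>j<n. snd (X i j) = cnj (snd (X j i))"
    unfolding pos_semidef_def amplify_def by blast
  moreover have "X \<in> cone (unitization F) n \<longleftrightarrow> X \<in> Mat_sa U n \<and> pos_semidef n (amplify snd X) \<and>
     (\<forall>\<epsilon>>0. \<forall>R \<phi>. is_inv_sqrt n (plus_eps \<epsilon> (amplify snd X)) R \<longrightarrow> norm_one_positive_functional F n \<phi> \<longrightarrow>
        Re (\<phi> (mat_conj F n n R (amplify fst X))) \<ge> -1)"
    by (simp add: unitization_def Let_def star_space.defs flip: U_def)
  ultimately show ?thesis by blast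
qed

text \<open>Complete positivity of a map and of its inverse amounts to a single equivalence between
  the cones of source and target.\<close>

lemma complete_order_iso_onto_rangeI:
  assumes V: "star_vector_space V" and f: "lin_map V W f" "f (vzero V) = vzero W" and inj: "inj_on f (carrier V)"
    and cV: "\<And>n. 0 < n \<Longrightarrow> cone V n \<subseteq> Mat V n" and cW: "\<And>n. 0 < n \<Longrightarrow> cone W n \<subseteq> Mat W n"
    and iff: "\<And>n x. 0 < n \<Longrightarrow> x \<in> Mat V n \<Longrightarrow> x \<in> cone V n \<longleftrightarrow> amplify f x \<in> cone W n"
  shows "complete_order_iso_onto_range V W f"
proof -
  interpret V: star_vector_space V by (rule V)
  have lin: "f x \<in> carrier W" "f (vscale V c x) = vscale W c (f x)" if "x \<in> carrier V" for x c
    using f that by (auto simp: lin_map_def)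
  have add: "f (vadd V x y) = vadd W (f x) (f y)" if "x \<in> carrier V" "y \<in> carrier V" for x y
    using f that by (auto simp: lin_map_def)
  let ?R = "restrict_to W (f ` carrier V)" and ?g = "inv_into (carrier V) f"
  have g: "?g (f x) = x" if "x \<in> carrier V" for x using inj that by (rule inv_into_f_f)
  have "completely_positive V ?R f"
    unfolding completely_positive_def
  proof (intro conjI allI impI ballI)
    show "lin_map V ?R f" by (auto simp: lin_map_def restrict_to_def lin add)
    fix n :: nat and x assume n: "n > 0" and x: "x \<in> cone V n"
    then have xM: "x \<in> Mat V n" using cV by blast
    then have "amplify f x \<in> cone W n" using iff[OF n] x by simp
    then show "amplify f x \<in> cone ?R n" using V.Mat_closed[OF xM] by (simp add: restrict_to_def amplify_def)
  qed
  moreover have "completely_positive ?R V ?g"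
    unfolding completely_positive_def
  proof (intro conjI allI impI ballI)
    show "lin_map ?R V ?g"
      by (auto simp: lin_map_def restrict_to_def g V.add_closed V.scale_closed simp flip: add lin(2))
    fix n :: nat and X assume n: "n > 0" and X: "X \<in> cone ?R n"
    then have X': "X \<in> cone W n" "\<And>i j. i < n \<Longrightarrow> j < n \<Longrightarrow> X i j \<in> f ` carrier V"
      by (auto simp: restrict_to_def)
    then have XM: "X \<in> Mat W n" using cW[OF n] by blast
    have X0: "X i j = f (vzero V)" if "\<not> (i < n \<and> j < n)" for i j
      using XM that unfolding f(2) Mat_def mem_Collect_eq by presburger
    have Xr: "X i j \<in> f ` carrier V" for i j
      using X'(2)[of i j] X0[of i j] V.zero_closed by (cases "i < n \<and> j < n") auto
    have x: "amplify ?g X \<in> Mat V n"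
      unfolding Mat_def amplify_def mem_Collect_eq
      using inv_into_into[OF Xr] X0 g[OF V.zero_closed] by simp
    have "amplify f (amplify ?g X) = X"
      by (intro ext) (simp add: amplify_def f_inv_into_f[OF Xr])
    then show "amplify ?g X \<in> cone V n" using iff[OF n x] X' by simp
  qed
  moreover have "bij_betw f (carrier V) (carrier ?R)"
    using inj by (simp add: bij_betw_def restrict_to_def)
  ultimately show ?thesis
    using lin by (auto simp: complete_order_iso_onto_range_def complete_order_iso_def)
qed

lemma complete_order_iso_onto_range_cone:
  assumes V: "star_vector_space V" and f: "complete_order_iso_onto_range V W f"
    and x: "0 < n" "x \<in> Mat V n" "amplify f x \<in> cone W n"
  shows "x \<in> cone V n"
proof -
  interpret V: star_vector_space V by (rule V)
  let ?R = "restrict_to W (f ` carrier V)" and ?g = "inv_into (carrier V) f"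
  have "inj_on f (carrier V)" "completely_positive ?R V ?g"
    using f by (auto simp: complete_order_iso_onto_range_def complete_order_iso_def bij_betw_def)
  moreover have "amplify f x \<in> cone ?R n"
    using x V.Mat_closed by (auto simp: restrict_to_def amplify_def)
  ultimately have "amplify ?g (amplify f x) \<in> cone V n"
    using x by (auto simp: completely_positive_def)
  moreover have "amplify ?g (amplify f x) = x"
    using \<open>inj_on f (carrier V)\<close> V.Mat_closed[OF x(2)] by (simp add: amplify_def)
  ultimately show ?thesis by simp
qed

text \<open>An operator space given by operators. The last axiom replaces the unit of a unital operator
  system: a bounded approximate unit of positive elements.\<close>

locale presentation = star_vector_space F for F :: "'x operator_space" +
  fixes \<theta> :: "'x \<Rightarrow> 'h::complex_hilbert op"
  assumes rep_inj: "inj_on \<theta> (carrier F)"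
    and rep_clin: "x \<in> carrier F \<Longrightarrow> clin (\<theta> x)"
    and rep_add: "x \<in> carrier F \<Longrightarrow> y \<in> carrier F \<Longrightarrow> \<theta> (vadd F x y) = \<theta> x + \<theta> y"
    and rep_scale: "x \<in> carrier F \<Longrightarrow> \<theta> (vscale F c x) = op_scale c (\<theta> x)"
    and rep_star: "x \<in> carrier F \<Longrightarrow> \<theta> (vstar F x) = adj (\<theta> x)"
    and rep_norm: "0 < n \<Longrightarrow> X \<in> Mat F n \<Longrightarrow> mnorm F n X = norm (op_mat n (amplify \<theta> X))"
    and rep_cone: "0 < n \<Longrightarrow> cone F n = {X \<in> Mat_sa F n. op_pos (op_mat n (amplify \<theta> X))}"
    and rep_approx: "0 < n \<Longrightarrow> X \<in> Mat_sa F n \<Longrightarrow> op_pos (id_blinfun + op_mat n (amplify \<theta> X)) \<Longrightarrow>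
      0 < \<delta> \<Longrightarrow> \<exists>Z\<in>Mat F n. \<exists>U\<in>cone F n. mnorm F n Z \<le> 1 \<and>
        norm (op_mat n (\<lambda>i j. \<theta> (X i j) - \<theta> (U i j) + \<theta> (Z i j))) \<le> \<delta>"
begin

lemma rep_zero: "\<theta> (vzero F) = 0"
  using rep_scale[OF zero_closed, of 0] by (simp add: scale_zero_right)

lemma rep_lin_map: "op_alg B \<Longrightarrow> \<theta> ` carrier F \<subseteq> B \<Longrightarrow> lin_map F (op_cstar B) \<theta>"
  by (auto simp: lin_map_def rep_add rep_scale)

lemma rep_op_mats: "\<theta> ` carrier F \<subseteq> B \<Longrightarrow> x \<in> Mat F n \<Longrightarrow> amplify \<theta> x \<in> op_mats B n"
  by (auto simp: Mat_def op_mats_def amplify_def rep_zero split: if_splits)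

lemma rep_Mat_clin: "x \<in> Mat F n \<Longrightarrow> clin (\<theta> (x i j))"
  by (intro rep_clin Mat_closed)

lemma clin_rep_mat: "x \<in> Mat F n \<Longrightarrow> clin (op_mat n (amplify \<theta> x))"
  by (intro clin_op_mat) (simp add: amplify_def rep_Mat_clin)

lemma rep_mat_star: "x \<in> Mat F n \<Longrightarrow> amplify \<theta> (mat_star F n x) = op_mat_adj (amplify \<theta> x)"
  by (intro ext)
    (auto simp: amplify_def mat_star_def op_mat_adj_def rep_star rep_zero Mat_closed Mat_def)

lemma rep_Mat_inj: "x \<in> Mat F n \<Longrightarrow> y \<in> Mat F n \<Longrightarrow> amplify \<theta> x = amplify \<theta> y \<Longrightarrow> x = y"
  by (intro ext inj_onD[OF rep_inj]) (auto simp: amplify_def Mat_closed dest!: fun_cong)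

lemma Mat_sa_iff: "x \<in> Mat F n \<Longrightarrow> x \<in> Mat_sa F n \<longleftrightarrow> op_mat_adj (amplify \<theta> x) = amplify \<theta> x"
  using rep_Mat_inj[OF mat_star_closed, of x n x] by (auto simp: Mat_sa_def rep_mat_star[symmetric])

lemma adj_rep_mat:
  assumes x: "x \<in> Mat_sa F n"
  shows "adj (op_mat n (amplify \<theta> x)) = op_mat n (amplify \<theta> x)"
proof -
  have xM: "x \<in> Mat F n" using x by (simp add: Mat_sa_def)
  have "clin (amplify \<theta> x i j)" for i j unfolding amplify_def by (rule rep_Mat_clin[OF xM])
  then have "op_mat n (op_mat_adj (amplify \<theta> x)) = adj (op_mat n (amplify \<theta> x))"
    by (intro op_mat_of_adj)
  then show ?thesis using Mat_sa_iff[OF xM] x by simp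
qed

lemma rep_mat_conj:
  assumes x: "x \<in> Mat F n"
  shows "amplify \<theta> (mat_conj F m n R x) =
    (\<lambda>i j. if i < m \<and> j < m then \<Sum>k<n. \<Sum>l<n. op_scale (R i k * cnj (R j l)) (\<theta> (x k l)) else 0)"
proof -
  interpret C: cstar_algebra "op_cstar (bounded_ops :: 'h op set)"
    by (rule cstar_algebra_op_cstar[OF op_alg_bounded_ops])
  have v: "vsum (op_cstar (bounded_ops :: 'h op set)) f k = (\<Sum>i<k. f i)" for f k
    by (induction k) auto
  have "lin_map F (op_cstar bounded_ops) \<theta>"
    by (rule rep_lin_map[OF op_alg_bounded_ops]) (auto simp: bounded_ops_iff rep_clin)
  then have "amplify \<theta> (mat_conj F m n R x) = mat_conj (op_cstar bounded_ops) m n R (amplify \<theta> x)"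
    using lin_map_mat_conj[OF star_vector_space_axioms C.star_vector_space_axioms] x by blast
  then show ?thesis by (simp add: mat_conj_def v amplify_def cong: if_cong)
qed

lemma mat_conj_sa:
  assumes x: "x \<in> Mat_sa F n"
  shows "mat_conj F n n R x \<in> Mat_sa F n"
proof -
  have xM: "x \<in> Mat F n" using x by (simp add: Mat_sa_def)
  have sa: "adj (\<theta> (x k l)) = \<theta> (x l k)" for k l
    using Mat_sa_iff[OF xM] x by (simp add: op_mat_adj_def amplify_def fun_eq_iff)
  have c: "clin (op_scale c (\<theta> (x k l)))" for c k l by (intro clin_op_scale rep_Mat_clin[OF xM])
  have "op_mat_adj (amplify \<theta> (mat_conj F n n R x)) = amplify \<theta> (mat_conj F n n R x)"
  proof (intro ext)
    fix i j
    have "adj (\<Sum>k<n. \<Sum>l<n. op_scale (R j k * cnj (R i l)) (\<theta> (x k l))) =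
        (\<Sum>k<n. \<Sum>l<n. op_scale (R i l * cnj (R j k)) (\<theta> (x l k)))"
      by (simp add: adj_sum clin_sum c adj_op_scale rep_Mat_clin[OF xM] sa mult.commute)
    also have "\<dots> = (\<Sum>l<n. \<Sum>k<n. op_scale (R i l * cnj (R j k)) (\<theta> (x l k)))" by (rule sum.swap)
    finally show "op_mat_adj (amplify \<theta> (mat_conj F n n R x)) i j = amplify \<theta> (mat_conj F n n R x) i j"
      by (simp add: rep_mat_conj[OF xM] op_mat_adj_def)
  qed
  then show ?thesis using Mat_sa_iff[OF mat_conj_closed[OF xM]] by simp
qed

lemma mnorm_nonneg: "0 < n \<Longrightarrow> x \<in> Mat F n \<Longrightarrow> 0 \<le> mnorm F n x"
  by (simp add: rep_norm)

text \<open>This is where the approximate unit enters: by \<open>rep_approx\<close>, x is within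
  \<delta> of u - z with u positive and z of norm at most 1, so the value at x is at least -1 -
  \<delta>.\<close>

lemma positive_contraction_ge:
  assumes n: "0 < n" and \<phi>: "positive_contraction F n \<phi>" and x: "x \<in> Mat_sa F n"
    and pos: "op_pos (id_blinfun + op_mat n (amplify \<theta> x))"
  shows "-1 \<le> Re (\<phi> x)"
proof (rule field_le_epsilon)
  fix \<delta> :: real assume "\<delta> > 0"
  obtain z u where z: "z \<in> Mat F n" "mnorm F n z \<le> 1" and u: "u \<in> cone F n"
    and le: "norm (op_mat n (\<lambda>i j. \<theta> (x i j) - \<theta> (u i j) + \<theta> (z i j))) \<le> \<delta>"
    using rep_approx[OF n x pos \<open>\<delta> > 0\<close>] by blast
  have xM: "x \<in> Mat F n" and uM: "u \<in> Mat F n" using x u rep_cone[OF n] by (auto simp: Mat_sa_def)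
  define d where "d = mat_add F (mat_add F x (mat_scale F (-1) u)) z"
  have dM: "d \<in> Mat F n" unfolding d_def by (intro mat_add_closed mat_scale_closed xM uM z)
  have "amplify \<theta> d = (\<lambda>i j. \<theta> (x i j) - \<theta> (u i j) + \<theta> (z i j))"
    by (intro ext) (simp add: d_def amplify_def mat_add_def mat_scale_def rep_add rep_scale add_closed scale_closed
        Mat_closed[OF xM] Mat_closed[OF uM] Mat_closed[OF z(1)] op_scale_minus_one)
  then have "mnorm F n d \<le> \<delta>" using le rep_norm[OF n dM] by simp
  moreover have "\<phi> d = \<phi> x - \<phi> u + \<phi> z"
    using \<phi> xM uM z unfolding d_def positive_contraction_def
    by (simp add: mat_add_closed mat_scale_closed)
  moreover have "cmod (\<phi> d) \<le> mnorm F n d" "cmod (\<phi> z) \<le> mnorm F n z" "0 \<le> Re (\<phi> u)"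
    using \<phi> dM z u by (auto simp: positive_contraction_def complex_nonneg_Reals_iff)
  moreover have "- cmod (\<phi> d) \<le> Re (\<phi> d)" "Re (\<phi> z) \<le> cmod (\<phi> z)"
    using abs_Re_le_cmod[of "\<phi> d"] complex_Re_le_cmod by auto
  ultimately show "-1 \<le> Re (\<phi> x) + \<delta>" using z(2) by simp
qed

text \<open>Positivity in \<open>operator_space_of_cstar\<close> means being of the form y^* y;
  positive matrices over F acquire such a root over any concrete algebra containing F.\<close>

lemma cone_square:
  assumes n: "0 < n" and B: "op_alg B" "\<theta> ` carrier F \<subseteq> B" and x: "x \<in> cone F n"
  shows "\<exists>Y\<in>op_mats B n. op_mat_mult n (op_mat_adj Y) Y = amplify \<theta> x"
proof -
  have x': "x \<in> Mat_sa F n" "x \<in> Mat F n" "op_pos (op_mat n (amplify \<theta> x))"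
    using x rep_cone[OF n] by (auto simp: Mat_sa_def)
  have xB: "amplify \<theta> x \<in> op_mats B n" by (rule rep_op_mats[OF B(2) x'(2)])
  obtain S where S: "S \<in> op_mat n ` op_mats B n" "adj S = S" "S o\<^sub>L S = op_mat n (amplify \<theta> x)"
    using op_sqrt[OF op_alg_op_mats[OF B(1)] imageI[OF xB] adj_rep_mat[OF x'(1)] x'(3)] by blast
  then obtain Y where Y: "Y \<in> op_mats B n" "S = op_mat n Y" by blast
  have cY: "clin (Y i j)" for i j
    using op_matsD'[OF op_algD(1)[OF B(1)] Y(1)] op_subspaceD(1)[OF op_algD(1)[OF B(1)]] by blast
  have "op_mat n (op_mat_mult n (op_mat_adj Y) Y) = op_mat n (amplify \<theta> x)"
    using S Y by (simp add: op_mat_of_mult op_mat_of_adj cY)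
  then have "op_mat_mult n (op_mat_adj Y) Y = amplify \<theta> x"
    by (rule inj_onD[OF op_mats_inj _ op_mat_mult_closed[OF B(1) op_mat_adj_closed[OF op_algD(1)[OF B(1)] Y(1)] Y(1)] xB])
  then show ?thesis using Y by blast
qed

end

text \<open>Positive contractive functionals on the matrices over B/I, seen on B: vanishing on
  \<open>I\<close> stands for passing to the quotient, and positivity is required on the products
  X^* X.\<close>

definition op_functional ::
  "'h::complex_hilbert op set \<Rightarrow> 'h op set \<Rightarrow> nat \<Rightarrow> ('h op mat \<Rightarrow> complex) \<Rightarrow> bool" where
  "op_functional B I n \<phi> \<longleftrightarrow>
     (\<forall>X\<in>op_mats B n. \<forall>Y\<in>op_mats B n. \<phi> (\<lambda>i j. X i j + Y i j) = \<phi> X + \<phi> Y) \<and>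
     (\<forall>c. \<forall>X\<in>op_mats B n. \<phi> (\<lambda>i j. op_scale c (X i j)) = c * \<phi> X) \<and>
     (\<forall>X\<in>op_mats B n. \<phi> (op_mat_mult n (op_mat_adj X) X) \<in> \<real>\<^sub>\<ge>\<^sub>0) \<and>
     (\<forall>X\<in>op_mats B n. cmod (\<phi> X) \<le> norm (op_mat n X)) \<and> (\<forall>X\<in>op_mats I n. \<phi> X = 0)"

lemma op_functional_vector:
  assumes B: "B \<subseteq> bounded_ops" and \<xi>: "norm \<xi> \<le> 1"
  shows "op_functional B {0} n (\<lambda>X. cinner \<xi> (op_mat n X \<xi>))"
  unfolding op_functional_def
proof (intro conjI ballI allI)
  fix X assume X: "X \<in> op_mats B n"
  have cX: "clin (X i j)" if "i < n" "j < n" for i j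
    using op_matsD[OF X that] B by (auto simp: bounded_ops_iff)
  show "cinner \<xi> (op_mat n (op_mat_mult n (op_mat_adj X) X) \<xi>) \<in> \<real>\<^sub>\<ge>\<^sub>0"
    using op_pos_adj_comp[OF clin_op_mat[of n X]] cX
    by (simp add: op_mat_of_mult op_mat_of_adj op_pos_def)
  have "cmod (cinner \<xi> (op_mat n X \<xi>)) \<le> norm \<xi> * (norm (op_mat n X) * norm \<xi>)"
    by (rule order_trans[OF cmod_cinner_le mult_left_mono[OF norm_blinfun]]) simp
  also have "\<dots> \<le> 1 * (norm (op_mat n X) * 1)"
    using \<xi> by (intro mult_mono) auto
  finally show "cmod (cinner \<xi> (op_mat n X \<xi>)) \<le> norm (op_mat n X)" by simp
  show "cinner \<xi> (op_mat n (\<lambda>i j. op_scale c (X i j)) \<xi>) = c * cinner \<xi> (op_mat n X \<xi>)" for c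
    by (simp add: op_mat_op_scale cinner_scale_right)
  show "cinner \<xi> (op_mat n (\<lambda>i j. X i j + Y i j) \<xi>) = cinner \<xi> (op_mat n X \<xi>) + cinner \<xi> (op_mat n Y \<xi>)" for Y
    by (simp add: op_mat_add blinfun.add_left cinner.add_right)
next
  fix X :: "'a op mat" assume "X \<in> op_mats {0} n"
  then have "op_mat n X = op_mat n (\<lambda>i j. 0)"
    by (intro op_mat_cong) (auto dest: op_matsD)
  then show "cinner \<xi> (op_mat n X \<xi>) = 0" by (simp add: op_mat_zero)
qed

lemma not_op_pos_vector:
  assumes T: "clin T" "adj T = T" and "\<not> op_pos (id_blinfun + T)"
  shows "\<exists>\<xi>. norm \<xi> = 1 \<and> Re (cinner \<xi> (T \<xi>)) < -1"
proof -
  have "\<not> (\<forall>v. 0 \<le> Re (cinner v ((id_blinfun + T) v)))"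
  proof
    assume "\<forall>v. 0 \<le> Re (cinner v ((id_blinfun + T) v))"
    then have "op_pos (id_blinfun + T)"
      using T by (intro op_posI) (simp_all add: clin_add adj_add)
    then show False using assms(3) by simp
  qed
  then obtain v where v: "Re (cinner v ((id_blinfun + T) v)) < 0"
    by (meson not_le)
  have "v \<noteq> 0" using v by auto
  define c where "c = 1 / norm v"
  have "Re (cinner v v) + Re (cinner v (T v)) < 0" using v by (simp add: blinfun.add_left cinner.add_right)
  then have "Re (cinner v (T v)) < - (norm v)\<^sup>2" by (simp add: cinner_norm)
  then have "c\<^sup>2 * Re (cinner v (T v)) < c\<^sup>2 * (- (norm v)\<^sup>2)"
    using \<open>v \<noteq> 0\<close> by (intro mult_strict_left_mono) (simp_all add: c_def)
  also have "\<dots> = -1" using \<open>v \<noteq> 0\<close> by (simp add: c_def power_divide)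
  finally have "Re (cinner (c *\<^sub>R v) (T (c *\<^sub>R v))) < -1"
    by (simp add: blinfun.scaleR_right cinner.scaleR_left cinner.scaleR_right power2_eq_square mult.assoc)
  moreover have "norm (c *\<^sub>R v) = 1" using \<open>v \<noteq> 0\<close> by (simp add: c_def)
  ultimately show ?thesis by blast
qed

context presentation
begin

lemma op_functional_positive_contraction:
  assumes n: "0 < n" and B: "op_alg B" "\<theta> ` carrier F \<subseteq> B" and \<phi>: "op_functional B I n \<phi>"
  shows "positive_contraction F n (\<lambda>x. \<phi> (amplify \<theta> x))"
  unfolding positive_contraction_def
proof (intro conjI ballI allI)
  note mats = rep_op_mats[OF B(2)]
  fix x y c assume x: "x \<in> Mat F n"
  have "amplify \<theta> (mat_scale F c x) = (\<lambda>i j. op_scale c (amplify \<theta> x i j))"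
    by (intro ext) (simp add: amplify_def mat_scale_def rep_scale Mat_closed[OF x])
  then show "\<phi> (amplify \<theta> (mat_scale F c x)) = c * \<phi> (amplify \<theta> x)"
    using \<phi> mats[OF x] by (simp add: op_functional_def)
  show "cmod (\<phi> (amplify \<theta> x)) \<le> mnorm F n x"
    using \<phi> mats[OF x] by (simp add: op_functional_def rep_norm[OF n x])
  assume y: "y \<in> Mat F n"
  have "amplify \<theta> (mat_add F x y) = (\<lambda>i j. amplify \<theta> x i j + amplify \<theta> y i j)"
    by (intro ext) (simp add: amplify_def mat_add_def rep_add Mat_closed[OF x] Mat_closed[OF y])
  then show "\<phi> (amplify \<theta> (mat_add F x y)) = \<phi> (amplify \<theta> x) + \<phi> (amplify \<theta> y)"
    using \<phi> mats[OF x] mats[OF y] by (simp add: op_functional_def)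
next
  fix x assume "x \<in> cone F n"
  then obtain Y where "Y \<in> op_mats B n" "op_mat_mult n (op_mat_adj Y) Y = amplify \<theta> x"
    using cone_square[OF n B] by blast
  then show "\<phi> (amplify \<theta> x) \<in> \<real>\<^sub>\<ge>\<^sub>0"
    using \<phi> unfolding op_functional_def by metis
qed

lemma op_functional_separating:
  assumes x: "x \<in> Mat_sa F n" and "\<not> op_pos (id_blinfun + op_mat n (amplify \<theta> x))" and B: "B \<subseteq> bounded_ops"
  shows "\<exists>\<phi>. op_functional B {0} n \<phi> \<and> Re (\<phi> (amplify \<theta> x)) < -1"
proof -
  have "clin (op_mat n (amplify \<theta> x))" using x by (simp add: clin_rep_mat Mat_sa_def)
  then obtain \<xi> where "norm \<xi> = 1" "Re (cinner \<xi> (op_mat n (amplify \<theta> x) \<xi>)) < -1"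
    using not_op_pos_vector[OF _ adj_rep_mat[OF x]] assms(2) by blast
  then show ?thesis using op_functional_vector[OF B, of \<xi> n] by auto
qed

text \<open>One direction uses vector states, normalized on F, the other is
  \<open>positive_contraction_ge\<close>. The quantification over states in the partial unitization
  is thereby replaced by positivity of one operator.\<close>

lemma norm_one_functionals_ge_iff:
  assumes n: "0 < n" and x: "x \<in> Mat_sa F n"
  shows "(\<forall>\<phi>. norm_one_positive_functional F n \<phi> \<longrightarrow> Re (\<phi> x) \<ge> -1) \<longleftrightarrow>
    op_pos (id_blinfun + op_mat n (amplify \<theta> x))"
proof
  assume L: "\<forall>\<phi>. norm_one_positive_functional F n \<phi> \<longrightarrow> Re (\<phi> x) \<ge> -1"
  have sub: "\<theta> ` carrier F \<subseteq> bounded_ops" by (auto simp: bounded_ops_iff rep_clin)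
  have xM: "x \<in> Mat F n" using x by (simp add: Mat_sa_def)
  show "op_pos (id_blinfun + op_mat n (amplify \<theta> x))"
  proof (rule ccontr)
    assume "\<not> op_pos (id_blinfun + op_mat n (amplify \<theta> x))"
    then obtain \<phi> where \<phi>: "op_functional bounded_ops {0} n \<phi>" "Re (\<phi> (amplify \<theta> x)) < -1"
      using op_functional_separating[OF x _ order_refl] by blast
    obtain \<psi> where "norm_one_positive_functional F n \<psi>" "Re (\<psi> x) < -1"
      using normalize_positive_contraction[where \<phi> = "\<lambda>x. \<phi> (amplify \<theta> x)", OF
        op_functional_positive_contraction[OF n op_alg_bounded_ops sub \<phi>(1)]
        mnorm_nonneg[OF n] xM \<phi>(2)] by blast
    then show False using L by force
  qed
next
  assume "op_pos (id_blinfun + op_mat n (amplify \<theta> x))"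
  then show "\<forall>\<phi>. norm_one_positive_functional F n \<phi> \<longrightarrow> Re (\<phi> x) \<ge> -1"
    using positive_contraction_ge[OF n norm_one_positive_contraction x] by blast
qed

lemma unitization_cone_iff:
  assumes n: "0 < n"
  shows "X \<in> cone (unitization F) n \<longleftrightarrow>
     amplify fst X \<in> Mat_sa F n \<and> (\<forall>i j. \<not> (i < n \<and> j < n) \<longrightarrow> snd (X i j) = 0) \<and> pos_semidef n (amplify snd X) \<and>
     (\<forall>\<epsilon>>0. \<forall>R. is_inv_sqrt n (plus_eps \<epsilon> (amplify snd X)) R \<longrightarrow>
        op_pos (id_blinfun + op_mat n (amplify \<theta> (mat_conj F n n R (amplify fst X)))))"
  unfolding unitization_cone using norm_one_functionals_ge_iff[OF n mat_conj_sa] by blast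

end

section \<open>Generated operator algebras\<close>

lemma closure_add:
  fixes S :: "'v::real_normed_vector set"
  assumes "\<And>x y. x \<in> S \<Longrightarrow> y \<in> S \<Longrightarrow> x + y \<in> S" "x \<in> closure S" "y \<in> closure S"
  shows "x + y \<in> closure S"
proof -
  obtain f g where "\<And>n::nat. f n \<in> S" "f \<longlonglongrightarrow> x" "\<And>n::nat. g n \<in> S" "g \<longlonglongrightarrow> y"
    using assms(2,3) unfolding closure_sequential by blast
  then show ?thesis
    unfolding closure_sequential using assms(1) by (intro exI[of _ "\<lambda>n. f n + g n"] conjI allI tendsto_add) auto
qed

lemma op_subspace_closure:
  assumes S: "op_subspace S"
  shows "op_subspace (closure S)"
proof -
  note D = op_subspaceD[OF S]
  have lim: "\<exists>f. (\<forall>n::nat. f n \<in> S) \<and> f \<longlonglongrightarrow> T" if "T \<in> closure S" for T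
    using that by (simp add: closure_sequential)
  have limI: "T \<in> closure S" if "\<And>n::nat. f n \<in> S" "f \<longlonglongrightarrow> T" for f T
    using that unfolding closure_sequential by blast
  have sub: "closure S \<subseteq> bounded_ops"
    by (rule closure_minimal[OF _ closed_bounded_ops]) (use S in \<open>simp add: op_subspace_def\<close>)
  show ?thesis
    unfolding op_subspace_def
  proof (intro conjI ballI allI)
    show "closure S \<subseteq> bounded_ops" by (rule sub)
    show "0 \<in> closure S" using D(2) closure_subset by blast
    fix T c assume T: "T \<in> closure S"
    then obtain f where f: "\<And>n::nat. f n \<in> S" "f \<longlonglongrightarrow> T" using lim by blast
    show "op_scale c T \<in> closure S"
      by (rule limI[of "\<lambda>n. op_scale c (f n)"])
        (use D f bounded_linear.tendsto[OF bounded_linear_op_scale] in auto)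
    have "clin T" using T sub by (auto simp: bounded_ops_iff)
    have "(\<lambda>n. adj (f n)) \<longlonglongrightarrow> adj T"
      by (rule tendsto_adj[OF f(2) D(1)[OF f(1)] \<open>clin T\<close>])
    then show "adj T \<in> closure S" by (rule limI[OF D(5)[OF f(1)]])
    show "T + R \<in> closure S" if "R \<in> closure S" for R using D(3) T that by (rule closure_add)
  qed
qed

lemma op_alg_closure:
  assumes S: "op_subspace S" and m: "\<And>R T. R \<in> S \<Longrightarrow> T \<in> S \<Longrightarrow> R o\<^sub>L T \<in> S"
  shows "op_alg (closure S)"
  unfolding op_alg_def
proof (intro conjI ballI op_subspace_closure[OF S] closed_closure)
  fix R T assume "R \<in> closure S" "T \<in> closure S"
  then obtain f g where fg: "\<And>n::nat. f n \<in> S" "f \<longlonglongrightarrow> R" "\<And>n::nat. g n \<in> S" "g \<longlonglongrightarrow> T"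
    unfolding closure_sequential by blast
  show "R o\<^sub>L T \<in> closure S"
    unfolding closure_sequential
    by (rule exI[of _ "\<lambda>n. f n o\<^sub>L g n"]) (use fg m in \<open>auto intro: tendsto_comp\<close>)
qed

fun word_op :: "('x \<Rightarrow> 'h::complex_hilbert op) \<Rightarrow> 'x list \<Rightarrow> 'h op" where
  "word_op \<theta> [] = id_blinfun"
| "word_op \<theta> (x # w) = \<theta> x o\<^sub>L word_op \<theta> w"

lemma word_op_append: "word_op \<theta> (u @ v) = word_op \<theta> u o\<^sub>L word_op \<theta> v"
  by (induction u) (auto simp: comp_assoc)

context presentation
begin

definition word_set :: "'x list set" where
  "word_set = {w. w \<noteq> [] \<and> set w \<subseteq> carrier F}"

text \<open>Scalars are absorbed into the first letter of a word, so these sums form a linear span.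
  Words are nonempty: the empty product is not adjoined.\<close>

inductive_set word_sums :: "nat \<Rightarrow> 'h op set" for k where
  zero: "0 \<in> word_sums k"
| word: "w \<in> word_set \<Longrightarrow> length w \<le> k \<Longrightarrow> word_op \<theta> w \<in> word_sums k"
| add: "S \<in> word_sums k \<Longrightarrow> T \<in> word_sums k \<Longrightarrow> S + T \<in> word_sums k"

lemma clin_word_op: "set w \<subseteq> carrier F \<Longrightarrow> clin (word_op \<theta> w)"
  by (induction w) (auto intro: clin_comp rep_clin)

lemma adj_word_op: "set w \<subseteq> carrier F \<Longrightarrow> adj (word_op \<theta> w) = word_op \<theta> (rev (map (vstar F) w))"
  by (induction w) (auto simp: word_op_append adj_comp clin_word_op rep_clin rep_star)

lemma word_sums_mono: "j \<le> k \<Longrightarrow> word_sums j \<subseteq> word_sums k"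
proof
  show "T \<in> word_sums k" if "j \<le> k" "T \<in> word_sums j" for T
    using that(2,1) by (induction rule: word_sums.induct) (auto intro: word_sums.intros)
qed

lemma clin_word_sums: "T \<in> word_sums k \<Longrightarrow> clin T"
  by (erule word_sums.induct) (auto simp: word_set_def intro: clin_add clin_word_op)

lemma op_subspace_word_sums: "op_subspace (word_sums k)"
  unfolding op_subspace_def
proof (intro conjI ballI allI)
  show "word_sums k \<subseteq> bounded_ops" using clin_word_sums by (auto simp: bounded_ops_iff)
  fix T c assume T: "T \<in> word_sums k"
  show "op_scale c T \<in> word_sums k"
    using T
  proof (rule word_sums.induct)
    fix w assume w: "w \<in> word_set" "length w \<le> k"
    then obtain x v where xv: "w = x # v" "x \<in> carrier F" "set v \<subseteq> carrier F"
      by (cases w) (auto simp: word_set_def)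
    then have "op_scale c (word_op \<theta> w) = word_op \<theta> (vscale F c x # v)"
      by (simp add: rep_scale comp_op_scale_left)
    then show "op_scale c (word_op \<theta> w) \<in> word_sums k"
      using word_sums.word[of "vscale F c x # v" k] w xv by (simp add: word_set_def scale_closed)
  qed (auto simp: op_scale_add_right intro: word_sums.add word_sums.zero)
  show "adj T \<in> word_sums k"
    using T
  proof (rule word_sums.induct)
    fix w assume "w \<in> word_set" "length w \<le> k"
    then show "adj (word_op \<theta> w) \<in> word_sums k"
      by (auto simp: adj_word_op word_set_def intro!: word_sums.word star_closed)
  qed (auto simp: adj_add clin_word_sums intro: word_sums.add word_sums.zero)
qed (rule word_sums.zero word_sums.add; assumption)+

lemma word_sums_comp:
  assumes S: "S \<in> word_sums j" and T: "T \<in> word_sums k"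
  shows "S o\<^sub>L T \<in> word_sums (j + k)"
  using S
proof (rule word_sums.induct)
  fix u assume u: "u \<in> word_set" "length u \<le> j"
  show "word_op \<theta> u o\<^sub>L T \<in> word_sums (j + k)"
    using T
  proof (rule word_sums.induct)
    fix v assume "v \<in> word_set" "length v \<le> k"
    then show "word_op \<theta> u o\<^sub>L word_op \<theta> v \<in> word_sums (j + k)"
      using u word_sums.word[of "u @ v"] by (simp add: word_op_append word_set_def)
  qed (auto simp: comp_simps intro: word_sums.add word_sums.zero)
qed (auto simp: comp_simps intro: word_sums.add word_sums.zero)

definition gen_alg :: "'h op set" where
  "gen_alg = closure (\<Union>k. word_sums k)"

lemma word_sums_gen_alg: "T \<in> word_sums k \<Longrightarrow> T \<in> gen_alg"
  unfolding gen_alg_def by (rule subsetD[OF closure_subset UN_I[OF UNIV_I]])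

lemma rep_word_sums: "x \<in> carrier F \<Longrightarrow> 1 \<le> k \<Longrightarrow> \<theta> x \<in> word_sums k"
  using word_sums.word[of "[x]" k] by (simp add: word_set_def)

lemma rep_bounded: "\<theta> ` carrier F \<subseteq> bounded_ops"
  by (auto simp: bounded_ops_iff rep_clin)

lemma op_alg_gen_alg: "op_alg gen_alg"
  unfolding gen_alg_def
proof (rule op_alg_closure)
  show "op_subspace (\<Union>k. word_sums k)"
    unfolding op_subspace_def
  proof (intro conjI ballI allI)
    show "(\<Union>k. word_sums k) \<subseteq> bounded_ops" using op_subspaceD(1)[OF op_subspace_word_sums] by (auto simp: bounded_ops_iff)
    fix S T assume "S \<in> (\<Union>k. word_sums k)" "T \<in> (\<Union>k. word_sums k)"
    then obtain j k where "S \<in> word_sums j" "T \<in> word_sums k" by blast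
    then show "S + T \<in> (\<Union>k. word_sums k)"
      using word_sums.add[of S "j + k" T] word_sums_mono[of j "j + k"] word_sums_mono[of k "j + k"] by auto
  qed (auto intro: word_sums.zero op_subspaceD(4,5)[OF op_subspace_word_sums])
qed (auto intro: word_sums_comp)

lemma rep_gen_alg: "\<theta> ` carrier F \<subseteq> gen_alg"
  using rep_word_sums[of _ 1] word_sums_gen_alg by blast

text \<open>Words grow by prefixing one letter, so closure under left multiplication by generators
  suffices; the premise \<open>T \<in> gen_alg\<close> lets facts about the algebra be applied to
  \<open>T\<close>.\<close>

lemma gen_alg_induct:
  assumes C: "closed C" "0 \<in> C" "\<And>S T. S \<in> C \<Longrightarrow> T \<in> C \<Longrightarrow> S + T \<in> C"
    and rep: "\<And>x. x \<in> carrier F \<Longrightarrow> \<theta> x \<in> C"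
    and comp: "\<And>x T. x \<in> carrier F \<Longrightarrow> T \<in> C \<Longrightarrow> T \<in> gen_alg \<Longrightarrow> \<theta> x o\<^sub>L T \<in> C"
  shows "gen_alg \<subseteq> C"
  unfolding gen_alg_def
proof (rule closure_minimal[OF UN_least C(1)], rule subsetI)
  have word: "word_op \<theta> w \<in> C" if "w \<in> word_set" for w
    using that
  proof (induction w)
    case (Cons x w)
    then show ?case
      using rep comp word_sums_gen_alg[OF word_sums.word[of w "length w"]]
      by (cases "w = []") (auto simp: word_set_def)
  qed (simp add: word_set_def)
  show "T \<in> C" if "T \<in> word_sums k" for k T
    using that by (rule word_sums.induct) (auto simp: C word)
qed

lemma gen_alg_least: "op_alg C \<Longrightarrow> \<theta> ` carrier F \<subseteq> C \<Longrightarrow> gen_alg \<subseteq> C"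
  by (rule gen_alg_induct) (auto dest: op_algD op_subspaceD(2,3)[OF op_algD(1)])

lemma gen_alg_bounded: "gen_alg \<subseteq> bounded_ops"
  by (rule gen_alg_least[OF op_alg_bounded_ops rep_bounded])

text \<open>An element is determined by any sequence of word sums converging to it. Choosing one for
  each element embeds the algebra into the type over which \<open>Csharp_envelope\<close>
  quantifies.\<close>

lemma gen_alg_encoding: "\<exists>j :: 'h op \<Rightarrow> 'x extension_carrier. inj_on j gen_alg"
proof -
  have "\<exists>s. (\<lambda>n. \<Sum>w\<leftarrow>s n. word_op \<theta> w) \<longlonglongrightarrow> T" if T: "T \<in> gen_alg" for T
  proof -
    obtain f where f: "\<And>n::nat. f n \<in> (\<Union>k. word_sums k)" "f \<longlonglongrightarrow> T"
      using T unfolding gen_alg_def closure_sequential by blast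
    have "\<exists>ws. S = (\<Sum>w\<leftarrow>ws. word_op \<theta> w)" if "S \<in> word_sums k" for S k
      using that
    proof (induction rule: word_sums.induct)
      case zero show ?case by (rule exI[of _ "[]"]) simp
    next
      case (word w) show ?case by (rule exI[of _ "[w]"]) simp
    next
      case (add S T)
      then obtain us ws where "S = (\<Sum>w\<leftarrow>us. word_op \<theta> w)" "T = (\<Sum>w\<leftarrow>ws. word_op \<theta> w)" by blast
      then show ?case by (intro exI[of _ "us @ ws"]) simp
    qed
    then have "\<forall>n. \<exists>ws. f n = (\<Sum>w\<leftarrow>ws. word_op \<theta> w)" using f(1) by (meson UN_E)
    then obtain s where "f = (\<lambda>n. \<Sum>w\<leftarrow>s n. word_op \<theta> w)" by metis
    then show ?thesis using f(2) by blast
  qed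
  then obtain j where j: "\<And>T. T \<in> gen_alg \<Longrightarrow> (\<lambda>n. \<Sum>w\<leftarrow>j T n. word_op \<theta> w) \<longlonglongrightarrow> T" by metis
  have "inj_on j gen_alg" by (rule inj_onI) (rule LIMSEQ_unique[OF j], simp_all add: j)
  then show ?thesis by blast
qed

end

section \<open>Extensions from quotients\<close>

text \<open>Cosets live on the given type as images under \<open>j\<close> of chosen
  representatives; this makes quotients of \<open>gen_alg\<close> available on
  \<open>extension_carrier\<close>.\<close>

lemma op_quotient_exists:
  fixes j :: "'h::complex_hilbert op \<Rightarrow> 'b"
  assumes B: "op_alg B" and I: "op_ideal B I" and j: "inj_on j B"
  shows "\<exists>(Q :: 'b cstar) f. cstar_algebra Q \<and> op_quotient B I Q f"
proof -
  note Bs = op_algD(1)[OF B] and Is = op_idealD(1)[OF I]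
  \<comment> \<open>The predicate under the choice depends on \<open>T\<close> only through its
    coset, so \<open>rep\<close> is constant on cosets.\<close>
  define rep where "rep T = (SOME S. S \<in> B \<and> T - S \<in> I)" for T
  have rep: "rep T \<in> B" "T - rep T \<in> I" if "T \<in> B" for T
  proof -
    have "rep T \<in> B \<and> T - rep T \<in> I"
      unfolding rep_def by (rule someI[of _ T]) (use that op_subspaceD(2)[OF Is] in simp)
    then show "rep T \<in> B" "T - rep T \<in> I" by auto
  qed
  have rep_eq: "rep S = rep T \<longleftrightarrow> S - T \<in> I" if "S \<in> B" "T \<in> B" for S T
  proof
    assume eq: "rep S = rep T"
    have "(S - rep S) - (T - rep T) \<in> I" by (rule op_subspace_diff[OF Is rep(2)[OF that(1)] rep(2)[OF that(2)]])
    then show "S - T \<in> I" by (simp add: eq)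
  next
    assume ST: "S - T \<in> I"
    have "(S - R \<in> I) = (T - R \<in> I)" for R
    proof
      assume "S - R \<in> I"
      then have "(S - R) - (S - T) \<in> I" by (rule op_subspace_diff[OF Is _ ST])
      then show "T - R \<in> I" by simp
    next
      assume "T - R \<in> I"
      then have "(T - R) + (S - T) \<in> I" by (rule op_subspaceD(3)[OF Is _ ST])
      then show "S - R \<in> I" by simp
    qed
    then show "rep S = rep T" by (simp add: rep_def)
  qed
  define f where "f T = j (rep T)" for T
  have f_eq: "f S = f T \<longleftrightarrow> S - T \<in> I" if "S \<in> B" "T \<in> B" for S T
    using inj_on_eq_iff[OF j rep(1)[OF that(1)] rep(1)[OF that(2)]] rep_eq[OF that] by (simp add: f_def)
  define dec where "dec q = (SOME S. S \<in> B \<and> f S = q)" for q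
  have dec: "dec (f T) \<in> B" "f (dec (f T)) = f T" if "T \<in> B" for T
  proof -
    have "dec (f T) \<in> B \<and> f (dec (f T)) = f T"
      unfolding dec_def by (rule someI[of _ T]) (use that in simp)
    then show "dec (f T) \<in> B" "f (dec (f T)) = f T" by auto
  qed
  have dI: "dec (f T) - T \<in> I" if "T \<in> B" for T
    using f_eq[OF dec(1)[OF that] that] dec(2)[OF that] by simp
  define Q :: "'b cstar" where "Q = \<lparr>carrier = f ` B, vzero = f 0, vadd = \<lambda>p q. f (dec p + dec q),
    vscale = \<lambda>c q. f (op_scale c (dec q)), vstar = \<lambda>q. f (adj (dec q)),
    cmult = \<lambda>p q. f (dec p o\<^sub>L dec q), cnorm = \<lambda>q. infdist (dec q) I\<rparr>"
  have "op_quotient B I Q f"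
    unfolding op_quotient_def
  proof (intro conjI ballI allI B I)
    show "carrier Q = f ` B" "vzero Q = f 0" by (simp_all add: Q_def)
    fix T assume T: "T \<in> B"
    have cT: "clin T" "clin (dec (f T))" using T dec(1) op_subspaceD(1)[OF Bs] by auto
    show "vscale Q c (f T) = f (op_scale c T)" for c
    proof -
      have "op_scale c (dec (f T)) - op_scale c T = op_scale c (dec (f T) - T)" by (simp add: op_scale_diff_right)
      then show ?thesis
        using T dec dI op_subspaceD(4)[OF Is dI[OF T], of c] by (simp add: Q_def f_eq op_subspaceD(4)[OF Bs])
    qed
    show "vstar Q (f T) = f (adj T)"
    proof -
      have "adj (dec (f T)) - adj T = adj (dec (f T) - T)" using cT by (simp add: adj_diff)
      then show ?thesis
        using T dec dI op_subspaceD(5)[OF Is dI[OF T]] by (simp add: Q_def f_eq op_subspaceD(5)[OF Bs])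
    qed
    fix S assume S: "S \<in> B"
    show "(f T = f S) = (T - S \<in> I)" by (rule f_eq[OF T S])
    show "vadd Q (f T) (f S) = f (T + S)"
    proof -
      have "(dec (f T) + dec (f S)) - (T + S) = (dec (f T) - T) + (dec (f S) - S)" by simp
      then have "(dec (f T) + dec (f S)) - (T + S) \<in> I"
        using op_subspaceD(3)[OF Is dI[OF T] dI[OF S]] by metis
      then show ?thesis using T S dec by (simp add: Q_def f_eq op_subspaceD(3)[OF Bs])
    qed
    show "cmult Q (f T) (f S) = f (T o\<^sub>L S)"
    proof -
      have "(dec (f T) o\<^sub>L dec (f S)) - (T o\<^sub>L S) = (dec (f T) o\<^sub>L (dec (f S) - S)) + ((dec (f T) - T) o\<^sub>L S)"
        by (simp add: comp_simps)
      then have "(dec (f T) o\<^sub>L dec (f S)) - (T o\<^sub>L S) \<in> I"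
        using op_subspaceD(3)[OF Is op_idealD(3)[OF I dec(1)[OF T] dI[OF S]] op_idealD(4)[OF I S dI[OF T]]] by metis
      then show ?thesis using T S dec by (simp add: Q_def f_eq op_algD(2)[OF B])
    qed
  qed
  moreover from this have "cstar_algebra Q"
  proof (rule op_quotient_cstar_algebra)
    fix T assume "T \<in> B"
    then show "cnorm Q (f T) = infdist T I"
      using infdist_op_ideal_cong[OF Is dI] by (simp add: Q_def)
  qed
  ultimately show ?thesis by blast
qed

lemma op_space_cstar_sel [simp]:
  "carrier (operator_space_of_cstar A) = carrier A" "vzero (operator_space_of_cstar A) = vzero A"
  "vadd (operator_space_of_cstar A) = vadd A" "vscale (operator_space_of_cstar A) = vscale A"
  "vstar (operator_space_of_cstar A) = vstar A"
  "cone (operator_space_of_cstar A) n = {mat_mult A n (mat_star A n y) y | y. y \<in> Mat A n}"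
  "mnorm (operator_space_of_cstar A) = cstar_mnorm A"
  by (simp_all add: operator_space_of_cstar_def)

lemma mat_op_space_cstar [simp]:
  "Mat (operator_space_of_cstar A) n = Mat A n" "mat_add (operator_space_of_cstar A) = mat_add A"
  "mat_scale (operator_space_of_cstar A) = mat_scale A" "mat_star (operator_space_of_cstar A) n = mat_star A n"
  by (simp_all add: Mat_def mat_add_def mat_scale_def mat_star_def fun_eq_iff)

lemma vsum_op_space_cstar [simp]: "vsum (operator_space_of_cstar A) f n = vsum A f n"
  by (induction n) auto

lemma star_vector_space_op_space_cstar:
  assumes "cstar_algebra A"
  shows "star_vector_space (operator_space_of_cstar A)"
proof -
  interpret cstar_algebra A by (rule assms)
  show ?thesis
    by unfold_locales (auto simp: zero_closed add_closed scale_closed star_closed add_assoc add_zero add_minus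
        scale_one scale_scale scale_add_left scale_add_right star_star star_add star_scale intro: add_commute)
qed

lemma star_vector_space_unitization:
  assumes "star_vector_space F"
  shows "star_vector_space (unitization F)"
proof -
  interpret star_vector_space F by (rule assms)
  have st: "vstar (unitization F) = (\<lambda>u. (vstar F (fst u), cnj (snd u)))"
    by (simp add: unitization_def Let_def star_space.defs)
  show ?thesis
    by unfold_locales (auto simp: unitization_sel st zero_closed add_closed scale_closed star_closed add_assoc add_zero add_minus
        scale_one scale_scale scale_add_left scale_add_right star_star star_add star_scale algebra_simps intro: add_commute)
qed

context presentation
begin

text \<open>The ideals for which the quotient of the generated algebra is a $C^\sharp$-extension, described without
  reference to the quotient: its matrix norms and its states restrict to those of \<open>F\<close>.\<close>

definition admissible :: "'h op set \<Rightarrow> bool" where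
  "admissible I \<longleftrightarrow> op_ideal gen_alg I \<and>
     (\<forall>n>0. \<forall>x\<in>Mat F n. \<forall>Y\<in>op_mats I n.
        norm (op_mat n (amplify \<theta> x)) \<le> norm (op_mat n (\<lambda>i j. \<theta> (x i j) + Y i j))) \<and>
     (\<forall>n>0. \<forall>x\<in>Mat_sa F n. \<not> op_pos (id_blinfun + op_mat n (amplify \<theta> x)) \<longrightarrow>
        (\<exists>\<phi>. op_functional gen_alg I n \<phi> \<and> Re (\<phi> (amplify \<theta> x)) < -1))"

lemma admissible_zero: "admissible {0}"
  unfolding admissible_def
proof (intro conjI allI impI ballI)
  show "op_ideal gen_alg {0}" by (rule op_ideal_zero[OF op_alg_gen_alg])
  fix n x Y assume "x \<in> Mat F n" and Y: "Y \<in> op_mats ({0} :: 'h op set) n"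
  have "Y i j = 0" for i j using op_matsD[OF Y] op_mats_outside[OF Y] by (cases "i < n \<and> j < n") auto
  then show "norm (op_mat n (amplify \<theta> x)) \<le> norm (op_mat n (\<lambda>i j. \<theta> (x i j) + Y i j))"
    by (simp add: amplify_def)
qed (rule op_functional_separating[OF _ _ gen_alg_bounded])

text \<open>The functional is constant on cosets, and it stays contractive because the quotient norm
  is a distance to matrices on which it vanishes.\<close>

lemma functional_on_quotient:
  assumes Q: "op_quotient gen_alg I Q f" and n: "0 < n" and \<phi>: "op_functional gen_alg I n \<phi>"
  shows "\<exists>\<psi>. positive_contraction (operator_space_of_cstar Q) n \<psi> \<and> (\<forall>X\<in>op_mats gen_alg n. \<psi> (amplify f X) = \<phi> X)"
proof -
  note B = op_alg_gen_alg and Bs = op_algD(1)[OF op_alg_gen_alg]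
  note qd = op_quotientD[OF Q]
  have add: "\<phi> (\<lambda>i j. X i j + Y i j) = \<phi> X + \<phi> Y" if "X \<in> op_mats gen_alg n" "Y \<in> op_mats gen_alg n" for X Y
    using \<phi> that by (simp add: op_functional_def)
  have sc: "\<phi> (\<lambda>i j. op_scale c (X i j)) = c * \<phi> X" if "X \<in> op_mats gen_alg n" for c X
    using \<phi> that by (simp add: op_functional_def)
  have ker: "\<phi> X = 0" if "X \<in> op_mats I n" for X using \<phi> that by (simp add: op_functional_def)
  have diff: "\<phi> (\<lambda>i j. X i j - Y i j) = \<phi> X - \<phi> Y" if X: "X \<in> op_mats gen_alg n" and Y: "Y \<in> op_mats gen_alg n" for X Y
    using add[OF op_mats_diff[OF Bs X Y] Y] by simp
  have cong: "\<phi> X = \<phi> Y" if X: "X \<in> op_mats gen_alg n" and Y: "Y \<in> op_mats gen_alg n" and eq: "amplify f X = amplify f Y" for X Y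
  proof -
    have "X i j - Y i j \<in> I" for i j
      using qd(5)[OF op_matsD'[OF Bs X] op_matsD'[OF Bs Y]] fun_cong[OF fun_cong[OF eq]] by (simp add: amplify_def)
    then have "(\<lambda>i j. X i j - Y i j) \<in> op_mats I n"
      using X Y by (intro op_matsI) (auto simp: op_mats_outside)
    then show ?thesis using diff[OF X Y] ker by simp
  qed
  define \<psi> where "\<psi> q = \<phi> (SOME X. X \<in> op_mats gen_alg n \<and> amplify f X = q)" for q
  have \<psi>: "\<psi> (amplify f X) = \<phi> X" if X: "X \<in> op_mats gen_alg n" for X
  proof -
    have "(SOME Y. Y \<in> op_mats gen_alg n \<and> amplify f Y = amplify f X) \<in> op_mats gen_alg n \<and>
        amplify f (SOME Y. Y \<in> op_mats gen_alg n \<and> amplify f Y = amplify f X) = amplify f X"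
      by (rule someI[of _ X]) (use X in simp)
    then show ?thesis unfolding \<psi>_def using cong[OF _ X] by blast
  qed
  have "positive_contraction (operator_space_of_cstar Q) n \<psi>"
    unfolding positive_contraction_def mat_op_space_cstar op_space_cstar_sel op_quotient_Mat[OF Q]
  proof (intro conjI ballI allI)
    fix p q c assume "p \<in> amplify f ` op_mats gen_alg n"
    then obtain X where X: "X \<in> op_mats gen_alg n" "p = amplify f X" by blast
    show "\<psi> (mat_scale Q c p) = c * \<psi> p"
      using X by (simp add: op_quotient_mat_ops[OF Q] \<psi> op_mats_op_scale[OF Bs] sc)
    show "cmod (\<psi> p) \<le> cstar_mnorm Q n p"
    proof -
      have ne: "op_mat n ` op_mats I n \<noteq> {}"
        using op_subspaceD(2)[OF op_subspace_op_mats[OF op_idealD(1)[OF qd(2)]], of n] by blast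
      have "cmod (\<phi> X) \<le> dist (op_mat n X) (op_mat n Y)" if Y: "Y \<in> op_mats I n" for Y
      proof -
        have YB: "Y \<in> op_mats gen_alg n" using Y op_mats_mono[of I gen_alg] op_idealD(2)[OF qd(2)] by blast
        have "cmod (\<phi> X) = cmod (\<phi> (\<lambda>i j. X i j - Y i j))" using diff[OF X(1) YB] ker[OF Y] by simp
        also have "\<dots> \<le> norm (op_mat n (\<lambda>i j. X i j - Y i j))"
          using \<phi> op_mats_diff[OF Bs X(1) YB] by (simp add: op_functional_def)
        finally show ?thesis by (simp add: op_mat_diff dist_norm)
      qed
      then show ?thesis
        unfolding X(2) \<psi>[OF X(1)] op_quotient_mnorm[OF Q X(1)] infdist_notempty[OF ne]
        by (intro cINF_greatest[OF ne]) auto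
    qed
    assume "q \<in> amplify f ` op_mats gen_alg n"
    then obtain Y where Y: "Y \<in> op_mats gen_alg n" "q = amplify f Y" by blast
    show "\<psi> (mat_add Q p q) = \<psi> p + \<psi> q"
      using X Y by (simp add: op_quotient_mat_ops[OF Q] \<psi> op_mats_add[OF Bs] add)
  next
    fix p assume "p \<in> {mat_mult Q n (mat_star Q n y) y | y. y \<in> amplify f ` op_mats gen_alg n}"
    then obtain Y where Y: "Y \<in> op_mats gen_alg n" "p = mat_mult Q n (mat_star Q n (amplify f Y)) (amplify f Y)" by blast
    have "p = amplify f (op_mat_mult n (op_mat_adj Y) Y)"
      unfolding Y(2) using Y(1) by (simp add: op_quotient_mat_ops[OF Q] op_mat_adj_closed[OF Bs])
    then show "\<psi> p \<in> \<real>\<^sub>\<ge>\<^sub>0"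
      using Y(1) \<phi> op_mat_mult_closed[OF B op_mat_adj_closed[OF Bs Y(1)] Y(1)] by (simp add: \<psi> op_functional_def)
  qed
  then show ?thesis using \<psi> by blast
qed

text \<open>The first condition of \<open>admissible\<close> makes the quotient map completely
  isometric on F, the second supplies enough states on the quotient for the orders of the
  unitizations to agree. The encoding puts the quotient on the type to which the universal property
  applies.\<close>

theorem quotient_extension:
  assumes I: "admissible I"
  shows "\<exists>(Q :: 'x extension_carrier cstar) f. op_quotient gen_alg I Q f \<and> Csharp_extension F Q (\<lambda>x. f (\<theta> x))"
proof -
  note B = op_alg_gen_alg and Bs = op_algD(1)[OF op_alg_gen_alg]
  have ideal: "op_ideal gen_alg I"
    and iso: "\<And>n x Y. 0 < n \<Longrightarrow> x \<in> Mat F n \<Longrightarrow> Y \<in> op_mats I n \<Longrightarrow>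
      norm (op_mat n (amplify \<theta> x)) \<le> norm (op_mat n (\<lambda>i j. \<theta> (x i j) + Y i j))"
    and sep: "\<And>n x. 0 < n \<Longrightarrow> x \<in> Mat_sa F n \<Longrightarrow> \<not> op_pos (id_blinfun + op_mat n (amplify \<theta> x)) \<Longrightarrow>
        \<exists>\<phi>. op_functional gen_alg I n \<phi> \<and> Re (\<phi> (amplify \<theta> x)) < -1"
    using I unfolding admissible_def by blast+
  obtain j :: "'h op \<Rightarrow> 'x extension_carrier" where j: "inj_on j gen_alg"
    using gen_alg_encoding by blast
  obtain Q :: "'x extension_carrier cstar" and f where QA: "cstar_algebra Q" and Q: "op_quotient gen_alg I Q f"
    using op_quotient_exists[OF B ideal j] by blast
  interpret Q: cstar_algebra Q by (rule QA)
  note qd = op_quotientD[OF Q]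
  let ?C = "operator_space_of_cstar Q"
  interpret C: star_vector_space ?C by (rule star_vector_space_op_space_cstar[OF QA])
  define \<kappa> where "\<kappa> x = f (\<theta> x)" for x
  have \<theta>B: "\<theta> x \<in> gen_alg" if "x \<in> carrier F" for x using that rep_gen_alg by blast
  have lin: "lin_map F ?C \<kappa>"
    by (auto simp: lin_map_def \<kappa>_def qd(3) \<theta>B qd(6,7) rep_add rep_scale)
  have \<kappa>_star: "\<kappa> (vstar F x) = vstar Q (\<kappa> x)" if "x \<in> carrier F" for x
    using that by (simp add: \<kappa>_def qd(8) \<theta>B rep_star)
  have \<kappa>0: "\<kappa> (vzero F) = vzero Q" by (simp add: \<kappa>_def rep_zero qd(4))
  have amp: "amplify \<kappa> x = amplify f (amplify \<theta> x)" for x by (simp add: amplify_def \<kappa>_def)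
  have mats: "amplify \<theta> x \<in> op_mats gen_alg n" if "x \<in> Mat F n" for x n
    by (rule rep_op_mats[OF rep_gen_alg that])
  have \<kappa>Mat: "amplify \<kappa> x \<in> Mat Q n" if "x \<in> Mat F n" for x n
    unfolding amp op_quotient_Mat[OF Q] using mats[OF that] by blast
  \<comment> \<open>The quotient norm is the distance to the matrices over \<open>I\<close>, which
    \<open>admissible\<close> bounds below by the norm on F.\<close>
  have mn: "cstar_mnorm Q n (amplify \<kappa> x) = mnorm F n x" if n: "0 < n" and x: "x \<in> Mat F n" for n x
  proof (rule antisym)
    have z: "0 \<in> op_mat n ` op_mats I n"
      by (rule op_subspaceD(2)[OF op_subspace_op_mats[OF op_idealD(1)[OF ideal]]])
    show "cstar_mnorm Q n (amplify \<kappa> x) \<le> mnorm F n x"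
      unfolding amp op_quotient_mnorm[OF Q mats[OF x]] rep_norm[OF n x]
      using infdist_le[OF z, of "op_mat n (amplify \<theta> x)"] by simp
    have "norm (op_mat n (amplify \<theta> x)) \<le> dist (op_mat n (amplify \<theta> x)) (op_mat n Y)"
      if Y: "Y \<in> op_mats I n" for Y
    proof -
      have "(\<lambda>i j. - Y i j) \<in> op_mats I n"
        using op_mats_op_scale[OF op_idealD(1)[OF ideal] Y, of "-1"] by (simp add: op_scale_minus_one)
      from iso[OF n x this] show ?thesis
        by (simp add: dist_norm amplify_def flip: op_mat_diff)
    qed
    then have "norm (op_mat n (amplify \<theta> x)) \<le> (INF Y\<in>op_mat n ` op_mats I n. dist (op_mat n (amplify \<theta> x)) Y)"
      using z by (intro cINF_greatest) auto
    then show "mnorm F n x \<le> cstar_mnorm Q n (amplify \<kappa> x)"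
      unfolding amp op_quotient_mnorm[OF Q mats[OF x]] rep_norm[OF n x] using z by (subst infdist_notempty) auto
  qed
  have iso': "completely_isometric F ?C \<kappa>"
    unfolding completely_isometric_def using lin mn by simp
  have pos: "amplify \<kappa> x \<in> cone ?C n" if n: "0 < n" and x: "x \<in> cone F n" for n x
  proof -
    obtain Y where Y: "Y \<in> op_mats gen_alg n" "op_mat_mult n (op_mat_adj Y) Y = amplify \<theta> x"
      using cone_square[OF n B rep_gen_alg x] by blast
    have "amplify \<kappa> x = mat_mult Q n (mat_star Q n (amplify f Y)) (amplify f Y)"
      using Y by (simp add: op_quotient_mat_ops[OF Q] op_mat_adj_closed[OF Bs] amp)
    moreover have "amplify f Y \<in> Mat Q n" using Y op_quotient_Mat[OF Q] by blast
    ultimately show ?thesis by (simp only: op_space_cstar_sel) blast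
  qed
  have cp: "completely_positive F ?C \<kappa>"
    unfolding completely_positive_def using lin pos by blast
  have gen: "cstar_generated Q (\<kappa> ` carrier F) = carrier Q"
  proof (rule antisym)
    have "cstar_subalgebra Q (carrier Q)"
      by (auto simp: cstar_subalgebra_def lin_subspace_def cstar_closure_def Q.zero_closed Q.add_closed
          Q.scale_closed Q.mult_closed Q.star_closed)
    then show "cstar_generated Q (\<kappa> ` carrier F) \<subseteq> carrier Q"
      using lin by (auto simp: cstar_generated_def lin_map_def)
    show "carrier Q \<subseteq> cstar_generated Q (\<kappa> ` carrier F)"
      unfolding cstar_generated_def
    proof (intro Inter_greatest)
      fix S assume "S \<in> {S. cstar_subalgebra Q S \<and> \<kappa> ` carrier F \<subseteq> S}"
      then have S: "cstar_subalgebra Q S" "\<kappa> ` carrier F \<subseteq> S" by auto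
      have SD: "S \<subseteq> carrier Q" "vzero Q \<in> S" "\<And>p q. p \<in> S \<Longrightarrow> q \<in> S \<Longrightarrow> vadd Q p q \<in> S" "\<And>c q. q \<in> S \<Longrightarrow> vscale Q c q \<in> S"
        "\<And>p q. p \<in> S \<Longrightarrow> q \<in> S \<Longrightarrow> cmult Q p q \<in> S" "\<And>q. q \<in> S \<Longrightarrow> vstar Q q \<in> S" "cstar_closure Q S \<subseteq> S"
        using S(1) by (auto simp: cstar_subalgebra_def lin_subspace_def)
      \<comment> \<open>The preimage of a closed subalgebra containing the generators; it is closed
        because the quotient map is contractive, so it exhausts \<open>gen_alg\<close>.\<close>
      define D where "D = {T \<in> gen_alg. f T \<in> S}"
      have "closed D"
        unfolding closed_sequential_limits
      proof (intro allI impI, elim conjE)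
        fix T L assume T: "\<forall>n. T n \<in> D" and L: "T \<longlonglongrightarrow> L"
        have LB: "L \<in> gen_alg" using T L closed_sequentially[OF op_algD(3)[OF B], of T L] by (simp add: D_def)
        have "f L \<in> cstar_closure Q S"
          unfolding cstar_closure_def
        proof (intro CollectI conjI allI impI)
          show "f L \<in> carrier Q" using LB by (simp add: qd(3))
          fix e :: real assume "e > 0"
          then obtain n where n: "norm (T n - L) < e" using LIMSEQ_D[OF L] by blast
          have Tn: "T n \<in> gen_alg" "f (T n) \<in> S" using T by (auto simp: D_def)
          have "cnorm Q (vminus Q (f L) (f (T n))) = infdist (L - T n) I"
            using LB Tn by (simp add: op_quotient_minus[OF Q] op_quotient_norm[OF Q QA] op_subspace_diff[OF Bs])
          also have "\<dots> \<le> norm (L - T n)"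
            using infdist_le[OF op_subspaceD(2)[OF op_idealD(1)[OF ideal]], of "L - T n"] by simp
          also have "\<dots> < e" using n by (simp add: norm_minus_commute)
          finally show "\<exists>y\<in>S. cnorm Q (vminus Q (f L) y) < e" using Tn by blast
        qed
        then show "L \<in> D" using SD(7) LB by (auto simp: D_def)
      qed
      then have "gen_alg \<subseteq> D"
      proof (rule gen_alg_induct)
        show "0 \<in> D" using SD(2) op_subspaceD(2)[OF Bs] by (simp add: D_def qd(4))
        show "R + T \<in> D" if "R \<in> D" "T \<in> D" for R T
          using that SD(3)[of "f R" "f T"] op_subspaceD(3)[OF Bs] by (simp add: D_def qd(6))
        show "\<theta> x \<in> D" if "x \<in> carrier F" for x using that S(2) \<theta>B by (auto simp: D_def \<kappa>_def)
        then show "\<theta> x o\<^sub>L T \<in> D" if "x \<in> carrier F" "T \<in> D" for x T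
          using that SD(5)[of "f (\<theta> x)" "f T"] op_algD(2)[OF B] by (simp add: D_def qd(9))
      qed
      then show "carrier Q \<subseteq> S" by (auto simp: qd(3) D_def)
    qed
  qed
  have inj: "inj_on \<kappa> (carrier F)"
  proof (rule inj_onI)
    fix x y assume x: "x \<in> carrier F" and y: "y \<in> carrier F" and eq: "\<kappa> x = \<kappa> y"
    have d: "vminus F x y \<in> carrier F" using x y by (rule minus_closed)
    \<comment> \<open>Injectivity is read off from the isometry at matrix size one.\<close>
    define z :: "'x mat" where "z = (\<lambda>i j. if i < 1 \<and> j < 1 then vminus F x y else vzero F)"
    have zM: "z \<in> Mat F 1" using d by (simp add: z_def Mat_def)
    have "\<kappa> (vminus F x y) = vminus Q (\<kappa> x) (\<kappa> y)"
      using lin x y by (simp add: lin_map_def vminus_def scale_closed)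
    also have "\<dots> = vzero Q" unfolding eq using lin y by (intro Q.minus_self) (auto simp: lin_map_def)
    finally have "amplify \<kappa> z = amplify \<kappa> (mat_zero F)"
      by (simp add: amplify_def z_def mat_zero_def \<kappa>0 if_distrib[of \<kappa>] cong: if_cong)
    then have "mnorm F 1 z = mnorm F 1 (mat_zero F)"
      using mn[of 1 z] mn[of 1 "mat_zero F"] zM by (simp add: Mat_def mat_zero_def zero_closed)
    also have "\<dots> = 0"
      using rep_norm[of 1 "mat_zero F"] zero_closed
      by (simp add: Mat_def mat_zero_def amplify_def rep_zero op_mat_zero)
    finally have "norm (op_mat 1 (amplify \<theta> z)) = 0" using rep_norm[of 1 z] zM by simp
    then have "norm (amplify \<theta> z 0 0) = 0" using norm_entry_le[of 0 1 0 "amplify \<theta> z"] by simp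
    then have "\<theta> (vminus F x y) = \<theta> (vzero F)" by (simp add: amplify_def z_def rep_zero)
    then have "vminus F x y = vzero F" using inj_onD[OF rep_inj] d zero_closed by blast
    then show "x = y" using x y by (simp add: minus_eq_zero_iff)
  qed
  have sa_iff: "x \<in> Mat_sa F n \<longleftrightarrow> amplify \<kappa> x \<in> Mat_sa ?C n" if x: "x \<in> Mat F n" for x n
  proof -
    have st: "amplify \<kappa> (mat_star F n x) = mat_star Q n (amplify \<kappa> x)"
      by (intro ext) (simp add: amplify_def mat_star_def \<kappa>_star Mat_closed[OF x] \<kappa>0)
    have "amplify \<kappa> (mat_star F n x) = amplify \<kappa> x \<longleftrightarrow> mat_star F n x = x"
    proof
      assume "amplify \<kappa> (mat_star F n x) = amplify \<kappa> x"
      then have eq: "\<kappa> (mat_star F n x i j) = \<kappa> (x i j)" for i j by (metis amplify_def)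
      show "mat_star F n x = x"
        by (rule ext, rule ext, rule inj_onD[OF inj eq Mat_closed[OF mat_star_closed[OF x]] Mat_closed[OF x]])
    qed simp
    then show ?thesis using x \<kappa>Mat[OF x] by (simp add: Mat_sa_def st)
  qed
  \<comment> \<open>States of the quotient and positivity on the Hilbert space agree on F: a
    separating functional descends to the quotient, and conversely states of the quotient restrict
    to positive contractions of F.\<close>
  have functional: "(\<forall>\<phi>. norm_one_positive_functional ?C n \<phi> \<longrightarrow> Re (\<phi> (amplify \<kappa> x)) \<ge> -1) \<longleftrightarrow>
      op_pos (id_blinfun + op_mat n (amplify \<theta> x))" if n: "0 < n" and x: "x \<in> Mat_sa F n" for n x
  proof
    have xM: "x \<in> Mat F n" using x by (simp add: Mat_sa_def)
    assume L: "\<forall>\<phi>. norm_one_positive_functional ?C n \<phi> \<longrightarrow> Re (\<phi> (amplify \<kappa> x)) \<ge> -1"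
    show "op_pos (id_blinfun + op_mat n (amplify \<theta> x))"
    proof (rule ccontr)
      assume "\<not> op_pos (id_blinfun + op_mat n (amplify \<theta> x))"
      then obtain \<phi> where \<phi>: "op_functional gen_alg I n \<phi>" "Re (\<phi> (amplify \<theta> x)) < -1"
        using sep[OF n x] by blast
      obtain \<psi> where \<psi>: "positive_contraction ?C n \<psi>" "\<forall>X\<in>op_mats gen_alg n. \<psi> (amplify f X) = \<phi> X"
        using functional_on_quotient[OF Q n \<phi>(1)] by blast
      have "0 \<le> mnorm ?C n q" if "q \<in> Mat ?C n" for q
      proof -
        obtain X where "X \<in> op_mats gen_alg n" "q = amplify f X"
          using \<open>q \<in> Mat ?C n\<close> by (auto simp: op_quotient_Mat[OF Q])
        then show ?thesis using op_quotient_mnorm[OF Q] infdist_nonneg by simp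
      qed
      moreover have "Re (\<psi> (amplify \<kappa> x)) < -1" using \<psi>(2) \<phi>(2) mats[OF xM] by (simp add: amp)
      ultimately obtain \<psi>' where "norm_one_positive_functional ?C n \<psi>'" "Re (\<psi>' (amplify \<kappa> x)) < -1"
        using normalize_positive_contraction[OF \<psi>(1), of "amplify \<kappa> x"] \<kappa>Mat[OF xM] by auto
      then show False using L by force
    qed
  next
    assume P: "op_pos (id_blinfun + op_mat n (amplify \<theta> x))"
    show "\<forall>\<phi>. norm_one_positive_functional ?C n \<phi> \<longrightarrow> Re (\<phi> (amplify \<kappa> x)) \<ge> -1"
    proof (intro allI impI)
      fix \<phi> assume "norm_one_positive_functional ?C n \<phi>"
      then have \<phi>: "positive_contraction ?C n \<phi>" by (rule norm_one_positive_contraction)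
      have "positive_contraction F n (\<lambda>x. \<phi> (amplify \<kappa> x))"
        unfolding positive_contraction_def
      proof (intro conjI ballI allI)
        fix y z c assume y: "y \<in> Mat F n"
        show "\<phi> (amplify \<kappa> (mat_scale F c y)) = c * \<phi> (amplify \<kappa> y)"
          using \<phi> \<kappa>Mat[OF y] by (simp add: positive_contraction_def lin_map_mat_scale[OF star_vector_space_axioms lin y])
        show "cmod (\<phi> (amplify \<kappa> y)) \<le> mnorm F n y"
          using \<phi> \<kappa>Mat[OF y] by (simp add: positive_contraction_def mn[OF n y, symmetric])
        assume z: "z \<in> Mat F n"
        show "\<phi> (amplify \<kappa> (mat_add F y z)) = \<phi> (amplify \<kappa> y) + \<phi> (amplify \<kappa> z)"
          using \<phi> \<kappa>Mat[OF y] \<kappa>Mat[OF z] by (simp add: positive_contraction_def lin_map_mat_add[OF star_vector_space_axioms lin y z])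
      next
        fix y assume "y \<in> cone F n"
        then show "\<phi> (amplify \<kappa> y) \<in> \<real>\<^sub>\<ge>\<^sub>0"
          using \<phi> pos[OF n] unfolding positive_contraction_def by blast
      qed
      then show "Re (\<phi> (amplify \<kappa> x)) \<ge> -1" by (rule positive_contraction_ge[OF n _ x P])
    qed
  qed
  have "complete_order_iso_onto_range (unitization F) (unitization ?C) (unital_extension \<kappa>)"
  proof (rule complete_order_iso_onto_rangeI)
    show "star_vector_space (unitization F)"
      by (rule star_vector_space_unitization[OF star_vector_space_axioms])
    show "lin_map (unitization F) (unitization ?C) (unital_extension \<kappa>)"
      using lin by (auto simp: lin_map_def unitization_sel unital_extension_def)
    show "unital_extension \<kappa> (vzero (unitization F)) = vzero (unitization ?C)"
      by (simp add: unital_extension_def unitization_sel \<kappa>0)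
    show "inj_on (unital_extension \<kappa>) (carrier (unitization F))"
      using inj by (auto simp: inj_on_def unital_extension_def unitization_sel)
    show "cone (unitization F) n \<subseteq> Mat (unitization F) n" for n
      by (auto simp: unitization_def Let_def star_space.defs Mat_sa_def Mat_def)
    show "cone (unitization ?C) n \<subseteq> Mat (unitization ?C) n" for n
      by (auto simp: unitization_def Let_def star_space.defs Mat_sa_def Mat_def)
    fix n :: nat and X assume n: "0 < n" and X: "X \<in> Mat (unitization F) n"
    define x where "x = amplify fst X"
    have xM: "x \<in> Mat F n"
      using X unfolding Mat_def x_def amplify_def unitization_sel mem_Collect_eq
      by (metis fst_conv mem_Times_iff)
    have fs: "amplify fst (amplify (unital_extension \<kappa>) X) = amplify \<kappa> x"
      "amplify snd (amplify (unital_extension \<kappa>) X) = amplify snd X"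
      "snd (amplify (unital_extension \<kappa>) X i j) = snd (X i j)" for i j
      by (simp_all add: amplify_def unital_extension_def x_def)
    have mc: "mat_conj ?C n n R (amplify \<kappa> x) = amplify \<kappa> (mat_conj F n n R x)" for R
      by (rule lin_map_mat_conj[OF star_vector_space_axioms C.star_vector_space_axioms lin xM, symmetric])
    show "X \<in> cone (unitization F) n \<longleftrightarrow> amplify (unital_extension \<kappa>) X \<in> cone (unitization ?C) n"
      unfolding unitization_cone_iff[OF n] unitization_cone[of _ ?C] fs x_def[symmetric] mc sa_iff[OF xM, symmetric]
      using functional[OF n mat_conj_sa] by blast
  qed
  then have "Csharp_extension F Q \<kappa>"
    unfolding Csharp_extension_def using QA iso' cp gen by blast
  then show ?thesis using Q unfolding \<kappa>_def by blast
qed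

end

section \<open>The envelope as a quotient of a concrete algebra\<close>

lemma star_hom_tends_to:
  assumes B: "op_alg B" and A: "cstar_algebra A" and f: "star_hom (op_cstar B) A f"
    and T: "\<And>n. T n \<in> B" "L \<in> B" "T \<longlonglongrightarrow> L"
  shows "cstar_algebra.tends_to A (\<lambda>n. f (T n)) (f L)"
proof -
  interpret A: cstar_algebra A by (rule A)
  note Bs = op_algD(1)[OF B]
  have lin: "f S \<in> carrier A" "f (op_scale c S) = vscale A c (f S)" if "S \<in> B" for c S
    using f that by (auto simp: star_hom_def lin_map_def)
  have add: "f (S + R) = vadd A (f S) (f R)" if "S \<in> B" "R \<in> B" for S R
    using f that by (auto simp: star_hom_def lin_map_def)
  show ?thesis
  proof (rule A.tends_toI)
    show "f (T n) \<in> carrier A" "f L \<in> carrier A" for n using T lin by auto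
    show "(\<lambda>n. norm (T n - L)) \<longlonglongrightarrow> 0" using T(3) tendsto_norm_zero LIM_zero by blast
    fix n
    have eq: "T n - L = T n + op_scale (-1) L" by (simp add: op_scale_minus_one)
    have "vminus A (f (T n)) (f L) = f (T n - L)"
      unfolding eq vminus_def using T by (simp add: add lin op_subspaceD(4)[OF Bs])
    then show "cnorm A (vminus A (f (T n)) (f L)) \<le> norm (T n - L)"
      using star_hom_contractive[OF cstar_algebra_op_cstar[OF B] A f, of "T n - L"] T
      by (simp add: op_subspace_diff[OF Bs])
  qed
qed

lemma op_quotient_imp_star_hom:
  assumes Q: "op_quotient B I A f"
  shows "star_hom (op_cstar B) A f"
  using op_quotientD[OF Q] by (auto simp: star_hom_def lin_map_def)

lemma star_hom_comp: "star_hom A B f \<Longrightarrow> star_hom B C g \<Longrightarrow> star_hom A C (\<lambda>x. g (f x))"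
  by (auto simp: star_hom_def lin_map_def Pi_iff)

text \<open>From R^2 = s^2 follows R (R - s) = - s (R - s), so each column v of R - s has <v, R v> =
  - s |v|^2, which is nonnegative only for v = 0. This matters because \<open>is_inv_sqrt\<close>
  gives \<open>R\<close> only by its properties.\<close>

lemma inverse_sqrt_scalar:
  assumes R: "pos_semidef n R" and s: "s > 0"
    and sq: "\<And>i j. i < n \<Longrightarrow> j < n \<Longrightarrow> (\<Sum>k<n. R i k * R k j) = (if i = j then complex_of_real (s\<^sup>2) else 0)"
    and ij: "i < n" "j < n"
  shows "R i j = (if i = j then complex_of_real s else 0)"
proof -
  define v where "v k = R k j - (if k = j then complex_of_real s else 0)" for k
  have Rv: "(\<Sum>k<n. R i k * v k) = - complex_of_real s * v i" if i: "i < n" for i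
  proof -
    have "(\<Sum>k<n. R i k * v k) = (\<Sum>k<n. R i k * R k j) - (\<Sum>k<n. if k = j then complex_of_real s * R i j else 0)"
      unfolding sum_subtractf[symmetric] by (intro sum.cong) (auto simp: v_def algebra_simps)
    also have "\<dots> = (if i = j then complex_of_real (s\<^sup>2) else 0) - complex_of_real s * R i j"
      using ij by (simp add: sq[OF i ij(2)])
    also have "\<dots> = - complex_of_real s * v i"
      by (simp add: v_def power2_eq_square algebra_simps)
    finally show ?thesis .
  qed
  have "(\<Sum>i<n. \<Sum>k<n. cnj (v i) * R i k * v k) = (\<Sum>i<n. cnj (v i) * (\<Sum>k<n. R i k * v k))"
    by (simp add: sum_distrib_left mult.assoc)
  also have "\<dots> = (\<Sum>i<n. - complex_of_real (s * (cmod (v i))\<^sup>2))"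
  proof (intro sum.cong refl)
    fix i assume "i \<in> {..<n}"
    then have "cnj (v i) * (\<Sum>k<n. R i k * v k) = - (complex_of_real s * (v i * cnj (v i)))"
      by (simp add: Rv)
    then show "cnj (v i) * (\<Sum>k<n. R i k * v k) = - complex_of_real (s * (cmod (v i))\<^sup>2)"
      unfolding of_real_mult complex_norm_square .
  qed
  also have "\<dots> = complex_of_real (- (\<Sum>i<n. s * (cmod (v i))\<^sup>2))" by (simp add: sum_negf)
  finally have eq: "(\<Sum>i<n. \<Sum>k<n. cnj (v i) * R i k * v k) = complex_of_real (- (\<Sum>i<n. s * (cmod (v i))\<^sup>2))" .
  have "(\<Sum>i<n. \<Sum>k<n. cnj (v i) * R i k * v k) \<in> \<real>\<^sub>\<ge>\<^sub>0"
    using R unfolding pos_semidef_def by blast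
  then have "complex_of_real (- (\<Sum>i<n. s * (cmod (v i))\<^sup>2)) \<in> \<real>\<^sub>\<ge>\<^sub>0"
    unfolding eq .
  then have "(\<Sum>i<n. s * (cmod (v i))\<^sup>2) \<le> 0" by (simp add: complex_nonneg_Reals_iff)
  moreover have "s * (cmod (v i))\<^sup>2 \<le> (\<Sum>i<n. s * (cmod (v i))\<^sup>2)"
    using s ij by (intro member_le_sum) auto
  ultimately have "s * (cmod (v i))\<^sup>2 \<le> 0" by simp
  then have "v i = 0" using s by (simp add: mult_le_0_iff)
  then show ?thesis by (simp add: v_def)
qed

definition unit_mat :: "nat \<Rightarrow> complex mat" where
  "unit_mat n = (\<lambda>i j. if i < n \<and> i = j then 1 else 0)"

lemma pos_semidef_scalar:
  assumes "0 \<le> s"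
  shows "pos_semidef n (\<lambda>i j. if i < n \<and> i = j then complex_of_real s else 0)"
  unfolding pos_semidef_def
proof (intro conjI allI impI)
  fix v :: "nat \<Rightarrow> complex"
  have "(\<Sum>i<n. \<Sum>j<n. cnj (v i) * (if i < n \<and> i = j then complex_of_real s else 0) * v j) =
      (\<Sum>i<n. \<Sum>j<n. if j = i then complex_of_real (s * (cmod (v i))\<^sup>2) else 0)"
    by (intro sum.cong refl) (unfold of_real_mult complex_norm_square, auto simp: mult_ac)
  also have "\<dots> = complex_of_real (\<Sum>i<n. s * (cmod (v i))\<^sup>2)" by simp
  finally show "(\<Sum>i<n. \<Sum>j<n. cnj (v i) * (if i < n \<and> i = j then complex_of_real s else 0) * v j) \<in> \<real>\<^sub>\<ge>\<^sub>0"
    using assms by (simp add: sum_nonneg complex_nonneg_Reals_iff)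
qed auto

lemma plus_eps_unit_mat_sum:
  assumes "j < n"
  shows "(\<Sum>k<n. \<Sum>l<n. R i k * R k l * plus_eps \<epsilon> (unit_mat n) l j) =
    complex_of_real (1 + \<epsilon>) * (\<Sum>k<n. R i k * R k j)"
proof -
  have "(\<Sum>k<n. \<Sum>l<n. R i k * R k l * plus_eps \<epsilon> (unit_mat n) l j) =
      (\<Sum>k<n. \<Sum>l<n. if l = j then complex_of_real (1 + \<epsilon>) * (R i k * R k j) else 0)"
    using assms by (intro sum.cong refl) (auto simp: plus_eps_def unit_mat_def)
  then show ?thesis using assms by (simp add: sum_distrib_left)
qed

lemma inv_sqrt_unit_mat:
  assumes \<epsilon>: "\<epsilon> > 0" and R: "is_inv_sqrt n (plus_eps \<epsilon> (unit_mat n)) R" and ij: "i < n" "j < n"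
  shows "R i j = (if i = j then complex_of_real (1 / sqrt (1 + \<epsilon>)) else 0)"
proof (rule inverse_sqrt_scalar[OF _ _ _ ij])
  show "pos_semidef n R" using R by (simp add: is_inv_sqrt_def)
  show "0 < 1 / sqrt (1 + \<epsilon>)" using \<epsilon> by simp
  have sq: "(1 / sqrt (1 + \<epsilon>))\<^sup>2 = 1 / (1 + \<epsilon>)" using \<epsilon> by (simp add: power_divide)
  fix i j assume ij: "i < n" "j < n"
  have "(\<Sum>k<n. \<Sum>l<n. R i k * R k l * plus_eps \<epsilon> (unit_mat n) l j) = (if i = j then 1 else 0)"
    using R ij unfolding is_inv_sqrt_def by blast
  then have "complex_of_real (1 + \<epsilon>) * (\<Sum>k<n. R i k * R k j) = (if i = j then 1 else 0)"
    unfolding plus_eps_unit_mat_sum[OF ij(2)] .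
  moreover have "complex_of_real (1 + \<epsilon>) \<noteq> 0" using \<epsilon> unfolding of_real_eq_0_iff by simp
  ultimately have "(\<Sum>k<n. R i k * R k j) = (if i = j then 1 else 0) / complex_of_real (1 + \<epsilon>)"
    by (subst eq_divide_eq) (simp add: mult.commute)
  also have "\<dots> = (if i = j then complex_of_real ((1 / sqrt (1 + \<epsilon>))\<^sup>2) else 0)"
    unfolding sq by simp
  finally show "(\<Sum>k<n. R i k * R k j) = (if i = j then complex_of_real ((1 / sqrt (1 + \<epsilon>))\<^sup>2) else 0)" .
qed

lemma is_inv_sqrt_unit_mat:
  assumes \<epsilon>: "\<epsilon> > 0"
  shows "is_inv_sqrt n (plus_eps \<epsilon> (unit_mat n)) (\<lambda>i j. if i < n \<and> i = j then complex_of_real (1 / sqrt (1 + \<epsilon>)) else 0)"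
  unfolding is_inv_sqrt_def
proof (intro conjI allI impI)
  show "pos_semidef n (\<lambda>i j. if i < n \<and> i = j then complex_of_real (1 / sqrt (1 + \<epsilon>)) else 0)"
    using \<epsilon> by (intro pos_semidef_scalar) simp
  fix i j assume ij: "i < n" "j < n"
  let ?s = "complex_of_real (1 / sqrt (1 + \<epsilon>))"
  have s: "complex_of_real (1 + \<epsilon>) * (?s * ?s) = 1"
    unfolding of_real_mult[symmetric] using \<epsilon> by simp
  have "(\<Sum>k<n. (if i < n \<and> i = k then ?s else 0) * (if k < n \<and> k = j then ?s else 0)) =
      (\<Sum>k<n. if k = i then (if i = j then ?s * ?s else 0) else 0)"
    using ij by (intro sum.cong refl) auto
  also have "\<dots> = (if i = j then ?s * ?s else 0)" using ij by simp
  finally have S: "(\<Sum>k<n. (if i < n \<and> i = k then ?s else 0) * (if k < n \<and> k = j then ?s else 0)) =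
      (if i = j then ?s * ?s else 0)" .
  show "(\<Sum>k<n. \<Sum>l<n. (if i < n \<and> i = k then ?s else 0) * (if k < n \<and> k = l then ?s else 0) *
      plus_eps \<epsilon> (unit_mat n) l j) = (if i = j then 1 else 0)"
    unfolding plus_eps_unit_mat_sum[OF ij(2), of "\<lambda>i j. if i < n \<and> i = j then ?s else 0"] S
    using s by (cases "i = j") (simp_all only: if_True if_False mult_zero_right refl)
qed

context star_vector_space
begin

lemma vsum_single:
  assumes "i < n" "f i \<in> carrier V" "\<And>k. k < n \<Longrightarrow> k \<noteq> i \<Longrightarrow> f k = vzero V"
  shows "vsum V f n = f i"
proof -
  have z: "vsum V g m = vzero V" if "\<And>k. k < m \<Longrightarrow> g k = vzero V" for g m
    using that by (induction m) (auto simp: add_zero zero_closed)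
  show ?thesis
    using assms
  proof (induction n)
    case (Suc n)
    show ?case
    proof (cases "i = n")
      case True
      then have "vsum V f n = vzero V" using Suc.prems by (intro z) auto
      then show ?thesis using True Suc.prems by (simp add: add_zero)
    next
      case False
      then have "vsum V f n = f i" using Suc by auto
      then show ?thesis using False Suc.prems by (simp add: add_zero_right)
    qed
  qed simp
qed

lemma mat_conj_scalar:
  assumes x: "x \<in> Mat V n" and R: "\<And>i j. i < n \<Longrightarrow> j < n \<Longrightarrow> R i j = (if i = j then complex_of_real s else 0)"
  shows "mat_conj V n n R x = mat_scale V (complex_of_real (s\<^sup>2)) x"
proof (rule ext, rule ext)
  fix i j
  show "mat_conj V n n R x i j = mat_scale V (complex_of_real (s\<^sup>2)) x i j"
  proof (cases "i < n \<and> j < n")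
    case True
    have inner: "vsum V (\<lambda>l. vscale V (R i k * cnj (R j l)) (x k l)) n =
        (if k = i then vscale V (complex_of_real (s\<^sup>2)) (x i j) else vzero V)" if k: "k < n" for k
    proof -
      have "vsum V (\<lambda>l. vscale V (R i k * cnj (R j l)) (x k l)) n = vscale V (R i k * cnj (R j j)) (x k j)"
        using True k by (intro vsum_single) (auto simp: R scale_closed Mat_closed[OF x] scale_zero_left)
      then show ?thesis
        using True k by (auto simp: R scale_zero_left Mat_closed[OF x] power2_eq_square)
    qed
    have "vsum V (\<lambda>k. vsum V (\<lambda>l. vscale V (R i k * cnj (R j l)) (x k l)) n) n =
        vsum V (\<lambda>k. if k = i then vscale V (complex_of_real (s\<^sup>2)) (x i j) else vzero V) n"
      by (rule vsum_cong) (rule inner)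
    also have "\<dots> = vscale V (complex_of_real (s\<^sup>2)) (x i j)"
      using True by (subst vsum_single[of i]) (auto simp: scale_closed Mat_closed[OF x])
    finally show ?thesis using True by (simp add: mat_conj_def mat_scale_def)
  next
    case False
    then have "x i j = vzero V" using x unfolding Mat_def mem_Collect_eq by presburger
    then show ?thesis using False by (auto simp: mat_conj_def mat_scale_def scale_zero_right)
  qed
qed

end

context presentation
begin

text \<open>The equalizer of two star-homomorphisms is a closed star-subalgebra, by their
  continuity, and it contains the generators.\<close>

lemma star_hom_gen_alg_eq:
  assumes A: "cstar_algebra A" and f: "star_hom (op_cstar gen_alg) A f" and g: "star_hom (op_cstar gen_alg) A g"
    and eq: "\<And>x. x \<in> carrier F \<Longrightarrow> f (\<theta> x) = g (\<theta> x)" and T: "T \<in> gen_alg"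
  shows "f T = g T"
proof -
  interpret A: cstar_algebra A by (rule A)
  interpret C: cstar_algebra "op_cstar gen_alg" by (rule cstar_algebra_op_cstar[OF op_alg_gen_alg])
  note B = op_alg_gen_alg and Bs = op_algD(1)[OF op_alg_gen_alg]
  have h: "h 0 = vzero A" "\<And>S. S \<in> gen_alg \<Longrightarrow> h (adj S) = vstar A (h S)"
    "\<And>S c. S \<in> gen_alg \<Longrightarrow> h (op_scale c S) = vscale A c (h S)"
    "\<And>S R. S \<in> gen_alg \<Longrightarrow> R \<in> gen_alg \<Longrightarrow> h (S + R) = vadd A (h S) (h R)"
    "\<And>S R. S \<in> gen_alg \<Longrightarrow> R \<in> gen_alg \<Longrightarrow> h (S o\<^sub>L R) = cmult A (h S) (h R)"
    if "star_hom (op_cstar gen_alg) A h" for h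
    using that lin_map_zero[OF C.star_vector_space_axioms A.star_vector_space_axioms, of h]
    by (auto simp: star_hom_def lin_map_def)
  define D where "D = {S \<in> gen_alg. f S = g S}"
  have "closed D"
    unfolding closed_sequential_limits
  proof (intro allI impI, elim conjE)
    fix S L assume S: "\<forall>n. S n \<in> D" and L: "S \<longlonglongrightarrow> L"
    have SB: "S n \<in> gen_alg" "f (S n) = g (S n)" for n using S by (auto simp: D_def)
    have LB: "L \<in> gen_alg" by (rule closed_sequentially[OF op_algD(3)[OF B] SB(1) L])
    have "A.tends_to (\<lambda>n. f (S n)) (f L)" "A.tends_to (\<lambda>n. f (S n)) (g L)"
      using star_hom_tends_to[OF B A f SB(1) LB L] star_hom_tends_to[OF B A g SB(1) LB L] SB(2) by simp_all
    then have "f L = g L" by (rule A.tends_to_unique)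
    then show "L \<in> D" using LB by (simp add: D_def)
  qed
  moreover have "op_subspace D"
    using op_subspaceD[OF Bs] unfolding op_subspace_def D_def
    by (auto simp: bounded_ops_iff h[OF f] h[OF g])
  moreover have "\<forall>S\<in>D. \<forall>R\<in>D. S o\<^sub>L R \<in> D"
    by (auto simp: D_def h[OF f] h[OF g] op_algD(2)[OF B])
  ultimately have "op_alg D" by (simp add: op_alg_def)
  moreover have "\<theta> ` carrier F \<subseteq> D" using eq rep_gen_alg by (auto simp: D_def)
  ultimately have "gen_alg \<subseteq> D" by (rule gen_alg_least)
  then show ?thesis using T by (auto simp: D_def)
qed

text \<open>Every admissible quotient B/I maps onto the envelope, and the composites from B through
  B/I to A agree on generators, hence on B. So the one map obtained for I = 0 kills all admissible
  ideals.\<close>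

theorem envelope_quotient_map:
  assumes env: "Csharp_envelope F A \<iota>"
  shows "\<exists>\<rho>. star_hom (op_cstar gen_alg) A \<rho> \<and> \<rho> ` gen_alg = carrier A \<and> (\<forall>x\<in>carrier F. \<rho> (\<theta> x) = \<iota> x) \<and>
    (\<forall>I T. admissible I \<longrightarrow> T \<in> I \<longrightarrow> \<rho> T = vzero A)"
proof -
  have A: "cstar_algebra A" using env by (simp add: Csharp_envelope_def Csharp_extension_def)
  interpret A: cstar_algebra A by (rule A)
  have ex: "\<exists>\<rho>. star_hom (op_cstar gen_alg) A \<rho> \<and> \<rho> ` gen_alg = carrier A \<and> (\<forall>x\<in>carrier F. \<rho> (\<theta> x) = \<iota> x) \<and>
    (\<forall>T\<in>I. \<rho> T = vzero A)" if I: "admissible I" for I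
  proof -
    obtain Q :: "'x extension_carrier cstar" and f where Q: "op_quotient gen_alg I Q f"
      and ext: "Csharp_extension F Q (\<lambda>x. f (\<theta> x))"
      using quotient_extension[OF I] by blast
    have QA: "cstar_algebra Q" using ext by (simp add: Csharp_extension_def)
    interpret Q: cstar_algebra Q by (rule QA)
    obtain \<sigma> where \<sigma>: "star_hom Q A \<sigma>" "\<sigma> ` carrier Q = carrier A" "\<forall>x\<in>carrier F. \<sigma> (f (\<theta> x)) = \<iota> x"
      using env ext unfolding Csharp_envelope_def by blast
    have "\<sigma> (f T) = vzero A" if T: "T \<in> I" for T
    proof -
      have "T \<in> gen_alg" using T op_idealD(2)[OF op_quotientD(2)[OF Q]] by blast
      then have "f T = vzero Q"
        using op_quotientD(5)[OF Q, of T 0] T op_subspaceD(2)[OF op_algD(1)[OF op_alg_gen_alg]]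
        by (simp add: op_quotientD(4)[OF Q])
      moreover have "lin_map Q A \<sigma>" using \<sigma>(1) by (simp add: star_hom_def)
      ultimately show ?thesis
        using lin_map_zero[OF Q.star_vector_space_axioms A.star_vector_space_axioms, of \<sigma>] by simp
    qed
    moreover have "(\<lambda>T. \<sigma> (f T)) ` gen_alg = carrier A"
      using \<sigma>(2) op_quotientD(3)[OF Q] by (simp add: image_image)
    ultimately show ?thesis
      using star_hom_comp[OF op_quotient_imp_star_hom[OF Q] \<sigma>(1)] \<sigma>(3)
      by (intro exI[of _ "\<lambda>T. \<sigma> (f T)"]) blast
  qed
  obtain \<rho> where \<rho>: "star_hom (op_cstar gen_alg) A \<rho>" "\<rho> ` gen_alg = carrier A" "\<forall>x\<in>carrier F. \<rho> (\<theta> x) = \<iota> x"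
    using ex[OF admissible_zero] by blast
  have "\<rho> T = vzero A" if I: "admissible I" and T: "T \<in> I" for I T
  proof -
    obtain \<rho>' where \<rho>': "star_hom (op_cstar gen_alg) A \<rho>'" "\<forall>x\<in>carrier F. \<rho>' (\<theta> x) = \<iota> x" "\<rho>' T = vzero A"
      using ex[OF I] T by blast
    have "T \<in> gen_alg" using I T by (auto simp: admissible_def dest: op_idealD(2))
    then have "\<rho> T = \<rho>' T" using star_hom_gen_alg_eq[OF A \<rho>(1) \<rho>'(1)] \<rho>(3) \<rho>'(2) by simp
    then show ?thesis using \<rho>'(3) by simp
  qed
  then show ?thesis using \<rho> by blast
qed

text \<open>The unit matrix turns the order isomorphism of the partial unitizations into enough states.\<close>

lemma extension_separating:
  assumes extn: "Csharp_extension F C \<kappa>" and st: "\<And>x. x \<in> carrier F \<Longrightarrow> \<kappa> (vstar F x) = vstar C (\<kappa> x)"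
    and n: "0 < n" and x: "x \<in> Mat_sa F n" and np: "\<not> op_pos (id_blinfun + op_mat n (amplify \<theta> x))"
  shows "\<exists>\<psi>. norm_one_positive_functional (operator_space_of_cstar C) n \<psi> \<and> Re (\<psi> (amplify \<kappa> x)) < -1"
proof -
  let ?C = "operator_space_of_cstar C"
  have CA: "cstar_algebra C" and lin: "lin_map F ?C \<kappa>"
    and iso: "complete_order_iso_onto_range (unitization F) (unitization ?C) (unital_extension \<kappa>)"
    using extn by (auto simp: Csharp_extension_def completely_isometric_def)
  interpret C: star_vector_space ?C by (rule star_vector_space_op_space_cstar[OF CA])
  have \<kappa>0: "\<kappa> (vzero F) = vzero C"
    using lin_map_zero[OF star_vector_space_axioms C.star_vector_space_axioms lin] by simp
  have xM: "x \<in> Mat F n" using x by (simp add: Mat_sa_def)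
  have clx: "clin (op_mat n (amplify \<theta> x))" by (rule clin_rep_mat[OF xM])
  obtain \<xi> where \<xi>: "norm \<xi> = 1" "Re (cinner \<xi> (op_mat n (amplify \<theta> x) \<xi>)) < -1"
    using not_op_pos_vector[OF clx adj_rep_mat[OF x] np] by blast
  define q where "q = Re (cinner \<xi> (op_mat n (amplify \<theta> x) \<xi>))"
  \<comment> \<open>Half the gap below -1: conjugation by the inverse root of (1 + \<epsilon>) 1
    divides by 1 + \<epsilon>, and q / (1 + \<epsilon>) is still below -1.\<close>
  define \<epsilon> where "\<epsilon> = (- 1 - q) / 2"
  have \<epsilon>: "\<epsilon> > 0" and q\<epsilon>: "q < - (1 + \<epsilon>)" using \<xi>(2) unfolding \<epsilon>_def q_def by (simp_all add: field_simps)
  define X where "X i j = (x i j, unit_mat n i j)" for i j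
  have X: "amplify fst X = x" "amplify snd X = unit_mat n" "snd (X i j) = unit_mat n i j" for i j
    by (simp_all add: amplify_def X_def)
  define R where "R = (\<lambda>i j. if i < n \<and> i = j then complex_of_real (1 / sqrt (1 + \<epsilon>)) else 0)"
  have conj: "mat_conj F n n R x = mat_scale F (complex_of_real (1 / (1 + \<epsilon>))) x"
    using mat_conj_scalar[OF xM, of R "1 / sqrt (1 + \<epsilon>)"] \<epsilon> by (simp add: R_def power_divide)
  have "\<not> op_pos (id_blinfun + op_mat n (amplify \<theta> (mat_conj F n n R x)))"
  proof
    assume P: "op_pos (id_blinfun + op_mat n (amplify \<theta> (mat_conj F n n R x)))"
    have "amplify \<theta> (mat_conj F n n R x) = (\<lambda>i j. op_scale (complex_of_real (1 / (1 + \<epsilon>))) (amplify \<theta> x i j))"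
      unfolding conj by (simp add: amplify_def mat_scale_def rep_scale Mat_closed[OF xM])
    then have "op_mat n (amplify \<theta> (mat_conj F n n R x)) = op_scale (complex_of_real (1 / (1 + \<epsilon>))) (op_mat n (amplify \<theta> x))"
      by (simp only: op_mat_op_scale)
    then have "op_mat n (amplify \<theta> (mat_conj F n n R x)) = (1 / (1 + \<epsilon>)) *\<^sub>R op_mat n (amplify \<theta> x)"
      by (simp only: op_scale_of_real)
    then have "0 \<le> 1 + q / (1 + \<epsilon>)"
      using op_posD[OF P, of \<xi>] \<xi>(1)
      by (simp add: blinfun.add_left blinfun.scaleR_left cinner.add_right cinner.scaleR_right cinner_norm q_def)
    then have "- (1 + \<epsilon>) \<le> q" using \<epsilon> by (simp add: field_simps)
    then show False using q\<epsilon> by simp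
  qed
  then have "X \<notin> cone (unitization F) n"
    unfolding unitization_cone_iff[OF n] X using is_inv_sqrt_unit_mat[OF \<epsilon>, of n] \<epsilon> unfolding R_def by blast
  moreover have XM: "X \<in> Mat (unitization F) n"
    using xM unfolding Mat_def unitization_sel X_def unit_mat_def mem_Collect_eq by auto
  ultimately have notin: "amplify (unital_extension \<kappa>) X \<notin> cone (unitization ?C) n"
    using complete_order_iso_onto_range_cone[OF star_vector_space_unitization[OF star_vector_space_axioms] iso n]
    by blast
  have \<kappa>M: "amplify \<kappa> x \<in> Mat C n"
    using lin_map_Mat[OF star_vector_space_axioms C.star_vector_space_axioms lin xM] by simp
  have "amplify \<kappa> (mat_star F n x) = mat_star C n (amplify \<kappa> x)"
    by (rule ext, rule ext) (simp add: amplify_def mat_star_def st Mat_closed[OF xM] \<kappa>0)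
  then have sa: "amplify \<kappa> x \<in> Mat_sa ?C n" using x \<kappa>M by (simp add: Mat_sa_def)
  have fs: "amplify fst (amplify (unital_extension \<kappa>) X) = amplify \<kappa> x"
    "amplify snd (amplify (unital_extension \<kappa>) X) = unit_mat n"
    "snd (amplify (unital_extension \<kappa>) X i j) = unit_mat n i j" for i j
    by (simp_all add: amplify_def unital_extension_def X_def)
  have "pos_semidef n (unit_mat n)" using pos_semidef_scalar[of 1 n] unfolding unit_mat_def of_real_1 by simp
  moreover have "\<forall>i j. \<not> (i < n \<and> j < n) \<longrightarrow> unit_mat n i j = 0" by (simp add: unit_mat_def)
  ultimately obtain \<delta> R' \<psi> where \<delta>: "\<delta> > 0" and R': "is_inv_sqrt n (plus_eps \<delta> (unit_mat n)) R'"
    and \<psi>: "norm_one_positive_functional ?C n \<psi>" and less: "Re (\<psi> (mat_conj ?C n n R' (amplify \<kappa> x))) < -1"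
    using notin sa unfolding unitization_cone fs by force
  have "mat_conj ?C n n R' (amplify \<kappa> x) = mat_scale C (complex_of_real (1 / (1 + \<delta>))) (amplify \<kappa> x)"
    using C.mat_conj_scalar[of "amplify \<kappa> x" n R' "1 / sqrt (1 + \<delta>)"] inv_sqrt_unit_mat[OF \<delta> R'] \<kappa>M \<delta>
    by (simp add: power_divide)
  moreover have "\<psi> (mat_scale C (complex_of_real (1 / (1 + \<delta>))) (amplify \<kappa> x)) = complex_of_real (1 / (1 + \<delta>)) * \<psi> (amplify \<kappa> x)"
    using \<psi> \<kappa>M by (simp add: norm_one_positive_functional_def)
  \<comment> \<open>The size of \<open>\<delta>\<close> is unknown but harmless: multiplying by 1 +
    \<delta> only lowers the value.\<close>
  ultimately have "Re (\<psi> (amplify \<kappa> x)) / (1 + \<delta>) < -1" using less by (simp add: Re_divide_of_real)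
  then have "Re (\<psi> (amplify \<kappa> x)) < - (1 + \<delta>)" using \<delta> by (simp add: divide_less_eq)
  then have "Re (\<psi> (amplify \<kappa> x)) < -1" using \<delta> by simp
  then show ?thesis using \<psi> by blast
qed

end

section \<open>The propagation number as a density condition\<close>

lemma cstar_subalgebra_carrier:
  assumes "cstar_algebra A"
  shows "cstar_subalgebra A (carrier A)"
proof -
  interpret cstar_algebra A by (rule assms)
  show ?thesis
    by (auto simp: cstar_subalgebra_def lin_subspace_def cstar_closure_def zero_closed add_closed
        scale_closed mult_closed star_closed)
qed

context presentation
begin

definition word_dense :: "'h op set \<Rightarrow> nat \<Rightarrow> bool" where
  "word_dense I k \<longleftrightarrow> gen_alg \<subseteq> closure {S + J | S J. S \<in> word_sums k \<and> J \<in> I}"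

text \<open>The map onto the envelope carries word sums to spans of products, and norms in
  \<open>A\<close> are distances to the kernel, so closures can be compared in B. A closed
  subalgebra containing the generators is all of \<open>A\<close>, which turns being a C*-algebra
  into density; \<open>1 \<le> k\<close> puts the generators inside.\<close>

theorem propagation_word_dense:
  assumes extn: "Csharp_extension F A \<iota>" and \<rho>: "star_hom (op_cstar gen_alg) A \<rho>" and onto: "\<rho> ` gen_alg = carrier A"
    and \<rho>\<iota>: "\<And>x. x \<in> carrier F \<Longrightarrow> \<rho> (\<theta> x) = \<iota> x" and k: "1 \<le> k"
  shows "cstar_subalgebra A (product_closure A (\<iota> ` carrier F) k) \<longleftrightarrow> word_dense {T \<in> gen_alg. \<rho> T = vzero A} k"
proof -
  have AA: "cstar_algebra A" and gen: "cstar_generated A (\<iota> ` carrier F) = carrier A"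
    using extn by (auto simp: Csharp_extension_def)
  interpret A: cstar_algebra A by (rule AA)
  note B = op_alg_gen_alg and Bs = op_algD(1)[OF op_alg_gen_alg]
  define I where "I = {T \<in> gen_alg. \<rho> T = vzero A}"
  have Q: "op_quotient gen_alg I A \<rho>" unfolding I_def by (rule op_quotient_star_hom[OF B AA \<rho> onto])
  note qd = op_quotientD[OF Q]
  define X where "X = {nonempty_product A x xs | x xs. set (x # xs) \<subseteq> \<iota> ` carrier F \<and> length (x # xs) \<le> k}"
  have prod: "nonempty_product A (\<iota> x) (map \<iota> w) = \<rho> (word_op \<theta> (x # w))" if "set (x # w) \<subseteq> carrier F" for x w
    using that
  proof (induction w arbitrary: x)
    case Nil then show ?case by (simp add: \<rho>\<iota>)
  next
    case (Cons y w)
    have "y # w \<in> word_set" using Cons.prems by (simp add: word_set_def)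
    then have "word_op \<theta> (y # w) \<in> gen_alg" by (rule word_sums_gen_alg[OF word_sums.word[OF _ order_refl]])
    moreover have "\<theta> x \<in> gen_alg" using Cons.prems rep_gen_alg by auto
    ultimately show ?case using Cons by (simp add: qd(9)[symmetric] \<rho>\<iota>)
  qed
  have X: "X = \<rho> ` word_op \<theta> ` {w \<in> word_set. length w \<le> k}"
  proof (intro equalityI subsetI)
    fix a assume "a \<in> X"
    then obtain y ys where y: "a = nonempty_product A y ys" "set (y # ys) \<subseteq> \<iota> ` carrier F" "length (y # ys) \<le> k"
      by (auto simp: X_def)
    have "y # ys \<in> lists (\<iota> ` carrier F)" using y(2) unfolding in_lists_conv_set by blast
    then obtain v where vl: "v \<in> lists (carrier F)" and v2: "y # ys = map \<iota> v"
      unfolding lists_image by (elim imageE)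
    have "set v \<subseteq> carrier F" using vl by (auto simp: in_lists_conv_set)
    note v = this v2
    obtain x w where "v = x # w" using v2 by (cases v) simp_all
    then have "a = \<rho> (word_op \<theta> v)" "v \<in> word_set"
      using y(1) v prod[of x w] by (simp_all add: word_set_def)
    moreover have "length v \<le> k" using y(3) v(2) by (metis length_map)
    ultimately show "a \<in> \<rho> ` word_op \<theta> ` {w \<in> word_set. length w \<le> k}" by blast
  next
    fix a assume "a \<in> \<rho> ` word_op \<theta> ` {w \<in> word_set. length w \<le> k}"
    then obtain w where w: "w \<in> word_set" "length w \<le> k" "a = \<rho> (word_op \<theta> w)" by blast
    then obtain x v where "w = x # v" by (cases w) (auto simp: word_set_def)
    then show "a \<in> X"
      unfolding X_def using w prod[of x v]
      by (intro CollectI exI[of _ "\<iota> x"] exI[of _ "map \<iota> v"]) (auto simp: word_set_def)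
  qed
  have span: "lin_span A X = \<rho> ` word_sums k"
  proof (rule antisym)
    have "lin_subspace A (\<rho> ` word_sums k)"
      unfolding lin_subspace_def
    proof (intro conjI ballI allI)
      show "\<rho> ` word_sums k \<subseteq> carrier A" using word_sums_gen_alg by (auto simp: qd(3))
      show "vzero A \<in> \<rho> ` word_sums k" using word_sums.zero by (auto simp: qd(4))
      fix p c assume "p \<in> \<rho> ` word_sums k"
      then obtain S where S: "S \<in> word_sums k" "p = \<rho> S" by blast
      show "vscale A c p \<in> \<rho> ` word_sums k"
        using S word_sums_gen_alg[OF S(1)] op_subspaceD(4)[OF op_subspace_word_sums S(1), of c] by (simp add: qd(7))
      fix q assume "q \<in> \<rho> ` word_sums k"
      then obtain T where T: "T \<in> word_sums k" "q = \<rho> T" by blast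
      show "vadd A p q \<in> \<rho> ` word_sums k"
        using S T word_sums_gen_alg[OF S(1)] word_sums_gen_alg[OF T(1)] word_sums.add[OF S(1) T(1)]
        by (simp add: qd(6))
    qed
    moreover have "X \<subseteq> \<rho> ` word_sums k"
      unfolding X using word_sums.word by blast
    ultimately show "lin_span A X \<subseteq> \<rho> ` word_sums k" unfolding lin_span_def by blast
    show "\<rho> ` word_sums k \<subseteq> lin_span A X"
      unfolding lin_span_def
    proof (intro Inter_greatest subsetI)
      fix S a assume "S \<in> {S. lin_subspace A S \<and> X \<subseteq> S}" and "a \<in> \<rho> ` word_sums k"
      then obtain T where S: "lin_subspace A S" "X \<subseteq> S" and T: "T \<in> word_sums k" "a = \<rho> T" by blast
      have "\<rho> T \<in> S"
        using T(1)
      proof (rule word_sums.induct)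
        show "\<rho> 0 \<in> S" using S(1) qd(4) by (simp add: lin_subspace_def)
        show "\<rho> (word_op \<theta> w) \<in> S" if "w \<in> word_set" "length w \<le> k" for w
          using S(2) that unfolding X by blast
        fix U V assume "\<rho> U \<in> S" "\<rho> V \<in> S" "U \<in> word_sums k" "V \<in> word_sums k"
        then show "\<rho> (U + V) \<in> S"
          using S(1) word_sums_gen_alg qd(6)[symmetric] by (simp add: lin_subspace_def)
      qed
      then show "a \<in> S" using T(2) by simp
    qed
  qed
  have PC: "product_closure A (\<iota> ` carrier F) k = cstar_closure A (\<rho> ` word_sums k)"
    unfolding product_closure_def X_def[symmetric] span ..
  have nrm: "cnorm A (vminus A (\<rho> T) (\<rho> S)) = infdist (T - S) I" if "T \<in> gen_alg" "S \<in> gen_alg" for S T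
    using that by (simp add: op_quotient_minus[OF Q] op_quotient_norm[OF Q AA] op_subspace_diff[OF Bs])
  have ne: "I \<noteq> {}" using op_subspaceD(2)[OF op_idealD(1)[OF qd(2)]] by blast
  let ?W = "{S + J | S J. S \<in> word_sums k \<and> J \<in> I}"
  \<comment> \<open>Being closer than \<open>\<epsilon>\<close> modulo the kernel means that some
    kernel element corrects the difference to within \<open>\<epsilon>\<close>.\<close>
  have mem: "\<rho> T \<in> cstar_closure A (\<rho> ` word_sums k) \<longleftrightarrow> T \<in> closure ?W" if T: "T \<in> gen_alg" for T
  proof -
    have "(infdist (T - S) I < \<epsilon>) \<longleftrightarrow> (\<exists>J\<in>I. dist (S + J) T < \<epsilon>)" for S \<epsilon>
    proof -
      have d: "dist (T - S) J = dist (S + J) T" for J by (simp add: dist_norm norm_minus_commute algebra_simps)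
      show ?thesis
      proof
        show "\<exists>J\<in>I. dist (S + J) T < \<epsilon>" if "infdist (T - S) I < \<epsilon>"
          using infdist_less_attained[OF ne that] by (simp add: d)
        show "infdist (T - S) I < \<epsilon>" if "\<exists>J\<in>I. dist (S + J) T < \<epsilon>"
          using that infdist_le[of _ I "T - S"] d by (metis order_le_less_trans)
      qed
    qed
    then have "(\<rho> T \<in> cstar_closure A (\<rho> ` word_sums k)) \<longleftrightarrow>
        (\<forall>\<epsilon>>0. \<exists>S\<in>word_sums k. \<exists>J\<in>I. dist (S + J) T < \<epsilon>)"
      unfolding cstar_closure_def using T nrm[OF T word_sums_gen_alg] by (simp add: qd(3))
    then show ?thesis unfolding closure_approachable by blast
  qed
  have "word_dense I k \<longleftrightarrow> carrier A \<subseteq> cstar_closure A (\<rho> ` word_sums k)"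
    unfolding word_dense_def qd(3) using mem by blast
  also have "\<dots> \<longleftrightarrow> cstar_subalgebra A (cstar_closure A (\<rho> ` word_sums k))"
  proof
    assume "carrier A \<subseteq> cstar_closure A (\<rho> ` word_sums k)"
    then have "cstar_closure A (\<rho> ` word_sums k) = carrier A" by (auto simp: cstar_closure_def)
    then show "cstar_subalgebra A (cstar_closure A (\<rho> ` word_sums k))"
      using cstar_subalgebra_carrier[OF AA] by simp
  next
    assume sub: "cstar_subalgebra A (cstar_closure A (\<rho> ` word_sums k))"
    have "\<iota> ` carrier F \<subseteq> cstar_closure A (\<rho> ` word_sums k)"
    proof (intro subsetI, elim imageE)
      fix a x assume a: "a = \<iota> x" and x: "x \<in> carrier F"
      have "[x] \<in> word_set" using x by (simp add: word_set_def)
      then have b: "\<theta> x \<in> word_sums k" using word_sums.word[of "[x]" k] k by simp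
      show "a \<in> cstar_closure A (\<rho> ` word_sums k)"
        unfolding a \<rho>\<iota>[OF x, symmetric] mem[OF word_sums_gen_alg[OF b]]
        using b op_subspaceD(2)[OF op_idealD(1)[OF qd(2)]]
        by (intro subsetD[OF closure_subset] CollectI exI[of _ "\<theta> x"] exI[of _ 0]) simp
    qed
    then have "cstar_generated A (\<iota> ` carrier F) \<subseteq> cstar_closure A (\<rho> ` word_sums k)"
      using sub unfolding cstar_generated_def by blast
    then show "carrier A \<subseteq> cstar_closure A (\<rho> ` word_sums k)" using gen by simp
  qed
  finally show ?thesis unfolding PC I_def ..
qed

end

section \<open>Unital operator systems\<close>

lemma op_space_system_sel [simp]:
  "carrier (operator_space_of_system E e) = carrier E" "vzero (operator_space_of_system E e) = vzero E"
  "vadd (operator_space_of_system E e) = vadd E" "vscale (operator_space_of_system E e) = vscale E"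
  "vstar (operator_space_of_system E e) = vstar E" "cone (operator_space_of_system E e) = cone E"
  "mnorm (operator_space_of_system E e) = order_mnorm E e"
  by (simp_all add: operator_space_of_system_def ordered_space.defs)

lemma mat_op_space_system [simp]:
  "Mat (operator_space_of_system E e) n = Mat E n" "mat_star (operator_space_of_system E e) n = mat_star E n"
  "Mat_sa (operator_space_of_system E e) n = Mat_sa E n"
  by (simp_all add: Mat_def mat_star_def Mat_sa_def fun_eq_iff)

lemma concrete_sel [simp]:
  "carrier (concrete_operator_space S) = S" "vzero (concrete_operator_space S) = 0"
  "vadd (concrete_operator_space S) = (+)" "vscale (concrete_operator_space S) = op_scale"
  "vstar (concrete_operator_space S) = adj"
  by (simp_all add: concrete_operator_space_def Let_def star_space.defs op_adjoint_eq)

lemma Mat_sa_cong: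
  "carrier V = carrier W \<Longrightarrow> vzero V = vzero W \<Longrightarrow> vstar V = vstar W \<Longrightarrow> Mat_sa V n = Mat_sa W n"
  by (simp add: Mat_sa_def Mat_def mat_star_def cong: if_cong)

lemma concrete_cone:
  "cone (concrete_operator_space S) n =
    {X \<in> Mat_sa (concrete_operator_space S) n. op_pos (op_mat n X)}"
proof -
  define U where "U = \<lparr>carrier = S, vzero = 0, vadd = (+), vscale = op_scale, vstar = op_adjoint\<rparr>"
  have "Mat_sa (concrete_operator_space S) n = Mat_sa U n"
    by (rule Mat_sa_cong) (simp_all add: U_def op_adjoint_eq)
  then show ?thesis
    unfolding op_pos_op_mat
    by (simp add: concrete_operator_space_def Let_def star_space.defs flip: U_def)
qed

lemma concrete_mnorm: "mnorm (concrete_operator_space S) n X = norm (op_mat n X)"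
  unfolding norm_op_mat_eq by (simp add: concrete_operator_space_def Let_def star_space.defs)

lemma concrete_Mat: "Mat (concrete_operator_space S) n = op_mats S n"
  by (simp add: Mat_def op_mats_def)

lemma concrete_mat_star: "X \<in> op_mats S n \<Longrightarrow> mat_star (concrete_operator_space S) n X = op_mat_adj X"
  by (intro HOL.ext) (auto simp: mat_star_def op_mat_adj_def op_mats_outside)

abbreviation diag :: "nat \<Rightarrow> 'h::complex_hilbert op \<Rightarrow> 'h op mat" where
  "diag n x \<equiv> \<lambda>i j. if i < n \<and> i = j then x else 0"

lemma sum_lessThan_add: "(\<Sum>i<n + m. f i) = (\<Sum>i<n. f i) + (\<Sum>i<m. f (n + i :: nat))"
  for f :: "nat \<Rightarrow> 'a::comm_monoid_add"
  by (induction m) (auto simp: add.assoc)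

lemma norm_ell2_fin_sq: "(norm (ell2_fin n v))\<^sup>2 = (\<Sum>i<n. (norm (v i))\<^sup>2)"
  by (simp add: norm_ell2_fin L2_set_def sum_nonneg)

text \<open>The quadratic form of the block matrix at (a, b) is t |a|^2 + t |b|^2 + 2 Re <a, M b>.
  The equivalence identifies \<open>order_mnorm\<close> with the operator norm in a
  realization.\<close>

lemma block_op_pos_iff:
  assumes X: "\<And>i j. i < n \<Longrightarrow> j < n \<Longrightarrow> clin (X i j)" and t: "0 \<le> t"
  shows "op_pos (op_mat (2 * n) (mat_block n (diag n (t *\<^sub>R id_blinfun)) X
      (\<lambda>i j. if i < n \<and> j < n then adj (X j i) else 0) (diag n (t *\<^sub>R id_blinfun))))
    \<longleftrightarrow> norm (op_mat n X) \<le> t"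
  (is "op_pos (op_mat (2 * n) ?B) \<longleftrightarrow> _")
proof -
  define M where "M = op_mat n X"
  let ?a = "\<lambda>v. ell2_fin n v" and ?b = "\<lambda>v. ell2_fin n (\<lambda>i. v (n + i))"
  let ?Q = "\<lambda>v. t * (norm (?a v))\<^sup>2 + t * (norm (?b v))\<^sup>2 + 2 * Re (cinner (?a v) (M (?b v)))"
  have form: "(\<Sum>i<2*n. \<Sum>j<2*n. cinner (v i) (?B i j (v j))) =
      complex_of_real (?Q v)" for v
  proof -
    define a where "a = ell2_fin n v"
    define b where "b = ell2_fin n (\<lambda>i. v (n + i))"
    have diag: "(\<Sum>i<n. \<Sum>j<n. cinner (w i) (diag n (t *\<^sub>R id_blinfun) i j (w j)))
        = complex_of_real (t * (norm (ell2_fin n w))\<^sup>2)" for w :: "nat \<Rightarrow> 'a"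
    proof -
      have "(\<Sum>i<n. \<Sum>j<n. cinner (w i) (diag n (t *\<^sub>R id_blinfun) i j (w j))) =
        (\<Sum>i<n. \<Sum>j<n. if j = i then complex_of_real (t * (norm (w i))\<^sup>2) else 0)"
        by (intro sum.cong refl) (auto simp: blinfun.scaleR_left cinner.scaleR_right cinner_norm scaleR_conv_of_real)
      then show ?thesis unfolding norm_ell2_fin_sq by (simp add: sum_distrib_left)
    qed
    have off: "(\<Sum>i<n. \<Sum>j<n. cinner (v i) (X i j (v (n + j)))) = cinner a (M b)"
      unfolding M_def a_def b_def cinner_op_mat by (simp add: ell2_fin_nth)
    have off': "(\<Sum>i<n. \<Sum>j<n. cinner (v (n + i)) (blinfun_apply (if i < n \<and> j < n then adj (X j i) else 0) (v j))) = cnj (cinner a (M b))"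
    proof -
      have "(\<Sum>i<n. \<Sum>j<n. cinner (v (n + i)) (blinfun_apply (if i < n \<and> j < n then adj (X j i) else 0) (v j))) =
          (\<Sum>i<n. \<Sum>j<n. cnj (cinner (v j) (X j i (v (n + i)))))"
        by (intro sum.cong refl) (simp add: cinner_adj_right X cinner_commute[symmetric])
      also have "\<dots> = cnj (cinner a (M b))"
        unfolding off[symmetric] cnj_sum by (rule sum.swap)
      finally show ?thesis .
    qed
    have "(\<Sum>i<2*n. \<Sum>j<2*n. cinner (v i) (?B i j (v j))) =
       ((\<Sum>i<n. \<Sum>j<n. cinner (v i) (diag n (t *\<^sub>R id_blinfun) i j (v j))) +
        (\<Sum>i<n. \<Sum>j<n. cinner (v (n + i)) (blinfun_apply (if i < n \<and> j < n then adj (X j i) else 0) (v j)))) +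
       ((\<Sum>i<n. \<Sum>j<n. cinner (v i) (X i j (v (n + j)))) +
        (\<Sum>i<n. \<Sum>j<n. cinner (v (n + i)) (diag n (t *\<^sub>R id_blinfun) i j (v (n + j)))))"
      unfolding mult_2 sum_lessThan_add sum.distrib
      by (intro arg_cong2[of _ _ _ _ "(+)"] sum.cong refl) (auto simp: mat_block_def)
    also have "\<dots> = complex_of_real (t * (norm a)\<^sup>2) + cnj (cinner a (M b)) + (cinner a (M b) + complex_of_real (t * (norm b)\<^sup>2))"
      unfolding off off' diag[of v] diag[of "\<lambda>i. v (n + i)"] a_def b_def ..
    also have "\<dots> = complex_of_real (t * (norm a)\<^sup>2 + t * (norm b)\<^sup>2 + 2 * Re (cinner a (M b)))"
      using complex_add_cnj[of "cinner a (M b)"] by (simp add: algebra_simps)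
    finally show ?thesis unfolding a_def b_def .
  qed
  have "op_pos (op_mat (2 * n) ?B) \<longleftrightarrow> (\<forall>v. 0 \<le> ?Q v)"
    unfolding op_pos_op_mat form by (simp add: complex_nonneg_Reals_iff del: of_real_add of_real_mult)
  also have "\<dots> \<longleftrightarrow> norm M \<le> t"
  proof
    assume L: "\<forall>v. 0 \<le> ?Q v"
    show "norm M \<le> t"
    proof (rule norm_blinfun_bound[OF t])
      fix \<xi> :: "'a ell2"
      \<comment> \<open>\<open>M\<close> sees only the first \<open>n\<close> coordinates, so
        \<open>\<xi>\<close> may be truncated.\<close>
      define b where "b = ell2_fin n (ell2_nth \<xi>)"
      have Mb: "M \<xi> = M b"
        unfolding M_def b_def by (rule ell2_eqI) (simp add: op_mat_nth ell2_fin_nth)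
      have nb: "norm b \<le> norm \<xi>" unfolding b_def norm_ell2_fin by (rule L2_set_le_norm_ell2)
      show "norm (M \<xi>) \<le> t * norm \<xi>"
      proof (cases "M b = 0")
        case False
        \<comment> \<open>Makes c M b a vector of norm |b| pointing opposite to M b, the worst case
          for the form.\<close>
        define c where "c = - (norm b / norm (M b))"
        define v where "v i = (if i < n then c *\<^sub>R ell2_nth (M b) i else ell2_nth \<xi> (i - n))" for i
        have v1: "ell2_fin n v = c *\<^sub>R M b"
          by (rule ell2_eqI) (simp add: ell2_fin_nth v_def nth_scaleR M_def op_mat_nth)
        have v2: "ell2_fin n (\<lambda>i. v (n + i)) = b" by (simp add: v_def b_def)
        have "0 \<le> t * (norm (c *\<^sub>R M b))\<^sup>2 + t * (norm b)\<^sup>2 + 2 * Re (cinner (c *\<^sub>R M b) (M b))"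
          using L[rule_format, of v] unfolding v1 v2 .
        also have "norm (c *\<^sub>R M b) = norm b" using False by (simp add: c_def)
        also have "Re (cinner (c *\<^sub>R M b) (M b)) = - (norm b * norm (M b))"
          unfolding cinner.scaleR_left using False by (simp add: cinner_norm c_def power2_eq_square)
        finally have "norm b * norm (M b) \<le> norm b * (t * norm b)" by (simp add: power2_eq_square mult_ac)
        moreover have "norm b > 0" using False by (auto simp: blinfun.zero_right)
        ultimately have "norm (M b) \<le> t * norm b" by simp
        also have "\<dots> \<le> t * norm \<xi>" using nb t by (rule mult_left_mono)
        finally show ?thesis unfolding Mb .
      qed (use t Mb in simp)
    qed
  next
    assume R: "norm M \<le> t"
    show "\<forall>v. 0 \<le> ?Q v"
    proof
      fix v :: "nat \<Rightarrow> 'a"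
      define a where "a = ell2_fin n v"
      define b where "b = ell2_fin n (\<lambda>i. v (n + i))"
      have "- Re (cinner a (M b)) \<le> norm a * norm (M b)"
        using Re_cinner_le_norm[of "- a" "M b"] by (simp add: cinner.minus_left)
      also have "\<dots> \<le> norm a * (t * norm b)"
        by (rule mult_left_mono[OF order_trans[OF norm_blinfun mult_right_mono[OF R norm_ge_zero]] norm_ge_zero])
      finally have "- Re (cinner a (M b)) \<le> norm a * (t * norm b)" .
      moreover have "t * (2 * norm a * norm b) = 2 * (norm a * (t * norm b))" by (simp only: mult_ac)
      ultimately have "- (2 * Re (cinner a (M b))) \<le> t * (2 * norm a * norm b)" by linarith
      also have "\<dots> \<le> t * ((norm a)\<^sup>2 + (norm b)\<^sup>2)"
        using t by (intro mult_left_mono sum_squares_bound)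
      finally show "0 \<le> ?Q v"
        unfolding a_def[symmetric] b_def[symmetric] distrib_left by linarith
    qed
  qed
  finally show ?thesis unfolding M_def .
qed

text \<open>\<open>id_blinfun\<close> is the identity in all coordinates, while the unit of the
  matrix algebra occupies only the first \<open>n\<close>; restricting the vectors to these
  coordinates passes from one to the other.\<close>

lemma op_pos_id_add_imp:
  assumes P: "op_pos (id_blinfun + op_mat n X)"
  shows "op_pos (op_mat n (\<lambda>i j. X i j + (diag n id_blinfun i j)))"
  unfolding op_pos_op_mat
proof
  fix v :: "nat \<Rightarrow> 'a"
  have "(\<Sum>i<n. \<Sum>j<n. cinner (v i) (diag n id_blinfun i j (v j))) =
      (\<Sum>i<n. \<Sum>j<n. if j = i then cinner (v i) (v i) else 0)"
    by (intro sum.cong refl) auto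
  also have "\<dots> = cinner (ell2_fin n v) (ell2_fin n v)"
    by (simp add: cinner_ell2_fin ell2_fin_nth)
  finally have "(\<Sum>i<n. \<Sum>j<n. cinner (v i) (blinfun_apply (X i j + (diag n id_blinfun i j)) (v j))) =
      cinner (ell2_fin n v) ((id_blinfun + op_mat n X) (ell2_fin n v))"
    by (simp add: blinfun.add_left cinner.add_right sum.distrib cinner_op_mat ell2_fin_nth add.commute)
  then show "(\<Sum>i<n. \<Sum>j<n. cinner (v i) (blinfun_apply (X i j + (diag n id_blinfun i j)) (v j))) \<in> \<real>\<^sub>\<ge>\<^sub>0"
    using P by (simp add: op_pos_def)
qed

lemma norm_op_mat_diag_id: "norm (op_mat n (diag n id_blinfun)) \<le> 1"
proof (rule norm_blinfun_bound)
  fix v :: "'a ell2"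
  have "op_mat n (diag n id_blinfun) v = ell2_fin n (ell2_nth v)"
  proof (rule ell2_eqI)
    fix i
    have "(\<Sum>j<n. diag n id_blinfun i j (ell2_nth v j)) =
        (\<Sum>j<n. if j = i then ell2_nth v i else 0)" if "i < n"
      using that by (intro sum.cong refl) auto
    then show "ell2_nth (op_mat n (diag n id_blinfun) v) i = ell2_nth (ell2_fin n (ell2_nth v)) i"
      by (simp add: op_mat_nth ell2_fin_nth)
  qed
  then show "norm (op_mat n (diag n id_blinfun) v) \<le> 1 * norm v"
    using L2_set_le_norm_ell2[of v n] by (simp add: norm_ell2_fin)
qed simp

text \<open>Order and involution come from the realization, the norms from
  \<open>block_op_pos_iff\<close>, and the unit matrix serves as approximate unit.\<close>

theorem unital_presentation:
  fixes \<pi> :: "'a \<Rightarrow> 'h::complex_hilbert op"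
  assumes E: "unital_operator_system E e" and \<pi>: "realization E e \<pi>"
  shows "presentation (operator_space_of_system E e) \<pi>"
proof -
  interpret E: unital_operator_system E e by (rule E)
  let ?S = "\<pi> ` carrier E"
  let ?C = "concrete_operator_space ?S"
  have clin: "clin (\<pi> x)" and star: "\<pi> (vstar E x) = adj (\<pi> x)" if "x \<in> carrier E" for x
    using \<pi> that by (auto simp: realization_def bounded_ops_iff op_adjoint_eq)
  have unit: "\<pi> e = id_blinfun" using \<pi> by (simp add: realization_def)
  have iso: "bij_betw \<pi> (carrier E) ?S" "completely_positive E ?C \<pi>" "completely_positive ?C E (inv_into (carrier E) \<pi>)"
    using \<pi> by (auto simp: realization_def complete_order_iso_def)
  have inj: "inj_on \<pi> (carrier E)" using iso(1) by (simp add: bij_betw_def)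
  have add: "\<pi> (vadd E x y) = \<pi> x + \<pi> y" if "x \<in> carrier E" "y \<in> carrier E" for x y
    using iso(2) that by (simp add: completely_positive_def lin_map_def)
  have scale: "\<pi> (vscale E c x) = op_scale c (\<pi> x)" if "x \<in> carrier E" for x c
    using iso(2) that by (simp add: completely_positive_def lin_map_def)
  have zero: "\<pi> (vzero E) = 0" using scale[OF E.zero_closed, of 0] by (simp add: E.scale_zero_right)
  have mats: "amplify \<pi> X \<in> op_mats ?S n" if "X \<in> Mat E n" for X n
    using that by (auto simp: Mat_def op_mats_def amplify_def zero split: if_splits)
  have cone_iff: "X \<in> cone E n \<longleftrightarrow> op_pos (op_mat n (amplify \<pi> X))" if n: "0 < n" and X: "X \<in> Mat_sa E n" for n X
  proof
    assume "X \<in> cone E n"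
    then have "amplify \<pi> X \<in> cone ?C n" using iso(2) n by (simp add: completely_positive_def)
    then show "op_pos (op_mat n (amplify \<pi> X))" by (simp add: concrete_cone)
  next
    assume P: "op_pos (op_mat n (amplify \<pi> X))"
    have XM: "X \<in> Mat E n" "mat_star E n X = X" using X by (auto simp: Mat_sa_def)
    have "op_mat_adj (amplify \<pi> X) = amplify \<pi> (mat_star E n X)"
    proof (rule HOL.ext, rule HOL.ext)
      fix i j
      have "\<not> (j < n \<and> i < n) \<Longrightarrow> X j i = vzero E" using XM(1) unfolding Mat_def mem_Collect_eq by metis
      then show "op_mat_adj (amplify \<pi> X) i j = amplify \<pi> (mat_star E n X) i j"
        by (auto simp: op_mat_adj_def amplify_def mat_star_def star E.Mat_closed[OF XM(1)] zero)
    qed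
    then have "amplify \<pi> X \<in> cone ?C n"
      using P mats[OF XM(1)] XM(2) by (simp add: concrete_cone Mat_sa_def concrete_Mat concrete_mat_star)
    then have "amplify (inv_into (carrier E) \<pi>) (amplify \<pi> X) \<in> cone E n"
      using iso(3) n by (simp add: completely_positive_def)
    moreover have "amplify (inv_into (carrier E) \<pi>) (amplify \<pi> X) = X"
      using inj E.Mat_closed[OF XM(1)] by (simp add: amplify_def)
    ultimately show "X \<in> cone E n" by simp
  qed
  have diagM: "mat_diag E n (vscale E c e) \<in> Mat E n" for n c
    by (auto simp: Mat_def mat_diag_def E.scale_closed E.unit_closed E.zero_closed)
  have norm_eq: "order_mnorm E e n X = norm (op_mat n (amplify \<pi> X))" if n: "0 < n" and X: "X \<in> Mat E n" for n X
  proof -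
    have iff: "mat_block n (mat_diag E n (vscale E (complex_of_real t) e)) X (mat_star E n X)
          (mat_diag E n (vscale E (complex_of_real t) e)) \<in> cone E (2 * n) \<longleftrightarrow> norm (op_mat n (amplify \<pi> X)) \<le> t"
      if t: "0 \<le> t" for t
    proof -
      let ?D = "mat_diag E n (vscale E (complex_of_real t) e)"
      let ?M = "mat_block n ?D X (mat_star E n X) ?D"
      have X0: "\<And>i j. \<not> (i < n \<and> j < n) \<Longrightarrow> X i j = vzero E" using X unfolding Mat_def mem_Collect_eq by presburger
      have se: "vscale E (complex_of_real t) e \<in> carrier E" "vstar E (vscale E (complex_of_real t) e) = vscale E (complex_of_real t) e"
        by (simp_all add: E.scale_closed E.unit_closed E.star_scale E.unit_selfadjoint)
      have MM: "?M \<in> Mat E (2 * n)"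
        unfolding Mat_def mem_Collect_eq mat_block_def
        by (auto simp: mat_diag_def mat_star_def X0 E.Mat_closed[OF X] E.star_closed E.zero_closed E.scale_closed E.unit_closed)
      have "mat_star E (2 * n) ?M = ?M"
      proof (rule HOL.ext, rule HOL.ext)
        fix i j
        show "mat_star E (2 * n) ?M i j = ?M i j"
          using E.star_star[OF E.Mat_closed[OF X]]
          by (auto simp: mat_star_def mat_block_def mat_diag_def se E.star_zero X0)
      qed
      then have sa: "?M \<in> Mat_sa E (2 * n)" using MM by (simp add: Mat_sa_def)
      have "op_mat (2 * n) (amplify \<pi> ?M) = op_mat (2 * n) (mat_block n (diag n (t *\<^sub>R id_blinfun)) (amplify \<pi> X)
          (\<lambda>i j. if i < n \<and> j < n then adj (amplify \<pi> X j i) else 0) (diag n (t *\<^sub>R id_blinfun)))"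
        by (rule op_mat_cong)
          (auto simp: amplify_def mat_block_def mat_diag_def mat_star_def scale E.unit_closed unit op_scale_of_real zero star E.Mat_closed[OF X])
      then show ?thesis
        using cone_iff[OF _ sa] n block_op_pos_iff[of n "amplify \<pi> X" t] t clin E.Mat_closed[OF X]
        by (simp add: amplify_def)
    qed
    have "order_mnorm E e n X = Inf {t. 0 \<le> t \<and> norm (op_mat n (amplify \<pi> X)) \<le> t}"
      unfolding order_mnorm_def Let_def using iff by (intro arg_cong[of _ _ Inf]) blast
    also have "\<dots> = norm (op_mat n (amplify \<pi> X))"
      by (rule cInf_eq_minimum) auto
    finally show ?thesis .
  qed
  show ?thesis
  proof (intro presentation.intro presentation_axioms.intro)
    show "star_vector_space (operator_space_of_system E e)"
      by unfold_locales (auto simp: E.zero_closed E.add_closed E.scale_closed E.star_closed E.add_assoc E.add_zero E.add_minus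
        E.scale_one E.scale_scale E.scale_add_left E.scale_add_right E.star_star E.star_add E.star_scale intro: E.add_commute)
    show "inj_on \<pi> (carrier (operator_space_of_system E e))" using inj by simp
    fix n :: nat and X assume n: "0 < n"
    show "cone (operator_space_of_system E e) n =
        {X \<in> Mat_sa (operator_space_of_system E e) n. op_pos (op_mat n (amplify \<pi> X))}"
      using cone_iff[OF n] E.cone_selfadjoint[OF n] by auto
    show "mnorm (operator_space_of_system E e) n X = norm (op_mat n (amplify \<pi> X))"
      if "X \<in> Mat (operator_space_of_system E e) n" using norm_eq[OF n] that by simp
    fix \<delta> :: real
    assume X: "X \<in> Mat_sa (operator_space_of_system E e) n" and P: "op_pos (id_blinfun + op_mat n (amplify \<pi> X))"
      and \<delta>: "0 < \<delta>"
    have XM: "X \<in> Mat E n" "mat_star E n X = X" using X by (auto simp: Mat_sa_def)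
    define Z where "Z = mat_diag E n e"
    have ZM: "Z \<in> Mat E n" using diagM[of n 1] by (simp add: Z_def E.scale_one E.unit_closed)
    have Z\<pi>: "amplify \<pi> Z = (diag n id_blinfun)"
      by (simp add: Z_def amplify_def mat_diag_def unit zero if_distrib[of \<pi>] cong: if_cong)
    \<comment> \<open>U = X + 1 is positive, and X - U + Z vanishes identically, so any \<delta>
      will do.\<close>
    define U where "U = mat_add E X Z"
    have UM: "U \<in> Mat E n" unfolding U_def by (rule E.mat_add_closed[OF XM(1) ZM])
    have "mat_star E n Z = Z" by (intro HOL.ext) (auto simp: mat_star_def Z_def mat_diag_def E.unit_selfadjoint E.star_zero)
    moreover have "mat_star E n U = mat_add E (mat_star E n X) (mat_star E n Z)"
      by (rule HOL.ext, rule HOL.ext)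
        (simp add: mat_star_def U_def mat_add_def E.star_add E.Mat_closed[OF XM(1)] E.Mat_closed[OF ZM] E.add_zero E.zero_closed)
    ultimately have Usa: "U \<in> Mat_sa E n" using UM XM(2) by (simp add: Mat_sa_def U_def)
    have U\<pi>: "amplify \<pi> U = (\<lambda>i j. amplify \<pi> X i j + (diag n id_blinfun i j))"
      unfolding Z\<pi>[THEN fun_cong, THEN fun_cong, symmetric]
      by (simp add: U_def amplify_def mat_add_def add E.Mat_closed[OF XM(1)] E.Mat_closed[OF ZM])
    have "U \<in> cone E n"
      using cone_iff[OF n Usa] op_pos_id_add_imp[OF P] by (simp add: U\<pi>)
    moreover have "order_mnorm E e n Z \<le> 1"
      unfolding norm_eq[OF n ZM] Z\<pi> by (rule norm_op_mat_diag_id)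
    moreover have "(\<lambda>i j. \<pi> (X i j) - \<pi> (U i j) + \<pi> (Z i j)) = (\<lambda>i j. 0)"
      by (simp add: U_def mat_add_def add E.Mat_closed[OF XM(1)] E.Mat_closed[OF ZM])
    then have "norm (op_mat n (\<lambda>i j. \<pi> (X i j) - \<pi> (U i j) + \<pi> (Z i j))) \<le> \<delta>"
      using \<delta> by (simp add: op_mat_zero)
    ultimately show "\<exists>Z\<in>Mat (operator_space_of_system E e) n. \<exists>U\<in>cone (operator_space_of_system E e) n.
        mnorm (operator_space_of_system E e) n Z \<le> 1 \<and> norm (op_mat n (\<lambda>i j. \<pi> (X i j) - \<pi> (U i j) + \<pi> (Z i j))) \<le> \<delta>"
      using ZM by auto
  qed (auto simp: clin star add scale)
qed

section \<open>Hilbert space tensor products\<close>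

definition orthonormal :: "'l::complex_hilbert set \<Rightarrow> bool" where
  "orthonormal G \<longleftrightarrow> finite G \<and> (\<forall>g\<in>G. \<forall>h\<in>G. cinner g h = (if g = h then 1 else 0))"

definition projection :: "'l::complex_hilbert set \<Rightarrow> 'l \<Rightarrow> 'l" where
  "projection G a = (\<Sum>g\<in>G. cscale (cinner g a) g)"

lemma cinner_projection:
  assumes "orthonormal G" "g \<in> G"
  shows "cinner g (projection G a) = cinner g a"
proof -
  have "cinner g (projection G a) = (\<Sum>h\<in>G. if h = g then cinner g a else 0)"
    unfolding projection_def cinner.sum_right
    using assms by (intro sum.cong refl) (auto simp: cinner_scale_right orthonormal_def)
  then show ?thesis using assms by (simp add: orthonormal_def)
qed

lemma projection_add: "projection G (a + b) = projection G a + projection G b"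
  by (simp add: projection_def cinner.add_right cscale_add_left sum.distrib)

lemma projection_diff: "projection G (a - b) = projection G a - projection G b"
  using projection_add[of G "a - b" b] by simp

lemma projection_cscale: "projection G (cscale c a) = cscale c (projection G a)"
  by (simp add: projection_def cinner_scale_right cscale_sum_right cscale_cscale)

lemma projection_zero: "projection G 0 = 0"
  by (simp add: projection_def)

lemma norm_sub_projection:
  assumes G: "orthonormal G"
  shows "(norm (a - projection G a))\<^sup>2 = (norm a)\<^sup>2 - (norm (projection G a))\<^sup>2"
proof -
  have 1: "cinner (projection G a) b = cinner (projection G a) (projection G b)" for b
    unfolding projection_def[of G a] cinner.sum_left cinner_scale_left
    by (intro sum.cong refl) (simp add: cinner_projection[OF G])
  have 2: "cinner (projection G a) a = cinner (projection G a) (projection G a)" by (rule 1)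
  have 3: "cinner a (projection G a) = cinner (projection G a) (projection G a)"
    unfolding cinner_commute[of a "projection G a"] 2 by (rule cinner_commute[symmetric])
  show ?thesis by (simp add: norm_sq_cinner cinner.diff_left cinner.diff_right 2 3)
qed

lemma norm_sub_projection_le: "orthonormal G \<Longrightarrow> norm (a - projection G a) \<le> norm a"
  by (rule power2_le_imp_le) (simp_all add: norm_sub_projection)

text \<open>Gram-Schmidt: the residue of the new vector is normalized and adjoined, unless it
  vanishes.\<close>

lemma orthonormal_exists:
  assumes "finite W"
  shows "\<exists>G. orthonormal G \<and> (\<forall>w\<in>W. projection G w = w)"
  using assms
proof (induction W)
  case empty then show ?case by (intro exI[of _ "{}"]) (simp add: orthonormal_def)
next
  case (insert x W)
  then obtain G where G: "orthonormal G" "\<forall>w\<in>W. projection G w = w" by blast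
  define r where "r = x - projection G x"
  show ?case
  proof (cases "r = 0")
    case True
    then show ?thesis using G by (intro exI[of _ G]) (auto simp: r_def)
  next
    case False
    define e where "e = cscale (complex_of_real (1 / norm r)) r"
    have ge: "cinner g e = 0" if "g \<in> G" for g
      using cinner_projection[OF G(1) that, of x] by (simp add: e_def r_def cinner_scale_right cinner.diff_right)
    have eg: "cinner e g = 0" if "g \<in> G" for g
      unfolding cinner_commute[of e g] ge[OF that] by simp
    have ee: "cinner e e = 1"
      unfolding e_def cinner_scale_left cinner_scale_right using False by (simp add: cinner_norm power2_eq_square)
    have eG: "e \<notin> G" using ge ee by force
    have fin: "finite G" using G(1) by (simp add: orthonormal_def)
    have on: "orthonormal (insert e G)"
      using G(1) ge eg ee by (auto simp: orthonormal_def)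
    have pr: "projection (insert e G) a = cscale (cinner e a) e + projection G a" for a
      using fin eG by (simp add: projection_def)
    have eproj: "cinner e (projection G a) = 0" for a
      unfolding projection_def cinner.sum_right by (simp add: cinner_scale_right eg)
    have "projection (insert e G) w = w" if "w \<in> W" for w
      using G(2) that eproj[of w] by (simp add: pr)
    moreover have "projection (insert e G) x = x"
    proof -
      have "cinner e x = cinner e r" using eproj[of x] by (simp add: r_def cinner.diff_right)
      also have "\<dots> = complex_of_real (norm r)"
        using False by (simp add: e_def cinner_scale_left cinner_norm power2_eq_square)
      finally have "cscale (cinner e x) e = r"
        using False by (simp add: e_def cscale_cscale)
      then show ?thesis by (simp add: pr r_def)
    qed
    ultimately show ?thesis using on by (intro exI[of _ "insert e G"]) auto
  qed
qed

text \<open>\<open>G n\<close> fixes the first n + 1 members of a dense sequence; since id minus a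
  projection is contractive, strong convergence follows for all vectors.\<close>

lemma approximating_projections:
  assumes "separable_infinite_dimensional (UNIV :: 'l::complex_hilbert set)"
  shows "\<exists>G. (\<forall>n::nat. orthonormal (G n)) \<and> (\<forall>a::'l. (\<lambda>n. projection (G n) a) \<longlonglongrightarrow> a)"
proof -
  obtain D :: "'l set" where D: "countable D" "closure D = UNIV"
    using assms by (auto simp: separable_infinite_dimensional_def)
  then have ne: "D \<noteq> {}" by auto
  define d where "d = from_nat_into D"
  have dD: "range d = D" unfolding d_def by (rule range_from_nat_into[OF ne D(1)])
  have "\<exists>G. orthonormal G \<and> (\<forall>w\<in>d ` {..n}. projection G w = w)" for n :: nat
    by (rule orthonormal_exists) simp
  then obtain G where G: "\<And>n. orthonormal (G n)" "\<And>n k. k \<le> n \<Longrightarrow> projection (G n) (d k) = d k"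
    by (metis atMost_iff imageI)
  have "(\<lambda>n. projection (G n) a) \<longlonglongrightarrow> a" for a
  proof (rule LIMSEQ_I)
    fix e :: real assume "e > 0"
    have "a \<in> closure (range d)" using D(2) dD by simp
    then obtain k where k: "dist (d k) a < e" using \<open>e > 0\<close> unfolding closure_approachable by blast
    show "\<exists>no. \<forall>n\<ge>no. norm (projection (G n) a - a) < e"
    proof (intro exI[of _ k] allI impI)
      fix n assume "n \<ge> k"
      then have eq: "a - projection (G n) a = (a - d k) - projection (G n) (a - d k)"
        using G(2) by (simp add: projection_diff)
      have "norm (a - projection (G n) a) \<le> norm (a - d k)"
        unfolding eq by (rule norm_sub_projection_le[OF G(1)])
      then show "norm (projection (G n) a - a) < e" using k by (simp add: dist_norm norm_minus_commute)
    qed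
  qed
  then show ?thesis using G(1) by blast
qed

section \<open>Elementary tensors of vectors and operators\<close>

lemma hilbert_tensorD:
  assumes "hilbert_tensor t"
  shows "t (u + u') v = t u v + t u' v" "t u (v + v') = t u v + t u v'" "t (cscale c u) v = cscale c (t u v)"
    "t u (cscale c v) = cscale c (t u v)" "cinner (t u v) (t u' v') = cinner u u' * cinner v v'"
    "closure (span {t u v | u v. True}) = UNIV"
  using assms unfolding hilbert_tensor_def by blast+

lemma hilbert_tensor_flip:
  assumes "hilbert_tensor t"
  shows "hilbert_tensor (\<lambda>v u. t u v)"
proof -
  have "{t u v | v u. True} = {t u v | u v. True}" by blast
  then show ?thesis using assms unfolding hilbert_tensor_def by (simp add: mult.commute)
qed

locale tensor_product =
  fixes t :: "'h::complex_hilbert \<Rightarrow> 'l::complex_hilbert \<Rightarrow> 'k::complex_hilbert"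
  assumes tensor: "hilbert_tensor t"
begin

lemmas t_add_left = hilbert_tensorD(1)[OF tensor]
  and t_add_right = hilbert_tensorD(2)[OF tensor]
  and t_scale_left = hilbert_tensorD(3)[OF tensor]
  and t_scale_right = hilbert_tensorD(4)[OF tensor]
  and cinner_t = hilbert_tensorD(5)[OF tensor]
  and t_dense = hilbert_tensorD(6)[OF tensor]

lemma norm_t: "norm (t u v) = norm u * norm v"
proof -
  have "complex_of_real ((norm (t u v))\<^sup>2) = complex_of_real ((norm u * norm v)\<^sup>2)"
    unfolding cinner_norm[symmetric] cinner_t by (simp add: cinner_norm power_mult_distrib)
  then show ?thesis by (simp add: power2_eq_iff_nonneg del: of_real_power of_real_mult)
qed

lemma t_zero_left: "t 0 v = 0" and t_zero_right: "t u 0 = 0"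
  using norm_t[of 0 v] norm_t[of u 0] by simp_all

lemma t_sum_left: "t (\<Sum>i\<in>I. f i) v = (\<Sum>i\<in>I. t (f i) v)"
  by (induction I rule: infinite_finite_induct) (auto simp: t_zero_left t_add_left)

lemma t_sum_right: "t u (\<Sum>i\<in>I. f i) = (\<Sum>i\<in>I. t u (f i))"
  by (induction I rule: infinite_finite_induct) (auto simp: t_zero_right t_add_right)

lemma t_diff_right: "t u (v - w) = t u v - t u w"
  using t_add_right[of u "v - w" w] by simp

lemma t_scaleR_left: "t (r *\<^sub>R u) v = r *\<^sub>R t u v"
  by (simp add: scaleR_cscale t_scale_left)

text \<open>The operator V_a of the overview.\<close>

definition creation :: "'l \<Rightarrow> ('h \<Rightarrow>\<^sub>L 'k)" where
  "creation a = Blinfun (\<lambda>u. t u a)"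

lemma creation_apply: "blinfun_apply (creation a) u = t u a"
proof -
  have "bounded_linear (\<lambda>u. t u a)"
    by (rule bounded_linear_intro[where K = "norm a"]) (simp_all add: t_add_left t_scaleR_left norm_t)
  then show ?thesis by (simp add: creation_def bounded_linear_Blinfun_apply)
qed

lemma clin_creation: "clin (creation a)"
  by (simp add: clin_def creation_apply t_scale_left)

lemma norm_creation_le: "norm (creation a) \<le> norm a"
  by (rule norm_blinfun_bound) (simp_all add: creation_apply norm_t mult.commute)

lemma creation_diff: "creation (a - b) = creation a - creation b"
proof (rule blinfun_eqI)
  fix u
  have "t u (a - b) + t u b = t u a" using t_add_right[of u "a - b" b] by simp
  then show "creation (a - b) u = (creation a - creation b) u"
    by (simp add: creation_apply blinfun.diff_left eq_diff_eq)
qed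

lemma adj_creation_t: "adj (creation a) (t u b) = cscale (cinner a b) u"
  by (rule cinner_ext) (simp add: cinner_adj_right clin_creation creation_apply cinner_t cinner_scale_right mult.commute)

lemma adj_creation_creation: "adj (creation a) o\<^sub>L creation b = op_scale (cinner a b) id_blinfun"
  by (rule blinfun_eqI) (simp add: creation_apply adj_creation_t)

text \<open>x tensor the rank one operator sending v to <b, v> a, factored through the first
  space.\<close>

definition elem :: "'l \<Rightarrow> 'h op \<Rightarrow> 'l \<Rightarrow> 'k op" where
  "elem a x b = creation a o\<^sub>L (x o\<^sub>L adj (creation b))"

lemma elem_t: "clin x \<Longrightarrow> elem a x b (t u v) = cscale (cinner b v) (t (x u) a)"
  by (simp add: elem_def creation_apply adj_creation_t clinD t_scale_left)

lemma clin_elem: "clin x \<Longrightarrow> clin (elem a x b)"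
  by (simp add: elem_def clin_comp clin_creation clin_adj)

lemma adj_elem: "clin x \<Longrightarrow> adj (elem a x b) = elem b (adj x) a"
  by (simp add: elem_def adj_comp clin_comp clin_creation clin_adj adj_adj comp_assoc)

lemma elem_add: "elem a (x + y) b = elem a x b + elem a y b"
  by (simp add: elem_def comp_simps)

lemma elem_zero: "elem a 0 b = 0"
  by (simp add: elem_def)

lemma elem_op_scale: "elem a (op_scale c x) b = op_scale c (elem a x b)"
  by (rule blinfun_eqI) (simp add: elem_def creation_apply t_scale_left)

lemma norm_elem_le: "norm (elem a x b) \<le> norm a * (norm x * norm b)"
proof -
  have "norm (adj (creation b)) \<le> norm b" using norm_creation_le[of b] by (simp add: norm_adj clin_creation)
  then have "norm (x o\<^sub>L adj (creation b)) \<le> norm x * norm b"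
    by (intro order_trans[OF norm_blinfun_compose] mult_left_mono) auto
  then show ?thesis
    unfolding elem_def
    by (intro order_trans[OF norm_blinfun_compose mult_mono[OF norm_creation_le]]) auto
qed

lemma creation_elem_creation:
  "clin x \<Longrightarrow> adj (creation a) o\<^sub>L (elem b x c o\<^sub>L creation d) = op_scale (cinner a b * cinner c d) x"
  by (rule blinfun_eqI)
    (simp add: elem_def creation_apply adj_creation_t clinD t_scale_left cscale_cscale mult.commute
      clinD[OF clin_adj[OF clin_creation]])

lemma elem_comp:
  assumes "clin x"
  shows "elem a x b o\<^sub>L elem c y d = op_scale (cinner b c) (elem a (x o\<^sub>L y) d)"
proof -
  have "elem a x b o\<^sub>L elem c y d =
      creation a o\<^sub>L (x o\<^sub>L ((adj (creation b) o\<^sub>L creation c) o\<^sub>L (y o\<^sub>L adj (creation d))))"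
    by (simp add: elem_def comp_assoc)
  also have "\<dots> = op_scale (cinner b c) (elem a (x o\<^sub>L y) d)"
    using assms
    by (simp add: adj_creation_creation comp_op_scale_left comp_op_scale_right clin_creation elem_def comp_assoc)
      (rule blinfun_eqI, simp add: clinD[OF clin_creation] clinD[OF assms])
  finally show ?thesis .
qed

lemma ops_eq_on_t:
  assumes "clin R" "clin S" "\<And>u v. R (t u v) = S (t u v)"
  shows "R = S"
proof (rule blinfun_eqI)
  fix w
  have "{w. R w = S w} = UNIV"
  proof -
    have "span {t u v | u v. True} \<subseteq> {w. R w = S w}"
    proof
      fix w assume "w \<in> span {t u v | u v. True}"
      then show "w \<in> {w. R w = S w}"
        by (induction rule: span_induct_alt)
          (auto simp: blinfun.add_right blinfun.scaleR_right blinfun.zero_right assms(3))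
    qed
    moreover have "closed {w. R w = S w}"
      by (intro closed_Collect_eq linear_continuous_on blinfun.bounded_linear_right)
    ultimately have "closure (span {t u v | u v. True}) \<subseteq> {w. R w = S w}" by (rule closure_minimal)
    then show ?thesis using t_dense by auto
  qed
  then show "R w = S w" by blast
qed

lemma op_tensor_eq:
  assumes "z \<in> bounded_ops" "\<And>u v. blinfun_apply z (t u v) = t (blinfun_apply x u) (blinfun_apply y v)"
  shows "op_tensor t x y = z"
  unfolding op_tensor_def
proof (rule the_equality)
  fix z' assume "z' \<in> bounded_ops \<and> (\<forall>u v. blinfun_apply z' (t u v) = t (blinfun_apply x u) (blinfun_apply y v))"
  then show "z' = z" using assms by (intro ops_eq_on_t) (auto simp: bounded_ops_iff)
qed (use assms in blast)

text \<open>All second legs are expanded in one common orthonormal family and the coefficients moved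
  to the first legs; the norm of such a sum is then given by Pythagoras in
  \<open>norm_orthonormal_sum\<close>.\<close>

lemma span_orthonormal:
  assumes "w \<in> span {t u v | u v. True}"
  shows "\<exists>G u. orthonormal G \<and> w = (\<Sum>g\<in>G. t (u g) g)"
  using assms
proof (induction rule: span_induct_alt)
  case base
  show ?case by (intro exI[of _ "{}"] exI[of _ "\<lambda>_. 0"]) (simp add: orthonormal_def)
next
  case (step c x y)
  then obtain G u where G: "orthonormal G" "y = (\<Sum>g\<in>G. t (u g) g)" by blast
  obtain p q where x: "x = t p q" using step by blast
  have "finite (insert q G)" using G(1) by (simp add: orthonormal_def)
  then obtain H where H: "orthonormal H" "\<forall>w\<in>insert q G. projection H w = w"
    using orthonormal_exists by blast
  have ex: "t u a = (\<Sum>h\<in>H. t (cscale (cinner h a) u) h)" if "projection H a = a" for u a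
  proof -
    have "t u a = t u (projection H a)" using that by simp
    then show ?thesis by (simp add: projection_def t_sum_right t_scale_left t_scale_right)
  qed
  have "y = (\<Sum>g\<in>G. \<Sum>h\<in>H. t (cscale (cinner h g) (u g)) h)"
    unfolding G(2) using H(2) by (intro sum.cong refl ex) auto
  also have "\<dots> = (\<Sum>h\<in>H. t (\<Sum>g\<in>G. cscale (cinner h g) (u g)) h)"
    unfolding t_sum_left by (rule sum.swap)
  finally have y: "y = (\<Sum>h\<in>H. t (\<Sum>g\<in>G. cscale (cinner h g) (u g)) h)" .
  have "c *\<^sub>R x = t (c *\<^sub>R p) q" by (simp add: x t_scaleR_left)
  also have "\<dots> = (\<Sum>h\<in>H. t (cscale (cinner h q) (c *\<^sub>R p)) h)" using H(2) by (intro ex) auto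
  finally have "c *\<^sub>R x + y = (\<Sum>h\<in>H. t (cscale (cinner h q) (c *\<^sub>R p) + (\<Sum>g\<in>G. cscale (cinner h g) (u g))) h)"
    unfolding y t_add_left sum.distrib by simp
  then show ?case using H(1)
    by (intro exI[of _ H] exI[of _ "\<lambda>h. cscale (cinner h q) (c *\<^sub>R p) + (\<Sum>g\<in>G. cscale (cinner h g) (u g))"]) simp
qed

lemma norm_orthonormal_sum:
  assumes G: "orthonormal G"
  shows "(norm (\<Sum>g\<in>G. t (u g) g))\<^sup>2 = (\<Sum>g\<in>G. (norm (u g))\<^sup>2)"
proof -
  have fin: "finite G" using G by (simp add: orthonormal_def)
  have "cinner (\<Sum>g\<in>G. t (u g) g) (\<Sum>g\<in>G. t (u g) g) = (\<Sum>g\<in>G. \<Sum>h\<in>G. cinner (u g) (u h) * cinner g h)"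
    by (simp add: cinner.sum_left cinner.sum_right cinner_t) (rule sum.swap)
  also have "\<dots> = (\<Sum>g\<in>G. \<Sum>h\<in>G. if h = g then cinner (u g) (u g) else 0)"
    using G by (intro sum.cong refl) (auto simp: orthonormal_def)
  also have "\<dots> = (\<Sum>g\<in>G. cinner (u g) (u g))" using fin by simp
  finally show ?thesis by (simp add: norm_sq_cinner)
qed

lemma norm_le_of_span:
  assumes "C \<ge> 0" "\<And>w. w \<in> span {t u v | u v. True} \<Longrightarrow> norm (blinfun_apply z w) \<le> C * norm w"
  shows "norm z \<le> C"
proof (rule norm_blinfun_bound[OF assms(1)])
  fix w
  have "closed {w. norm (blinfun_apply z w) \<le> C * norm w}"
    by (intro closed_Collect_le continuous_intros linear_continuous_on blinfun.bounded_linear_right)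
  then have "closure (span {t u v | u v. True}) \<subseteq> {w. norm (blinfun_apply z w) \<le> C * norm w}"
    using assms(2) by (intro closure_minimal) auto
  then show "norm (blinfun_apply z w) \<le> C * norm w" using t_dense by auto
qed

lemma norm_tensor_id_le:
  assumes "\<And>u v. blinfun_apply z (t u v) = t u (blinfun_apply y v)"
  shows "w \<in> span {t u v | u v. True} \<Longrightarrow> norm (blinfun_apply z w) \<le> norm y * norm w"
proof -
  assume "w \<in> span {t u v | u v. True}"
  then have w: "w \<in> span {t u v | v u. True}" by (rule back_subst[of "\<lambda>S. w \<in> span S"]) blast
  \<comment> \<open>After exchanging the factors the legs in the first space can be made
    orthonormal, and \<open>y\<close> acts on the free coefficients.\<close>
  interpret flip: tensor_product "\<lambda>v u. t u v" by unfold_locales (rule hilbert_tensor_flip[OF tensor])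
  obtain H v where H: "orthonormal H" "w = (\<Sum>h\<in>H. t h (v h))" using flip.span_orthonormal[OF w] by blast
  have zw: "z w = (\<Sum>h\<in>H. t h (y (v h)))" unfolding H(2) blinfun.sum_right assms ..
  have "(norm (z w))\<^sup>2 = (\<Sum>h\<in>H. (norm (y (v h)))\<^sup>2)"
    unfolding zw by (rule flip.norm_orthonormal_sum[OF H(1)])
  also have "\<dots> \<le> (\<Sum>h\<in>H. (norm y)\<^sup>2 * (norm (v h))\<^sup>2)"
    unfolding power_mult_distrib[symmetric] by (intro sum_mono power_mono norm_blinfun) simp
  also have "\<dots> = (norm y * norm w)\<^sup>2"
    using flip.norm_orthonormal_sum[OF H(1), of v] by (simp add: H(2) power_mult_distrib sum_distrib_left)
  finally show "norm (z w) \<le> norm y * norm w" by (rule power2_le_imp_le) simp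
qed

text \<open>x tensor y is estimated in two stages: x acts on the first legs while the second are
  orthonormal, then \<open>z'\<close>, which is 1 tensor y. The stage x tensor 1 appears only on the
  algebraic span, as the vector \<open>w2\<close>.\<close>

lemma norm_tensor_le:
  assumes z': "\<And>u v. blinfun_apply z' (t u v) = t u (blinfun_apply y v)"
    and z: "\<And>u v. blinfun_apply z (t u v) = t (blinfun_apply x u) (blinfun_apply y v)"
  shows "norm z \<le> norm x * norm y"
proof (rule norm_le_of_span)
  fix w assume w: "w \<in> span {t u v | u v. True}"
  obtain G u where G: "orthonormal G" "w = (\<Sum>g\<in>G. t (u g) g)" using span_orthonormal[OF w] by blast
  define w2 where "w2 = (\<Sum>g\<in>G. t (x (u g)) g)"
  have w2: "w2 \<in> span {t u v | u v. True}"
    unfolding w2_def by (intro span_sum span_base) blast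
  have "z w = z' w2" by (simp add: G(2) w2_def blinfun.sum_right z z')
  then have zw: "norm (z w) \<le> norm y * norm w2" using norm_tensor_id_le[of z' y, OF z' w2] by simp
  have "norm w2 \<le> norm x * norm w"
  proof (rule power2_le_imp_le)
    have "(norm w2)\<^sup>2 = (\<Sum>g\<in>G. (norm (x (u g)))\<^sup>2)"
      unfolding w2_def by (rule norm_orthonormal_sum[OF G(1)])
    also have "\<dots> \<le> (\<Sum>g\<in>G. (norm x)\<^sup>2 * (norm (u g))\<^sup>2)"
      unfolding power_mult_distrib[symmetric] by (intro sum_mono power_mono norm_blinfun) simp
    also have "\<dots> = (norm x * norm w)\<^sup>2"
      using norm_orthonormal_sum[OF G(1), of u] by (simp add: G(2) power_mult_distrib sum_distrib_left)
    finally show "(norm w2)\<^sup>2 \<le> (norm x * norm w)\<^sup>2" .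
  qed simp
  then have "norm y * norm w2 \<le> norm y * (norm x * norm w)" by (rule mult_left_mono) simp
  also have "\<dots> = norm x * norm y * norm w" by (simp only: mult_ac)
  finally show "norm (z w) \<le> norm x * norm y * norm w" using zw by simp
qed simp

text \<open>The algebraic tensor product of \<open>S\<close> with the finite rank operators.\<close>

inductive_set elem_sums :: "'h op set \<Rightarrow> 'k op set" for S where
  zero: "0 \<in> elem_sums S"
| elem: "x \<in> S \<Longrightarrow> elem a x b \<in> elem_sums S"
| add: "T \<in> elem_sums S \<Longrightarrow> R \<in> elem_sums S \<Longrightarrow> T + R \<in> elem_sums S"

lemma op_subspace_elem_sums:
  assumes S: "op_subspace S"
  shows "op_subspace (elem_sums S)"
proof -
  note D = op_subspaceD[OF S]
  have cl: "clin T" if "T \<in> elem_sums S" for T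
    using that by (rule elem_sums.induct) (auto intro: clin_add clin_elem D)
  show ?thesis
    unfolding op_subspace_def
  proof (intro conjI ballI allI)
    show "elem_sums S \<subseteq> bounded_ops" using cl by (auto simp: bounded_ops_iff)
    show "0 \<in> elem_sums S" by (rule elem_sums.zero)
    fix T assume T: "T \<in> elem_sums S"
    show "T + R \<in> elem_sums S" if "R \<in> elem_sums S" for R using T that by (rule elem_sums.add)
    show "op_scale c T \<in> elem_sums S" for c
      using T by (rule elem_sums.induct)
        (auto simp: op_scale_add_right elem_sums.zero elem_op_scale[symmetric] intro: elem_sums.add elem_sums.elem D)
    show "adj T \<in> elem_sums S"
      using T by (rule elem_sums.induct)
        (auto simp: adj_add cl elem_sums.zero adj_elem D(1) intro: elem_sums.add elem_sums.elem D)
  qed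
qed

definition rank_one :: "'l \<Rightarrow> 'l \<Rightarrow> 'l op" where
  "rank_one a b = Blinfun (\<lambda>v. cscale (cinner b v) a)"

lemma rank_one_apply: "blinfun_apply (rank_one a b) v = cscale (cinner b v) a"
proof -
  have "bounded_linear (\<lambda>v. cscale (cinner b v) a)"
  proof (rule bounded_linear_intro[where K = "norm b * norm a"])
    show "norm (cscale (cinner b v) a) \<le> norm v * (norm b * norm a)" for v
      using mult_right_mono[OF cmod_cinner_le[of b v] norm_ge_zero[of a]] by (simp add: norm_cscale mult_ac)
  qed (simp_all add: cinner.add_right cscale_add_left scaleR_cscale cinner_scale_right cscale_cscale)
  then show ?thesis by (simp add: rank_one_def bounded_linear_Blinfun_apply)
qed

lemma rank_one_compact: "rank_one a b \<in> compact_ops"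
proof -
  let ?K = "(\<lambda>c. cscale c a) ` cball 0 (norm b)"
  have "bounded_linear (\<lambda>c. cscale c a)"
    by (rule bounded_linear_intro[where K = "norm a"])
      (simp_all add: cscale_add_left norm_cscale scaleR_conv_of_real scaleR_cscale cscale_cscale)
  then have K: "compact ?K" by (intro compact_continuous_image linear_continuous_on) auto
  have "blinfun_apply (rank_one a b) ` cball 0 1 \<subseteq> ?K"
  proof
    fix w assume "w \<in> blinfun_apply (rank_one a b) ` cball 0 1"
    then obtain v where v: "norm v \<le> 1" "w = cscale (cinner b v) a" by (auto simp: rank_one_apply)
    have "cmod (cinner b v) \<le> norm b * norm v" by (rule cmod_cinner_le)
    also have "\<dots> \<le> norm b * 1" using v(1) by (intro mult_left_mono) auto
    finally show "w \<in> ?K" using v(2) by simp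
  qed
  then have "closure (blinfun_apply (rank_one a b) ` cball 0 1) \<subseteq> ?K"
    by (rule closure_minimal[OF _ compact_imp_closed[OF K]])
  then have "closure (blinfun_apply (rank_one a b) ` cball 0 1) = ?K \<inter> closure (blinfun_apply (rank_one a b) ` cball 0 1)" by blast
  moreover have "compact \<dots>" by (rule compact_Int_closed[OF K closed_closure])
  moreover have "rank_one a b \<in> bounded_ops"
    by (simp add: bounded_ops_iff clin_def rank_one_apply cinner_scale_right cscale_cscale)
  ultimately show ?thesis by (simp add: compact_ops_def)
qed

lemma op_tensor_rank_one: "clin x \<Longrightarrow> op_tensor t x (rank_one a b) = elem a x b"
  by (rule op_tensor_eq) (simp_all add: bounded_ops_iff clin_elem elem_t rank_one_apply t_scale_right)

text \<open>Compactness gives a finite net of mesh \<delta> for the image of the unit ball;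
  projecting onto the span of its centres removes all but \<delta>.\<close>

lemma compact_projection_approx:
  assumes y: "y \<in> compact_ops" and \<delta>: "\<delta> > 0"
  shows "\<exists>G. orthonormal G \<and> (\<forall>v. norm (y v - projection G (y v)) \<le> \<delta> * norm v)"
proof -
  have "compact (closure (blinfun_apply y ` cball 0 1))" using y by (simp add: compact_ops_def)
  then obtain K where K: "finite K" "closure (blinfun_apply y ` cball 0 1) \<subseteq> (\<Union>x\<in>K. ball x \<delta>)"
    using \<delta> unfolding compact_eq_totally_bounded by blast
  obtain G where G: "orthonormal G" "\<forall>w\<in>K. projection G w = w" using orthonormal_exists[OF K(1)] by blast
  have unit: "norm (y v - projection G (y v)) \<le> \<delta>" if "norm v \<le> 1" for v
  proof -
    have "y v \<in> closure (blinfun_apply y ` cball 0 1)"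
      by (rule subsetD[OF closure_subset]) (use that in auto)
    then obtain k where k: "k \<in> K" "dist k (y v) < \<delta>" using K(2) by auto
    have eq: "y v - projection G (y v) = (y v - k) - projection G (y v - k)"
      using G(2) k(1) by (simp add: projection_diff)
    have "norm (y v - projection G (y v)) \<le> norm (y v - k)"
      unfolding eq by (rule norm_sub_projection_le[OF G(1)])
    then show ?thesis using k(2) by (simp add: dist_norm norm_minus_commute)
  qed
  have "norm (y v - projection G (y v)) \<le> \<delta> * norm v" for v
  proof (cases "v = 0")
    case True then show ?thesis by (simp add: blinfun.zero_right projection_zero)
  next
    case False
    define c where "c = complex_of_real (1 / norm v)"
    have cy: "y (cscale c v) = cscale c (y v)" using y by (simp add: compact_ops_def bounded_ops_def)
    have "norm (cscale c v) \<le> 1" using False by (simp add: norm_cscale c_def norm_divide)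
    from unit[OF this] have "norm (cscale c (y v - projection G (y v))) \<le> \<delta>"
      unfolding cy projection_cscale by (simp add: cscale_diff_right)
    then show ?thesis using False by (simp add: norm_cscale c_def norm_divide divide_le_eq)
  qed
  then show ?thesis using G(1) by blast
qed

text \<open>\<open>op_tensor\<close> is a definite description, so x tensor y has to be constructed.
  It is the limit of x tensor q n, with q n the operator \<open>y\<close> followed by a finite rank
  projection, and therefore lies in the closure.\<close>

lemma op_tensor_compact:
  assumes S: "op_subspace S" "x \<in> S" and y: "y \<in> compact_ops"
  shows "op_tensor t x y \<in> closure (elem_sums S)"
proof -
  have x: "clin x" using op_subspaceD(1)[OF S] .
  have cy: "clin y" using y by (simp add: compact_ops_def bounded_ops_iff)
  have "\<exists>G. orthonormal G \<and> (\<forall>v. norm (y v - projection G (y v)) \<le> 1 / real (Suc n) * norm v)" for n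
    by (rule compact_projection_approx[OF y]) simp
  then obtain G where G: "\<And>n. orthonormal (G n)" "\<And>n v. norm (y v - projection (G n) (y v)) \<le> 1 / real (Suc n) * norm v"
    by metis
  have fin: "finite (G n)" for n using G(1) by (simp add: orthonormal_def)
  \<comment> \<open>x tensor q n. The first factor is kept as a parameter, since
    \<open>norm_tensor_le\<close> also asks for the operator with the identity in its place.\<close>
  define Z where "Z x n = (\<Sum>g\<in>G n. elem g x (adj y g))" for x n
  let ?z = "Z x"
  define q where "q n = (\<Sum>g\<in>G n. rank_one g (adj y g))" for n
  have q: "q n v = projection (G n) (y v)" for n v
    by (simp add: q_def blinfun.sum_left rank_one_apply projection_def cinner_adj_left cy)
  have zt: "Z x n (t u v) = t (x u) (q n v)" if "clin x" for x n u v
    using that by (simp add: Z_def q_def blinfun.sum_left elem_t rank_one_apply t_sum_right t_scale_right)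
  have qy: "norm (q n - y) \<le> 1 / real (Suc n)" for n
    by (rule norm_blinfun_bound) (use G(2) in \<open>simp_all add: q blinfun.diff_left norm_minus_commute\<close>)
  have zz: "norm (?z m - ?z n) \<le> norm x * norm (q m - q n)" for m n
    by (rule norm_tensor_le[of "Z id_blinfun m - Z id_blinfun n"])
      (simp_all add: blinfun.diff_left zt x t_diff_right)
  have qlim: "q \<longlonglongrightarrow> y"
  proof (rule LIM_zero_cancel, rule Lim_null_comparison)
    show "\<forall>\<^sub>F n in sequentially. norm (q n - y) \<le> 1 / real (Suc n)" using qy by simp
    show "(\<lambda>n. 1 / real (Suc n)) \<longlonglongrightarrow> 0" by (rule LIMSEQ_Suc[OF lim_1_over_n])
  qed
  have "Cauchy ?z"
  proof (rule metric_CauchyI)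
    fix e :: real assume "e > 0"
    define d where "d = e / (norm x + 1)"
    have "norm x + 1 > 0" by (simp add: add_nonneg_pos)
    then have "d > 0" using \<open>e > 0\<close> by (simp add: d_def)
    then obtain M where M: "\<And>m n. m \<ge> M \<Longrightarrow> n \<ge> M \<Longrightarrow> dist (q m) (q n) < d"
      using LIMSEQ_imp_Cauchy[OF qlim] unfolding Cauchy_def by blast
    show "\<exists>M. \<forall>m\<ge>M. \<forall>n\<ge>M. dist (?z m) (?z n) < e"
    proof (intro exI[of _ M] allI impI)
      fix m n assume "m \<ge> M" "n \<ge> M"
      have "dist (?z m) (?z n) \<le> norm x * dist (q m) (q n)" using zz by (simp add: dist_norm)
      also have "\<dots> \<le> norm x * d" using M[OF \<open>m \<ge> M\<close> \<open>n \<ge> M\<close>] by (intro mult_left_mono) auto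
      also have "\<dots> < (norm x + 1) * d" using \<open>d > 0\<close> by (intro mult_strict_right_mono) auto
      also have "\<dots> = e" using \<open>norm x + 1 > 0\<close> by (simp add: d_def)
      finally show "dist (?z m) (?z n) < e" .
    qed
  qed
  then obtain L where L: "?z \<longlonglongrightarrow> L" using Cauchy_convergent_iff convergent_def by blast
  have cz: "clin (?z n)" for n unfolding Z_def by (intro clin_sum clin_elem x)
  have "L \<in> bounded_ops" using closed_sequentially[OF closed_bounded_ops _ L] cz by (simp add: bounded_ops_iff)
  moreover have "L (t u v) = t (x u) (y v)" for u v
  proof -
    have "(\<lambda>n. ?z n (t u v)) \<longlonglongrightarrow> L (t u v)" by (intro blinfun.tendsto L tendsto_const)
    moreover have "(\<lambda>n. creation (q n v) (x u)) \<longlonglongrightarrow> creation (y v) (x u)"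
    proof (intro blinfun.tendsto tendsto_const)
      have n0: "(\<lambda>n. norm (q n v - y v)) \<longlonglongrightarrow> 0"
        by (intro tendsto_norm_zero LIM_zero blinfun.tendsto qlim tendsto_const)
      have "(\<lambda>n. creation (q n v) - creation (y v)) \<longlonglongrightarrow> 0"
        by (rule Lim_null_comparison[OF always_eventually n0])
          (unfold creation_diff[symmetric], rule allI, rule norm_creation_le)
      then show "(\<lambda>n. creation (q n v)) \<longlonglongrightarrow> creation (y v)" by (rule LIM_zero_cancel)
    qed
    ultimately show ?thesis using LIMSEQ_unique by (simp add: creation_apply zt x)
  qed
  ultimately have "op_tensor t x y = L" by (rule op_tensor_eq)
  moreover have "?z n \<in> elem_sums S" for n
    unfolding Z_def by (intro sum_mem elem_sums.intros S(2))
  ultimately show ?thesis unfolding closure_sequential using L by blast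
qed

text \<open>Compact operators are limits of finite rank ones and these are sums of rank one
  operators, so the elements \<open>elem a x b\<close> suffice as generators.\<close>

theorem min_tensor_eq:
  assumes S: "op_subspace S"
  shows "min_tensor t S compact_ops = closure (elem_sums S)"
proof (rule antisym)
  note D = op_subspaceD[OF S]
  let ?C = "concrete_operator_space (bounded_ops :: 'k op set)"
  let ?X = "{op_tensor t x y | x y. x \<in> S \<and> y \<in> compact_ops}"
  note cl = op_subspaceD[OF op_subspace_closure[OF op_subspace_elem_sums[OF S]]]
  have "lin_subspace ?C (closure (elem_sums S))"
    unfolding lin_subspace_def using cl by (auto simp: bounded_ops_iff)
  moreover have "?X \<subseteq> closure (elem_sums S)"
  proof
    fix z assume "z \<in> ?X"
    then obtain x y where xy: "z = op_tensor t x y" "x \<in> S" "y \<in> compact_ops" by blast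
    then show "z \<in> closure (elem_sums S)" using op_tensor_compact[OF S] by simp
  qed
  ultimately have "lin_span ?C ?X \<subseteq> closure (elem_sums S)" unfolding lin_span_def by blast
  then show "min_tensor t S compact_ops \<subseteq> closure (elem_sums S)"
    unfolding min_tensor_def by (rule closure_minimal[OF _ closed_closure])
  show "closure (elem_sums S) \<subseteq> min_tensor t S compact_ops"
    unfolding min_tensor_def
  proof (rule closure_mono, rule subsetI)
    fix T assume T: "T \<in> elem_sums S"
    show "T \<in> lin_span ?C ?X"
      unfolding lin_span_def
    proof (rule InterI)
      fix U assume "U \<in> {U. lin_subspace ?C U \<and> ?X \<subseteq> U}"
      then have U: "0 \<in> U" "\<And>R T. R \<in> U \<Longrightarrow> T \<in> U \<Longrightarrow> R + T \<in> U" "?X \<subseteq> U"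
        by (auto simp: lin_subspace_def)
      show "T \<in> U"
        using T
      proof (rule elem_sums.induct)
        fix a x b assume "x \<in> S"
        then have "elem a x b \<in> ?X"
          using op_tensor_rank_one[OF D(1), of x a b] rank_one_compact by (intro CollectI exI[of _ x] exI[of _ "rank_one a b"]) auto
        then show "elem a x b \<in> U" using U(3) by blast
      qed (use U in auto)
    qed
  qed
qed

end

section \<open>Amplification and compression\<close>

text \<open>\<open>V\<close> in every coordinate. It writes the entrywise operation W X_ij V on
  matrices as a product of operators, from which norm and positivity estimates follow.\<close>

definition ell2_map :: "('h::complex_hilbert \<Rightarrow>\<^sub>L 'k::complex_hilbert) \<Rightarrow> ('h ell2 \<Rightarrow>\<^sub>L 'k ell2)" where
  "ell2_map V = Blinfun (\<lambda>v. mk_ell2 (\<lambda>i. V (ell2_nth v i)))"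

lemma L2_set_blinfun_le:
  "L2_set (\<lambda>i. norm (blinfun_apply V (f i))) A \<le> norm V * L2_set (\<lambda>i. norm (f i)) A"
proof -
  have "L2_set (\<lambda>i. norm (blinfun_apply V (f i))) A \<le> L2_set (\<lambda>i. norm V * norm (f i)) A"
    by (intro L2_set_mono norm_blinfun) simp
  also have "\<dots> = norm V * L2_set (\<lambda>i. norm (f i)) A" by (rule L2_set_right_distrib[symmetric]) simp
  finally show ?thesis .
qed

lemma summable_blinfun_sq:
  "summable (\<lambda>i. (norm (blinfun_apply V (ell2_nth v i)))\<^sup>2)"
  by (rule L2_bounded_summable[where C = "norm V * norm v"])
    (rule order_trans[OF L2_set_blinfun_le mult_left_mono[OF L2_set_le_norm_ell2 norm_ge_zero]])

lemma ell2_map_nth: "ell2_nth (blinfun_apply (ell2_map V) v) i = V (ell2_nth v i)"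
proof -
  have nth: "ell2_nth (mk_ell2 (\<lambda>i. V (ell2_nth v i))) i = V (ell2_nth v i)" for v i
    by (simp add: mk_ell2_nth summable_blinfun_sq)
  have "bounded_linear (\<lambda>v. mk_ell2 (\<lambda>i. V (ell2_nth v i)))"
  proof (rule bounded_linear_intro[where K = "norm V"])
    show "norm (mk_ell2 (\<lambda>i. V (ell2_nth v i))) \<le> norm v * norm V" for v
    proof (rule norm_ell2_le)
      fix n
      have "L2_set (\<lambda>i. norm (V (ell2_nth v i))) {..<n} \<le> norm V * norm v"
        by (rule order_trans[OF L2_set_blinfun_le mult_left_mono[OF L2_set_le_norm_ell2 norm_ge_zero]])
      then show "L2_set (\<lambda>i. norm (ell2_nth (mk_ell2 (\<lambda>i. V (ell2_nth v i))) i)) {..<n} \<le> norm v * norm V"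
        by (simp only: nth mult.commute)
    qed
  next
    fix v w
    show "mk_ell2 (\<lambda>i. V (ell2_nth (v + w) i)) = mk_ell2 (\<lambda>i. V (ell2_nth v i)) + mk_ell2 (\<lambda>i. V (ell2_nth w i))"
      by (rule ell2_eqI) (subst nth_add, simp only: nth, subst nth_add, rule blinfun.add_right)
  next
    fix r v
    show "mk_ell2 (\<lambda>i. V (ell2_nth (r *\<^sub>R v) i)) = r *\<^sub>R mk_ell2 (\<lambda>i. V (ell2_nth v i))"
      by (rule ell2_eqI) (subst nth_scaleR, simp only: nth, subst nth_scaleR, rule blinfun.scaleR_right)
  qed
  then show ?thesis by (simp add: ell2_map_def bounded_linear_Blinfun_apply nth)
qed

lemma norm_ell2_map_le: "norm (ell2_map V) \<le> norm V"
proof (rule norm_blinfun_bound)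
  show "norm (ell2_map V v) \<le> norm V * norm v" for v
    unfolding ell2_map_nth[symmetric]
    by (rule norm_ell2_le)
      (simp only: ell2_map_nth, rule order_trans[OF L2_set_blinfun_le mult_left_mono[OF L2_set_le_norm_ell2 norm_ge_zero]])
qed simp

lemma clin_ell2_map: "clin V \<Longrightarrow> clin (ell2_map V)"
  unfolding clin_def[of "ell2_map V"] by (intro allI ell2_eqI) (simp add: ell2_map_nth nth_cscale clinD)

lemma adj_ell2_map: "clin V \<Longrightarrow> adj (ell2_map V) = ell2_map (adj V)"
  by (rule adj_eqI) (simp add: cinner_ell2_def ell2_map_nth cinner_adj_left)

lemma ell2_map_op_mat:
  "ell2_map W o\<^sub>L (op_mat n X o\<^sub>L ell2_map V) = op_mat n (\<lambda>i j. W o\<^sub>L (X i j o\<^sub>L V))"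
  by (intro blinfun_eqI ell2_eqI)
    (simp add: ell2_map_nth op_mat_nth blinfun.sum_right blinfun.zero_right)

lemma norm_op_mat_conj_le:
  "norm (op_mat n (\<lambda>i j. W o\<^sub>L (X i j o\<^sub>L V))) \<le> norm W * (norm (op_mat n X) * norm V)"
  unfolding ell2_map_op_mat[symmetric]
  by (intro order_trans[OF norm_blinfun_compose] mult_mono norm_ell2_map_le mult_nonneg_nonneg norm_ge_zero
      order_trans[OF norm_blinfun_compose mult_left_mono[OF norm_ell2_map_le norm_ge_zero]])

lemma op_pos_conj: "clin V \<Longrightarrow> op_pos T \<Longrightarrow> op_pos (adj V o\<^sub>L (T o\<^sub>L V))"
  by (simp add: op_pos_def cinner_adj_right[of V] cinner_adj_right)

lemma op_mats_square:
  assumes B: "op_alg B" and X: "X \<in> op_mats B n" "adj (op_mat n X) = op_mat n X" "op_pos (op_mat n X)"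
  shows "\<exists>Y\<in>op_mats B n. op_mat_mult n (op_mat_adj Y) Y = X"
proof -
  note Bs = op_algD(1)[OF B]
  obtain S where S: "S \<in> op_mat n ` op_mats B n" "adj S = S" "S o\<^sub>L S = op_mat n X"
    using op_sqrt[OF op_alg_op_mats[OF B] imageI[OF X(1)] X(2,3)] by blast
  then obtain Y where Y: "Y \<in> op_mats B n" "S = op_mat n Y" by blast
  have cY: "clin (Y i j)" for i j
    using op_matsD'[OF Bs Y(1)] op_subspaceD(1)[OF Bs] by blast
  have "op_mat n (op_mat_mult n (op_mat_adj Y) Y) = op_mat n X"
    using S Y by (simp add: op_mat_of_mult op_mat_of_adj cY)
  then have "op_mat_mult n (op_mat_adj Y) Y = X"
    by (rule inj_onD[OF op_mats_inj _ op_mat_mult_closed[OF B op_mat_adj_closed[OF Bs Y(1)] Y(1)] X(1)])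
  then show ?thesis using Y by blast
qed

lemma star_vector_space_concrete:
  assumes S: "op_subspace S"
  shows "star_vector_space (concrete_operator_space S)"
proof -
  note D = op_subspaceD[OF S]
  show ?thesis
    by unfold_locales (auto simp: D algebra_simps op_scale_scale op_scale_add_left op_scale_add_right
        op_scale_minus_one op_subspace_uminus[OF S] adj_add adj_adj adj_op_scale)
qed

section \<open>Cut-offs by finite rank projections\<close>

locale approximated_tensor = tensor_product t
  for t :: "'h::complex_hilbert \<Rightarrow> 'l::complex_hilbert \<Rightarrow> 'k::complex_hilbert" +
  fixes G :: "nat \<Rightarrow> 'l set"
  assumes G_orthonormal: "orthonormal (G n)" and G_lim: "(\<lambda>n. projection (G n) a) \<longlonglongrightarrow> a"
begin

text \<open>1 tensor the projection onto the span of \<open>G m\<close>.\<close>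

definition proj :: "nat \<Rightarrow> 'k op" where
  "proj m = (\<Sum>g\<in>G m. elem g id_blinfun g)"

lemma finite_G: "finite (G m)"
  using G_orthonormal by (simp add: orthonormal_def)

lemma clin_proj: "clin (proj m)"
  unfolding proj_def by (intro clin_sum clin_elem clin_id)

lemma adj_proj: "adj (proj m) = proj m"
  by (simp add: proj_def adj_sum clin_elem adj_elem)

lemma proj_creation: "proj m o\<^sub>L creation a = creation (projection (G m) a)"
proof (rule blinfun_eqI)
  fix u
  show "(proj m o\<^sub>L creation a) u = creation (projection (G m) a) u"
    by (simp add: proj_def creation_apply blinfun.sum_left elem_t projection_def t_sum_right t_scale_right)
qed

lemma proj_elem: "proj m o\<^sub>L elem a x b = elem (projection (G m) a) x b"
  by (simp add: elem_def comp_assoc[symmetric] proj_creation)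

lemma elem_proj: "elem a x b o\<^sub>L proj m = elem a x (projection (G m) b)"
proof -
  have "adj (creation b) o\<^sub>L proj m = adj (creation (projection (G m) b))"
    unfolding proj_creation[symmetric] by (simp add: adj_comp clin_proj clin_creation adj_proj)
  then show ?thesis by (simp add: elem_def comp_assoc)
qed

lemma projection_G: "g \<in> G m \<Longrightarrow> projection (G m) g = g"
proof -
  assume g: "g \<in> G m"
  have "projection (G m) g = (\<Sum>h\<in>G m. if h = g then g else 0)"
    unfolding projection_def using G_orthonormal[of m] g by (intro sum.cong refl) (auto simp: orthonormal_def)
  then show ?thesis using g finite_G by simp
qed

lemma proj_idem: "proj m o\<^sub>L proj m = proj m"
proof -
  have "proj m o\<^sub>L proj m = (\<Sum>g\<in>G m. proj m o\<^sub>L elem g id_blinfun g)"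
    by (subst (2) proj_def) (simp add: bounded_bilinear.sum_right[OF bounded_bilinear_blinfun_compose])
  then show ?thesis by (simp add: proj_elem projection_G) (simp add: proj_def)
qed

lemma norm_proj: "norm (proj m) \<le> 1"
proof -
  have "(norm (proj m))\<^sup>2 = norm (proj m)"
    using norm_adj_comp[OF clin_proj, of m] by (simp add: adj_proj proj_idem)
  then have "norm (proj m) * norm (proj m) = 1 * norm (proj m)" by (simp add: power2_eq_square)
  then show ?thesis unfolding mult_cancel_right by auto
qed

lemma proj_elem_tendsto: "(\<lambda>m. proj m o\<^sub>L elem a x b) \<longlonglongrightarrow> elem a x b"
proof -
  have "(\<lambda>m. norm (projection (G m) a - a) * (norm x * norm b)) \<longlonglongrightarrow> 0 * (norm x * norm b)"
    by (intro tendsto_mult tendsto_const tendsto_norm_zero LIM_zero G_lim)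
  then have lim: "(\<lambda>m. norm (projection (G m) a - a) * (norm x * norm b)) \<longlonglongrightarrow> 0" by simp
  have "norm ((proj m o\<^sub>L elem a x b) - elem a x b) \<le> norm (projection (G m) a - a) * (norm x * norm b)" for m
  proof -
    have eq: "(proj m o\<^sub>L elem a x b) - elem a x b = elem (projection (G m) a - a) x b"
      unfolding proj_elem by (simp add: elem_def creation_diff comp_simps)
    show ?thesis unfolding eq using norm_elem_le[of "projection (G m) a - a" x b] by (simp add: mult_ac)
  qed
  then have "(\<lambda>m. (proj m o\<^sub>L elem a x b) - elem a x b) \<longlonglongrightarrow> 0"
    by (intro Lim_null_comparison[OF always_eventually lim]) auto
  then show ?thesis by (rule LIM_zero_cancel)
qed

text \<open>The operators on which the cut-offs converge in norm from both sides. They form a closed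
  star-algebra containing every \<open>elem a x b\<close>, so the whole algebra of the stabilization
  is recovered from finite matrices over the first factor.\<close>

definition compressible :: "'k op set" where
  "compressible = {T \<in> bounded_ops. (\<lambda>m. proj m o\<^sub>L T) \<longlonglongrightarrow> T \<and> (\<lambda>m. T o\<^sub>L proj m) \<longlonglongrightarrow> T}"

text \<open>The cut-offs are uniformly bounded by 1, so the convergence passes to norm
  limits.\<close>

lemma proj_tendsto_closed:
  assumes f: "\<And>k::nat. (\<lambda>m. proj m o\<^sub>L f k) \<longlonglongrightarrow> f k" and lim: "f \<longlonglongrightarrow> L"
  shows "(\<lambda>m. proj m o\<^sub>L L) \<longlonglongrightarrow> L"
proof (rule LIMSEQ_I)
  fix e :: real assume "e > 0"
  then obtain k where k: "norm (f k - L) < e / 3" using LIMSEQ_D[OF lim, of "e / 3"] by auto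
  obtain N where N: "\<And>m. m \<ge> N \<Longrightarrow> norm ((proj m o\<^sub>L f k) - f k) < e / 3"
    using LIMSEQ_D[OF f[of k], of "e / 3"] \<open>e > 0\<close> by auto
  show "\<exists>no. \<forall>m\<ge>no. norm ((proj m o\<^sub>L L) - L) < e"
  proof (intro exI[of _ N] allI impI)
    fix m assume "m \<ge> N"
    have "(proj m o\<^sub>L L) - L = (((proj m o\<^sub>L f k) - f k) - (proj m o\<^sub>L (f k - L))) + (f k - L)"
      by (simp add: comp_simps)
    then have "norm ((proj m o\<^sub>L L) - L) \<le> norm (((proj m o\<^sub>L f k) - f k) - (proj m o\<^sub>L (f k - L))) + norm (f k - L)"
      using norm_triangle_ineq by metis
    also have "norm (((proj m o\<^sub>L f k) - f k) - (proj m o\<^sub>L (f k - L))) \<le> norm ((proj m o\<^sub>L f k) - f k) + norm (proj m o\<^sub>L (f k - L))"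
      by (rule norm_triangle_ineq4)
    also have "norm (proj m o\<^sub>L (f k - L)) \<le> 1 * norm (f k - L)"
      by (intro order_trans[OF norm_blinfun_compose] mult_right_mono norm_proj) simp
    finally show "norm ((proj m o\<^sub>L L) - L) < e" using N[OF \<open>m \<ge> N\<close>] k by linarith
  qed
qed

lemma compressible_adj:
  assumes "T \<in> compressible" shows "adj T \<in> compressible"
proof -
  have cT: "clin T" and l: "(\<lambda>m. proj m o\<^sub>L T) \<longlonglongrightarrow> T" "(\<lambda>m. T o\<^sub>L proj m) \<longlonglongrightarrow> T"
    using assms by (auto simp: compressible_def bounded_ops_iff)
  have "(\<lambda>m. adj (proj m o\<^sub>L T)) \<longlonglongrightarrow> adj T" by (rule tendsto_adj[OF l(1)]) (auto intro: clin_comp clin_proj cT)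
  moreover have "(\<lambda>m. adj (T o\<^sub>L proj m)) \<longlonglongrightarrow> adj T" by (rule tendsto_adj[OF l(2)]) (auto intro: clin_comp clin_proj cT)
  ultimately show ?thesis
    using cT by (simp add: compressible_def bounded_ops_iff clin_adj adj_comp clin_proj adj_proj)
qed

lemma op_alg_compressible: "op_alg compressible"
proof -
  have sub: "compressible \<subseteq> bounded_ops" by (auto simp: compressible_def)
  have "op_subspace compressible"
    unfolding op_subspace_def
  proof (intro conjI ballI allI sub compressible_adj)
    show "0 \<in> compressible" by (simp add: compressible_def bounded_ops_iff)
    fix T c assume T: "T \<in> compressible"
    then have cT: "clin T" and l: "(\<lambda>m. proj m o\<^sub>L T) \<longlonglongrightarrow> T" "(\<lambda>m. T o\<^sub>L proj m) \<longlonglongrightarrow> T"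
      by (auto simp: compressible_def bounded_ops_iff)
    show "op_scale c T \<in> compressible"
      using bounded_linear.tendsto[OF bounded_linear_op_scale l(1), of c] bounded_linear.tendsto[OF bounded_linear_op_scale l(2), of c]
      by (simp add: compressible_def bounded_ops_iff clin_op_scale cT comp_op_scale_left comp_op_scale_right clin_proj)
    fix R assume R: "R \<in> compressible"
    then show "T + R \<in> compressible"
      using T by (auto simp: compressible_def bounded_ops_iff clin_add comp_simps intro: tendsto_add)
  qed
  moreover have "R o\<^sub>L T \<in> compressible" if R: "R \<in> compressible" and T: "T \<in> compressible" for R T
  proof -
    have "(\<lambda>m. (proj m o\<^sub>L R) o\<^sub>L T) \<longlonglongrightarrow> (R o\<^sub>L T)" "(\<lambda>m. R o\<^sub>L (T o\<^sub>L proj m)) \<longlonglongrightarrow> (R o\<^sub>L T)"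
      using R T by (auto simp: compressible_def intro!: tendsto_comp tendsto_const)
    then show ?thesis using R T by (simp add: compressible_def bounded_ops_iff clin_comp comp_assoc)
  qed
  moreover have "closed compressible"
    unfolding closed_sequential_limits
  proof (intro allI impI, elim conjE)
    fix T L assume T: "\<forall>k. T k \<in> compressible" and L: "T \<longlonglongrightarrow> L"
    have cT: "clin (T k)" for k using T by (auto simp: compressible_def bounded_ops_iff)
    have cL: "clin L" using closed_sequentially[OF closed_bounded_ops _ L] cT by (simp add: bounded_ops_iff)
    have l1: "(\<lambda>m. proj m o\<^sub>L L) \<longlonglongrightarrow> L" by (rule proj_tendsto_closed[OF _ L]) (use T in \<open>simp add: compressible_def\<close>)
    have "(\<lambda>k. adj (T k)) \<longlonglongrightarrow> adj L" by (rule tendsto_adj[OF L cT cL])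
    then have "(\<lambda>m. proj m o\<^sub>L adj L) \<longlonglongrightarrow> adj L"
      by (rule proj_tendsto_closed[rotated]) (use T compressible_adj in \<open>auto simp: compressible_def\<close>)
    then have "(\<lambda>m. adj (proj m o\<^sub>L adj L)) \<longlonglongrightarrow> adj (adj L)"
      by (rule tendsto_adj) (auto intro: clin_comp clin_proj clin_adj cL)
    then have "(\<lambda>m. L o\<^sub>L proj m) \<longlonglongrightarrow> L" by (simp add: adj_comp clin_proj clin_adj cL adj_adj adj_proj)
    then show "L \<in> compressible" using l1 cL by (simp add: compressible_def bounded_ops_iff)
  qed
  ultimately show ?thesis by (simp add: op_alg_def)
qed

lemma elem_compressible: "clin x \<Longrightarrow> elem a x b \<in> compressible"
proof -
  assume x: "clin x"
  have "(\<lambda>m. adj (proj m o\<^sub>L elem b (adj x) a)) \<longlonglongrightarrow> adj (elem b (adj x) a)"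
    by (rule tendsto_adj[OF proj_elem_tendsto]) (auto intro: clin_comp clin_proj clin_elem clin_adj x)
  then have "(\<lambda>m. elem a x b o\<^sub>L proj m) \<longlonglongrightarrow> elem a x b"
    by (simp add: adj_comp clin_proj clin_elem clin_adj x adj_proj adj_elem adj_adj)
  then show ?thesis using proj_elem_tendsto x by (simp add: compressible_def bounded_ops_iff clin_elem)
qed

lemma elem_sums_compressible:
  assumes S: "op_subspace S"
  shows "closure (elem_sums S) \<subseteq> compressible"
proof (rule closure_minimal[OF _ op_algD(3)[OF op_alg_compressible]], rule subsetI)
  note C = op_subspaceD[OF op_algD(1)[OF op_alg_compressible]]
  fix T assume "T \<in> elem_sums S"
  then show "T \<in> compressible"
    by (rule elem_sums.induct) (auto intro: C(2,3) elem_compressible op_subspaceD(1)[OF S])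
qed

lemma compressible_tendsto:
  assumes T: "T \<in> compressible"
  shows "(\<lambda>m. proj m o\<^sub>L (T o\<^sub>L proj m)) \<longlonglongrightarrow> T"
proof -
  have l: "(\<lambda>m. proj m o\<^sub>L T) \<longlonglongrightarrow> T" "(\<lambda>m. T o\<^sub>L proj m) \<longlonglongrightarrow> T" using T by (auto simp: compressible_def)
  have n0: "(\<lambda>m. norm ((T o\<^sub>L proj m) - T)) \<longlonglongrightarrow> 0" by (intro tendsto_norm_zero LIM_zero l)
  have "(\<lambda>m. proj m o\<^sub>L ((T o\<^sub>L proj m) - T)) \<longlonglongrightarrow> 0"
  proof (rule Lim_null_comparison[OF always_eventually n0], rule allI)
    fix m
    have "norm (proj m o\<^sub>L ((T o\<^sub>L proj m) - T)) \<le> 1 * norm ((T o\<^sub>L proj m) - T)"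
      by (intro order_trans[OF norm_blinfun_compose] mult_right_mono norm_proj) simp
    then show "norm (proj m o\<^sub>L ((T o\<^sub>L proj m) - T)) \<le> norm ((T o\<^sub>L proj m) - T)" by simp
  qed
  then have "(\<lambda>m. (proj m o\<^sub>L ((T o\<^sub>L proj m) - T)) + (proj m o\<^sub>L T)) \<longlonglongrightarrow> 0 + T"
    by (intro tendsto_add l)
  then show ?thesis by (simp add: comp_simps)
qed

lemma proj_elem_sums:
  assumes S: "op_subspace S" and T: "T \<in> closure (elem_sums S)"
  shows "proj m o\<^sub>L (T o\<^sub>L proj m) \<in> closure (elem_sums S)"
proof -
  have el: "proj m o\<^sub>L (T o\<^sub>L proj m) \<in> elem_sums S" if "T \<in> elem_sums S" for T
    using that by (rule elem_sums.induct)
      (auto simp: comp_simps elem_sums.zero elem_proj proj_elem intro: elem_sums.add elem_sums.elem)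
  obtain f where f: "\<And>n::nat. f n \<in> elem_sums S" "f \<longlonglongrightarrow> T" using T unfolding closure_sequential by blast
  have "(\<lambda>n. proj m o\<^sub>L (f n o\<^sub>L proj m)) \<longlonglongrightarrow> (proj m o\<^sub>L (T o\<^sub>L proj m))"
    by (intro tendsto_comp tendsto_const f)
  then show ?thesis unfolding closure_sequential
    by (intro exI[of _ "\<lambda>n. proj m o\<^sub>L (f n o\<^sub>L proj m)"] conjI allI el f(1))
qed

lemma proj_mem:
  assumes S: "op_subspace S" "id_blinfun \<in> S"
  shows "proj m \<in> elem_sums S"
  unfolding proj_def by (intro op_subspace_sum[OF op_subspace_elem_sums[OF S(1)]] elem_sums.elem S)

text \<open>The cut-offs P are the approximate unit: with Z the diagonal matrix of P, U = P X P + Z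
  = P (X + 1) P is positive, while X - U + Z = X - P X P becomes small. P belongs to the space
  because the identity belongs to \<open>S\<close>.\<close>

theorem stabilized_presentation:
  assumes S: "op_subspace S" and unit: "id_blinfun \<in> S"
  shows "presentation (concrete_operator_space (closure (elem_sums S))) id"
proof -
  let ?M = "closure (elem_sums S)"
  have M: "op_subspace ?M" by (rule op_subspace_closure[OF op_subspace_elem_sums[OF S]])
  note D = op_subspaceD[OF M]
  have am: "amplify id X = X" for X :: "'k op mat" by (simp add: amplify_def)
  show ?thesis
  proof (intro presentation.intro presentation_axioms.intro)
    show "star_vector_space (concrete_operator_space ?M)" by (rule star_vector_space_concrete[OF M])
    fix n :: nat and X and \<delta> :: real
    assume n: "0 < n" and X: "X \<in> Mat_sa (concrete_operator_space ?M) n"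
      and P: "op_pos (id_blinfun + op_mat n (amplify id X))" and \<delta>: "0 < \<delta>"
    have XM: "X \<in> op_mats ?M n" and Xa: "op_mat_adj X = X"
      using X by (auto simp: Mat_sa_def concrete_Mat concrete_mat_star)
    have "(\<lambda>m. op_mat n (\<lambda>i j. proj m o\<^sub>L (X i j o\<^sub>L proj m))) \<longlonglongrightarrow> op_mat n X"
      using elem_sums_compressible[OF S] op_matsD[OF XM]
      by (intro tendsto_op_mat compressible_tendsto) auto
    then obtain m where m: "norm (op_mat n (\<lambda>i j. proj m o\<^sub>L (X i j o\<^sub>L proj m)) - op_mat n X) < \<delta>"
      using LIMSEQ_D[OF _ \<delta>] by blast
    define Z where "Z i j = (if i < n \<and> i = j then proj m else 0)" for i j
    define U where "U i j = (proj m o\<^sub>L (X i j o\<^sub>L proj m)) + Z i j" for i j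
    have pm: "proj m \<in> ?M" using proj_mem[OF S unit] closure_subset by blast
    have Z: "Z \<in> op_mats ?M n" using pm D(2) by (auto simp: op_mats_def Z_def)
    have PXP: "(\<lambda>i j. proj m o\<^sub>L (X i j o\<^sub>L proj m)) \<in> op_mats ?M n"
      using op_matsD[OF XM] op_mats_outside[OF XM] proj_elem_sums[OF S] by (intro op_matsI) auto
    have U: "U \<in> op_mats ?M n"
      using op_mats_add[OF M PXP Z] by (simp add: U_def[abs_def])
    have Xc: "clin (X i j)" for i j using op_matsD'[OF M XM] D(1) by blast
    have "op_mat_adj U = U"
    proof (rule HOL.ext, rule HOL.ext)
      fix i j
      have "adj (X j i) = X i j" using fun_cong[OF fun_cong[OF Xa]] by (simp add: op_mat_adj_def)
      then show "op_mat_adj U i j = U i j"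
        by (simp add: op_mat_adj_def U_def Z_def adj_add clin_comp clin_proj Xc adj_comp adj_proj comp_assoc)
    qed
    moreover have "op_pos (op_mat n U)"
      unfolding op_pos_op_mat
    proof
      fix v :: "nat \<Rightarrow> 'k"
      have zp: "cinner w (proj m w') = cinner (proj m w) (proj m w')" for w w'
        using cinner_adj_left[OF clin_proj, of m w "proj m w'"] proj_idem[of m]
        by (simp add: adj_proj) (metis blinfun_apply_blinfun_compose)
      have xp: "cinner w (proj m w') = cinner (proj m w) w'" for w w'
        using cinner_adj_left[OF clin_proj, of m w w'] by (simp add: adj_proj)
      have "(\<Sum>i<n. \<Sum>j<n. cinner (v i) (U i j (v j))) =
        (\<Sum>i<n. \<Sum>j<n. cinner (proj m (v i)) (blinfun_apply (X i j + diag n id_blinfun i j) (proj m (v j))))"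
        by (intro sum.cong refl) (auto simp: U_def Z_def blinfun.add_left cinner.add_right xp[of _ "X _ _ _"] zp[of "v _" "v _"])
      also have "\<dots> \<in> \<real>\<^sub>\<ge>\<^sub>0"
        using op_pos_id_add_imp[OF P[unfolded am]] unfolding op_pos_op_mat by (rule spec)
      finally show "(\<Sum>i<n. \<Sum>j<n. cinner (v i) (U i j (v j))) \<in> \<real>\<^sub>\<ge>\<^sub>0" .
    qed
    ultimately have "U \<in> cone (concrete_operator_space ?M) n"
      using U by (simp add: concrete_cone Mat_sa_def concrete_Mat concrete_mat_star)
    moreover have "norm (op_mat n Z) \<le> 1"
    proof -
      have "op_mat n (\<lambda>i j. proj m o\<^sub>L (diag n id_blinfun i j o\<^sub>L proj m)) = op_mat n Z"
        by (rule op_mat_cong) (auto simp: Z_def proj_idem)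
      then have "norm (op_mat n Z) \<le> norm (proj m) * (norm (op_mat n (diag n id_blinfun :: 'k op mat)) * norm (proj m))"
        using norm_op_mat_conj_le[of n "proj m" "diag n id_blinfun" "proj m"] by simp
      also have "\<dots> \<le> 1 * (1 * 1)"
        by (intro mult_mono norm_proj norm_op_mat_diag_id) auto
      finally show ?thesis by simp
    qed
    moreover have "norm (op_mat n (\<lambda>i j. id (X i j) - id (U i j) + id (Z i j))) \<le> \<delta>"
    proof -
      have "(\<lambda>i j. id (X i j) - id (U i j) + id (Z i j)) = (\<lambda>i j. X i j - (proj m o\<^sub>L (X i j o\<^sub>L proj m)))"
        by (simp add: U_def)
      then show ?thesis using m by (simp add: op_mat_diff norm_minus_commute)
    qed
    ultimately show "\<exists>Z\<in>Mat (concrete_operator_space ?M) n. \<exists>U\<in>cone (concrete_operator_space ?M) n.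
       mnorm (concrete_operator_space ?M) n Z \<le> 1 \<and> norm (op_mat n (\<lambda>i j. id (X i j) - id (U i j) + id (Z i j))) \<le> \<delta>"
      using Z by (intro bexI[of _ Z] bexI[of _ U]) (auto simp: concrete_Mat concrete_mnorm)
  qed (auto simp: D am concrete_mnorm concrete_cone)
qed

section \<open>Compression to matrices over the first factor\<close>

definition enum :: "nat \<Rightarrow> nat \<Rightarrow> 'l" where
  "enum m = (SOME f. bij_betw f {..<card (G m)} (G m))"

lemma enum_bij: "bij_betw (enum m) {..<card (G m)} (G m)"
proof -
  have "\<exists>f. bij_betw f {..<card (G m)} (G m)"
    using ex_bij_betw_nat_finite[OF finite_G] by (simp add: atLeast0LessThan)
  then show ?thesis unfolding enum_def by (rule someI_ex)
qed

lemma cinner_enum: "a < card (G m) \<Longrightarrow> b < card (G m) \<Longrightarrow> cinner (enum m a) (enum m b) = (if a = b then 1 else 0)"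
proof -
  assume ab: "a < card (G m)" "b < card (G m)"
  have "enum m a \<in> G m" "enum m b \<in> G m" "enum m a = enum m b \<longleftrightarrow> a = b"
    using enum_bij[of m] ab by (auto simp: bij_betw_def inj_on_def)
  then show ?thesis using G_orthonormal[of m] by (simp add: orthonormal_def)
qed

lemma sum_enum: "(\<Sum>a<card (G m). f (enum m a)) = (\<Sum>g\<in>G m. f g)"
  by (rule sum.reindex_bij_betw[OF enum_bij])

lemma sum_grouped: "(\<Sum>i<n. \<Sum>a<k. f (i * k + a)) = (\<Sum>p<n * k. f (p :: nat))"
  for f :: "nat \<Rightarrow> 'z::comm_monoid_add"
proof -
  have "(\<Sum>i<n. \<Sum>a<k. f (i * k + a)) = (\<Sum>i<n. sum f {i * k..<i * k + k})"
  proof (rule sum.cong[OF refl])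
    fix i
    show "(\<Sum>a<k. f (i * k + a)) = sum f {i * k..<i * k + k}"
      using sum.shift_bounds_nat_ivl[of f 0 "i * k" k] by (simp add: atLeast0LessThan add.commute)
  qed
  then show ?thesis by (simp add: sum.nat_group)
qed

text \<open>\<open>block_map n m\<close> identifies the first \<open>n * card (G m)\<close> summands of $\ell^2(H)$ with
  $(H\otimes\mathrm{span}(G_m))^n$; compressing $X\in M_n(B(H\otimes L))$ by it gives the matrix
  \<open>compress n m X\<close> over $B(H)$.\<close>

abbreviation block_fun :: "nat \<Rightarrow> nat \<Rightarrow> 'h ell2 \<Rightarrow> 'k ell2" where
  "block_fun n m w \<equiv> ell2_fin n (\<lambda>i. \<Sum>a<card (G m). t (ell2_nth w (i * card (G m) + a)) (enum m a))"

definition block_map :: "nat \<Rightarrow> nat \<Rightarrow> ('h ell2 \<Rightarrow>\<^sub>L 'k ell2)" where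
  "block_map n m = Blinfun (block_fun n m)"

lemma block_map_bound:
  "norm (block_fun n m w) \<le> norm w"
proof (rule power2_le_imp_le)
  have ortho: "(norm (\<Sum>a<card (G m). t (u a) (enum m a)))\<^sup>2 = (\<Sum>a<card (G m). (norm (u a))\<^sup>2)" for u
  proof -
    have "cinner (\<Sum>a<card (G m). t (u a) (enum m a)) (\<Sum>a<card (G m). t (u a) (enum m a)) =
        (\<Sum>b<card (G m). \<Sum>a<card (G m). cinner (u a) (u b) * cinner (enum m a) (enum m b))"
      by (simp add: cinner.sum_left cinner.sum_right cinner_t)
    also have "\<dots> = (\<Sum>b<card (G m). \<Sum>a<card (G m). if a = b then cinner (u b) (u b) else 0)"
      by (intro sum.cong refl) (auto simp: cinner_enum)
    also have "\<dots> = (\<Sum>b<card (G m). cinner (u b) (u b))" by simp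
    finally show ?thesis by (simp add: norm_sq_cinner)
  qed
  have "(norm (block_fun n m w))\<^sup>2 =
      (\<Sum>p<n * card (G m). (norm (ell2_nth w p))\<^sup>2)"
    unfolding norm_ell2_fin_sq ortho by (rule sum_grouped)
  also have "\<dots> = (norm (ell2_fin (n * card (G m)) (ell2_nth w)))\<^sup>2" by (simp add: norm_ell2_fin_sq)
  also have "\<dots> \<le> (norm w)\<^sup>2"
    unfolding norm_ell2_fin by (intro power_mono L2_set_le_norm_ell2) simp
  finally show "(norm (block_fun n m w))\<^sup>2 \<le> (norm w)\<^sup>2" .
qed simp

lemma block_map_apply: "block_map n m w = block_fun n m w"
proof -
  have "bounded_linear (block_fun n m)"
  proof (rule bounded_linear_intro[where K = 1])
    show "norm (block_fun n m w) \<le> norm w * 1" for w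
      using block_map_bound by simp
  qed (rule ell2_eqI, simp add: ell2_fin_nth nth_add nth_scaleR t_add_left t_scaleR_left sum.distrib scaleR_sum_right)+
  then show ?thesis by (simp add: block_map_def bounded_linear_Blinfun_apply)
qed

lemma block_map_nth:
  "ell2_nth (block_map n m w) i = (if i < n then \<Sum>a<card (G m). t (ell2_nth w (i * card (G m) + a)) (enum m a) else 0)"
  by (simp add: block_map_apply ell2_fin_nth)

lemma norm_block_map: "norm (block_map n m) \<le> 1"
  by (rule norm_blinfun_bound) (simp_all add: block_map_apply block_map_bound)

lemma clin_block_map: "clin (block_map n m)"
  unfolding clin_def
  by (intro allI ell2_eqI) (simp add: block_map_nth nth_cscale t_scale_left cscale_sum_right)

text \<open>Coordinate p = i * card (G m) + a stands for row i and basis vector number a, hence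
  \<open>div\<close> and \<open>mod\<close>.\<close>

lemma adj_block_map_nth:
  "ell2_nth (adj (block_map n m) v) p =
    (if p < n * card (G m) then adj (creation (enum m (p mod card (G m)))) (ell2_nth v (p div card (G m))) else 0)"
proof (rule cinner_ext)
  fix u
  let ?k = "card (G m)"
  let ?c = "\<lambda>p. adj (creation (enum m (p mod ?k))) (ell2_nth v (p div ?k))"
  have "cinner u (ell2_nth (adj (block_map n m) v) p) = cinner (block_map n m (ell2_single p u)) v"
    by (simp flip: cinner_ell2_single add: cinner_adj_right clin_block_map)
  also have "\<dots> = (\<Sum>i<n. \<Sum>a<?k. cinner (ell2_nth (ell2_single p u) (i * ?k + a)) (?c (i * ?k + a)))"
    unfolding block_map_apply cinner_ell2_fin cinner.sum_left
    by (intro sum.cong refl) (simp add: cinner_adj_right clin_creation creation_apply)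
  also have "\<dots> = (\<Sum>q<n * ?k. if q = p then cinner u (?c p) else 0)"
    unfolding sum_grouped[of "\<lambda>q. cinner (ell2_nth (ell2_single p u) q) (?c q)"]
    by (intro sum.cong refl) (simp add: ell2_single_nth)
  finally show "cinner u (ell2_nth (adj (block_map n m) v) p) = cinner u (if p < n * ?k then ?c p else 0)"
    by simp
qed

text \<open>The block of \<open>T\<close> at the vectors \<open>a\<close> and \<open>b\<close> of
  the second factor, a slice map.\<close>

definition slice :: "'l \<Rightarrow> 'k op \<Rightarrow> 'l \<Rightarrow> 'h op" where
  "slice a T b = adj (creation a) o\<^sub>L (T o\<^sub>L creation b)"

definition compress :: "nat \<Rightarrow> nat \<Rightarrow> 'k op mat \<Rightarrow> 'h op mat" where
  "compress n m X = (\<lambda>p q. if p < n * card (G m) \<and> q < n * card (G m)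
     then slice (enum m (p mod card (G m))) (X (p div card (G m)) (q div card (G m))) (enum m (q mod card (G m)))
     else 0)"

lemma op_mat_compress:
  "op_mat (n * card (G m)) (compress n m X) = adj (block_map n m) o\<^sub>L (op_mat n X o\<^sub>L block_map n m)"
proof (intro blinfun_eqI ell2_eqI)
  fix w p
  let ?k = "card (G m)"
  show "ell2_nth (op_mat (n * ?k) (compress n m X) w) p =
    ell2_nth ((adj (block_map n m) o\<^sub>L (op_mat n X o\<^sub>L block_map n m)) w) p"
  proof (cases "p < n * ?k")
    case True
    then have k: "?k > 0" by (cases "?k = 0") auto
    have d: "p div ?k < n" using True k by (simp add: less_mult_imp_div_less)
    have "ell2_nth (op_mat (n * ?k) (compress n m X) w) p =
       (\<Sum>q<n * ?k. slice (enum m (p mod ?k)) (X (p div ?k) (q div ?k)) (enum m (q mod ?k)) (ell2_nth w q))"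
      using True by (simp add: op_mat_nth compress_def)
    also have "\<dots> = (\<Sum>j<n. \<Sum>a<?k. slice (enum m (p mod ?k)) (X (p div ?k) j) (enum m a) (ell2_nth w (j * ?k + a)))"
      unfolding sum_grouped[symmetric] using k by (intro sum.cong refl) simp
    also have "\<dots> = adj (creation (enum m (p mod ?k))) (\<Sum>j<n. X (p div ?k) j (\<Sum>a<?k. t (ell2_nth w (j * ?k + a)) (enum m a)))"
      by (simp add: slice_def blinfun.sum_right creation_apply)
    also have "\<dots> = ell2_nth ((adj (block_map n m) o\<^sub>L (op_mat n X o\<^sub>L block_map n m)) w) p"
      using True d by (simp add: adj_block_map_nth op_mat_nth block_map_nth)
    finally show ?thesis .
  qed (simp add: op_mat_nth adj_block_map_nth)
qed

text \<open>\<open>block_map n m\<close> times its adjoint is the cut-off in each of the first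
  \<open>n\<close> coordinates, so the compressed matrix determines \<open>X\<close> up to that
  cut-off.\<close>

lemma block_map_compress:
  "block_map n m o\<^sub>L (op_mat (n * card (G m)) (compress n m X) o\<^sub>L adj (block_map n m)) =
    op_mat n (\<lambda>i j. proj m o\<^sub>L (X i j o\<^sub>L proj m))"
proof -
  let ?k = "card (G m)"
  have UU: "ell2_nth (block_map n m (adj (block_map n m) v)) i = (if i < n then proj m (ell2_nth v i) else 0)" for v i
  proof (cases "i < n")
    case True
    have "(\<Sum>a<?k. t (ell2_nth (adj (block_map n m) v) (i * ?k + a)) (enum m a)) =
        (\<Sum>a<?k. elem (enum m a) id_blinfun (enum m a) (ell2_nth v i))"
    proof (intro sum.cong refl)
      fix a assume a: "a \<in> {..<?k}"
      have "i * ?k + a < Suc i * ?k" using a by simp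
      also have "\<dots> \<le> n * ?k" using True by (intro mult_right_mono) auto
      finally have "i * ?k + a < n * ?k" .
      then show "t (ell2_nth (adj (block_map n m) v) (i * ?k + a)) (enum m a) = elem (enum m a) id_blinfun (enum m a) (ell2_nth v i)"
        using a by (simp add: adj_block_map_nth elem_def creation_apply)
    qed
    also have "\<dots> = (\<Sum>g\<in>G m. elem g id_blinfun g (ell2_nth v i))"
      by (rule sum_enum[of "\<lambda>g. elem g id_blinfun g (ell2_nth v i)"])
    also have "\<dots> = proj m (ell2_nth v i)" by (simp add: proj_def blinfun.sum_left)
    finally show ?thesis using True by (simp add: block_map_nth)
  qed (simp add: block_map_nth)
  show ?thesis
    unfolding op_mat_compress
  proof (intro blinfun_eqI ell2_eqI)
    fix v i
    show "ell2_nth ((block_map n m o\<^sub>L ((adj (block_map n m) o\<^sub>L (op_mat n X o\<^sub>L block_map n m)) o\<^sub>L adj (block_map n m))) v) i =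
       ell2_nth (op_mat n (\<lambda>i j. proj m o\<^sub>L (X i j o\<^sub>L proj m)) v) i"
      by (simp add: UU op_mat_nth blinfun.sum_right)
  qed
qed

lemma norm_compress_le: "norm (op_mat (n * card (G m)) (compress n m X)) \<le> norm (op_mat n X)"
proof -
  have "norm (op_mat (n * card (G m)) (compress n m X)) \<le> norm (adj (block_map n m)) * (norm (op_mat n X) * norm (block_map n m))"
    unfolding op_mat_compress
    by (rule order_trans[OF norm_blinfun_compose mult_left_mono[OF norm_blinfun_compose norm_ge_zero]])
  also have "\<dots> \<le> 1 * (norm (op_mat n X) * 1)"
    using norm_block_map[of n m] by (intro mult_mono) (auto simp: norm_adj clin_block_map)
  finally show ?thesis by simp
qed

text \<open>Together with \<open>norm_compress_le\<close> this places the norm of the compressed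
  matrix between those of the cut-off and of \<open>X\<close>.\<close>

lemma norm_proj_mat_le:
  "norm (op_mat n (\<lambda>i j. proj m o\<^sub>L (X i j o\<^sub>L proj m))) \<le> norm (op_mat (n * card (G m)) (compress n m X))"
proof -
  have "norm (op_mat n (\<lambda>i j. proj m o\<^sub>L (X i j o\<^sub>L proj m))) \<le>
      norm (block_map n m) * (norm (op_mat (n * card (G m)) (compress n m X)) * norm (adj (block_map n m)))"
    unfolding block_map_compress[symmetric]
    by (rule order_trans[OF norm_blinfun_compose mult_left_mono[OF norm_blinfun_compose norm_ge_zero]])
  also have "\<dots> \<le> 1 * (norm (op_mat (n * card (G m)) (compress n m X)) * 1)"
    using norm_block_map[of n m] by (intro mult_mono) (auto simp: norm_adj clin_block_map)
  finally show ?thesis by simp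
qed

end

section \<open>Admissible ideals\<close>

text \<open>\<open>c\<close> is not asked to be multiplicative, since compressions are not: it is
  enough that the image of each X^* X is again of the form Z^* Z.\<close>

lemma op_functional_pullback:
  assumes \<psi>: "op_functional C K m \<psi>"
    and mats: "\<And>X. X \<in> op_mats B n \<Longrightarrow> c X \<in> op_mats C m"
    and add: "\<And>X Y. X \<in> op_mats B n \<Longrightarrow> Y \<in> op_mats B n \<Longrightarrow> c (\<lambda>i j. X i j + Y i j) = (\<lambda>i j. c X i j + c Y i j)"
    and scale: "\<And>a X. X \<in> op_mats B n \<Longrightarrow> c (\<lambda>i j. op_scale a (X i j)) = (\<lambda>i j. op_scale a (c X i j))"
    and square: "\<And>X. X \<in> op_mats B n \<Longrightarrow>
      \<exists>Z\<in>op_mats C m. op_mat_mult m (op_mat_adj Z) Z = c (op_mat_mult n (op_mat_adj X) X)"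
    and contr: "\<And>X. X \<in> op_mats B n \<Longrightarrow> norm (op_mat m (c X)) \<le> norm (op_mat n X)"
    and ideal: "\<And>X. X \<in> op_mats I n \<Longrightarrow> c X \<in> op_mats K m"
  shows "op_functional B I n (\<lambda>X. \<psi> (c X))"
  unfolding op_functional_def
proof (intro conjI ballI allI)
  fix X assume X: "X \<in> op_mats B n"
  show "\<psi> (c (\<lambda>i j. op_scale a (X i j))) = a * \<psi> (c X)" for a
    using \<psi> mats[OF X] unfolding scale[OF X] op_functional_def by blast
  show "\<psi> (c (op_mat_mult n (op_mat_adj X) X)) \<in> \<real>\<^sub>\<ge>\<^sub>0"
    using square[OF X] \<psi> unfolding op_functional_def by metis
  show "cmod (\<psi> (c X)) \<le> norm (op_mat n X)"
    using \<psi> mats[OF X] contr[OF X] order_trans unfolding op_functional_def by blast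
  fix Y assume Y: "Y \<in> op_mats B n"
  show "\<psi> (c (\<lambda>i j. X i j + Y i j)) = \<psi> (c X) + \<psi> (c Y)"
    using \<psi> mats[OF X] mats[OF Y] unfolding add[OF X Y] op_functional_def by blast
next
  fix X assume "X \<in> op_mats I n"
  then show "\<psi> (c X) = 0" using \<psi> ideal unfolding op_functional_def by blast
qed

lemma op_mats_closure_approx:
  assumes S: "op_subspace S" and X: "X \<in> op_mats (closure S) n" and \<delta>: "\<delta> > 0"
  shows "\<exists>Y\<in>op_mats S n. norm (op_mat n X - op_mat n Y) < \<delta>"
proof -
  have "\<exists>f. \<forall>i j. (\<forall>l::nat. i < n \<and> j < n \<longrightarrow> f i j l \<in> S) \<and> (i < n \<and> j < n \<longrightarrow> f i j \<longlonglongrightarrow> X i j)"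
  proof -
    have "\<forall>i j. \<exists>g. (\<forall>l::nat. i < n \<and> j < n \<longrightarrow> g l \<in> S) \<and> (i < n \<and> j < n \<longrightarrow> g \<longlonglongrightarrow> X i j)"
      using op_matsD[OF X] unfolding closure_sequential by metis
    then show ?thesis by metis
  qed
  then obtain f where f: "\<And>i j l. i < n \<Longrightarrow> j < n \<Longrightarrow> f i j l \<in> S" "\<And>i j. i < n \<Longrightarrow> j < n \<Longrightarrow> f i j \<longlonglongrightarrow> X i j"
    by metis
  define Y where "Y l i j = (if i < n \<and> j < n then f i j l else 0)" for l i j
  have Y: "Y l \<in> op_mats S n" for l using f(1) by (intro op_matsI) (auto simp: Y_def)
  have "(\<lambda>l. op_mat n (Y l)) \<longlonglongrightarrow> op_mat n X"
    by (rule tendsto_op_mat) (simp add: Y_def f(2))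
  then obtain l where "norm (op_mat n (Y l) - op_mat n X) < \<delta>"
    using LIMSEQ_D[OF _ \<delta>] by blast
  then show ?thesis using Y[of l] by (auto simp: norm_minus_commute)
qed

lemma op_mat_size_zero: "op_mat 0 X = 0"
  using op_mat_cong[of 0 X "\<lambda>i j. 0"] by (simp add: op_mat_zero)

lemma op_pos_id: "op_pos (id_blinfun :: 'h::complex_hilbert op)"
  using op_pos_adj_comp[OF clin_id] by (simp add: adj_id)

context presentation
begin

lemma op_subspace_range: "op_subspace (\<theta> ` carrier F)"
  unfolding op_subspace_def
proof (intro conjI ballI allI rep_bounded)
  show "0 \<in> \<theta> ` carrier F" using imageI[OF zero_closed, of \<theta>] by (simp only: rep_zero)
  fix S T c assume "S \<in> \<theta> ` carrier F"
  then obtain x where x: "x \<in> carrier F" "S = \<theta> x" by blast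
  show "op_scale c S \<in> \<theta> ` carrier F" unfolding x(2) rep_scale[OF x(1), symmetric] by (rule imageI[OF scale_closed[OF x(1)]])
  show "adj S \<in> \<theta> ` carrier F" unfolding x(2) rep_star[OF x(1), symmetric] by (rule imageI[OF star_closed[OF x(1)]])
  assume "T \<in> \<theta> ` carrier F"
  then obtain y where y: "y \<in> carrier F" "T = \<theta> y" by blast
  show "S + T \<in> \<theta> ` carrier F" unfolding x(2) y(2) rep_add[OF x(1) y(1), symmetric] by (rule imageI[OF add_closed[OF x(1) y(1)]])
qed

lemma op_mats_range:
  assumes X: "X \<in> op_mats (\<theta> ` carrier F) n"
  shows "\<exists>x\<in>Mat F n. amplify \<theta> x = X"
proof -
  define y where "y i j = inv_into (carrier F) \<theta> (X i j)" for i j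
  have y: "y i j \<in> carrier F \<and> \<theta> (y i j) = X i j" if "i < n" "j < n" for i j
    unfolding y_def by (intro conjI inv_into_into f_inv_into_f op_matsD[OF X that])
  show ?thesis
  proof (rule bexI)
    show "(\<lambda>i j. if i < n \<and> j < n then y i j else vzero F) \<in> Mat F n" using y by (auto simp: Mat_def)
    show "amplify \<theta> (\<lambda>i j. if i < n \<and> j < n then y i j else vzero F) = X"
      using y op_mats_outside[OF X] by (intro HOL.ext) (auto simp: amplify_def rep_zero)
  qed
qed

text \<open>The envelope is itself an extension, so its matrix norms and states provide both
  conditions for the kernel. By \<open>envelope_quotient_map\<close> this kernel is then the largest
  admissible ideal.\<close>

theorem kernel_admissible:
  assumes extn: "Csharp_extension F A \<iota>" and \<rho>: "star_hom (op_cstar gen_alg) A \<rho>" and onto: "\<rho> ` gen_alg = carrier A"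
    and \<rho>\<iota>: "\<And>x. x \<in> carrier F \<Longrightarrow> \<rho> (\<theta> x) = \<iota> x"
  shows "admissible {T \<in> gen_alg. \<rho> T = vzero A}"
proof -
  let ?K = "{T \<in> gen_alg. \<rho> T = vzero A}"
  note B = op_alg_gen_alg
  have A: "cstar_algebra A" and isom: "completely_isometric F (operator_space_of_cstar A) \<iota>"
    using extn by (auto simp: Csharp_extension_def)
  have Q: "op_quotient gen_alg ?K A \<rho>" by (rule op_quotient_star_hom[OF B A \<rho> onto])
  note qd = op_quotientD[OF Q]
  note Ks = op_idealD(1)[OF qd(2)]
  have am: "amplify \<rho> (amplify \<theta> x) = amplify \<iota> x" if "x \<in> Mat F n" for n x
    using \<rho>\<iota> Mat_closed[OF that] by (simp add: amplify_def)
  have mats: "amplify \<theta> x \<in> op_mats gen_alg n" if "x \<in> Mat F n" for n x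
    by (rule rep_op_mats[OF rep_gen_alg that])
  have mn: "cstar_mnorm A n (amplify \<rho> X) \<le> norm (op_mat n (\<lambda>i j. X i j + Y i j))"
    if X: "X \<in> op_mats gen_alg n" and Y: "Y \<in> op_mats ?K n" for n X Y
  proof -
    have Y': "(\<lambda>i j. op_scale (-1) (Y i j)) \<in> op_mats ?K n" by (rule op_mats_op_scale[OF Ks Y])
    have "infdist (op_mat n X) (op_mat n ` op_mats ?K n) \<le>
        dist (op_mat n X) (op_mat n (\<lambda>i j. op_scale (-1) (Y i j)))"
      by (rule infdist_le[OF imageI[OF Y']])
    then show ?thesis
      unfolding op_quotient_mnorm[OF Q X] op_mat_op_scale
      by (simp only: dist_norm op_scale_minus_one op_mat_add diff_minus_eq_add)
  qed
  show ?thesis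
    unfolding admissible_def
  proof (intro conjI allI impI ballI qd(2))
    fix n :: nat and x Y assume n: "0 < n" and x: "x \<in> Mat F n" and Y: "Y \<in> op_mats ?K n"
    have "norm (op_mat n (amplify \<theta> x)) = cstar_mnorm A n (amplify \<iota> x)"
      using isom n x by (simp add: completely_isometric_def rep_norm)
    also have "\<dots> \<le> norm (op_mat n (\<lambda>i j. amplify \<theta> x i j + Y i j))"
      using mn[OF mats[OF x] Y] by (simp add: am[OF x])
    finally show "norm (op_mat n (amplify \<theta> x)) \<le> norm (op_mat n (\<lambda>i j. \<theta> (x i j) + Y i j))"
      by (simp add: amplify_def)
  next
    fix n :: nat and x assume n: "0 < n" and x: "x \<in> Mat_sa F n" and np: "\<not> op_pos (id_blinfun + op_mat n (amplify \<theta> x))"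
    have xM: "x \<in> Mat F n" using x by (simp add: Mat_sa_def)
    have st: "\<iota> (vstar F y) = vstar A (\<iota> y)" if y: "y \<in> carrier F" for y
    proof -
      have "\<theta> y \<in> gen_alg" using rep_gen_alg y by blast
      then show ?thesis using qd(8)[of "\<theta> y"] \<rho>\<iota>[OF y] \<rho>\<iota>[OF star_closed[OF y]] rep_star[OF y] by simp
    qed
    obtain \<psi> where \<psi>: "norm_one_positive_functional (operator_space_of_cstar A) n \<psi>" "Re (\<psi> (amplify \<iota> x)) < -1"
      using extension_separating[OF extn st n x np] by blast
    have p: "positive_contraction (operator_space_of_cstar A) n \<psi>" by (rule norm_one_positive_contraction[OF \<psi>(1)])
    have aM: "amplify \<rho> X \<in> Mat A n" if "X \<in> op_mats gen_alg n" for X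
      using that by (simp add: op_quotient_Mat[OF Q])
    have le: "cmod (\<psi> (amplify \<rho> X)) \<le> norm (op_mat n (\<lambda>i j. X i j + Y i j))"
      if X: "X \<in> op_mats gen_alg n" and Y: "Y \<in> op_mats ?K n" for X Y
      using p aM[OF X] mn[OF X Y] order_trans by (force simp: positive_contraction_def)
    have K0: "(\<lambda>i j. 0) \<in> op_mats ?K n" using op_subspaceD(2)[OF Ks] by (auto simp: op_mats_def)
    have "op_functional gen_alg ?K n (\<lambda>X. \<psi> (amplify \<rho> X))"
      unfolding op_functional_def
    proof (intro conjI ballI allI)
      fix X assume X: "X \<in> op_mats gen_alg n"
      show "\<psi> (amplify \<rho> (\<lambda>i j. op_scale c (X i j))) = c * \<psi> (amplify \<rho> X)" for c
        unfolding op_quotient_mat_ops(2)[OF Q X, of c, symmetric]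
        using p aM[OF X] by (simp add: positive_contraction_def)
      have "mat_mult A n (mat_star A n (amplify \<rho> X)) (amplify \<rho> X) = amplify \<rho> (op_mat_mult n (op_mat_adj X) X)"
        using op_quotient_mat_ops(3)[OF Q X] op_quotient_mat_ops(4)[OF Q op_mat_adj_closed[OF op_algD(1)[OF B] X] X] by simp
      then have "amplify \<rho> (op_mat_mult n (op_mat_adj X) X) \<in> cone (operator_space_of_cstar A) n"
        using aM[OF X] by force
      then show "\<psi> (amplify \<rho> (op_mat_mult n (op_mat_adj X) X)) \<in> \<real>\<^sub>\<ge>\<^sub>0"
        using p unfolding positive_contraction_def by blast
      show "cmod (\<psi> (amplify \<rho> X)) \<le> norm (op_mat n X)" using le[OF X K0] by simp
      fix Y assume Y: "Y \<in> op_mats gen_alg n"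
      show "\<psi> (amplify \<rho> (\<lambda>i j. X i j + Y i j)) = \<psi> (amplify \<rho> X) + \<psi> (amplify \<rho> Y)"
        unfolding op_quotient_mat_ops(1)[OF Q X Y, symmetric]
        using p aM[OF X] aM[OF Y] by (simp add: positive_contraction_def)
    next
      fix X assume X: "X \<in> op_mats ?K n"
      have XB: "X \<in> op_mats gen_alg n" using X op_mats_mono[of ?K gen_alg n] by blast
      have "norm (op_mat n (\<lambda>i j. X i j + op_scale (-1) (X i j))) = 0"
        by (simp add: op_scale_minus_one op_mat_zero)
      then show "\<psi> (amplify \<rho> X) = 0" using le[OF XB op_mats_op_scale[OF Ks X, of "-1"]] by simp
    qed
    moreover have "Re (\<psi> (amplify \<rho> (amplify \<theta> x))) < -1" using \<psi>(2) by (simp add: am[OF xM])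
    ultimately show "\<exists>\<phi>. op_functional gen_alg ?K n \<phi> \<and> Re (\<phi> (amplify \<theta> x)) < -1" by blast
  qed
qed

text \<open>Slices of the stabilization lie only in the closure of the image of F, which is not
  assumed complete, so the norm condition is extended by continuity.\<close>

lemma admissible_closure_norm:
  assumes I: "admissible I" and X: "X \<in> op_mats (closure (\<theta> ` carrier F)) n" and Y: "Y \<in> op_mats I n"
  shows "norm (op_mat n X) \<le> norm (op_mat n (\<lambda>i j. X i j + Y i j))"
proof (cases "n = 0")
  case False
  show ?thesis
  proof (rule field_le_epsilon)
    fix e :: real assume "e > 0"
    then obtain X' where X': "X' \<in> op_mats (\<theta> ` carrier F) n" "norm (op_mat n X - op_mat n X') < e / 2"
      using op_mats_closure_approx[OF op_subspace_range X, of "e / 2"] by auto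
    obtain x where x: "x \<in> Mat F n" "amplify \<theta> x = X'" using op_mats_range[OF X'(1)] by blast
    have "norm (op_mat n (amplify \<theta> x)) \<le> norm (op_mat n (\<lambda>i j. \<theta> (x i j) + Y i j))"
      using I x(1) Y False unfolding admissible_def by blast
    moreover have "(\<lambda>i j. \<theta> (x i j) + Y i j) = (\<lambda>i j. X' i j + Y i j)" using x(2) by (simp add: amplify_def fun_eq_iff)
    ultimately have le: "norm (op_mat n X') \<le> norm (op_mat n X' + op_mat n Y)"
      by (simp add: x(2) op_mat_add)
    have "op_mat n X' + op_mat n Y = (op_mat n X + op_mat n Y) - (op_mat n X - op_mat n X')" by simp
    then have "norm (op_mat n X' + op_mat n Y) \<le> norm (op_mat n X + op_mat n Y) + norm (op_mat n X - op_mat n X')"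
      using norm_triangle_ineq4 by metis
    moreover have "norm (op_mat n X) \<le> norm (op_mat n X') + norm (op_mat n X - op_mat n X')"
      by (rule norm_triangle_sub)
    ultimately show "norm (op_mat n X) \<le> norm (op_mat n (\<lambda>i j. X i j + Y i j)) + e"
      unfolding op_mat_add using le X'(2) by linarith
  qed
qed (simp add: op_mat_size_zero)

text \<open>Strictness of the bound -1 leaves room both for approximating \<open>X\<close> by a
  matrix over F and for a rescaling that pays for the error.\<close>

lemma admissible_closure_separating:
  assumes I: "admissible I" and X: "X \<in> op_mats (closure (\<theta> ` carrier F)) n" "op_mat_adj X = X"
    and np: "\<not> op_pos (id_blinfun + op_mat n X)"
  shows "\<exists>\<phi>. op_functional gen_alg I n \<phi> \<and> Re (\<phi> X) < -1"
proof (cases "n = 0")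
  case True
  then show ?thesis using np by (simp add: op_mat_size_zero op_pos_id)
next
  case False
  note Rs = op_subspace_range
  note B = op_alg_gen_alg
  have clB: "closure (\<theta> ` carrier F) \<subseteq> gen_alg" by (rule closure_minimal[OF rep_gen_alg op_algD(3)[OF B]])
  have cX: "clin (X i j)" for i j
    using op_matsD'[OF op_subspace_closure[OF Rs] X(1)] op_subspaceD(1)[OF op_subspace_closure[OF Rs]] by blast
  have "adj (op_mat n X) = op_mat n X" using op_mat_of_adj[of n X] cX X(2) by simp
  then obtain \<xi> where \<xi>: "norm \<xi> = 1" "Re (cinner \<xi> (op_mat n X \<xi>)) < -1"
    using not_op_pos_vector[OF clin_op_mat _ np] cX by blast
  \<comment> \<open>Half the gap: the form of \<open>X\<close> at \<open>\<xi>\<close> is -1 - 2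
    \<eta>, that of an \<eta>-close \<open>Y\<close> is below -1 - \<eta>, and that of Y / (1 +
    \<eta>) is below -1. Separation then puts \<phi> Y below -1 - \<eta> and \<phi> X below
    -1.\<close>
  define \<eta> where "\<eta> = (- 1 - Re (cinner \<xi> (op_mat n X \<xi>))) / 2"
  have \<eta>: "\<eta> > 0" using \<xi>(2) by (simp add: \<eta>_def)
  obtain Z where Z: "Z \<in> op_mats (\<theta> ` carrier F) n" "norm (op_mat n X - op_mat n Z) < \<eta>"
    using op_mats_closure_approx[OF Rs X(1) \<eta>] by blast
  have cZ: "clin (Z i j)" for i j using op_matsD'[OF Rs Z(1)] op_subspaceD(1)[OF Rs] by blast
  \<comment> \<open>Averaging with the adjoint makes the approximant self-adjoint and, as
    \<open>X\<close> is self-adjoint, does not increase the error.\<close>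
  define Y where "Y i j = op_scale (1/2) (Z i j + op_mat_adj Z i j)" for i j
  have Y: "Y \<in> op_mats (\<theta> ` carrier F) n"
    unfolding Y_def[abs_def] by (intro op_mats_op_scale[OF Rs] op_mats_add[OF Rs] Z(1) op_mat_adj_closed[OF Rs])
  have cY: "clin (Y i j)" for i j using op_matsD'[OF Rs Y] op_subspaceD(1)[OF Rs] by blast
  have Ysa: "op_mat_adj Y = Y"
    by (rule HOL.ext, rule HOL.ext)
      (simp add: op_mat_adj_def Y_def adj_op_scale adj_add adj_adj clin_add clin_adj cZ add.commute)
  have XY: "norm (op_mat n X - op_mat n Y) < \<eta>"
  proof -
    have Z': "op_mat n (op_mat_adj Z) = adj (op_mat n Z)" by (rule op_mat_of_adj[OF cZ])
    have X': "adj (op_mat n X) = op_mat n X" using op_mat_of_adj[of n X] cX X(2) by simp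
    define D where "D = op_mat n X - op_mat n Z"
    have cD: "clin D" unfolding D_def by (intro clin_diff clin_op_mat cX cZ)
    have "op_mat n Y = op_scale (1/2) (op_mat n Z + adj (op_mat n Z))"
      unfolding Y_def[abs_def] op_mat_op_scale op_mat_add Z' ..
    also have "\<dots> = (1/2) *\<^sub>R (op_mat n Z + adj (op_mat n Z))"
      using op_scale_of_real[of "1/2"] by simp
    finally have "op_mat n X - op_mat n Y = (1/2) *\<^sub>R D + (1/2) *\<^sub>R adj D"
      by (simp add: D_def adj_diff clin_op_mat cX cZ X' algebra_simps flip: scaleR_add_left)
    then have "norm (op_mat n X - op_mat n Y) \<le> norm ((1/2) *\<^sub>R D) + norm ((1/2) *\<^sub>R adj D)"
      by (simp only: norm_triangle_ineq)
    also have "\<dots> = norm D" by (simp add: norm_adj cD)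
    finally show ?thesis using Z(2) by (simp add: D_def)
  qed
  define W where "W i j = op_scale (complex_of_real (1 / (1 + \<eta>))) (Y i j)" for i j
  have W: "W \<in> op_mats (\<theta> ` carrier F) n"
    unfolding W_def[abs_def] by (intro op_mats_op_scale[OF Rs] Y)
  obtain w where w: "w \<in> Mat F n" "amplify \<theta> w = W" using op_mats_range[OF W] by blast
  have "adj (Y j i) = Y i j" for i j using fun_cong[OF fun_cong[OF Ysa, of i], of j] by (simp add: op_mat_adj_def)
  then have "op_mat_adj W = W"
    by (intro HOL.ext) (simp add: op_mat_adj_def W_def adj_op_scale cY)
  then have wsa: "w \<in> Mat_sa F n" using Mat_sa_iff[OF w(1)] w(2) by simp
  have Yneg: "Re (cinner \<xi> (op_mat n Y \<xi>)) < - 1 - \<eta>"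
  proof -
    have "cinner \<xi> (op_mat n X \<xi>) - cinner \<xi> (op_mat n Y \<xi>) = cinner \<xi> ((op_mat n X - op_mat n Y) \<xi>)"
      by (simp add: blinfun.diff_left cinner.diff_right)
    moreover have "cmod (cinner \<xi> ((op_mat n X - op_mat n Y) \<xi>)) \<le> norm \<xi> * (norm (op_mat n X - op_mat n Y) * norm \<xi>)"
      by (rule order_trans[OF cmod_cinner_le mult_left_mono[OF norm_blinfun]]) simp
    ultimately have "cmod (cinner \<xi> (op_mat n X \<xi>) - cinner \<xi> (op_mat n Y \<xi>)) < \<eta>"
      using XY \<xi>(1) by simp
    then have "Re (cinner \<xi> (op_mat n Y \<xi>)) - Re (cinner \<xi> (op_mat n X \<xi>)) < \<eta>"
      using abs_Re_le_cmod[of "cinner \<xi> (op_mat n X \<xi>) - cinner \<xi> (op_mat n Y \<xi>)"] by simp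
    moreover have "Re (cinner \<xi> (op_mat n X \<xi>)) = - 1 - 2 * \<eta>" by (simp add: \<eta>_def field_simps)
    ultimately show ?thesis by linarith
  qed
  have "\<not> op_pos (id_blinfun + op_mat n (amplify \<theta> w))"
  proof
    assume "op_pos (id_blinfun + op_mat n (amplify \<theta> w))"
    then have "0 \<le> Re (cinner \<xi> ((id_blinfun + op_mat n W) \<xi>))" unfolding w(2) by (rule op_posD)
    then have "0 \<le> 1 + 1 / (1 + \<eta>) * Re (cinner \<xi> (op_mat n Y \<xi>))"
      using \<xi>(1) by (simp add: W_def[abs_def] op_mat_op_scale blinfun.add_left cinner.add_right cinner_norm cinner_scale_right)
    then show False using Yneg \<eta> by (simp add: field_simps)
  qed
  then obtain \<phi> where \<phi>: "op_functional gen_alg I n \<phi>" "Re (\<phi> W) < -1"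
    using I wsa w(2) False unfolding admissible_def by blast
  have XB: "X \<in> op_mats gen_alg n" using X(1) op_mats_mono[OF clB] by blast
  have YB: "Y \<in> op_mats gen_alg n" using Y op_mats_mono[OF rep_gen_alg] by blast
  have D: "(\<lambda>i j. X i j - Y i j) \<in> op_mats gen_alg n" by (rule op_mats_diff[OF op_algD(1)[OF B] XB YB])
  have "\<phi> W = complex_of_real (1 / (1 + \<eta>)) * \<phi> Y"
    using \<phi>(1) YB unfolding W_def[abs_def] op_functional_def by blast
  then have "Re (\<phi> Y) = (1 + \<eta>) * Re (\<phi> W)" using \<eta> by simp
  also have "\<dots> < (1 + \<eta>) * (-1)" using \<phi>(2) \<eta> by (intro mult_strict_left_mono) auto
  finally have \<phi>Y: "Re (\<phi> Y) < - 1 - \<eta>" by simp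
  have "\<forall>X\<in>op_mats gen_alg n. \<forall>Y\<in>op_mats gen_alg n. \<phi> (\<lambda>i j. X i j + Y i j) = \<phi> X + \<phi> Y"
    using \<phi>(1) unfolding op_functional_def by blast
  from bspec[OF bspec[OF this D] YB] have "\<phi> X = \<phi> (\<lambda>i j. X i j - Y i j) + \<phi> Y" by simp
  moreover
  have "cmod (\<phi> (\<lambda>i j. X i j - Y i j)) \<le> norm (op_mat n (\<lambda>i j. X i j - Y i j))"
    using \<phi>(1) D unfolding op_functional_def by blast
  moreover have "Re (\<phi> (\<lambda>i j. X i j - Y i j)) \<le> cmod (\<phi> (\<lambda>i j. X i j - Y i j))" by (rule complex_Re_le_cmod)
  ultimately have "Re (\<phi> X) < -1" using \<phi>Y XY by (simp add: op_mat_diff)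
  then show ?thesis using \<phi>(1) by blast
qed

end

section \<open>Stabilization\<close>

context approximated_tensor
begin

lemma slice_add: "slice a (T + R) b = slice a T b + slice a R b"
  by (simp add: slice_def comp_simps)

lemma slice_zero: "slice a 0 b = 0"
  by (simp add: slice_def)

lemma slice_op_scale: "clin T \<Longrightarrow> slice a (op_scale c T) b = op_scale c (slice a T b)"
  by (rule blinfun_eqI) (simp add: slice_def clinD[OF clin_adj[OF clin_creation]])

lemma adj_slice: "clin T \<Longrightarrow> adj (slice a T b) = slice b (adj T) a"
  by (simp add: slice_def adj_comp clin_comp clin_creation clin_adj adj_adj comp_assoc)

lemma slice_elem: "clin x \<Longrightarrow> slice a (elem b x c) d = op_scale (cinner a b * cinner c d) x"
  by (simp add: slice_def creation_elem_creation)

lemma tendsto_slice: "T \<longlonglongrightarrow> L \<Longrightarrow> (\<lambda>n. slice a (T n) b) \<longlonglongrightarrow> slice a L b"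
  unfolding slice_def by (intro tendsto_comp tendsto_const)

lemma tendsto_elem: "x \<longlonglongrightarrow> y \<Longrightarrow> (\<lambda>n. elem a (x n) b) \<longlonglongrightarrow> elem a y b"
  unfolding elem_def by (intro tendsto_comp tendsto_const)

lemma elem_slice: "clin T \<Longrightarrow> elem a (slice b T c) d = elem a id_blinfun b o\<^sub>L (T o\<^sub>L elem c id_blinfun d)"
  by (simp add: elem_def slice_def comp_assoc)

text \<open>A cut-off operator is the sum of its blocks, which is how facts about slices return to
  the stabilization.\<close>

lemma proj_conj: "proj m o\<^sub>L (T o\<^sub>L proj m) = (\<Sum>g\<in>G m. \<Sum>h\<in>G m. elem g (slice g T h) h)"
  unfolding proj_def
  by (simp add: bounded_bilinear.sum_left[OF bounded_bilinear_blinfun_compose]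
      bounded_bilinear.sum_right[OF bounded_bilinear_blinfun_compose] elem_def slice_def comp_assoc) (rule sum.swap)

text \<open>Slicing is not multiplicative, but inserting a cut-off between the factors gives finite
  sums of products of slices, and these converge to the slice of the product.\<close>

lemma slice_comp_mem:
  assumes R: "R \<in> compressible" and C: "closed C" "0 \<in> C" "\<And>x y. x \<in> C \<Longrightarrow> y \<in> C \<Longrightarrow> x + y \<in> C"
    and mem: "\<And>g. slice a R g o\<^sub>L slice g T b \<in> C"
  shows "slice a (R o\<^sub>L T) b \<in> C"
proof -
  have "(\<lambda>m. slice a ((R o\<^sub>L proj m) o\<^sub>L T) b) \<longlonglongrightarrow> slice a (R o\<^sub>L T) b"
    using R by (intro tendsto_slice tendsto_comp tendsto_const) (simp add: compressible_def)
  moreover have "slice a ((R o\<^sub>L proj m) o\<^sub>L T) b \<in> C" for m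
  proof -
    have "slice a ((R o\<^sub>L proj m) o\<^sub>L T) b = (\<Sum>g\<in>G m. slice a R g o\<^sub>L slice g T b)"
      unfolding proj_def
      by (simp add: bounded_bilinear.sum_left[OF bounded_bilinear_blinfun_compose]
          bounded_bilinear.sum_right[OF bounded_bilinear_blinfun_compose] elem_def slice_def comp_assoc)
    also have "\<dots> \<in> C"
      using finite_G[of m] by (induction rule: finite_induct) (auto simp: C mem)
    finally show ?thesis .
  qed
  ultimately show ?thesis by (rule closed_sequentially[OF C(1), rotated])
qed

lemma compress_op_mats:
  assumes S: "0 \<in> S" and X: "\<And>i j. i < n \<Longrightarrow> j < n \<Longrightarrow> (\<And>a b. slice a (X i j) b \<in> S)"
  shows "compress n m X \<in> op_mats S (n * card (G m))"
proof (rule op_matsI)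
  fix p q assume pq: "p < n * card (G m)" "q < n * card (G m)"
  have "p div card (G m) < n" "q div card (G m) < n" using pq by (simp_all add: less_mult_imp_div_less)
  then show "compress n m X p q \<in> S" using pq X by (simp add: compress_def)
qed (auto simp: compress_def)

end

text \<open>\<open>ev\<close> fixes the corner embedding that sends b to
  \<open>elem ev b ev\<close>. The unit in F puts the cut-offs, being sums of
  \<open>elem g id_blinfun g\<close>, into the stabilization.\<close>

locale stabilization = F: presentation F \<theta> + approximated_tensor t G
  for F :: "'x operator_space" and \<theta> :: "'x \<Rightarrow> 'h::complex_hilbert op"
    and t :: "'h \<Rightarrow> 'l::complex_hilbert \<Rightarrow> 'k::complex_hilbert" and G :: "nat \<Rightarrow> 'l set" +
  fixes ev :: 'l
  assumes unit: "id_blinfun \<in> \<theta> ` carrier F" and norm_ev: "norm ev = 1"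
begin

abbreviation stable_space :: "'k op set" where
  "stable_space \<equiv> closure (elem_sums (\<theta> ` carrier F))"

sublocale FK: presentation "concrete_operator_space stable_space" id
  by (rule stabilized_presentation[OF F.op_subspace_range unit])

abbreviation B where "B \<equiv> F.gen_alg"
abbreviation BK where "BK \<equiv> FK.gen_alg"

lemma cinner_ev: "cinner ev ev = 1"
  by (simp add: cinner_norm norm_ev)

lemma stable_space_BK: "stable_space \<subseteq> BK"
  using FK.rep_gen_alg by simp

lemma elem_stable_space: "x \<in> carrier F \<Longrightarrow> elem a (\<theta> x) b \<in> stable_space"
  by (rule subsetD[OF closure_subset elem_sums.elem[OF imageI]])

lemma elem_BK:
  assumes "b \<in> B"
  shows "elem a b c \<in> BK"
proof -
  note alg = FK.op_alg_gen_alg and D = op_subspaceD[OF op_algD(1)[OF FK.op_alg_gen_alg]]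
  let ?C = "{b. \<forall>a c. elem a b c \<in> BK}"
  have "B \<subseteq> ?C"
  proof (rule F.gen_alg_induct)
    show "closed ?C"
      unfolding closed_sequential_limits
      using closed_sequentially[OF op_algD(3)[OF alg] _ tendsto_elem] by blast
    show rep: "\<theta> x \<in> ?C" if "x \<in> carrier F" for x
      using elem_stable_space[OF that] stable_space_BK by blast
    show "\<theta> x o\<^sub>L T \<in> ?C" if x: "x \<in> carrier F" and T: "T \<in> ?C" for x T
    proof (intro CollectI allI)
      fix a c
      \<comment> \<open>Calculus of matrix units: the inner vectors \<open>ev\<close> contract to 1,
        so x T at (a, c) is the product of x at (a, ev) and T at (ev, c).\<close>
      have "elem a (\<theta> x) ev o\<^sub>L elem ev T c \<in> BK" using rep[OF x] T by (intro op_algD(2)[OF alg]) auto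
      then show "elem a (\<theta> x o\<^sub>L T) c \<in> BK" using F.rep_clin[OF x] by (simp add: elem_comp cinner_ev)
    qed
  qed (auto simp: elem_zero elem_add D(2,3))
  then show ?thesis using assms by blast
qed

lemma stable_space_compressible: "stable_space \<subseteq> compressible"
  by (rule elem_sums_compressible[OF F.op_subspace_range])

lemma BK_compressible: "BK \<subseteq> compressible"
  using stable_space_compressible by (intro FK.gen_alg_least op_alg_compressible) simp

lemma slice_stable_space:
  assumes "T \<in> stable_space"
  shows "slice a T b \<in> closure (\<theta> ` carrier F)"
proof -
  note D = op_subspaceD[OF F.op_subspace_range]
  have el: "slice a T b \<in> \<theta> ` carrier F" if "T \<in> elem_sums (\<theta> ` carrier F)" for T
    using that
  proof (rule elem_sums.induct)
    show "slice a 0 b \<in> \<theta> ` carrier F" unfolding slice_zero by (rule D(2))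
    show "slice a (T + R) b \<in> \<theta> ` carrier F"
      if "slice a T b \<in> \<theta> ` carrier F" "slice a R b \<in> \<theta> ` carrier F" for T R
      unfolding slice_add by (rule D(3)[OF that])
    show "slice a (elem c x d) b \<in> \<theta> ` carrier F" if "x \<in> \<theta> ` carrier F" for c x d
      unfolding slice_elem[OF D(1)[OF that]] by (rule D(4)[OF that])
  qed
  obtain f where f: "\<And>n::nat. f n \<in> elem_sums (\<theta> ` carrier F)" "f \<longlonglongrightarrow> T"
    using assms unfolding closure_sequential by blast
  show ?thesis
    unfolding closure_sequential
    by (intro exI[of _ "\<lambda>n. slice a (f n) b"] conjI allI el f(1) tendsto_slice f(2))
qed

lemma closure_range_B: "closure (\<theta> ` carrier F) \<subseteq> B"
  by (rule closure_minimal[OF F.rep_gen_alg op_algD(3)[OF F.op_alg_gen_alg]])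

lemma slice_B:
  assumes "T \<in> BK"
  shows "slice a T b \<in> B"
proof -
  note alg = F.op_alg_gen_alg and D = op_subspaceD[OF op_algD(1)[OF F.op_alg_gen_alg]]
  let ?C = "{T. \<forall>a b. slice a T b \<in> B}"
  have "BK \<subseteq> ?C"
  proof (rule FK.gen_alg_induct)
    show "closed ?C"
      unfolding closed_sequential_limits
      using closed_sequentially[OF op_algD(3)[OF alg] _ tendsto_slice] by blast
    show rep: "id x \<in> ?C" if "x \<in> carrier (concrete_operator_space stable_space)" for x
      using that slice_stable_space closure_range_B by auto
    show "id x o\<^sub>L T \<in> ?C" if x: "x \<in> carrier (concrete_operator_space stable_space)" and T: "T \<in> ?C" for x T
      using x T rep[OF x] stable_space_compressible
      by (auto intro!: slice_comp_mem[OF _ op_algD(3)[OF alg] D(2,3)] op_algD(2)[OF alg])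
  qed (auto simp: slice_zero slice_add D(2,3))
  then show ?thesis using assms by blast
qed

lemma id_BK: "elem a id_blinfun b \<in> BK"
  using elem_BK F.rep_gen_alg unit by blast

lemma norm_elem_mat_le:
  "norm (op_mat n (\<lambda>i j. elem ev (X i j) ev)) \<le> norm (op_mat n X)"
  "norm (op_mat n (\<lambda>i j. slice ev (Y i j) ev)) \<le> norm (op_mat n Y)"
proof -
  have V: "norm (creation ev) \<le> 1" "norm (adj (creation ev)) \<le> 1"
    using norm_creation_le[of ev] by (simp_all add: norm_ev norm_adj clin_creation)
  have "norm (op_mat n (\<lambda>i j. elem ev (X i j) ev)) \<le> norm (creation ev) * (norm (op_mat n X) * norm (adj (creation ev)))"
    unfolding elem_def by (rule norm_op_mat_conj_le)
  also have "\<dots> \<le> 1 * (norm (op_mat n X) * 1)" using V by (intro mult_mono) auto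
  finally show "norm (op_mat n (\<lambda>i j. elem ev (X i j) ev)) \<le> norm (op_mat n X)" by simp
  have "norm (op_mat n (\<lambda>i j. slice ev (Y i j) ev)) \<le> norm (adj (creation ev)) * (norm (op_mat n Y) * norm (creation ev))"
    unfolding slice_def by (rule norm_op_mat_conj_le)
  also have "\<dots> \<le> 1 * (norm (op_mat n Y) * 1)" using V by (intro mult_mono) auto
  finally show "norm (op_mat n (\<lambda>i j. slice ev (Y i j) ev)) \<le> norm (op_mat n Y)" by simp
qed

lemma slice_elem_ev: "clin x \<Longrightarrow> slice ev (elem ev x ev) ev = x"
  by (simp add: slice_elem cinner_ev)

text \<open>Compression by the isometry \<open>ell2_map (creation ev)\<close> undoes the corner
  embedding and preserves positivity.\<close>

lemma elem_mat_pos: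
  assumes X: "\<And>i j. clin (X i j)" and pos: "op_pos (id_blinfun + op_mat n (\<lambda>i j. elem ev (X i j) ev))"
  shows "op_pos (id_blinfun + op_mat n X)"
proof -
  let ?V = "ell2_map (creation ev)"
  have "op_pos (adj ?V o\<^sub>L ((id_blinfun + op_mat n (\<lambda>i j. elem ev (X i j) ev)) o\<^sub>L ?V))"
    by (rule op_pos_conj[OF clin_ell2_map[OF clin_creation] pos])
  also have "adj ?V o\<^sub>L ((id_blinfun + op_mat n (\<lambda>i j. elem ev (X i j) ev)) o\<^sub>L ?V) =
      (adj ?V o\<^sub>L ?V) + (adj ?V o\<^sub>L (op_mat n (\<lambda>i j. elem ev (X i j) ev) o\<^sub>L ?V))"
    by (rule blinfun_eqI) (simp add: blinfun.add_left blinfun.add_right)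
  also have "adj ?V o\<^sub>L (op_mat n (\<lambda>i j. elem ev (X i j) ev) o\<^sub>L ?V) = op_mat n X"
    unfolding adj_ell2_map[OF clin_creation] ell2_map_op_mat slice_def[symmetric] by (simp add: slice_elem_ev X)
  also have "adj ?V o\<^sub>L ?V = id_blinfun"
    unfolding adj_ell2_map[OF clin_creation]
    by (intro blinfun_eqI ell2_eqI) (simp add: ell2_map_nth creation_apply adj_creation_t cinner_ev)
  finally show ?thesis .
qed

text \<open>The corner embedding is an isometric star-homomorphism with slicing at \<open>ev\<close>
  as left inverse. It sends matrices over F into the stabilization, where the hypothesis on
  \<open>K\<close> applies, and norms and functionals pull back along it.\<close>

theorem corner_admissible:
  assumes K: "FK.admissible K"
  shows "F.admissible {b \<in> B. elem ev b ev \<in> K}"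
proof -
  let ?I = "{b \<in> B. elem ev b ev \<in> K}"
  let ?c = "\<lambda>(X :: 'h op mat) i j. elem ev (X i j) ev"
  note BD = op_subspaceD[OF op_algD(1)[OF F.op_alg_gen_alg]]
  have K': "op_ideal BK K" using K unfolding FK.admissible_def by blast
  note KD = op_subspaceD[OF op_idealD(1)[OF K']]
  have ideal: "op_ideal B ?I"
    unfolding op_ideal_def
  proof (intro conjI ballI)
    show "op_subspace ?I"
      unfolding op_subspace_def
    proof (intro conjI ballI allI)
      show "?I \<subseteq> bounded_ops" "0 \<in> ?I" using F.gen_alg_bounded BD(2) KD(2) by (auto simp: elem_zero)
      fix T c assume T: "T \<in> ?I"
      then show "op_scale c T \<in> ?I" using BD(4) KD(4) by (simp add: elem_op_scale)
      have "adj (elem ev T ev) \<in> K" using T KD(5) by simp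
      then show "adj T \<in> ?I" using T BD(1,5) by (simp add: adj_elem)
      fix R assume "R \<in> ?I"
      then show "T + R \<in> ?I" using T BD(3) KD(3) by (simp add: elem_add)
    qed
    show "?I \<subseteq> B" by blast
    fix S T assume S: "S \<in> B" and T: "T \<in> ?I"
    have "elem ev S ev o\<^sub>L elem ev T ev \<in> K" "elem ev T ev o\<^sub>L elem ev S ev \<in> K"
      using T by (auto intro: op_idealD(3,4)[OF K' elem_BK[OF S]])
    then show "S o\<^sub>L T \<in> ?I" "T o\<^sub>L S \<in> ?I"
      using S T BD(1) op_algD(2)[OF F.op_alg_gen_alg] by (simp_all add: elem_comp cinner_ev)
  next
    show "closed ?I"
      unfolding closed_sequential_limits
    proof (intro allI impI, elim conjE)
      fix T L assume T: "\<forall>n. T n \<in> ?I" and L: "T \<longlonglongrightarrow> L"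
      have "L \<in> B" using T by (intro closed_sequentially[OF op_algD(3)[OF F.op_alg_gen_alg] _ L]) simp
      moreover have "elem ev L ev \<in> K"
        using T by (intro closed_sequentially[OF op_idealD(5)[OF K'] _ tendsto_elem[OF L]]) simp
      ultimately show "L \<in> ?I" by simp
    qed
  qed
  have cM: "?c (amplify \<theta> x) \<in> op_mats (closure (id ` carrier (concrete_operator_space stable_space))) n"
    if x: "x \<in> Mat F n" for x n
    using x by (intro op_matsI) (auto simp: amplify_def Mat_def F.rep_zero elem_zero intro: elem_stable_space)
  show ?thesis
    unfolding F.admissible_def
  proof (intro conjI allI impI ballI ideal)
    fix n :: nat and x Y assume n: "0 < n" and x: "x \<in> Mat F n" and Y: "Y \<in> op_mats ?I n"
    have cY: "?c Y \<in> op_mats K n"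
      using Y by (intro op_matsI) (auto dest: op_matsD simp: op_mats_outside elem_zero)
    from FK.admissible_closure_norm[OF K cM[OF x] cY]
    have "norm (op_mat n (?c (amplify \<theta> x))) \<le> norm (op_mat n (?c (\<lambda>i j. \<theta> (x i j) + Y i j)))"
      by (simp add: amplify_def elem_add)
    also have "\<dots> \<le> norm (op_mat n (\<lambda>i j. \<theta> (x i j) + Y i j))" by (rule norm_elem_mat_le)
    finally have "norm (op_mat n (?c (amplify \<theta> x))) \<le> norm (op_mat n (\<lambda>i j. \<theta> (x i j) + Y i j))" .
    moreover have "norm (op_mat n (\<lambda>i j. slice ev (?c (amplify \<theta> x) i j) ev)) \<le> norm (op_mat n (?c (amplify \<theta> x)))"
      by (rule norm_elem_mat_le)
    moreover have "(\<lambda>i j. slice ev (?c (amplify \<theta> x) i j) ev) = amplify \<theta> x"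
      using F.rep_Mat_clin[OF x] by (simp add: slice_elem_ev amplify_def)
    ultimately show "norm (op_mat n (amplify \<theta> x)) \<le> norm (op_mat n (\<lambda>i j. \<theta> (x i j) + Y i j))" by simp
  next
    fix n :: nat and x assume n: "0 < n" and x: "x \<in> Mat_sa F n" and np: "\<not> op_pos (id_blinfun + op_mat n (amplify \<theta> x))"
    have xM: "x \<in> Mat F n" using x by (simp add: Mat_sa_def)
    have cx: "clin (amplify \<theta> x i j)" for i j using F.rep_Mat_clin[OF xM] by (simp add: amplify_def)
    have adx: "adj (amplify \<theta> x j i) = amplify \<theta> x i j" for i j
    proof -
      have "op_mat_adj (amplify \<theta> x) = amplify \<theta> x" using F.Mat_sa_iff[OF xM] x by simp
      from fun_cong[OF fun_cong[OF this]] show ?thesis unfolding op_mat_adj_def .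
    qed
    have "op_mat_adj (?c (amplify \<theta> x)) = ?c (amplify \<theta> x)"
      by (rule HOL.ext, rule HOL.ext) (simp only: op_mat_adj_def adj_elem[OF cx] adx)
    moreover have "\<not> op_pos (id_blinfun + op_mat n (?c (amplify \<theta> x)))"
      using elem_mat_pos[OF cx] np by (rule contrapos_nn[rotated])
    ultimately obtain \<psi> where \<psi>: "op_functional BK K n \<psi>" "Re (\<psi> (?c (amplify \<theta> x))) < -1"
      using FK.admissible_closure_separating[OF K cM[OF xM]] by force
    have "op_functional B ?I n (\<lambda>X. \<psi> (?c X))"
    proof (rule op_functional_pullback[OF \<psi>(1)])
      show mats: "?c X \<in> op_mats BK n" if "X \<in> op_mats B n" for X
        using that by (intro op_matsI) (auto dest: op_matsD simp: op_mats_outside elem_zero intro: elem_BK)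
      show "?c X \<in> op_mats K n" if "X \<in> op_mats ?I n" for X
        using that by (intro op_matsI) (auto dest: op_matsD simp: op_mats_outside elem_zero)
      show "norm (op_mat n (?c X)) \<le> norm (op_mat n X)" for X by (rule norm_elem_mat_le)
      fix X assume X: "X \<in> op_mats B n"
      have cX: "clin (X i j)" for i j using op_matsD'[OF op_algD(1)[OF F.op_alg_gen_alg] X] BD(1) by blast
      have "op_mat_mult n (op_mat_adj (?c X)) (?c X) = ?c (op_mat_mult n (op_mat_adj X) X)"
      proof (rule HOL.ext, rule HOL.ext)
        fix i j
        have "elem ev (\<Sum>k<n. adj (X k i) o\<^sub>L X k j) ev = (\<Sum>k<n. elem ev (adj (X k i) o\<^sub>L X k j) ev)"
          by (simp add: elem_def bounded_bilinear.sum_left[OF bounded_bilinear_blinfun_compose]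
              bounded_bilinear.sum_right[OF bounded_bilinear_blinfun_compose])
        then show "op_mat_mult n (op_mat_adj (?c X)) (?c X) i j = ?c (op_mat_mult n (op_mat_adj X) X) i j"
          by (simp add: op_mat_mult_def op_mat_adj_def adj_elem cX elem_comp clin_adj cinner_ev elem_zero)
      qed
      then show "\<exists>Z\<in>op_mats BK n. op_mat_mult n (op_mat_adj Z) Z = ?c (op_mat_mult n (op_mat_adj X) X)"
        using mats[OF X] by blast
    qed (simp_all add: elem_add elem_op_scale)
    then show "\<exists>\<phi>. op_functional B ?I n \<phi> \<and> Re (\<phi> (amplify \<theta> x)) < -1"
      using \<psi>(2) by (intro exI[of _ "\<lambda>X. \<psi> (?c X)"] conjI)
  qed
qed

lemma proj_mat_tendsto:
  assumes "\<And>i j. i < n \<Longrightarrow> j < n \<Longrightarrow> X i j \<in> compressible"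
  shows "(\<lambda>m. op_mat n (\<lambda>i j. proj m o\<^sub>L (X i j o\<^sub>L proj m))) \<longlonglongrightarrow> op_mat n X"
  using assms by (intro tendsto_op_mat compressible_tendsto)

text \<open>Operators are compressed to matrices of size n * card (G m) over B whose entries are
  slices, where the hypothesis on \<open>J\<close> applies; letting m grow recovers the operators
  themselves.\<close>

theorem slices_admissible:
  assumes J: "F.admissible J"
  shows "FK.admissible {T \<in> BK. \<forall>a b. slice a T b \<in> J}"
proof -
  let ?I = "{T \<in> BK. \<forall>a b. slice a T b \<in> J}"
  note BD = op_subspaceD[OF op_algD(1)[OF F.op_alg_gen_alg]] and BKD = op_subspaceD[OF op_algD(1)[OF FK.op_alg_gen_alg]]
  have J': "op_ideal B J" using J unfolding F.admissible_def by blast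
  note JD = op_subspaceD[OF op_idealD(1)[OF J']]
  have ideal: "op_ideal BK ?I"
    unfolding op_ideal_def
  proof (intro conjI ballI)
    show "op_subspace ?I"
      unfolding op_subspace_def
    proof (intro conjI ballI allI)
      show "?I \<subseteq> bounded_ops" "0 \<in> ?I" using FK.gen_alg_bounded BKD(2) JD(2) by (auto simp: slice_zero)
      fix T c assume T: "T \<in> ?I"
      then show "op_scale c T \<in> ?I" using BKD(1,4) JD(4) by (simp add: slice_op_scale)
      have "adj (slice a T b) \<in> J" for a b using T JD(5) by simp
      then show "adj T \<in> ?I" using T BKD(1,5) by (simp add: adj_slice)
      fix R assume "R \<in> ?I"
      then show "T + R \<in> ?I" using T BKD(3) JD(3) by (simp add: slice_add)
    qed
    show "?I \<subseteq> BK" by blast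
    fix S T assume S: "S \<in> BK" and T: "T \<in> ?I"
    have TB: "T \<in> BK" using T by simp
    have "slice a (S o\<^sub>L T) b \<in> J" for a b
      using T by (intro slice_comp_mem[OF subsetD[OF BK_compressible S] op_idealD(5)[OF J'] JD(2,3)])
        (auto intro: op_idealD(3)[OF J' slice_B[OF S]])
    moreover have "slice a (T o\<^sub>L S) b \<in> J" for a b
      using T by (intro slice_comp_mem[OF subsetD[OF BK_compressible TB] op_idealD(5)[OF J'] JD(2,3)])
        (auto intro: op_idealD(4)[OF J' slice_B[OF S]])
    ultimately show "S o\<^sub>L T \<in> ?I" "T o\<^sub>L S \<in> ?I"
      using op_algD(2)[OF FK.op_alg_gen_alg S TB] op_algD(2)[OF FK.op_alg_gen_alg TB S] by simp_all
  next
    show "closed ?I"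
      unfolding closed_sequential_limits
    proof (intro allI impI, elim conjE)
      fix T L assume T: "\<forall>n. T n \<in> ?I" and L: "T \<longlonglongrightarrow> L"
      have "L \<in> BK" using T by (intro closed_sequentially[OF op_algD(3)[OF FK.op_alg_gen_alg] _ L]) simp
      moreover have "slice a L b \<in> J" for a b
        using T by (intro closed_sequentially[OF op_idealD(5)[OF J'] _ tendsto_slice[OF L]]) simp
      ultimately show "L \<in> ?I" by simp
    qed
  qed
  have comp_mats: "compress n m x \<in> op_mats (closure (\<theta> ` carrier F)) (n * card (G m))"
    if x: "x \<in> op_mats stable_space n" for x n m
    by (rule compress_op_mats)
      (use x in \<open>auto dest: op_matsD intro: slice_stable_space op_subspaceD(2)[OF op_subspace_closure[OF F.op_subspace_range]]\<close>)
  have lim: "(\<lambda>m. op_mat n (\<lambda>i j. proj m o\<^sub>L (x i j o\<^sub>L proj m))) \<longlonglongrightarrow> op_mat n x"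
    if x: "x \<in> op_mats stable_space n" for x n
    by (rule proj_mat_tendsto) (rule subsetD[OF stable_space_compressible op_matsD[OF x]])
  have comp_add: "compress n m (\<lambda>i j. X i j + Y i j) = (\<lambda>i j. compress n m X i j + compress n m Y i j)" for n m X Y
    by (rule HOL.ext, rule HOL.ext) (simp add: compress_def slice_add)
  have comp_I: "compress n m Y \<in> op_mats J (n * card (G m))" if "Y \<in> op_mats ?I n" for n m Y
    by (rule compress_op_mats) (use that JD(2) in \<open>auto dest: op_matsD\<close>)
  have am: "amplify id X = X" for X :: "'k op mat" by (simp add: amplify_def)
  show ?thesis
    unfolding FK.admissible_def am
  proof (intro conjI allI impI ballI ideal)
    fix n :: nat and x Y assume n: "0 < n" and x: "x \<in> Mat (concrete_operator_space stable_space) n" and Y: "Y \<in> op_mats ?I n"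
    have xs: "x \<in> op_mats stable_space n" using x by (simp add: concrete_Mat)
    have "norm (op_mat n (\<lambda>i j. proj m o\<^sub>L (x i j o\<^sub>L proj m))) \<le> norm (op_mat n (\<lambda>i j. x i j + Y i j))" for m
    proof -
      have "norm (op_mat n (\<lambda>i j. proj m o\<^sub>L (x i j o\<^sub>L proj m))) \<le> norm (op_mat (n * card (G m)) (compress n m x))"
        by (rule norm_proj_mat_le)
      also have "\<dots> \<le> norm (op_mat (n * card (G m)) (\<lambda>i j. compress n m x i j + compress n m Y i j))"
        by (rule F.admissible_closure_norm[OF J comp_mats[OF xs] comp_I[OF Y]])
      also have "\<dots> = norm (op_mat (n * card (G m)) (compress n m (\<lambda>i j. x i j + Y i j)))"
        by (simp only: comp_add)
      also have "\<dots> \<le> norm (op_mat n (\<lambda>i j. x i j + Y i j))" by (rule norm_compress_le)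
      finally show ?thesis .
    qed
    then have "norm (op_mat n x) \<le> norm (op_mat n (\<lambda>i j. x i j + Y i j))"
      by (intro LIMSEQ_le_const2[OF tendsto_norm[OF lim[OF xs]]] exI[of _ 0] allI impI)
    then show "norm (op_mat n x) \<le> norm (op_mat n (\<lambda>i j. id (x i j) + Y i j))" by simp
  next
    fix n :: nat and x assume n: "0 < n" and x: "x \<in> Mat_sa (concrete_operator_space stable_space) n"
      and np: "\<not> op_pos (id_blinfun + op_mat n x)"
    have xM: "x \<in> Mat (concrete_operator_space stable_space) n" using x by (simp add: Mat_sa_def)
    have xs: "x \<in> op_mats stable_space n" using xM by (simp add: concrete_Mat)
    have xadj: "op_mat_adj x = x" using FK.Mat_sa_iff[OF xM] x by (simp add: am)
    have cl: "clin (op_mat n x)" "adj (op_mat n x) = op_mat n x"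
      using FK.clin_rep_mat[OF xM] FK.adj_rep_mat[OF x] by (simp_all add: am)
    obtain \<xi> where \<xi>: "norm \<xi> = 1" "Re (cinner \<xi> (op_mat n x \<xi>)) < -1"
      using not_op_pos_vector[OF cl np] by blast
    \<comment> \<open>The strict inequality at \<open>\<xi>\<close> survives a sufficiently fine
      cut-off.\<close>
    have "(\<lambda>m. Re (cinner \<xi> (op_mat n (\<lambda>i j. proj m o\<^sub>L (x i j o\<^sub>L proj m)) \<xi>))) \<longlonglongrightarrow> Re (cinner \<xi> (op_mat n x \<xi>))"
      by (intro tendsto_Re cinner.tendsto tendsto_const blinfun.tendsto lim[OF xs])
    from order_tendstoD(2)[OF this \<xi>(2)] obtain m
      where m: "Re (cinner \<xi> (op_mat n (\<lambda>i j. proj m o\<^sub>L (x i j o\<^sub>L proj m)) \<xi>)) < -1"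
      by (auto simp: eventually_sequentially)
    let ?N = "n * card (G m)"
    let ?c = "compress n m"
    \<comment> \<open>This vector has norm at most 1, and the compressed matrix has at
      \<open>w\<close> the same form value as the cut-off of \<open>x\<close> at
      \<open>\<xi>\<close>. If id plus the compressed matrix were positive, |w| would exceed
      1.\<close>
    define w where "w = adj (block_map n m) \<xi>"
    have w1: "norm w \<le> 1"
      using norm_blinfun[of "adj (block_map n m)" \<xi>] norm_block_map[of n m] \<xi>(1)
      by (simp add: w_def norm_adj clin_block_map)
    have "\<not> op_pos (id_blinfun + op_mat ?N (?c x))"
    proof
      assume "op_pos (id_blinfun + op_mat ?N (?c x))"
      then have "0 \<le> Re (cinner w ((id_blinfun + op_mat ?N (?c x)) w))" by (rule op_posD)
      also have "\<dots> = (norm w)\<^sup>2 + Re (cinner w (op_mat ?N (?c x) w))"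
        by (simp add: blinfun.add_left cinner.add_right cinner_norm)
      also have "cinner w (op_mat ?N (?c x) w) = cinner \<xi> (op_mat n (\<lambda>i j. proj m o\<^sub>L (x i j o\<^sub>L proj m)) \<xi>)"
        unfolding block_map_compress[symmetric] by (simp add: w_def cinner_adj_left clin_block_map)
      finally have "1 < (norm w)\<^sup>2" using m by linarith
      moreover have "(norm w)\<^sup>2 \<le> 1" using w1 by (simp add: power_le_one)
      ultimately show False by linarith
    qed
    moreover have "op_mat_adj (?c x) = ?c x"
    proof (rule HOL.ext, rule HOL.ext)
      fix p q
      have ax: "adj (x j i) = x i j" for i j
        using fun_cong[OF fun_cong[OF xadj, of i], of j] by (simp add: op_mat_adj_def)
      have cx: "clin (x i j)" for i j
        using FK.rep_Mat_clin[OF xM] by simp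
      show "op_mat_adj (?c x) p q = ?c x p q"
        by (simp add: op_mat_adj_def compress_def adj_slice cx ax)
    qed
    ultimately obtain \<psi> where \<psi>: "op_functional B J ?N \<psi>" "Re (\<psi> (?c x)) < -1"
      using F.admissible_closure_separating[OF J comp_mats[OF xs]] by blast
    have "op_functional BK ?I n (\<lambda>X. \<psi> (?c X))"
    proof (rule op_functional_pullback[OF \<psi>(1)])
      show mats: "?c X \<in> op_mats B ?N" if "X \<in> op_mats BK n" for X
        by (rule compress_op_mats) (use that BD(2) slice_B in \<open>auto dest: op_matsD\<close>)
      show "?c X \<in> op_mats J ?N" if "X \<in> op_mats ?I n" for X by (rule comp_I[OF that])
      show "norm (op_mat ?N (?c X)) \<le> norm (op_mat n X)" for X by (rule norm_compress_le)
      show "?c (\<lambda>i j. X i j + Y i j) = (\<lambda>i j. ?c X i j + ?c Y i j)" for X Y by (rule comp_add)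
      fix X assume X: "X \<in> op_mats BK n"
      have cX: "clin (X i j)" for i j using op_matsD'[OF op_algD(1)[OF FK.op_alg_gen_alg] X] BKD(1) by blast
      show "?c (\<lambda>i j. op_scale a (X i j)) = (\<lambda>i j. op_scale a (?c X i j))" for a
        by (rule HOL.ext, rule HOL.ext) (simp add: compress_def slice_op_scale cX)
      let ?P = "op_mat_mult n (op_mat_adj X) X"
      have P: "?P \<in> op_mats BK n"
        by (intro op_mat_mult_closed op_mat_adj_closed op_algD(1) FK.op_alg_gen_alg X)
      have "op_mat n ?P = adj (op_mat n X) o\<^sub>L op_mat n X"
        by (simp add: op_mat_of_mult op_mat_of_adj cX)
      \<comment> \<open>The compression of X^* X is not the corresponding product of compressions,
        but it is positive and so has a square root over \<open>B\<close>.\<close>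
      then have "op_mat ?N (?c ?P) = adj (op_mat n X o\<^sub>L block_map n m) o\<^sub>L (op_mat n X o\<^sub>L block_map n m)"
        by (simp add: op_mat_compress adj_comp clin_op_mat cX clin_block_map comp_assoc)
      moreover have "clin (op_mat n X o\<^sub>L block_map n m)" by (intro clin_comp clin_op_mat cX clin_block_map)
      ultimately have "op_pos (op_mat ?N (?c ?P))" "adj (op_mat ?N (?c ?P)) = op_mat ?N (?c ?P)"
        by (simp_all add: op_pos_adj_comp adj_comp clin_adj adj_adj)
      then show "\<exists>Z\<in>op_mats B ?N. op_mat_mult ?N (op_mat_adj Z) Z = ?c ?P"
        by (intro op_mats_square[OF F.op_alg_gen_alg mats[OF P]])
    qed
    then show "\<exists>\<phi>. op_functional BK ?I n \<phi> \<and> Re (\<phi> x) < -1"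
      using \<psi>(2) by (intro exI[of _ "\<lambda>X. \<psi> (?c X)"] conjI)
  qed
qed

section \<open>Word length and density\<close>

text \<open>By \<open>slice_comp_mem\<close> the slice of a product is a limit of sums of products
  of slices, and slices of letters are limits of elements of F; so the length is kept up to
  closure.\<close>

lemma slice_word:
  assumes "set w \<subseteq> stable_space" "w \<noteq> []"
  shows "slice a (word_op id w) b \<in> closure (F.word_sums (length w))"
  using assms
proof (induction w arbitrary: a)
  case (Cons x w)
  have x: "x \<in> stable_space" using Cons.prems by simp
  show ?case
  proof (cases "w = []")
    case True
    have "\<theta> ` carrier F \<subseteq> F.word_sums (length [x])" using F.rep_word_sums by auto
    from subsetD[OF closure_mono[OF this] slice_stable_space[OF x]] show ?thesis using True by simp
  next
    case False
    let ?k = "length w"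
    have "slice a (x o\<^sub>L word_op id w) b \<in> closure (F.word_sums (Suc ?k))"
    proof (rule slice_comp_mem[OF subsetD[OF stable_space_compressible x] closed_closure])
      show "0 \<in> closure (F.word_sums (Suc ?k))" using F.word_sums.zero closure_subset by blast
      fix g
      show "slice a x g o\<^sub>L slice g (word_op id w) b \<in> closure (F.word_sums (Suc ?k))"
      proof -
        obtain f where f: "\<And>n::nat. f n \<in> F.word_sums ?k" "f \<longlonglongrightarrow> slice g (word_op id w) b"
          using Cons.IH[of g] Cons.prems False unfolding closure_sequential by auto
        obtain h where h: "\<And>n::nat. h n \<in> \<theta> ` carrier F" "h \<longlonglongrightarrow> slice a x g"
          using slice_stable_space[OF x, of a g] unfolding closure_sequential by blast
        have "h n o\<^sub>L f n \<in> F.word_sums (Suc ?k)" for n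
          using F.word_sums_comp[of "h n" 1, OF _ f(1)[of n]] h(1)[of n] F.rep_word_sums[of _ 1] by auto
        then show ?thesis
          unfolding closure_sequential by (intro exI[of _ "\<lambda>n. h n o\<^sub>L f n"] conjI allI tendsto_comp f(2) h(2))
      qed
    qed (rule closure_add[OF F.word_sums.add])
    then show ?thesis by (simp add: id_def)
  qed
qed simp

lemma slice_word_sums:
  assumes "T \<in> FK.word_sums k"
  shows "slice a T b \<in> closure (F.word_sums k)"
  using assms
proof (rule FK.word_sums.induct)
  show "slice a 0 b \<in> closure (F.word_sums k)"
    using F.word_sums.zero closure_subset by (auto simp: slice_zero)
  show "slice a (S + T) b \<in> closure (F.word_sums k)"
    if "slice a S b \<in> closure (F.word_sums k)" "slice a T b \<in> closure (F.word_sums k)" for S T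
    unfolding slice_add by (rule closure_add[OF F.word_sums.add that])
  show "slice a (word_op id w) b \<in> closure (F.word_sums k)" if "w \<in> FK.word_set" "length w \<le> k" for w
    using slice_word[of w a b] closure_mono[OF F.word_sums_mono[OF that(2)]] that(1)
    by (auto simp: FK.word_set_def)
qed

text \<open>The letters are distributed over the matrix units at (a, ev), (ev, ev), ..., (ev, b),
  one letter each, so the length is unchanged.\<close>

lemma elem_word:
  assumes "w \<in> F.word_set"
  shows "\<exists>v\<in>FK.word_set. length v = length w \<and> elem a (word_op \<theta> w) b = word_op id v"
  using assms
proof (induction w arbitrary: a)
  case (Cons x w)
  have x: "x \<in> carrier F" using Cons.prems by (simp add: F.word_set_def)
  show ?case
  proof (cases "w = []")
    case True
    then show ?thesis
      using elem_stable_space[OF x] by (intro bexI[of _ "[elem a (\<theta> x) b]"]) (simp_all add: FK.word_set_def)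
  next
    case False
    then have "w \<in> F.word_set" using Cons.prems by (simp add: F.word_set_def)
    from Cons.IH[OF this, of ev] obtain v where v: "v \<in> FK.word_set" "length v = length w"
      "elem ev (word_op \<theta> w) b = word_op id v" by blast
    have "elem a (\<theta> x o\<^sub>L word_op \<theta> w) b = elem a (\<theta> x) ev o\<^sub>L elem ev (word_op \<theta> w) b"
      using F.rep_clin[OF x] by (simp add: elem_comp cinner_ev)
    then show ?thesis
      using v elem_stable_space[OF x] by (intro bexI[of _ "elem a (\<theta> x) ev # v"]) (simp_all add: FK.word_set_def id_def)
  qed
qed (simp add: F.word_set_def)

lemma elem_word_sums:
  assumes "T \<in> F.word_sums k"
  shows "elem a T b \<in> FK.word_sums k"
  using assms
proof (rule F.word_sums.induct)
  show "elem a 0 b \<in> FK.word_sums k" by (simp add: elem_zero FK.word_sums.zero)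
  show "elem a (S + T) b \<in> FK.word_sums k"
    if "elem a S b \<in> FK.word_sums k" "elem a T b \<in> FK.word_sums k" for S T
    unfolding elem_add by (rule FK.word_sums.add[OF that])
  show "elem a (word_op \<theta> w) b \<in> FK.word_sums k" if w: "w \<in> F.word_set" "length w \<le> k" for w
    using elem_word[OF w(1), of a b] FK.word_sums.word w(2) by force
qed

text \<open>The inclusion \<open>slices\<close> makes \<open>elem\<close> send J into K, the
  inclusion \<open>corner\<close> makes slicing at \<open>ev\<close> send K into J, and both maps
  respect word length up to closure. A general element of \<open>BK\<close> is reached through its
  cut-offs, which are sums of \<open>elem\<close> applied to slices.\<close>

lemma word_dense_stable:
  assumes J: "op_ideal B J" and K: "op_ideal BK K"
    and corner: "{b \<in> B. elem ev b ev \<in> K} \<subseteq> J" and slices: "{T \<in> BK. \<forall>a b. slice a T b \<in> J} \<subseteq> K"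
  shows "F.word_dense J k \<longleftrightarrow> FK.word_dense K k"
proof
  note JD = op_subspaceD[OF op_idealD(1)[OF J]] and KD = op_subspaceD[OF op_idealD(1)[OF K]]
  let ?W = "{S + T | S T. S \<in> F.word_sums k \<and> T \<in> J}"
  let ?WK = "{S + T | S T. S \<in> FK.word_sums k \<and> T \<in> K}"
  have W: "x + y \<in> ?W" if xy: "x \<in> ?W" "y \<in> ?W" for x y
  proof -
    obtain S T S' T' where "x = S + T" "y = S' + T'" "S \<in> F.word_sums k" "S' \<in> F.word_sums k" "T \<in> J" "T' \<in> J"
      using xy by blast
    then show ?thesis
      using F.word_sums.add JD(3) by (intro CollectI exI[of _ "S + S'"] exI[of _ "T + T'"]) simp
  qed
  have WK: "x + y \<in> ?WK" if xy: "x \<in> ?WK" "y \<in> ?WK" for x y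
  proof -
    obtain S T S' T' where "x = S + T" "y = S' + T'" "S \<in> FK.word_sums k" "S' \<in> FK.word_sums k" "T \<in> K" "T' \<in> K"
      using xy by blast
    then show ?thesis
      using FK.word_sums.add KD(3) by (intro CollectI exI[of _ "S + S'"] exI[of _ "T + T'"]) simp
  qed
  {
    assume "F.word_dense J k"
    then have dense: "B \<subseteq> closure ?W" by (simp add: F.word_dense_def)
    have el: "elem a b c \<in> closure ?WK" if b: "b \<in> B" for a b c
    proof -
      obtain f where f: "\<And>n::nat. f n \<in> ?W" "f \<longlonglongrightarrow> b"
        using subsetD[OF dense b] unfolding closure_sequential by blast
      have "elem a (f n) c \<in> ?WK" for n
      proof -
        obtain S T where ST: "f n = S + T" "S \<in> F.word_sums k" "T \<in> J" using f(1)[of n] by blast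
        have "elem a T c \<in> K"
        proof (rule subsetD[OF slices], intro CollectI conjI allI)
          show "elem a T c \<in> BK" by (rule elem_BK[OF op_idealD(2)[OF J ST(3)]])
          show "slice x (elem a T c) y \<in> J" for x y
            unfolding slice_elem[OF JD(1)[OF ST(3)]] by (rule JD(4)[OF ST(3)])
        qed
        then show ?thesis using elem_word_sums[OF ST(2)] unfolding ST(1) elem_add by blast
      qed
      then show ?thesis
        unfolding closure_sequential[of _ ?WK] by (intro exI[of _ "\<lambda>n. elem a (f n) c"] conjI allI tendsto_elem f(2))
    qed
    have z: "0 \<in> closure ?WK"
      using el[OF op_subspaceD(2)[OF op_algD(1)[OF F.op_alg_gen_alg]]] by (simp add: elem_zero)
    show "FK.word_dense K k"
      unfolding FK.word_dense_def
    proof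
      fix T assume T: "T \<in> BK"
      have "proj m o\<^sub>L (T o\<^sub>L proj m) \<in> closure ?WK" for m
        unfolding proj_conj by (intro sum_mem z closure_add[OF WK] el slice_B[OF T])
      then show "T \<in> closure ?WK"
        using closed_sequentially[OF closed_closure, of "\<lambda>m. proj m o\<^sub>L (T o\<^sub>L proj m)" ?WK T]
          compressible_tendsto[OF subsetD[OF BK_compressible T]] by blast
    qed
  }
  assume "FK.word_dense K k"
  then have dense: "BK \<subseteq> closure ?WK" by (simp add: FK.word_dense_def)
  show "F.word_dense J k"
    unfolding F.word_dense_def
  proof
    fix b assume b: "b \<in> B"
    obtain f where f: "\<And>n::nat. f n \<in> ?WK" "f \<longlonglongrightarrow> elem ev b ev"
      using subsetD[OF dense elem_BK[OF b, of ev ev]] unfolding closure_sequential by blast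
    have "slice ev (f n) ev \<in> closure ?W" for n
    proof -
      obtain S T where ST: "f n = S + T" "S \<in> FK.word_sums k" "T \<in> K" using f(1)[of n] by blast
      have TB: "T \<in> BK" by (rule op_idealD(2)[OF K ST(3)])
      \<comment> \<open>This is \<open>T\<close> multiplied on both sides by
        \<open>elem ev id_blinfun ev\<close>, an element of \<open>BK\<close>, so it stays in the
        ideal.\<close>
      have "elem ev (slice ev T ev) ev \<in> K"
        unfolding elem_slice[OF KD(1)[OF ST(3)]] by (intro op_idealD(3,4)[OF K] id_BK ST(3))
      then have J': "slice ev T ev \<in> J" using corner slice_B[OF TB] by blast
      obtain g where g: "\<And>n::nat. g n \<in> F.word_sums k" "g \<longlonglongrightarrow> slice ev S ev"
        using slice_word_sums[OF ST(2)] unfolding closure_sequential by blast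
      have "g n + slice ev T ev \<in> ?W" for n using g(1) J' by blast
      then show ?thesis
        unfolding ST(1) slice_add closure_sequential[of _ ?W]
        by (intro exI[of _ "\<lambda>n. g n + slice ev T ev"] conjI allI tendsto_add g(2) tendsto_const)
    qed
    moreover have "(\<lambda>n. slice ev (f n) ev) \<longlonglongrightarrow> b"
      using tendsto_slice[OF f(2), of ev ev] b op_subspaceD(1)[OF op_algD(1)[OF F.op_alg_gen_alg]] by (simp add: slice_elem_ev)
    ultimately show "b \<in> closure ?W"
      by (rule closed_sequentially[OF closed_closure])
  qed
qed

end

theorem proposition2p42:
  fixes E :: "'a ordered_space" and e :: 'a
    and \<pi> :: "'a \<Rightarrow> 'h::complex_hilbert \<Rightarrow>\<^sub>L 'h"
    and tensor :: "'h \<Rightarrow> 'l::complex_hilbert \<Rightarrow> 'k::complex_hilbert"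
    and EK :: "('k \<Rightarrow>\<^sub>L 'k) operator_space"
    and A :: "'b cstar" and \<iota> :: "'a \<Rightarrow> 'b"
    and A' :: "'c cstar" and \<iota>' :: "('k \<Rightarrow>\<^sub>L 'k) \<Rightarrow> 'c"
  assumes "unital_operator_system E e"
    and "realization E e \<pi>"
    and "separable_infinite_dimensional (UNIV :: 'l set)"
    and "hilbert_tensor tensor"
    and "EK = concrete_operator_space (min_tensor tensor (\<pi> ` carrier E) compact_ops)"
    and "Csharp_envelope (operator_space_of_system E e) A \<iota>"
    and "Csharp_envelope EK A' \<iota>'"
  shows "propagation_number (operator_space_of_system E e) A \<iota> = propagation_number EK A' \<iota>'"
proof -
  let ?F = "operator_space_of_system E e"
  interpret F: presentation ?F \<pi> by (rule unital_presentation[OF assms(1,2)])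
  obtain G :: "nat \<Rightarrow> 'l set" where G: "\<And>n. orthonormal (G n)" "\<And>a. (\<lambda>n. projection (G n) a) \<longlonglongrightarrow> a"
    using approximating_projections[OF assms(3)] by blast
  interpret E: unital_operator_system E e by (rule assms(1))
  \<comment> \<open>The zero space would be spanned by the empty set, contrary to infinite
    dimension.\<close>
  have "\<exists>u :: 'l. u \<noteq> 0"
  proof (rule ccontr)
    assume "\<nexists>u :: 'l. u \<noteq> 0"
    then have "UNIV \<subseteq> span ({} :: 'l set)" by auto
    then show False using assms(3) by (metis finite.emptyI separable_infinite_dimensional_def)
  qed
  then obtain u :: 'l where u: "u \<noteq> 0" by blast
  define ev where "ev = u /\<^sub>R norm u"
  have ev: "norm ev = 1" using u by (simp add: ev_def)
  have unit: "id_blinfun \<in> \<pi> ` carrier ?F"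
    using E.unit_closed assms(2) by (metis imageI op_space_system_sel(1) realization_def)
  interpret stabilization ?F \<pi> tensor G ev
    by unfold_locales (use assms(4) G unit ev in auto)
  have EK: "EK = concrete_operator_space stable_space"
    using assms(5) min_tensor_eq[OF F.op_subspace_range] by simp
  have env: "Csharp_envelope (concrete_operator_space stable_space) A' \<iota>'" using assms(7) EK by simp
  have ext: "Csharp_extension ?F A \<iota>" and ext': "Csharp_extension (concrete_operator_space stable_space) A' \<iota>'"
    using assms(6) env by (auto simp: Csharp_envelope_def)
  obtain \<rho> where \<rho>: "star_hom (op_cstar B) A \<rho>" "\<rho> ` B = carrier A" "\<And>x. x \<in> carrier ?F \<Longrightarrow> \<rho> (\<pi> x) = \<iota> x"
    and \<rho>I: "\<And>I T. F.admissible I \<Longrightarrow> T \<in> I \<Longrightarrow> \<rho> T = vzero A"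
    using F.envelope_quotient_map[OF assms(6)] by blast
  obtain \<rho>' where \<rho>': "star_hom (op_cstar BK) A' \<rho>'" "\<rho>' ` BK = carrier A'"
    "\<And>x. x \<in> carrier (concrete_operator_space stable_space) \<Longrightarrow> \<rho>' (id x) = \<iota>' x"
    and \<rho>'I: "\<And>I T. FK.admissible I \<Longrightarrow> T \<in> I \<Longrightarrow> \<rho>' T = vzero A'"
    using FK.envelope_quotient_map[OF env] by blast
  let ?J = "{T \<in> B. \<rho> T = vzero A}"
  let ?K = "{T \<in> BK. \<rho>' T = vzero A'}"
  have J: "F.admissible ?J" by (rule F.kernel_admissible[OF ext \<rho>])
  have K: "FK.admissible ?K" by (rule FK.kernel_admissible[OF ext' \<rho>'])
  have eq: "F.word_dense ?J k \<longleftrightarrow> FK.word_dense ?K k" for k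
  proof (rule word_dense_stable)
    show "op_ideal B ?J" using J unfolding F.admissible_def by blast
    show "op_ideal BK ?K" using K unfolding FK.admissible_def by blast
    \<comment> \<open>An admissible ideal lies in the kernel of the map onto the envelope; the next
      inclusion is the same on the stabilized side.\<close>
    show "{b \<in> B. elem ev b ev \<in> ?K} \<subseteq> ?J" using \<rho>I[OF corner_admissible[OF K]] by blast
    show "{T \<in> BK. \<forall>a b. slice a T b \<in> ?J} \<subseteq> ?K" using \<rho>'I[OF slices_admissible[OF J]] by blast
  qed
  show ?thesis
    unfolding propagation_number_def EK
    \<comment> \<open>The density criterion requires \<open>1 \<le> k\<close>, which the set
      defining the propagation number provides; hence the congruence rule for conjunctions.\<close>
    using F.propagation_word_dense[OF ext \<rho>] FK.propagation_word_dense[OF ext' \<rho>'] eq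
    by (intro arg_cong[where f = Inf] Collect_cong) (simp cong: conj_cong)
qed

end
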